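(* Let $U$ be an orientable $C^\infty$ manifold of dimension $d$, and let $X=\{X(t):t\in U\}$ be a real-valued Gaussian process with $C^2$ paths. Assume that in every chart $(X(t),DX(t))$ has a nondegenerate joint distribution, and that in every chart, for the process $Y=X\circ\phi^{-1}$ written in the chart, the following holds: either almost surely $Y$ is of class $C^3$, or for every compact subset $K$ of the domain of $Y$, $$\sup_{s\in K,\ x'\in V(0)}\mathrm{P}\big(|\det(Y''(s))|<\delta\,\big/\,Y'(s)=x'\big)\to0\quad\text{as }\delta\to0,$$ for some neighborhood $V(0)$ of $0$ in $\mathbb{R}^d$. Let $u\in\mathbb{R}$. Then, for $k=1,2$, the quantity which is expressed in every chart $\phi$ with coordinates $s_1,\dots,s_d$ as $$\int_u^{+\infty}dx\ \mathrm{E}\big(\delta^k(Y''(s))\,\big/\,Y(s)=x,\,Y'(s)=0\big)\,p_{Y(s),Y'(s)}(x,0)\ \bigwedge_{i=1}^d ds_i,$$ where $Y(s)$ is the process $X$ written in the chart, $Y=X\circ\phi^{-1}$, defines a $d$-form $\Omega^k$ on $\dot U$, and for every Borel set $S\subset\dot U$, $$\int_S\Omega^k=\mathrm{E}\big(M_{u,k}^X(S)\big).$$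
   Context: $\dot U$ is the interior of the manifold $U$. Orientable means that there is a nonvanishing differentiable $d$-form on $U$; equivalently, there is an atlas such that for any two intersecting charts $(U_i,\phi_i),(U_j,\phi_j)$ the Jacobian of $\phi_i\circ\phi_j^{-1}$ is positive, and charts are taken in such an atlas. A $d$-form on $\dot U$ is here a measure on $\dot U$ whose image in each chart is absolutely continuous with respect to Lebesgue measure $\bigwedge_{i=1}^d ds_i$ (so the claim includes that the local expressions agree on intersections of charts). $M_{u,1}^X(S)$ is the number of $t\in S$ at which $X$ has a local maximum and $X(t)>u$; $M_{u,2}^X(S)$ is the number of critical points $t\in S$ of $X$ with $X(t)>u$. For a $d\times d$ real symmetric matrix $M$, $\delta^1(M):=|\det(M)|\,\mathbb{1}_{M\prec0}$ and $\delta^2(M):=|\det(M)|$, where $M\prec0$ means negative definite. $p_{Y(s),Y'(s)}$ is the joint density of $(Y(s),Y'(s))$, and $\mathrm{E}(\,\cdot\,/\,\cdot\,)$, $\mathrm{P}(\,\cdot\,/\,\cdot\,)$ are conditional expectation and probability (Gaussian regression version). *)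

theory Defs
  imports "HOL-Probability.Probability"
begin

section \<open>Functions of class \<open>C\<^sup>k\<close>\<close>

text \<open>The derivatives are taken within \<open>T\<close>, which in the sequel is always relatively open in a
  closed half-space (or open in the whole space). On such a set the derivative within \<open>T\<close> is unique,
  it is the usual one at interior points, and it is one-sided at boundary points.\<close>

fun Ck_on :: "nat \<Rightarrow> ('e::real_normed_vector \<Rightarrow> 'f::real_normed_vector) \<Rightarrow> 'e set \<Rightarrow> bool" where
  "Ck_on 0 f T \<longleftrightarrow> continuous_on T f"
| "Ck_on (Suc k) f T \<longleftrightarrow>
     (\<forall>x\<in>T. f differentiable (at x within T)) \<and>
     (\<forall>v. Ck_on k (\<lambda>x. frechet_derivative f (at x within T) v) T)"

definition smooth_on :: "('e::real_normed_vector \<Rightarrow> 'f::real_normed_vector) \<Rightarrow> 'e set \<Rightarrow> bool" where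
  "smooth_on f T \<longleftrightarrow> (\<forall>k. Ck_on k f T)"

definition gradient_within :: "(real^'n \<Rightarrow> real) \<Rightarrow> (real^'n) set \<Rightarrow> real^'n \<Rightarrow> real^'n" where
  "gradient_within f T s = (\<chi> i. frechet_derivative f (at s within T) (axis i 1))"

definition hessian_within :: "(real^'n \<Rightarrow> real) \<Rightarrow> (real^'n) set \<Rightarrow> real^'n \<Rightarrow> real^'n^'n" where
  "hessian_within f T s = matrix (frechet_derivative (gradient_within f T) (at s within T))"


section \<open>Oriented smooth manifolds, possibly with boundary\<close>

text \<open>A chart is a domain together with a coordinate map.\<close>

type_synonym ('a, 'n) chart = "'a set \<times> ('a \<Rightarrow> real^'n)"

abbreviation chart_dom :: "('a, 'n::finite) chart \<Rightarrow> 'a set" where "chart_dom \<equiv> fst"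
abbreviation chart_map :: "('a, 'n::finite) chart \<Rightarrow> 'a \<Rightarrow> real^'n" where "chart_map \<equiv> snd"

definition chart_img :: "('a, 'n::finite) chart \<Rightarrow> (real^'n) set" where
  "chart_img c = chart_map c ` chart_dom c"

definition chart_inv :: "('a, 'n::finite) chart \<Rightarrow> real^'n \<Rightarrow> 'a" where
  "chart_inv c = inv_into (chart_dom c) (chart_map c)"

text \<open>The image of a chart is relatively open in \<open>{x. 0 \<le> a \<bullet> x}\<close> for some \<open>a\<close>: for \<open>a = 0\<close> this is
  an open subset of the whole space, otherwise an open subset of a half-space. All half-spaces are
  allowed since, in dimension 1, a single one would not admit oriented atlases of \<open>[0,1]\<close>.\<close>

definition is_chart :: "'a topology \<Rightarrow> ('a, 'n::finite) chart \<Rightarrow> bool" where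
  "is_chart U c \<longleftrightarrow>
     openin U (chart_dom c) \<and>
     homeomorphic_map (subtopology U (chart_dom c)) (top_of_set (chart_img c)) (chart_map c) \<and>
     (\<exists>a. openin (top_of_set {x. 0 \<le> a \<bullet> x}) (chart_img c))"

definition transition :: "('a, 'n::finite) chart \<Rightarrow> ('a, 'n::finite) chart \<Rightarrow> real^'n \<Rightarrow> real^'n" where
  "transition c c' = chart_map c \<circ> chart_inv c'"

definition overlap :: "('a, 'n::finite) chart \<Rightarrow> ('a, 'n::finite) chart \<Rightarrow> (real^'n) set" where
  "overlap c c' = chart_map c' ` (chart_dom c \<inter> chart_dom c')"

definition smooth_atlas :: "'a topology \<Rightarrow> ('a, 'n::finite) chart set \<Rightarrow> bool" where
  "smooth_atlas U \<A> \<longleftrightarrow>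
     (\<forall>c\<in>\<A>. is_chart U c) \<and>
     (\<Union>c\<in>\<A>. chart_dom c) = topspace U \<and>
     (\<forall>c\<in>\<A>. \<forall>c'\<in>\<A>. smooth_on (transition c c') (overlap c c'))"

definition oriented_atlas :: "('a, 'n::finite) chart set \<Rightarrow> bool" where
  "oriented_atlas \<A> \<longleftrightarrow>
     (\<forall>c\<in>\<A>. \<forall>c'\<in>\<A>. \<forall>s\<in>overlap c c'.
        det (matrix (frechet_derivative (transition c c') (at s within overlap c c'))) > 0)"

text \<open>A smooth manifold of dimension \<open>CARD('n)\<close>, given with an atlas whose transition maps
  have positive Jacobians; such an atlas exists iff the manifold is orientable.\<close>

definition oriented_manifold :: "'a topology \<Rightarrow> ('a, 'n::finite) chart set \<Rightarrow> bool" where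
  "oriented_manifold U \<A> \<longleftrightarrow>
     Hausdorff_space U \<and> second_countable U \<and> smooth_atlas U \<A> \<and> oriented_atlas \<A>"

definition manifold_interior :: "('a, 'n::finite) chart set \<Rightarrow> 'a set" where
  "manifold_interior \<A> = {t. \<exists>c\<in>\<A>. t \<in> chart_dom c \<and> chart_map c t \<in> interior (chart_img c)}"

definition borel_of_top :: "'a topology \<Rightarrow> 'a measure" where
  "borel_of_top U = sigma (topspace U) {S. openin U S}"


section \<open>Top-degree forms on the interior\<close>

definition top_form :: "'a topology \<Rightarrow> ('a, 'n::finite) chart set \<Rightarrow> 'a measure \<Rightarrow> bool" where
  "top_form U \<A> \<Omega> \<longleftrightarrow>
     sets \<Omega> = sets (restrict_space (borel_of_top U) (manifold_interior \<A>)) \<and>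
     (\<forall>c\<in>\<A>. absolutely_continuous lborel (distr (restrict_space \<Omega> (chart_dom c)) borel (chart_map c)))"

text \<open>\<open>\<Omega>\<close> is expressed in each chart \<open>c\<close> as \<open>f c s ds\<^sub>1 \<and> \<dots> \<and> ds\<^sub>d\<close>. The measurability of the local
  expression is part of the claim.\<close>

definition expressed_as ::
  "('a, 'n::finite) chart set \<Rightarrow> 'a measure \<Rightarrow> (('a, 'n::finite) chart \<Rightarrow> real^'n \<Rightarrow> ennreal) \<Rightarrow> bool" where
  "expressed_as \<A> \<Omega> f \<longleftrightarrow>
     (\<forall>c\<in>\<A>. let f\<^sub>c = (\<lambda>s. f c s * indicator (chart_map c ` (chart_dom c \<inter> manifold_interior \<A>)) s) in
        f\<^sub>c \<in> borel_measurable lborel \<and>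
        distr (restrict_space \<Omega> (chart_dom c)) borel (chart_map c) = density lborel f\<^sub>c)"


section \<open>Gaussian processes and Gaussian regression\<close>

text \<open>Constants are Gaussian.\<close>

definition gaussian_rv :: "'w measure \<Rightarrow> ('w \<Rightarrow> real) \<Rightarrow> bool" where
  "gaussian_rv P Z \<longleftrightarrow> Z \<in> borel_measurable P \<and>
     ((\<exists>\<mu>. AE \<omega> in P. Z \<omega> = \<mu>) \<or>
      (\<exists>\<mu> \<sigma>. 0 < \<sigma> \<and> distributed P lborel Z (\<lambda>x. ennreal (normal_density \<mu> \<sigma> x))))"

definition gaussian_process :: "'w measure \<Rightarrow> 'a set \<Rightarrow> ('a \<Rightarrow> 'w \<Rightarrow> real) \<Rightarrow> bool" where
  "gaussian_process P T X \<longleftrightarrow>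
     (\<forall>F b. finite F \<and> F \<subseteq> T \<longrightarrow> gaussian_rv P (\<lambda>\<omega>. \<Sum>t\<in>F. b t * X t \<omega>))"

text \<open>The covariance \<open>Cov(Z,W)\<close>, as the linear map \<open>v \<mapsto> E((Z - E Z) \<langle>W - E W, v\<rangle>)\<close>.\<close>

definition cov_op :: "'w measure \<Rightarrow> ('w \<Rightarrow> 'z::euclidean_space) \<Rightarrow> ('w \<Rightarrow> 'y::euclidean_space) \<Rightarrow> 'y \<Rightarrow> 'z"
  where
  "cov_op P Z W v =
     (\<integral>\<omega>. ((W \<omega> - (\<integral>\<omega>'. W \<omega>' \<partial>P)) \<bullet> v) *\<^sub>R (Z \<omega> - (\<integral>\<omega>'. Z \<omega>' \<partial>P)) \<partial>P)"

definition nondegenerate :: "'w measure \<Rightarrow> ('w \<Rightarrow> 'y::euclidean_space) \<Rightarrow> bool" where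
  "nondegenerate P W \<longleftrightarrow> bij (cov_op P W W)"

text \<open>Regression version of the conditional law of \<open>Z\<close> given \<open>W = w\<close>: with the regression coefficient
  \<open>A = Cov(Z,W) Cov(W,W)\<^sup>-\<^sup>1\<close>, the residual \<open>Z - A W\<close> is independent of \<open>W\<close>, and the conditional law
  is the law of \<open>A w + (Z - A W)\<close>. Here \<open>(Z,W)\<close> is jointly Gaussian and \<open>W\<close> is nondegenerate.\<close>

definition regression_coeff ::
  "'w measure \<Rightarrow> ('w \<Rightarrow> 'z::euclidean_space) \<Rightarrow> ('w \<Rightarrow> 'y::euclidean_space) \<Rightarrow> 'y \<Rightarrow> 'z" where
  "regression_coeff P Z W y = cov_op P Z W (inv (cov_op P W W) y)"

definition cond_law ::
  "'w measure \<Rightarrow> ('w \<Rightarrow> 'z::euclidean_space) \<Rightarrow> ('w \<Rightarrow> 'y::euclidean_space) \<Rightarrow> 'y \<Rightarrow> 'z measure" where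
  "cond_law P Z W w =
     distr P borel (\<lambda>\<omega>. regression_coeff P Z W w + (Z \<omega> - regression_coeff P Z W (W \<omega>)))"

text \<open>The continuous version of the density, which is what its values at single points refer to.\<close>

definition joint_density :: "'w measure \<Rightarrow> ('w \<Rightarrow> 'y::euclidean_space) \<Rightarrow> 'y \<Rightarrow> real" where
  "joint_density P W =
     (THE p. continuous_on UNIV p \<and> (\<forall>y. 0 \<le> p y) \<and> distributed P lborel W (\<lambda>y. ennreal (p y)))"


section \<open>The process in a chart\<close>

definition Y_chart :: "('a \<Rightarrow> 'w \<Rightarrow> real) \<Rightarrow> ('a, 'n::finite) chart \<Rightarrow> real^'n \<Rightarrow> 'w \<Rightarrow> real" where
  "Y_chart X c s \<omega> = X (chart_inv c s) \<omega>"

definition DY_chart :: "('a \<Rightarrow> 'w \<Rightarrow> real) \<Rightarrow> ('a, 'n::finite) chart \<Rightarrow> real^'n \<Rightarrow> 'w \<Rightarrow> real^'n" where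
  "DY_chart X c s \<omega> = gradient_within (\<lambda>s'. Y_chart X c s' \<omega>) (chart_img c) s"

definition D2Y_chart :: "('a \<Rightarrow> 'w \<Rightarrow> real) \<Rightarrow> ('a, 'n::finite) chart \<Rightarrow> real^'n \<Rightarrow> 'w \<Rightarrow> real^'n^'n" where
  "D2Y_chart X c s \<omega> = hessian_within (\<lambda>s'. Y_chart X c s' \<omega>) (chart_img c) s"

definition path_Ck_in_chart ::
  "nat \<Rightarrow> ('a \<Rightarrow> 'w \<Rightarrow> real) \<Rightarrow> ('a, 'n::finite) chart \<Rightarrow> 'w \<Rightarrow> bool" where
  "path_Ck_in_chart k X c \<omega> \<longleftrightarrow> Ck_on k (\<lambda>s. Y_chart X c s \<omega>) (chart_img c)"

text \<open>The suprema and probabilities are taken in \<open>ennreal\<close>, where a supremum over the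
  empty set is 0.\<close>

definition hessian_det_condition ::
  "'w measure \<Rightarrow> ('a \<Rightarrow> 'w \<Rightarrow> real) \<Rightarrow> ('a, 'n::finite) chart \<Rightarrow> bool" where
  "hessian_det_condition P X c \<longleftrightarrow>
     (\<forall>K. compact K \<and> K \<subseteq> chart_img c \<longrightarrow>
        (\<exists>V. open V \<and> 0 \<in> V \<and>
           ((\<lambda>\<delta>. SUP s\<in>K. SUP x'\<in>V.
               emeasure (cond_law P (D2Y_chart X c s) (DY_chart X c s) x') {M. \<bar>det M\<bar> < \<delta>}) \<longlongrightarrow> 0)
             (at_right 0)))"


section \<open>The two sides of the formula\<close>

definition negative_definite :: "real^'n^'n \<Rightarrow> bool" where
  "negative_definite M \<longleftrightarrow> (\<forall>v. v \<noteq> 0 \<longrightarrow> v \<bullet> (M *v v) < 0)"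

text \<open>In \<open>delta\<close> and \<open>M_count\<close> the index \<open>k\<close> is 1 or 2; any \<open>k \<noteq> 1\<close> is treated as 2.\<close>

definition delta :: "nat \<Rightarrow> real^'n^'n \<Rightarrow> real" where
  "delta k M = (if k = 1 then \<bar>det M\<bar> * of_bool (negative_definite M) else \<bar>det M\<bar>)"

definition critical_point ::
  "('a, 'n::finite) chart set \<Rightarrow> ('a \<Rightarrow> 'w \<Rightarrow> real) \<Rightarrow> 'w \<Rightarrow> 'a \<Rightarrow> bool" where
  "critical_point \<A> X \<omega> t \<longleftrightarrow> (\<forall>c\<in>\<A>. t \<in> chart_dom c \<longrightarrow> DY_chart X c (chart_map c t) \<omega> = 0)"

definition local_maximum :: "'a topology \<Rightarrow> ('a \<Rightarrow> 'w \<Rightarrow> real) \<Rightarrow> 'w \<Rightarrow> 'a \<Rightarrow> bool" where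
  "local_maximum U X \<omega> t \<longleftrightarrow> (\<exists>N. openin U N \<and> t \<in> N \<and> (\<forall>t'\<in>N. X t' \<omega> \<le> X t \<omega>))"

text \<open>With values in \<open>[0,\<infinity>]\<close>, since there may be infinitely many such points.\<close>

definition M_count ::
  "'a topology \<Rightarrow> ('a, 'n::finite) chart set \<Rightarrow> ('a \<Rightarrow> 'w \<Rightarrow> real) \<Rightarrow> real \<Rightarrow> nat \<Rightarrow> 'a set \<Rightarrow> 'w \<Rightarrow> ennreal"
  where
  "M_count U \<A> X u k S \<omega> =
     emeasure (count_space UNIV)
       {t\<in>S. (if k = 1 then local_maximum U X \<omega> t else critical_point \<A> X \<omega> t) \<and> u < X t \<omega>}"

definition rice_integrand ::
  "'w measure \<Rightarrow> ('a \<Rightarrow> 'w \<Rightarrow> real) \<Rightarrow> real \<Rightarrow> nat \<Rightarrow> ('a, 'n::finite) chart \<Rightarrow> real^'n \<Rightarrow> ennreal" where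
  "rice_integrand P X u k c s =
     (\<integral>\<^sup>+x\<in>{u<..}.
        ((\<integral>\<^sup>+M. ennreal (delta k M) \<partial>cond_law P (D2Y_chart X c s) (\<lambda>\<omega>. (Y_chart X c s \<omega>, DY_chart X c s \<omega>)) (x, 0)) *
         ennreal (joint_density P (\<lambda>\<omega>. (Y_chart X c s \<omega>, DY_chart X c s \<omega>)) (x, 0))) \<partial>lborel)"

end

theory Submission
  imports Defs
begin

text \<open>In a chart, let \<open>D\<close> and \<open>H\<close> be the gradient and the Hessian of the process \<open>Y\<close>. Near a point \<open>s\<close>, let \<open>\<xi>\<close> be
  the standardised vector \<open>D s\<close>, a Gaussian vector with unit covariance. Regression on \<open>\<xi>\<close> gives
  \<open>D t = b t (\<xi> - W t)\<close> with invertible \<open>b t\<close> and a random map \<open>W\<close> that is independent of \<open>\<xi>\<close>. Hence the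
  critical points of \<open>Y\<close> are the points which \<open>W\<close> maps to an independent Gaussian vector, and where this happens
  the derivative of \<open>W\<close> is \<open>- (b t)\<^sup>-\<^sup>1 H t\<close>. By Sard's theorem almost surely all critical points are nondegenerate,
  so that the local maxima are those with a negative definite Hessian. For fixed \<open>W\<close>, the area formula
  turns the integral over the values of \<open>\<xi>\<close> of the number of these points into an integral over \<open>t\<close>; taking
  expectations, the integrand becomes the regression version of the conditional expectation in the Rice formula.

  Thus \<open>S \<mapsto> E(M(S))\<close> is a measure on the interior whose local expressions are the Rice integrands, which is why
  these agree on intersections of charts; a countable atlas shows that it is the only such measure.\<close>

section \<open>Uniqueness of characteristic functions\<close>

text \<open>The integrand contains a conditional law and a density at the single value 0 of the
  gradient, whereas a disintegration determines them only for almost every value. So two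
  disintegrations, by regression on the pair (Y, D) and by regression on \<xi>, are compared along
  all values z of the gradient, and continuity in z carries the equality to z = 0. This is done for
  bounded continuous test functions and extended by equality of finite measures, since
  \<open>delta\<close> is unbounded. The number of solutions of W t = v depends on the whole map
  \<open>W\<close>, so independence from \<xi> is needed for the sigma-algebra of all residuals and
  not just for finitely many. Derivatives of the process are Gaussian as pointwise limits of
  difference quotients, so the work takes place in a linear space of Gaussian variables enlarged by
  such limits. Standardising the gradient at s makes \<open>b s\<close> invertible, and
  invertibility persists only near s; countably many neighbourhoods are therefore added up. The
  count agrees with a measurable one only almost surely, hence the completion of
  \<open>P\<close>.\<close>

lemma integral_iexp_eq:
  assumes "finite_measure M" and [measurable]: "Z \<in> borel_measurable M"
  shows "(CLINT x|M. iexp (Z x)) = Complex (\<integral>x. cos (Z x) \<partial>M) (\<integral>x. sin (Z x) \<partial>M)"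
proof -
  interpret finite_measure M by fact
  have i: "integrable M (\<lambda>x. iexp (Z x))"
    by (rule integrable_const_bound[where B = 1]) auto
  show ?thesis
    using integral_Re[OF i] integral_Im[OF i]
    by (intro complex_eqI) (simp_all add: Re_exp Im_exp)
qed

text \<open>Levy's uniqueness theorem for the law of \<open>Z\<close> after normalisation: the
  cosine identity at s = 0 says that both measures have the same total mass \<open>m\<close>, and
  mass 0 is treated apart because it cannot be normalised.\<close>

lemma finite_measure_vimage_eqI:
  fixes Z :: "'w \<Rightarrow> real"
  assumes "finite_measure M" "finite_measure N" and s: "sets N = sets M"
    and Z: "Z \<in> borel_measurable M"
    and c: "\<And>s. (\<integral>x. cos (s * Z x) \<partial>M) = (\<integral>x. cos (s * Z x) \<partial>N)"
    and d: "\<And>s. (\<integral>x. sin (s * Z x) \<partial>M) = (\<integral>x. sin (s * Z x) \<partial>N)"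
    and B: "B \<in> sets borel"
  shows "emeasure M (Z -` B \<inter> space M) = emeasure N (Z -` B \<inter> space M)"
proof -
  interpret M: finite_measure M by fact
  interpret N: finite_measure N by fact
  note [measurable] = Z B
  have sp: "space N = space M" using s by (rule sets_eq_imp_space_eq)
  have Z'[measurable]: "Z \<in> borel_measurable N"
    using Z measurable_cong_sets[OF s refl] by blast
  define m where "m = measure M (space M)"
  have m: "measure N (space M) = m"
    using c[of 0] sp by (simp add: m_def)
  show ?thesis
  proof (cases "m = 0")
    case True
    have "measure M (Z -` B \<inter> space M) \<le> 0" "measure N (Z -` B \<inter> space M) \<le> 0"
      using M.bounded_measure[of "Z -` B \<inter> space M"] N.bounded_measure[of "Z -` B \<inter> space M"] True m m_def sp
      by auto
    then show ?thesis by (simp add: M.emeasure_eq_measure N.emeasure_eq_measure measure_le_0_iff)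
  next
    case False
    then have mp: "m > 0" by (simp add: m_def less_le)
    define Q where "Q K = distr (density K (\<lambda>_. ennreal (1 / m))) borel Z" for K
    have pr: "prob_space (density K (\<lambda>_. ennreal (1 / m)))" if "finite_measure K" "measure K (space K) = m" for K
    proof
      interpret K: finite_measure K by fact
      have "emeasure K (space K) = ennreal m" using that by (simp add: K.emeasure_eq_measure)
      then show "emeasure (density K (\<lambda>_. ennreal (1 / m))) (space (density K (\<lambda>_. ennreal (1 / m)))) = 1"
        using mp by (simp add: emeasure_density nn_integral_cmult ennreal_mult[symmetric])
    qed
    have "real_distribution (Q M)" "real_distribution (Q N)"
      unfolding Q_def
      by (auto intro!: prob_space.real_distribution_distr pr assms simp: m m_def[symmetric] sp)
    moreover have "char (Q M) = char (Q N)"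
    proof
      fix t
      have ch: "char (Q K) t = (1 / m) * Complex (\<integral>x. cos (t * Z x) \<partial>K) (\<integral>x. sin (t * Z x) \<partial>K)"
        if "finite_measure K" and [measurable]: "Z \<in> borel_measurable K" for K
      proof -
        have "char (Q K) t = (CLINT x|density K (\<lambda>_. ennreal (1 / m)). iexp (t * Z x))"
          unfolding char_def Q_def by (rule integral_distr) auto
        also have "\<dots> = (CLINT x|K. (1 / m) *\<^sub>R iexp (t * Z x))"
          using mp by (intro integral_density) auto
        also have "\<dots> = (1 / m) * (CLINT x|K. iexp (t * Z x))"
          by (simp add: scaleR_conv_of_real)
        also have "(CLINT x|K. iexp (t * Z x)) = Complex (\<integral>x. cos (t * Z x) \<partial>K) (\<integral>x. sin (t * Z x) \<partial>K)"
          by (rule integral_iexp_eq) (use that in auto)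
        finally show ?thesis .
      qed
      show "char (Q M) t = char (Q N) t"
        using ch[OF \<open>finite_measure M\<close> Z] ch[OF \<open>finite_measure N\<close> Z'] c d by simp
    qed
    ultimately have "Q M = Q N" by (rule Levy_uniqueness)
    then have "emeasure (Q M) B = emeasure (Q N) B" by simp
    then have "ennreal (1 / m) * emeasure M (Z -` B \<inter> space M) = ennreal (1 / m) * emeasure N (Z -` B \<inter> space M)"
      using measurable_sets[OF Z B] measurable_sets[OF Z' B]
      by (simp add: Q_def emeasure_distr emeasure_density_const sp)
    then show ?thesis
      using mp by (metis ennreal_mult_cancel_left ennreal_neq_top ennreal_eq_0_iff divide_pos_pos less_le_not_le zero_less_one)
  qed
qed

text \<open>For a family \<open>Zs\<close> closed under linear combinations this is equality of all
  finite-dimensional characteristic functions, separated into real and imaginary parts so that only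
  real integrals occur.\<close>

definition same_trig :: "('w \<Rightarrow> real) set \<Rightarrow> 'w measure \<Rightarrow> 'w measure \<Rightarrow> bool" where
  "same_trig Zs M N \<longleftrightarrow> finite_measure M \<and> finite_measure N \<and> sets N = sets M \<and>
     Zs \<subseteq> borel_measurable M \<and>
     (\<forall>Z\<in>Zs. (\<integral>x. cos (Z x) \<partial>M) = (\<integral>x. cos (Z x) \<partial>N) \<and> (\<integral>x. sin (Z x) \<partial>M) = (\<integral>x. sin (Z x) \<partial>N))"

text \<open>The induction step of the uniqueness proof: conditioning on an event in one variable
  preserves the hypothesis. Product-to-sum formulas write the integrals of
  \<open>cos (s * Z1 x) * cos (Z x)\<close> and its companions through Z + s Z1 and Z - s Z1, which
  again lie in \<open>Zs\<close>. For fixed \<open>Z\<close> this determines the law of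
  \<open>Z1\<close> under the measure weighted by the cosine or sine of \<open>Z\<close>.\<close>

lemma same_trig_restrict:
  assumes E: "same_trig Zs M N"
    and lin: "\<And>Z Z' c. Z \<in> Zs \<Longrightarrow> Z' \<in> Zs \<Longrightarrow> (\<lambda>x. Z x + c * Z' x) \<in> Zs"
    and Z1: "Z1 \<in> Zs" and B[measurable]: "B \<in> sets borel"
  shows "same_trig Zs (density M (indicator (Z1 -` B \<inter> space M))) (density N (indicator (Z1 -` B \<inter> space M)))"
proof -
  let ?A = "Z1 -` B \<inter> space M"
  have fM: "finite_measure M" and fN: "finite_measure N" and s: "sets N = sets M" and
    Zs: "\<And>Z. Z \<in> Zs \<Longrightarrow> Z \<in> borel_measurable M"
    and cos_eq: "\<And>Z. Z \<in> Zs \<Longrightarrow> (\<integral>x. cos (Z x) \<partial>M) = (\<integral>x. cos (Z x) \<partial>N)"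
    and sin_eq: "\<And>Z. Z \<in> Zs \<Longrightarrow> (\<integral>x. sin (Z x) \<partial>M) = (\<integral>x. sin (Z x) \<partial>N)"
    using E by (auto simp: same_trig_def)
  interpret M: finite_measure M by fact
  interpret N: finite_measure N by fact
  have sp: "space N = space M" using s by (rule sets_eq_imp_space_eq)
  have ZsN: "\<And>Z. Z \<in> Zs \<Longrightarrow> Z \<in> borel_measurable N"
    using Zs measurable_cong_sets[OF s refl] by blast
  note [measurable] = Zs[OF Z1] ZsN[OF Z1]
  have A[measurable]: "?A \<in> sets M" "?A \<in> sets N" using s by auto
  have zero: "(\<lambda>x. 0) \<in> Zs" using lin[OF Z1 Z1, of "-1"] by simp
  have scale: "(\<lambda>x. c * Z1 x) \<in> Zs" for c using lin[OF zero Z1, of c] by simp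
  have intg: "integrable M g" "integrable N g" if "g \<in> borel_measurable M" "\<And>x. \<bar>g x\<bar> \<le> 2" for g :: "'a \<Rightarrow> real"
  proof -
    have "g \<in> borel_measurable N" using that(1) measurable_cong_sets[OF s refl] by blast
    then show "integrable M g" "integrable N g"
      using that by (auto intro!: M.integrable_const_bound[where B = 2] N.integrable_const_bound[where B = 2])
  qed
  have key: "(\<integral>x. g x * indicator ?A x \<partial>M) = (\<integral>x. g x * indicator ?A x \<partial>N)"
    if [measurable]: "g \<in> borel_measurable M" and gb: "\<And>x. \<bar>g x\<bar> \<le> 1"
      and gc: "\<And>s. (\<integral>x. cos (s * Z1 x) * g x \<partial>M) = (\<integral>x. cos (s * Z1 x) * g x \<partial>N)"
      and gs: "\<And>s. (\<integral>x. sin (s * Z1 x) * g x \<partial>M) = (\<integral>x. sin (s * Z1 x) * g x \<partial>N)" for g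
  proof -
    have gN[measurable]: "g \<in> borel_measurable N" using that(1) measurable_cong_sets[OF s refl] by blast
    have ge: "0 \<le> 1 + g x" for x using gb[of x] by (auto simp: abs_le_iff)
    have gb2: "\<bar>1 + g x\<bar> \<le> 2" for x using gb[of x] by (auto simp: abs_le_iff)
    \<comment> \<open>A sine or cosine changes sign and cannot serve as a density. Adding 1 makes it
      nonnegative; the contribution of the constant is known from the unweighted measures
      (\<open>e1\<close>) and is subtracted at the end.\<close>
    let ?d = "\<lambda>x. ennreal (1 + g x)"
    have fin: "finite_measure (density K ?d)" if "finite_measure K" "g \<in> borel_measurable K" for K
    proof
      interpret K: finite_measure K by fact
      note [measurable] = that(2)
      have "(\<integral>\<^sup>+x. ?d x \<partial>K) \<le> (\<integral>\<^sup>+x. 2 \<partial>K)"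
        using gb2 by (intro nn_integral_mono) (metis abs_le_D1 ennreal_leI ennreal_numeral zero_le_numeral)
      also have "\<dots> < \<infinity>" by (simp add: K.emeasure_eq_measure ennreal_mult_less_top)
      finally show "emeasure (density K ?d) (space (density K ?d)) \<noteq> \<infinity>"
        by (simp add: emeasure_density cong: nn_integral_cong)
    qed
    have mult2: "\<bar>a * b\<bar> \<le> 2" if "\<bar>a\<bar> \<le> 1" "\<bar>b\<bar> \<le> 2" for a b :: real
      using mult_mono[OF that] by (simp add: abs_mult)
    have e1: "emeasure M ?A = emeasure N ?A"
      by (rule finite_measure_vimage_eqI[OF fM fN s]) (use cos_eq[OF scale] sin_eq[OF scale] in auto)
    have "emeasure (density M ?d) (Z1 -` B \<inter> space (density M ?d)) = emeasure (density N ?d) (Z1 -` B \<inter> space (density M ?d))"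
    proof (rule finite_measure_vimage_eqI[OF fin[OF fM] fin[OF fN]])
      fix s
      have [simp]: "integrable M (\<lambda>x. g x * cos (s * Z1 x))" "integrable N (\<lambda>x. g x * cos (s * Z1 x))"
        "integrable M (\<lambda>x. g x * sin (s * Z1 x))" "integrable N (\<lambda>x. g x * sin (s * Z1 x))"
        "integrable M (\<lambda>x. cos (s * Z1 x) * g x)" "integrable N (\<lambda>x. cos (s * Z1 x) * g x)"
        "integrable M (\<lambda>x. sin (s * Z1 x) * g x)" "integrable N (\<lambda>x. sin (s * Z1 x) * g x)"
        "integrable M (\<lambda>x. cos (s * Z1 x))" "integrable N (\<lambda>x. cos (s * Z1 x))"
        "integrable M (\<lambda>x. sin (s * Z1 x))" "integrable N (\<lambda>x. sin (s * Z1 x))"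
        by (auto intro!: intg mult2 intro: order_trans[OF gb] order_trans[OF abs_cos_le_one] order_trans[OF abs_sin_le_one])
      show "(\<integral>x. cos (s * Z1 x) \<partial>density M ?d) = (\<integral>x. cos (s * Z1 x) \<partial>density N ?d)"
        using ge gc[of s] cos_eq[OF scale, of s] by (simp add: integral_density algebra_simps)
      show "(\<integral>x. sin (s * Z1 x) \<partial>density M ?d) = (\<integral>x. sin (s * Z1 x) \<partial>density N ?d)"
        using ge gs[of s] sin_eq[OF scale, of s] by (simp add: integral_density algebra_simps)
    qed (use s in auto)
    then have "(\<integral>\<^sup>+x. ?d x * indicator ?A x \<partial>M) = (\<integral>\<^sup>+x. ?d x * indicator ?A x \<partial>N)"
      by (simp add: emeasure_density)
    moreover have "(\<integral>\<^sup>+x. ?d x * indicator ?A x \<partial>M) = ennreal (\<integral>x. (1 + g x) * indicator ?A x \<partial>M)"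
      using ge gb2 by (subst nn_integral_eq_integral[symmetric])
        (auto intro!: intg nn_integral_cong split: split_indicator)
    moreover have "(\<integral>\<^sup>+x. ?d x * indicator ?A x \<partial>N) = ennreal (\<integral>x. (1 + g x) * indicator ?A x \<partial>N)"
      using ge gb2 by (subst nn_integral_eq_integral[symmetric])
        (auto intro!: intg nn_integral_cong split: split_indicator)
    ultimately have "(\<integral>x. (1 + g x) * indicator ?A x \<partial>M) = (\<integral>x. (1 + g x) * indicator ?A x \<partial>N)"
      using ge by (simp add: integral_nonneg_AE)
    moreover have "integrable M (\<lambda>x. g x * indicator ?A x)" "integrable N (\<lambda>x. g x * indicator ?A x)"
      "integrable M (\<lambda>x. indicator ?A x::real)" "integrable N (\<lambda>x. indicator ?A x::real)"
      using order_trans[OF gb, of 2] by (auto intro!: intg split: split_indicator)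
    ultimately show ?thesis
      using e1 by (simp add: distrib_right M.emeasure_eq_measure N.emeasure_eq_measure sp)
  qed
  have main: "(\<integral>x. cos (Z x) * indicator ?A x \<partial>M) = (\<integral>x. cos (Z x) * indicator ?A x \<partial>N)"
    "(\<integral>x. sin (Z x) * indicator ?A x \<partial>M) = (\<integral>x. sin (Z x) * indicator ?A x \<partial>N)" if Z: "Z \<in> Zs" for Z
  proof -
    note [measurable] = Zs[OF Z] ZsN[OF Z]
    have pm: "(\<lambda>x. Z x + s * Z1 x) \<in> Zs" "(\<lambda>x. Z x - s * Z1 x) \<in> Zs" for s
      using lin[OF Z Z1, of s] lin[OF Z Z1, of "-s"] by auto
    have [simp]: "integrable M (\<lambda>x. cos (Z x + s * Z1 x))" "integrable N (\<lambda>x. cos (Z x + s * Z1 x))"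
        "integrable M (\<lambda>x. sin (Z x + s * Z1 x))" "integrable N (\<lambda>x. sin (Z x + s * Z1 x))"
        "integrable M (\<lambda>x. cos (Z x - s * Z1 x))" "integrable N (\<lambda>x. cos (Z x - s * Z1 x))"
        "integrable M (\<lambda>x. sin (Z x - s * Z1 x))" "integrable N (\<lambda>x. sin (Z x - s * Z1 x))" for s
        by (auto intro!: intg intro: order_trans[OF abs_cos_le_one] order_trans[OF abs_sin_le_one])
    have t1: "cos (s * Z1 x) * cos (Z x) = (cos (Z x - s * Z1 x) + cos (Z x + s * Z1 x)) / 2"
      and t2: "sin (s * Z1 x) * cos (Z x) = (sin (Z x + s * Z1 x) - sin (Z x - s * Z1 x)) / 2"
      and t3: "cos (s * Z1 x) * sin (Z x) = (sin (Z x + s * Z1 x) + sin (Z x - s * Z1 x)) / 2"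
      and t4: "sin (s * Z1 x) * sin (Z x) = (cos (Z x - s * Z1 x) - cos (Z x + s * Z1 x)) / 2" for s x
      by (simp_all add: cos_add cos_diff sin_add sin_diff)
    show "(\<integral>x. cos (Z x) * indicator ?A x \<partial>M) = (\<integral>x. cos (Z x) * indicator ?A x \<partial>N)"
      by (rule key) (simp_all add: t1 t2 cos_eq[OF pm(1)] cos_eq[OF pm(2)] sin_eq[OF pm(1)] sin_eq[OF pm(2)])
    show "(\<integral>x. sin (Z x) * indicator ?A x \<partial>M) = (\<integral>x. sin (Z x) * indicator ?A x \<partial>N)"
      by (rule key) (simp_all add: t3 t4 cos_eq[OF pm(1)] cos_eq[OF pm(2)] sin_eq[OF pm(1)] sin_eq[OF pm(2)])
  qed
  have dens: "(\<integral>x. h x \<partial>density K (indicator ?A)) = (\<integral>x. h x * indicator ?A x \<partial>K)"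
    if "h \<in> borel_measurable K" "?A \<in> sets K" for h :: "'a \<Rightarrow> real" and K
  proof -
    have "(indicator ?A :: 'a \<Rightarrow> ennreal) = (\<lambda>x. ennreal (indicator ?A x))" by (auto split: split_indicator)
    then have "(\<integral>x. h x \<partial>density K (indicator ?A)) = (\<integral>x. h x \<partial>density K (\<lambda>x. ennreal (indicator ?A x)))"
      by simp
    also have "\<dots> = (\<integral>x. indicator ?A x *\<^sub>R h x \<partial>K)"
      using that by (intro integral_density) auto
    finally show ?thesis by (simp add: mult.commute)
  qed
  have fin: "finite_measure (density K (indicator ?A))" if "finite_measure K" "?A \<in> sets K" for K
  proof
    interpret K: finite_measure K by fact
    show "emeasure (density K (indicator ?A)) (space (density K (indicator ?A))) \<noteq> \<infinity>"
      using that(2) by (simp add: emeasure_density_const emeasure_restricted Int_absorb1 sets.sets_into_space)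
  qed
  show ?thesis
    unfolding same_trig_def
    using fin[OF fM] fin[OF fN] A s Zs ZsN main by (auto simp: dens)
qed

text \<open>Cylinder sets over finitely many members of \<open>Zs\<close> are an intersection-stable
  generator. On a cylinder the conditions are imposed one at a time, each by passing to restricted
  measures, until only the total mass is left, and that is the cosine integral of the zero
  function.\<close>

theorem finite_measure_eqI_trig:
  fixes M N :: "'w measure" and Zs :: "('w \<Rightarrow> real) set"
  assumes E: "same_trig Zs M N"
    and ne: "Zs \<noteq> {}"
    and lin: "\<And>Z Z' c. Z \<in> Zs \<Longrightarrow> Z' \<in> Zs \<Longrightarrow> (\<lambda>x. Z x + c * Z' x) \<in> Zs"
    and sets_M: "sets M = sigma_sets (space M) {Z -` B \<inter> space M |Z B. Z \<in> Zs \<and> B \<in> sets borel}"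
  shows "M = N"
proof -
  define \<Omega> where "\<Omega> = space M"
  define cyl where "cyl l = {x\<in>\<Omega>. \<forall>p\<in>set l. fst p x \<in> snd p}" for l :: "(('w \<Rightarrow> real) \<times> real set) list"
  define Ls where "Ls = lists (Zs \<times> sets (borel :: real measure))"
  have cyl_eq: "emeasure M (cyl l) = emeasure N (cyl l)" if "l \<in> Ls" for l
  proof -
    \<comment> \<open>The claim is quantified over all pairs of measures because the induction step
      replaces the pair by its restrictions to an event.\<close>
    have "\<forall>M N. same_trig Zs M N \<and> space M = \<Omega> \<longrightarrow> emeasure M (cyl l) = emeasure N (cyl l) \<and> cyl l \<in> sets M"
      using that
    proof (induction l)
      case Nil
      obtain Z where Z: "Z \<in> Zs" using ne by auto
      have zero: "(\<lambda>x. 0) \<in> Zs" using lin[OF Z Z, of "-1"] by simp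
      have "emeasure M \<Omega> = emeasure N \<Omega>" if "same_trig Zs M N" "space M = \<Omega>" for M N
      proof -
        interpret M: finite_measure M using that by (simp add: same_trig_def)
        interpret N: finite_measure N using that by (simp add: same_trig_def)
        have "space N = space M" using that by (auto simp: same_trig_def dest: sets_eq_imp_space_eq)
        then show ?thesis using that zero
          by (auto simp: same_trig_def M.emeasure_eq_measure N.emeasure_eq_measure dest: bspec[OF _ zero])
      qed
      moreover have "\<Omega> \<in> sets M" if "same_trig Zs M N" "space M = \<Omega>" for M N using that by auto
      ultimately show ?case by (auto simp: cyl_def)
    next
      case (Cons p l)
      obtain Z B where p: "p = (Z, B)" "Z \<in> Zs" and B[measurable]: "B \<in> sets borel"
        using Cons.prems by (auto simp: Ls_def)
      have l: "l \<in> Ls" using Cons.prems by (auto simp: Ls_def)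
      show ?case
      proof (intro allI impI)
        fix M N :: "'w measure" assume *: "same_trig Zs M N \<and> space M = \<Omega>"
        have s: "sets N = sets M" and [measurable]: "Z \<in> borel_measurable M" using * p by (auto simp: same_trig_def)
        let ?A = "Z -` B \<inter> space M"
        have A: "?A \<in> sets M" by simp
        note r = same_trig_restrict[OF conjunct1[OF *] lin p(2) B]
        have "emeasure (density M (indicator ?A)) (cyl l) = emeasure (density N (indicator ?A)) (cyl l) \<and> cyl l \<in> sets M"
          using Cons.IH[OF l] r * by fastforce
        moreover have "cyl (p # l) = ?A \<inter> cyl l" using * by (auto simp: cyl_def p)
        ultimately show "emeasure M (cyl (p # l)) = emeasure N (cyl (p # l)) \<and> cyl (p # l) \<in> sets M"
          using emeasure_restricted[of ?A M "cyl l"] emeasure_restricted[of ?A N "cyl l"] A s by auto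
      qed
    qed
    then show ?thesis using E by (auto simp: \<Omega>_def)
  qed
  have [simp]: "sets N = sets M" and Zm: "\<And>Z. Z \<in> Zs \<Longrightarrow> Z \<in> borel_measurable M" using E by (auto simp: same_trig_def)
  have cyl_meas: "cyl l \<in> sets M" if "l \<in> Ls" for l
    using that
  proof (induction l)
    case (Cons p l)
    then have "fst p -` snd p \<inter> space M \<in> sets M" "cyl l \<in> sets M"
      using measurable_sets[OF Zm, of "fst p" "snd p"] by (auto simp: Ls_def)
    moreover have "cyl (p # l) = (fst p -` snd p \<inter> space M) \<inter> cyl l" by (auto simp: cyl_def \<Omega>_def)
    ultimately show ?case by auto
  qed (simp add: cyl_def \<Omega>_def)
  interpret finite_measure M using E by (simp add: same_trig_def)
  have sub: "{Z -` B \<inter> space M |Z B. Z \<in> Zs \<and> B \<in> sets borel} \<subseteq> cyl ` Ls"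
  proof clarify
    fix Z B assume "Z \<in> Zs" "B \<in> sets (borel::real measure)"
    then have "[(Z, B)] \<in> Ls" "Z -` B \<inter> space M = cyl [(Z, B)]" by (auto simp: Ls_def cyl_def \<Omega>_def)
    then show "Z -` B \<inter> space M \<in> cyl ` Ls" by blast
  qed
  have sg: "sets M = sigma_sets \<Omega> (cyl ` Ls)"
  proof
    show "sets M \<subseteq> sigma_sets \<Omega> (cyl ` Ls)"
      unfolding sets_M \<Omega>_def[symmetric] by (rule sigma_sets_mono') (use sub in \<open>simp add: \<Omega>_def\<close>)
    show "sigma_sets \<Omega> (cyl ` Ls) \<subseteq> sets M"
      unfolding \<Omega>_def by (rule sets.sigma_sets_subset) (use cyl_meas in auto)
  qed
  show ?thesis
  proof (rule measure_eqI_generator_eq[where E = "cyl ` Ls" and \<Omega> = \<Omega> and A = "\<lambda>_. \<Omega>"])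
    show "Int_stable (cyl ` Ls)"
    proof (rule Int_stableI)
      fix a b assume "a \<in> cyl ` Ls" "b \<in> cyl ` Ls"
      then obtain k l where kl: "a = cyl k" "b = cyl l" "k \<in> Ls" "l \<in> Ls" by auto
      then have "a \<inter> b = cyl (k @ l)" "k @ l \<in> Ls" by (auto simp: cyl_def Ls_def)
      then show "a \<inter> b \<in> cyl ` Ls" by blast
    qed
    show "range (\<lambda>_. \<Omega>) \<subseteq> cyl ` Ls" by (auto simp: cyl_def Ls_def intro!: image_eqI[where x = "[]"])
    show "cyl ` Ls \<subseteq> Pow \<Omega>" by (auto simp: cyl_def)
  qed (use cyl_eq sg in \<open>auto simp: \<Omega>_def\<close>)
qed


section \<open>Gaussian spaces\<close>

lemma (in prob_space) gaussian_rv_square_integrable: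
  assumes "gaussian_rv M Z"
  shows "integrable M Z" "integrable M (\<lambda>\<omega>. (Z \<omega>)\<^sup>2)"
proof -
  have [measurable]: "Z \<in> borel_measurable M" using assms by (simp add: gaussian_rv_def)
  have "integrable M Z \<and> integrable M (\<lambda>\<omega>. (Z \<omega>)\<^sup>2)"
    using assms unfolding gaussian_rv_def
  proof (elim conjE disjE exE)
    fix c assume c: "AE \<omega> in M. Z \<omega> = c"
    have "integrable M Z \<longleftrightarrow> integrable M (\<lambda>_. c)"
      by (rule integrable_cong_AE) (use c in auto)
    moreover have "integrable M (\<lambda>\<omega>. (Z \<omega>)\<^sup>2) \<longleftrightarrow> integrable M (\<lambda>_. c\<^sup>2)"
      by (rule integrable_cong_AE) (use c in auto)
    ultimately show ?thesis by simp
  next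
    fix m s :: real assume s: "0 < s" and D: "distributed M lborel Z (\<lambda>x. ennreal (normal_density m s x))"
    have 1: "integrable lborel (\<lambda>x. normal_density m s x * x)"
      using integrable_normal_moment_nz_1[OF s] by simp
    have "integrable lborel (\<lambda>x. normal_density m s x * (x - m)\<^sup>2 + 2 * m * (normal_density m s x * x) - m\<^sup>2 * normal_density m s x)"
      using s 1 integrable_normal_moment[OF s, of m 2] by (intro Bochner_Integration.integrable_add Bochner_Integration.integrable_diff integrable_mult_right) auto
    then have 2: "integrable lborel (\<lambda>x. normal_density m s x * x\<^sup>2)"
      by (rule Bochner_Integration.integrable_cong[THEN iffD1, rotated -1])
        (auto simp: power2_eq_square algebra_simps)
    show ?thesis
      using 1 2 distributed_integrable[OF D, of "\<lambda>x. x"] distributed_integrable[OF D, of "\<lambda>x. x\<^sup>2"] by simp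
  qed
  then show "integrable M Z" "integrable M (\<lambda>\<omega>. (Z \<omega>)\<^sup>2)" by auto
qed

lemma (in prob_space) gaussian_rv_char:
  assumes "gaussian_rv M Z"
  shows "(CLINT \<omega>|M. iexp (Z \<omega>)) = exp (\<i> * expectation Z - variance Z / 2)"
proof -
  have [measurable]: "Z \<in> borel_measurable M" using assms by (simp add: gaussian_rv_def)
  show ?thesis
    using assms unfolding gaussian_rv_def
  proof (elim conjE disjE exE)
    fix c assume c: "AE \<omega> in M. Z \<omega> = c"
    have "expectation Z = (\<integral>\<omega>. c \<partial>M)" by (rule integral_cong_AE) (use c in auto)
    then have e: "expectation Z = c" by (simp add: prob_space)
    have "variance Z = (\<integral>\<omega>. 0 \<partial>M)" unfolding e by (rule integral_cong_AE) (use c in auto)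
    moreover have "(CLINT \<omega>|M. iexp (Z \<omega>)) = (CLINT \<omega>|M. iexp c)"
      by (rule integral_cong_AE) (use c in auto)
    ultimately show ?thesis by (simp add: e prob_space)
  next
    fix m s :: real assume s: "0 < s" and D: "distributed M lborel Z (\<lambda>x. ennreal (normal_density m s x))"
    have e: "expectation Z = m" and v: "variance Z = s\<^sup>2"
      using normal_distributed_expectation[OF s D] normal_distributed_variance[OF s D] by auto
    define S where "S \<omega> = (Z \<omega> - m) / s" for \<omega>
    have DS: "distributed M lborel S (\<lambda>x. ennreal (std_normal_density x))"
      using normal_standard_normal_convert[OF s, of Z m] D unfolding S_def by simp
    then have [measurable]: "S \<in> borel_measurable M" by (simp add: distributed_def)
    have dist: "distr M borel S = std_normal_distribution"
      using DS by (simp add: distributed_def cong: distr_cong)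
    have "(CLINT \<omega>|M. iexp (s * S \<omega>)) = char (distr M borel S) s"
      unfolding char_def by (rule integral_distr[symmetric]) auto
    also have "\<dots> = exp (- (s\<^sup>2) / 2)"
      unfolding dist char_std_normal_distribution ..
    finally have *: "(CLINT \<omega>|M. iexp (s * S \<omega>)) = exp (- (s\<^sup>2) / 2)" .
    have "(CLINT \<omega>|M. iexp (Z \<omega>)) = (CLINT \<omega>|M. iexp m * iexp (s * S \<omega>))"
    proof (rule Bochner_Integration.integral_cong)
      fix \<omega>
      have Zeq: "Z \<omega> = m + s * S \<omega>" using s by (simp add: S_def)
      show "iexp (Z \<omega>) = iexp m * iexp (s * S \<omega>)"
        by (subst Zeq) (simp add: exp_add[symmetric] distrib_left)
    qed simp
    also have "\<dots> = iexp m * exp (- (s\<^sup>2) / 2)" using * by simp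
    finally have "(CLINT \<omega>|M. iexp (Z \<omega>)) = iexp m * exp (- (s\<^sup>2) / 2)" .
    moreover have "exp (\<i> * m - complex_of_real (s\<^sup>2 / 2)) = iexp m * exp (- (s\<^sup>2) / 2)"
      by (simp add: exp_of_real[symmetric] exp_add[symmetric])
    ultimately show ?thesis unfolding v unfolding e by simp
  qed
qed

text \<open>Levy uniqueness recognises a Gaussian variable by its characteristic function, the form
  in which Gaussianity passes to limits. Variance 0 is split off because \<open>gaussian_rv\<close>
  describes constants without a density.\<close>

lemma (in prob_space) gaussian_rv_charI:
  assumes [measurable]: "Z \<in> borel_measurable M" and 2: "integrable M (\<lambda>\<omega>. (Z \<omega>)\<^sup>2)"
    and ch: "\<And>t. (CLINT \<omega>|M. iexp (t * Z \<omega>)) = exp (\<i> * (t * expectation Z) - t\<^sup>2 * variance Z / 2)"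
  shows "gaussian_rv M Z"
proof (cases "variance Z = 0")
  case True
  have 1: "integrable M Z" using square_integrable_imp_integrable[OF _ 2] by simp
  have "integrable M (\<lambda>\<omega>. (Z \<omega> - expectation Z)\<^sup>2)"
    using 1 2 by (simp add: power2_diff)
  then have "AE \<omega> in M. (Z \<omega> - expectation Z)\<^sup>2 = 0"
    using True by (subst (asm) integral_nonneg_eq_0_iff_AE) auto
  then show ?thesis by (auto simp: gaussian_rv_def intro!: exI[of _ "expectation Z"])
next
  case False
  define s m where "s = sqrt (variance Z)" and "m = expectation Z"
  have "variance Z > 0" using False variance_positive[of Z] by (simp add: less_le)
  then have s: "s > 0" and s2: "s\<^sup>2 = variance Z" by (auto simp: s_def)
  let ?N = "density lborel (\<lambda>x. ennreal (normal_density m s x))"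
  have "real_distribution ?N"
    using s by (auto simp: real_distribution_def real_distribution_axioms_def prob_space_normal_density)
  moreover have "char (distr M borel Z) = char ?N"
  proof
    fix t
    interpret N: prob_space ?N using s by (rule prob_space_normal_density)
    have D: "distributed ?N lborel (\<lambda>x. x) (\<lambda>x. ennreal (normal_density m s x))"
      by (auto simp: distributed_def distr_id2)
    have "gaussian_rv ?N (\<lambda>x. t * x)"
    proof (cases "t = 0")
      case False
      have "distributed ?N lborel (\<lambda>x. 0 + t * x) (\<lambda>x. ennreal (normal_density (0 + t * m) (\<bar>t\<bar> * s) x))"
        by (rule N.normal_density_affine) (use D s False in auto)
      then show ?thesis using False s unfolding gaussian_rv_def
        by (intro conjI disjI2 exI[of _ "t * m"] exI[of _ "\<bar>t\<bar> * s"]) auto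
    qed (auto simp: gaussian_rv_def)
    from N.gaussian_rv_char[OF this]
    have "char ?N t = exp (\<i> * N.expectation (\<lambda>x. t * x) - N.variance (\<lambda>x. t * x) / 2)"
      by (simp add: char_def)
    moreover have em: "N.expectation (\<lambda>x. x) = m"
      using N.normal_distributed_expectation[OF s D] by simp
    moreover have "N.variance (\<lambda>x. t * x) = t\<^sup>2 * s\<^sup>2"
      using N.normal_distributed_variance[OF s D] N.normal_distributed_expectation[OF s D]
      by (simp add: right_diff_distrib[symmetric] power_mult_distrib)
    moreover have "char (distr M borel Z) t = (CLINT \<omega>|M. iexp (t * Z \<omega>))"
      unfolding char_def by (rule integral_distr) auto
    ultimately show "char (distr M borel Z) t = char ?N t"
      using ch[of t] by (simp add: s2 em m_def[symmetric])
  qed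
  ultimately have "distr M borel Z = ?N"
    by (intro Levy_uniqueness) auto
  then have "distributed M lborel Z (\<lambda>x. ennreal (normal_density m s x))"
    by (auto simp: distributed_def cong: distr_cong)
  then show ?thesis using s by (auto simp: gaussian_rv_def)
qed

text \<open>For Gaussian variables smallness in probability controls the second moment. The density
  is at most 1/(2 s), so mass 3/4 on an interval of length 2 e forces s \<le> 2 e. By Chebyshev the
  event |Z - m| \<ge> 2 s has probability at most 1/4, so some outcome satisfies both |Z| \<le> e
  and |Z - m| < 2 s, whence |m| \<le> 5 e. The constant is 29 = 2^2 + 5^2.\<close>

lemma (in prob_space) gaussian_rv_small_ball:
  assumes Z: "gaussian_rv M Z" and e: "e > 0" and p: "prob {\<omega>\<in>space M. \<bar>Z \<omega>\<bar> \<le> e} \<ge> 3 / 4"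
  shows "expectation (\<lambda>\<omega>. (Z \<omega>)\<^sup>2) \<le> 29 * e\<^sup>2"
proof -
  have [measurable]: "Z \<in> borel_measurable M" using Z by (simp add: gaussian_rv_def)
  show ?thesis
    using Z unfolding gaussian_rv_def
  proof (elim conjE disjE exE)
    fix c assume c: "AE \<omega> in M. Z \<omega> = c"
    have "\<bar>c\<bar> \<le> e"
    proof (rule ccontr)
      assume "\<not> \<bar>c\<bar> \<le> e"
      then have "AE \<omega> in M. \<not> \<bar>Z \<omega>\<bar> \<le> e" using c by auto
      then have "prob {\<omega>\<in>space M. \<bar>Z \<omega>\<bar> \<le> e} = 0" by (subst prob_eq_0) auto
      then show False using p by simp
    qed
    then have "c\<^sup>2 \<le> e\<^sup>2" by (metis abs_ge_zero power2_abs power_mono)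
    moreover have "expectation (\<lambda>\<omega>. (Z \<omega>)\<^sup>2) = (\<integral>\<omega>. c\<^sup>2 \<partial>M)" by (rule integral_cong_AE) (use c in auto)
    moreover have "(\<integral>\<omega>. c\<^sup>2 \<partial>M) = c\<^sup>2" by (simp add: prob_space)
    moreover have "e\<^sup>2 \<le> 29 * e\<^sup>2" by simp
    ultimately show ?thesis by linarith
  next
    fix m s :: real assume s: "0 < s" and D: "distributed M lborel Z (\<lambda>x. ennreal (normal_density m s x))"
    have ex: "expectation Z = m" and v: "variance Z = s\<^sup>2"
      using normal_distributed_expectation[OF s D] normal_distributed_variance[OF s D] by auto
    have nb: "normal_density m s x \<le> 1 / (2 * s)" for x
    proof -
      have "2 \<le> sqrt (2 * pi)" using pi_gt3 by (intro real_le_rsqrt) auto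
      then have "2 * s \<le> sqrt (2 * pi * s\<^sup>2)" using s by (simp add: real_sqrt_mult)
      then have "1 / sqrt (2 * pi * s\<^sup>2) \<le> 1 / (2 * s)" using s by (simp add: frac_le)
      moreover have "exp (- (x - m)\<^sup>2 / (2 * s\<^sup>2)) \<le> 1" by simp
      ultimately show ?thesis unfolding normal_density_def
        by (smt (verit, best) exp_ge_zero mult_left_le real_sqrt_ge_zero divide_nonneg_nonneg zero_le_mult_iff zero_le_power2 pi_ge_zero)
    qed
    have "ennreal (prob {\<omega>\<in>space M. \<bar>Z \<omega>\<bar> \<le> e}) = emeasure M (Z -` {-e..e} \<inter> space M)"
      unfolding emeasure_eq_measure by (auto intro!: arg_cong[where f = prob])
    also have "\<dots> = (\<integral>\<^sup>+x. ennreal (normal_density m s x) * indicator {-e..e} x \<partial>lborel)"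
      using distributed_emeasure[OF D, of "{-e..e}"] by simp
    also have "\<dots> \<le> (\<integral>\<^sup>+x. ennreal (1 / (2 * s)) * indicator {-e..e} x \<partial>lborel)"
      using nb by (intro nn_integral_mono mult_right_mono ennreal_leI) auto
    also have "\<dots> = ennreal (1 / (2 * s) * (2 * e))"
      using e s by (simp add: nn_integral_cmult_indicator ennreal_mult[symmetric])
    finally have "prob {\<omega>\<in>space M. \<bar>Z \<omega>\<bar> \<le> e} \<le> e / s" using e s by (subst (asm) ennreal_le_iff) auto
    then have "3 / 4 \<le> e / s" using p by linarith
    then have se: "s \<le> 2 * e" using s e by (simp add: field_simps)
    have "prob {\<omega>\<in>space M. 2 * s \<le> \<bar>Z \<omega> - m\<bar>} \<le> s\<^sup>2 / (2 * s)\<^sup>2"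
      using Chebyshev_inequality[of Z "2 * s"] gaussian_rv_square_integrable[OF Z] s unfolding v unfolding ex by simp
    then have ch: "prob {\<omega>\<in>space M. 2 * s \<le> \<bar>Z \<omega> - m\<bar>} \<le> 1 / 4" using s by (simp add: power_mult_distrib)
    have "\<exists>\<omega>. \<bar>Z \<omega>\<bar> \<le> e \<and> \<bar>Z \<omega> - m\<bar> < 2 * s"
    proof (rule ccontr)
      assume "\<not> ?thesis"
      then have "prob {\<omega>\<in>space M. \<bar>Z \<omega>\<bar> \<le> e} \<le> prob {\<omega>\<in>space M. 2 * s \<le> \<bar>Z \<omega> - m\<bar>}"
        by (intro finite_measure_mono) (auto simp: not_less)
      then show False using p ch by simp
    qed
    then have "\<bar>m\<bar> \<le> 5 * e" using se by auto
    then have "m\<^sup>2 \<le> (5 * e)\<^sup>2" by (metis abs_ge_zero power2_abs power_mono)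
    moreover have "s\<^sup>2 \<le> (2 * e)\<^sup>2" using se s by (intro power_mono) auto
    moreover have "expectation (\<lambda>\<omega>. (Z \<omega>)\<^sup>2) = s\<^sup>2 + m\<^sup>2"
      using variance_eq[OF gaussian_rv_square_integrable[OF Z]] v ex by simp
    ultimately show ?thesis by (simp add: power_mult_distrib)
  qed
qed


section \<open>Covariances and linear spaces of Gaussian variables\<close>

definition (in prob_space) covar :: "('a \<Rightarrow> real) \<Rightarrow> ('a \<Rightarrow> real) \<Rightarrow> real" where
  "covar Z W = expectation (\<lambda>\<omega>. (Z \<omega> - expectation Z) * (W \<omega> - expectation W))"

lemma (in prob_space) integrable_mult_square:
  fixes X Y :: "'a \<Rightarrow> real"
  assumes [measurable]: "X \<in> borel_measurable M" "Y \<in> borel_measurable M"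
    and X: "integrable M (\<lambda>\<omega>. (X \<omega>)\<^sup>2)" and Y: "integrable M (\<lambda>\<omega>. (Y \<omega>)\<^sup>2)"
  shows "integrable M (\<lambda>\<omega>. X \<omega> * Y \<omega>)"
proof (rule Bochner_Integration.integrable_bound)
  show "integrable M (\<lambda>\<omega>. (X \<omega>)\<^sup>2 + (Y \<omega>)\<^sup>2)" using X Y by simp
  have "\<bar>x * y\<bar> \<le> x\<^sup>2 + y\<^sup>2" for x y :: real
    using sum_squares_bound[of "\<bar>x\<bar>" "\<bar>y\<bar>"] abs_ge_zero[of "x * y"] unfolding abs_mult power2_abs by linarith
  then show "AE \<omega> in M. norm (X \<omega> * Y \<omega>) \<le> norm ((X \<omega>)\<^sup>2 + (Y \<omega>)\<^sup>2)" by auto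
qed auto

lemma (in prob_space) expectation_cauchy_schwarz:
  fixes X Y :: "'a \<Rightarrow> real"
  assumes [measurable]: "X \<in> borel_measurable M" "Y \<in> borel_measurable M"
    and X: "integrable M (\<lambda>\<omega>. (X \<omega>)\<^sup>2)" and Y: "integrable M (\<lambda>\<omega>. (Y \<omega>)\<^sup>2)"
  shows "(expectation (\<lambda>\<omega>. X \<omega> * Y \<omega>))\<^sup>2 \<le> expectation (\<lambda>\<omega>. (X \<omega>)\<^sup>2) * expectation (\<lambda>\<omega>. (Y \<omega>)\<^sup>2)"
proof -
  note XY = integrable_mult_square[OF assms]
  define a b c where "a = expectation (\<lambda>\<omega>. (X \<omega>)\<^sup>2)" and "b = expectation (\<lambda>\<omega>. X \<omega> * Y \<omega>)" and "c = expectation (\<lambda>\<omega>. (Y \<omega>)\<^sup>2)"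
  have q: "0 \<le> a - 2 * t * b + t\<^sup>2 * c" for t
  proof -
    have "(X \<omega> - t * Y \<omega>)\<^sup>2 = (X \<omega>)\<^sup>2 - 2 * t * (X \<omega> * Y \<omega>) + t\<^sup>2 * (Y \<omega>)\<^sup>2" for \<omega>
      by (simp add: power2_eq_square algebra_simps)
    then have "expectation (\<lambda>\<omega>. (X \<omega> - t * Y \<omega>)\<^sup>2) = a - 2 * t * b + t\<^sup>2 * c"
      using X Y XY by (simp add: a_def b_def c_def)
    moreover have "0 \<le> expectation (\<lambda>\<omega>. (X \<omega> - t * Y \<omega>)\<^sup>2)" by (rule integral_nonneg_AE) simp
    ultimately show ?thesis by simp
  qed
  have "b\<^sup>2 \<le> a * c"
  proof (cases "c = 0")
    case True
    have "b = 0"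
    proof (rule ccontr)
      assume "b \<noteq> 0"
      \<comment> \<open>With c = 0 the quadratic is linear in t, and this t gives it the value
        -1.\<close>
      then show False using q[of "(a + 1) / (2 * b)"] True by (simp add: field_simps)
    qed
    then show ?thesis using True by simp
  next
    case False
    have "c \<ge> 0" unfolding c_def by (rule integral_nonneg_AE) simp
    then have "c > 0" using False by simp
    then show ?thesis using q[of "b / c"] by (simp add: field_simps power2_eq_square)
  qed
  then show ?thesis by (simp add: a_def b_def c_def)
qed

text \<open>Joint Gaussianity is encoded as linearity: every linear combination of members is again
  Gaussian, so finite families are jointly Gaussian and zero covariance will mean independence. The
  single closure rule contains the zero function (c = -1), scaling and sums.\<close>

locale gaussian_space = prob_space +
  fixes L :: "('a \<Rightarrow> real) set"
  assumes gauss: "Z \<in> L \<Longrightarrow> gaussian_rv M Z"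
    and lin: "Z \<in> L \<Longrightarrow> Z' \<in> L \<Longrightarrow> (\<lambda>\<omega>. Z \<omega> + c * Z' \<omega>) \<in> L"
    and nonempty: "L \<noteq> {}"
begin

lemma L_measurable[measurable_dest]: "Z \<in> L \<Longrightarrow> Z \<in> borel_measurable M"
  using gauss by (auto simp: gaussian_rv_def)

lemma L_integrable: "Z \<in> L \<Longrightarrow> integrable M Z"
  and L_square_integrable: "Z \<in> L \<Longrightarrow> integrable M (\<lambda>\<omega>. (Z \<omega>)\<^sup>2)"
  using gaussian_rv_square_integrable[OF gauss] by auto

lemma L_mult_integrable: "Z \<in> L \<Longrightarrow> W \<in> L \<Longrightarrow> integrable M (\<lambda>\<omega>. Z \<omega> * W \<omega>)"
  by (intro integrable_mult_square L_square_integrable L_measurable)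

lemma L_zero: "(\<lambda>\<omega>. 0) \<in> L"
  using nonempty lin[of _ _ "-1"] by fastforce

lemma L_scale: "Z \<in> L \<Longrightarrow> (\<lambda>\<omega>. c * Z \<omega>) \<in> L"
  using lin[OF L_zero] by simp

lemma L_add: "Z \<in> L \<Longrightarrow> W \<in> L \<Longrightarrow> (\<lambda>\<omega>. Z \<omega> + W \<omega>) \<in> L"
  using lin[of Z W 1] by simp

lemma L_diff: "Z \<in> L \<Longrightarrow> W \<in> L \<Longrightarrow> (\<lambda>\<omega>. Z \<omega> - W \<omega>) \<in> L"
  using lin[of Z W "-1"] by simp

lemma L_sum: "(\<And>i. i \<in> I \<Longrightarrow> Z i \<in> L) \<Longrightarrow> (\<lambda>\<omega>. \<Sum>i\<in>I. Z i \<omega>) \<in> L"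
  by (induction I rule: infinite_finite_induct) (auto intro: L_zero L_add)

lemma covar_eq: "Z \<in> L \<Longrightarrow> W \<in> L \<Longrightarrow> covar Z W = expectation (\<lambda>\<omega>. Z \<omega> * W \<omega>) - expectation Z * expectation W"
  unfolding covar_def using L_integrable[of Z] L_integrable[of W] L_mult_integrable[of Z W]
  by (simp add: algebra_simps prob_space)

lemma covar_sym: "covar Z W = covar W Z"
  by (simp add: covar_def mult.commute)

lemma covar_lin: "Z \<in> L \<Longrightarrow> Z' \<in> L \<Longrightarrow> W \<in> L \<Longrightarrow> covar (\<lambda>\<omega>. Z \<omega> + c * Z' \<omega>) W = covar Z W + c * covar Z' W"
  using L_integrable[of Z] L_integrable[of Z'] L_mult_integrable[of Z W] L_mult_integrable[of Z' W]
  by (simp add: covar_eq lin algebra_simps)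

lemma covar_zero: "W \<in> L \<Longrightarrow> covar (\<lambda>\<omega>. 0) W = 0"
  by (simp add: covar_def)

lemma covar_scale: "Z \<in> L \<Longrightarrow> W \<in> L \<Longrightarrow> covar (\<lambda>\<omega>. c * Z \<omega>) W = c * covar Z W"
  using covar_lin[OF L_zero, of Z W c] by (simp add: covar_zero)

lemma covar_add: "Z \<in> L \<Longrightarrow> Z' \<in> L \<Longrightarrow> W \<in> L \<Longrightarrow> covar (\<lambda>\<omega>. Z \<omega> + Z' \<omega>) W = covar Z W + covar Z' W"
  using covar_lin[of Z Z' W 1] by simp

lemma covar_diff: "Z \<in> L \<Longrightarrow> Z' \<in> L \<Longrightarrow> W \<in> L \<Longrightarrow> covar (\<lambda>\<omega>. Z \<omega> - Z' \<omega>) W = covar Z W - covar Z' W"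
  using covar_lin[of Z Z' W "-1"] by simp

lemma covar_sum: "(\<And>i. i \<in> I \<Longrightarrow> Z i \<in> L) \<Longrightarrow> W \<in> L \<Longrightarrow> covar (\<lambda>\<omega>. \<Sum>i\<in>I. Z i \<omega>) W = (\<Sum>i\<in>I. covar (Z i) W)"
  by (induction I rule: infinite_finite_induct) (auto simp: covar_zero covar_add L_sum)

text \<open>Pointwise convergence makes differences of late terms uniformly small on an event of
  probability at least 3/4. Such differences are Gaussian members of \<open>L\<close>, so
  \<open>gaussian_rv_small_ball\<close> upgrades this to a Cauchy property in mean square, and
  Fatou's lemma replaces the second index by the limit.\<close>

lemma L_limit:
  assumes Zn: "\<And>n::nat. Zn n \<in> L" and lim: "\<And>\<omega>. \<omega> \<in> space M \<Longrightarrow> (\<lambda>n. Zn n \<omega>) \<longlonglongrightarrow> Z \<omega>"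
  shows "Z \<in> borel_measurable M" "integrable M (\<lambda>\<omega>. (Z \<omega>)\<^sup>2)"
    "(\<lambda>n. expectation (\<lambda>\<omega>. (Zn n \<omega> - Z \<omega>)\<^sup>2)) \<longlonglongrightarrow> 0"
proof -
  have [measurable]: "\<And>n. Zn n \<in> borel_measurable M" using Zn L_measurable by auto
  show Z[measurable]: "Z \<in> borel_measurable M"
    by (rule borel_measurable_LIMSEQ_real[OF lim]) auto
  have ex: "\<exists>N. \<forall>n\<ge>N. (\<integral>\<^sup>+\<omega>. ennreal ((Zn n \<omega> - Z \<omega>)\<^sup>2) \<partial>M) \<le> ennreal (29 * e\<^sup>2)" if e: "e > 0" for e
  proof -
    define A where "A N = {\<omega>\<in>space M. \<forall>n\<ge>N. \<forall>m\<ge>N. \<bar>Zn n \<omega> - Zn m \<omega>\<bar> \<le> e}" for N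
    have [measurable]: "A N \<in> sets M" for N unfolding A_def by measurable
    have "incseq A" by (fastforce simp: incseq_def A_def)
    moreover have "(\<Union>N. A N) = space M"
    proof (intro set_eqI iffI)
      fix \<omega> assume w: "\<omega> \<in> space M"
      have "Cauchy (\<lambda>n. Zn n \<omega>)" using lim[OF w] by (rule LIMSEQ_imp_Cauchy)
      then obtain N where "\<And>n m. n \<ge> N \<Longrightarrow> m \<ge> N \<Longrightarrow> dist (Zn n \<omega>) (Zn m \<omega>) < e"
        using e by (metis Cauchy_def)
      then have "\<omega> \<in> A N" using w by (force simp: A_def dist_real_def intro: less_imp_le)
      then show "\<omega> \<in> (\<Union>N. A N)" by blast
    qed (auto simp: A_def)
    ultimately have "(\<lambda>N. prob (A N)) \<longlonglongrightarrow> 1"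
      using finite_Lim_measure_incseq[of A] by (simp add: prob_space image_subset_iff)
    then have "eventually (\<lambda>N. prob (A N) > 3 / 4) sequentially"
      by (rule order_tendstoD) simp
    then obtain N where N: "prob (A N) \<ge> 3 / 4" by (meson eventually_sequentially less_imp_le order_refl)
    have NM: "expectation (\<lambda>\<omega>. (Zn n \<omega> - Zn m \<omega>)\<^sup>2) \<le> 29 * e\<^sup>2" if "n \<ge> N" "m \<ge> N" for n m
    proof (rule gaussian_rv_small_ball[OF gauss[OF L_diff[OF Zn Zn]] e])
      have "prob (A N) \<le> prob {\<omega> \<in> space M. \<bar>Zn n \<omega> - Zn m \<omega>\<bar> \<le> e}"
        using that by (intro finite_measure_mono) (auto simp: A_def)
      then show "3 / 4 \<le> prob {\<omega> \<in> space M. \<bar>Zn n \<omega> - Zn m \<omega>\<bar> \<le> e}" using N by simp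
    qed
    show ?thesis
    proof (intro exI allI impI)
      fix n assume n: "n \<ge> N"
      have "(\<integral>\<^sup>+\<omega>. ennreal ((Zn n \<omega> - Z \<omega>)\<^sup>2) \<partial>M) = (\<integral>\<^sup>+\<omega>. liminf (\<lambda>m. ennreal ((Zn n \<omega> - Zn m \<omega>)\<^sup>2)) \<partial>M)"
        by (intro nn_integral_cong lim_imp_Liminf[symmetric] tendsto_intros lim) auto
      also have "\<dots> \<le> liminf (\<lambda>m. \<integral>\<^sup>+\<omega>. ennreal ((Zn n \<omega> - Zn m \<omega>)\<^sup>2) \<partial>M)"
        by (rule nn_integral_liminf) simp
      also have "\<dots> \<le> limsup (\<lambda>m. \<integral>\<^sup>+\<omega>. ennreal ((Zn n \<omega> - Zn m \<omega>)\<^sup>2) \<partial>M)"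
        by (rule Liminf_le_Limsup) simp
      also have "\<dots> \<le> ennreal (29 * e\<^sup>2)"
      proof (rule Limsup_bounded, rule eventually_sequentiallyI)
        fix m assume "m \<ge> N"
        then show "(\<integral>\<^sup>+\<omega>. ennreal ((Zn n \<omega> - Zn m \<omega>)\<^sup>2) \<partial>M) \<le> ennreal (29 * e\<^sup>2)"
          using NM[OF n, of m] L_square_integrable[OF L_diff[OF Zn Zn], of n m]
          by (subst nn_integral_eq_integral) (auto intro: ennreal_leI)
      qed
      finally show "(\<integral>\<^sup>+\<omega>. ennreal ((Zn n \<omega> - Z \<omega>)\<^sup>2) \<partial>M) \<le> ennreal (29 * e\<^sup>2)" .
    qed
  qed
  obtain N where N: "(\<integral>\<^sup>+\<omega>. ennreal ((Zn n \<omega> - Z \<omega>)\<^sup>2) \<partial>M) \<le> ennreal (29 * 1\<^sup>2)" if "n \<ge> N" for n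
    using ex[of 1] by auto
  have i: "integrable M (\<lambda>\<omega>. (Zn N \<omega> - Z \<omega>)\<^sup>2)"
    using N[of N] by (intro integrableI_bounded) (auto simp: less_top[symmetric] top_unique)
  have "integrable M (\<lambda>\<omega>. 2 * (Zn N \<omega>)\<^sup>2 + 2 * (Zn N \<omega> - Z \<omega>)\<^sup>2)" using i L_square_integrable[OF Zn] by simp
  then show Z2: "integrable M (\<lambda>\<omega>. (Z \<omega>)\<^sup>2)"
  proof (rule Bochner_Integration.integrable_bound)
    have "z\<^sup>2 \<le> 2 * y\<^sup>2 + 2 * (y - z)\<^sup>2" for y z :: real
      using zero_le_power2[of "2 * y - z"] by (simp add: power2_eq_square algebra_simps)
    then show "AE \<omega> in M. norm ((Z \<omega>)\<^sup>2) \<le> norm (2 * (Zn N \<omega>)\<^sup>2 + 2 * (Zn N \<omega> - Z \<omega>)\<^sup>2)" by auto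
  qed auto
  have i': "integrable M (\<lambda>\<omega>. (Zn n \<omega> - Z \<omega>)\<^sup>2)" for n
    using integrable_mult_square[of "Zn n" Z] L_square_integrable[OF Zn, of n] Z2 by (simp add: power2_diff mult.assoc)
  show "(\<lambda>n. expectation (\<lambda>\<omega>. (Zn n \<omega> - Z \<omega>)\<^sup>2)) \<longlonglongrightarrow> 0"
  proof (rule LIMSEQ_I)
    fix r :: real assume r: "0 < r"
    \<comment> \<open>Any constant above the 29 of the small ball estimate would do: the aim is 29
      e^2 < r.\<close>
    define e where "e = sqrt (r / 30)"
    have e: "e > 0" "29 * e\<^sup>2 < r" using r by (auto simp: e_def)
    from ex[OF e(1)] obtain N where N: "\<And>n. n \<ge> N \<Longrightarrow> (\<integral>\<^sup>+\<omega>. ennreal ((Zn n \<omega> - Z \<omega>)\<^sup>2) \<partial>M) \<le> ennreal (29 * e\<^sup>2)" by auto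
    have "norm (expectation (\<lambda>\<omega>. (Zn n \<omega> - Z \<omega>)\<^sup>2) - 0) < r" if "n \<ge> N" for n
    proof -
      have "0 \<le> expectation (\<lambda>\<omega>. (Zn n \<omega> - Z \<omega>)\<^sup>2)" by (rule integral_nonneg_AE) simp
      moreover have "expectation (\<lambda>\<omega>. (Zn n \<omega> - Z \<omega>)\<^sup>2) \<le> 29 * e\<^sup>2"
        using N[OF that] i'[of n] by (subst (asm) nn_integral_eq_integral) auto
      ultimately show ?thesis using e(2) by simp
    qed
    then show "\<exists>no. \<forall>n\<ge>no. norm (expectation (\<lambda>\<omega>. (Zn n \<omega> - Z \<omega>)\<^sup>2) - 0) < r" by blast
  qed
qed

lemma expectation_mult_limit:
  assumes Zn: "\<And>n::nat. Zn n \<in> L" and lim: "\<And>\<omega>. \<omega> \<in> space M \<Longrightarrow> (\<lambda>n. Zn n \<omega>) \<longlonglongrightarrow> Z \<omega>"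
    and W[measurable]: "W \<in> borel_measurable M" and W2: "integrable M (\<lambda>\<omega>. (W \<omega>)\<^sup>2)"
  shows "(\<lambda>n. expectation (\<lambda>\<omega>. Zn n \<omega> * W \<omega>)) \<longlonglongrightarrow> expectation (\<lambda>\<omega>. Z \<omega> * W \<omega>)"
proof -
  note Z = L_limit[OF Zn lim]
  note [measurable] = Z(1) L_measurable[OF Zn]
  have i: "integrable M (\<lambda>\<omega>. (Zn n \<omega> - Z \<omega>)\<^sup>2)" for n
    using integrable_mult_square[of "Zn n" Z] L_square_integrable[OF Zn, of n] Z(2) by (simp add: power2_diff mult.assoc)
  have "(\<lambda>n. (expectation (\<lambda>\<omega>. (Zn n \<omega> - Z \<omega>) * W \<omega>))\<^sup>2) \<longlonglongrightarrow> 0"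
  proof (rule tendsto_sandwich[OF _ _ tendsto_const])
    show "(\<lambda>n. expectation (\<lambda>\<omega>. (Zn n \<omega> - Z \<omega>)\<^sup>2) * expectation (\<lambda>\<omega>. (W \<omega>)\<^sup>2)) \<longlonglongrightarrow> 0"
      using tendsto_mult_right[OF Z(3), of "expectation (\<lambda>\<omega>. (W \<omega>)\<^sup>2)"] by simp
    show "\<forall>\<^sub>F n in sequentially. (expectation (\<lambda>\<omega>. (Zn n \<omega> - Z \<omega>) * W \<omega>))\<^sup>2 \<le> expectation (\<lambda>\<omega>. (Zn n \<omega> - Z \<omega>)\<^sup>2) * expectation (\<lambda>\<omega>. (W \<omega>)\<^sup>2)"
      using i W2 by (intro always_eventually allI expectation_cauchy_schwarz) auto
  qed auto
  then have "(\<lambda>n. expectation (\<lambda>\<omega>. (Zn n \<omega> - Z \<omega>) * W \<omega>)) \<longlonglongrightarrow> 0"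
    by (simp add: power_tendsto_0_iff)
  moreover have "expectation (\<lambda>\<omega>. (Zn n \<omega> - Z \<omega>) * W \<omega>) = expectation (\<lambda>\<omega>. Zn n \<omega> * W \<omega>) - expectation (\<lambda>\<omega>. Z \<omega> * W \<omega>)" for n
    using integrable_mult_square[OF L_measurable[OF Zn] W L_square_integrable[OF Zn] W2, of n] integrable_mult_square[OF Z(1) W Z(2) W2]
    by (simp add: left_diff_distrib)
  ultimately show ?thesis by (simp add: LIM_zero_iff)
qed

lemma covar_limit:
  assumes Zn: "\<And>n::nat. Zn n \<in> L" and lim: "\<And>\<omega>. \<omega> \<in> space M \<Longrightarrow> (\<lambda>n. Zn n \<omega>) \<longlonglongrightarrow> Z \<omega>"
    and Z: "Z \<in> L" and W: "W \<in> L"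
  shows "(\<lambda>n. covar (Zn n) W) \<longlonglongrightarrow> covar Z W"
proof -
  have "(\<lambda>n. expectation (\<lambda>\<omega>. Zn n \<omega> * 1)) \<longlonglongrightarrow> expectation (\<lambda>\<omega>. Z \<omega> * 1)"
    by (rule expectation_mult_limit[OF Zn lim]) auto
  moreover have "(\<lambda>n. expectation (\<lambda>\<omega>. Zn n \<omega> * W \<omega>)) \<longlonglongrightarrow> expectation (\<lambda>\<omega>. Z \<omega> * W \<omega>)"
    using W by (intro expectation_mult_limit[OF Zn lim] L_square_integrable L_measurable)
  ultimately show ?thesis
    using Zn Z W by (simp add: covar_eq) (intro tendsto_intros)
qed

text \<open>Mean and variance converge by mean square convergence, characteristic functions by
  dominated convergence; the limit therefore has the characteristic function that
  \<open>gaussian_rv_charI\<close> asks for.\<close>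

lemma gaussian_rv_limit:
  assumes Zn: "\<And>n::nat. Zn n \<in> L" and lim: "\<And>\<omega>. \<omega> \<in> space M \<Longrightarrow> (\<lambda>n. Zn n \<omega>) \<longlonglongrightarrow> Z \<omega>"
  shows "gaussian_rv M Z"
proof (rule gaussian_rv_charI)
  note Z = L_limit[OF Zn lim]
  show Zm[measurable]: "Z \<in> borel_measurable M" and Z2: "integrable M (\<lambda>\<omega>. (Z \<omega>)\<^sup>2)" using Z by auto
  have Z1: "integrable M Z" using square_integrable_imp_integrable[OF Zm Z2] by simp
  note [measurable] = L_measurable[OF Zn]
  have e: "(\<lambda>n. expectation (\<lambda>\<omega>. Zn n \<omega> * 1)) \<longlonglongrightarrow> expectation (\<lambda>\<omega>. Z \<omega> * 1)"
    by (rule expectation_mult_limit[OF Zn lim]) auto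
  have zz: "(\<lambda>n. expectation (\<lambda>\<omega>. Zn n \<omega> * Z \<omega>)) \<longlonglongrightarrow> expectation (\<lambda>\<omega>. Z \<omega> * Z \<omega>)"
    by (rule expectation_mult_limit[OF Zn lim]) (use Z2 in auto)
  have "expectation (\<lambda>\<omega>. (Zn n \<omega>)\<^sup>2) = expectation (\<lambda>\<omega>. (Zn n \<omega> - Z \<omega>)\<^sup>2) + 2 * expectation (\<lambda>\<omega>. Zn n \<omega> * Z \<omega>) - expectation (\<lambda>\<omega>. (Z \<omega>)\<^sup>2)" for n
    using integrable_mult_square[OF L_measurable[OF Zn] Zm L_square_integrable[OF Zn] Z2, of n] L_square_integrable[OF Zn, of n] Z2
    by (simp add: power2_diff mult.assoc)
  moreover have "(\<lambda>n. expectation (\<lambda>\<omega>. (Zn n \<omega> - Z \<omega>)\<^sup>2) + 2 * expectation (\<lambda>\<omega>. Zn n \<omega> * Z \<omega>) - expectation (\<lambda>\<omega>. (Z \<omega>)\<^sup>2))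
      \<longlonglongrightarrow> 0 + 2 * expectation (\<lambda>\<omega>. Z \<omega> * Z \<omega>) - expectation (\<lambda>\<omega>. (Z \<omega>)\<^sup>2)"
    by (intro tendsto_intros zz Z(3))
  ultimately have "(\<lambda>n. expectation (\<lambda>\<omega>. (Zn n \<omega>)\<^sup>2)) \<longlonglongrightarrow> expectation (\<lambda>\<omega>. (Z \<omega>)\<^sup>2)"
    by (simp add: power2_eq_square)
  then have v: "(\<lambda>n. variance (Zn n)) \<longlonglongrightarrow> variance Z"
    unfolding variance_eq[OF L_integrable[OF Zn] L_square_integrable[OF Zn]] variance_eq[OF Z1 Z2]
    using e by (intro tendsto_intros) auto
  fix t :: real
  have "(\<lambda>n. CLINT \<omega>|M. iexp (t * Zn n \<omega>)) \<longlonglongrightarrow> (CLINT \<omega>|M. iexp (t * Z \<omega>))"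
  proof (rule integral_dominated_convergence[where w = "\<lambda>_. 1"])
    show "AE \<omega> in M. (\<lambda>n. iexp (t * Zn n \<omega>)) \<longlonglongrightarrow> iexp (t * Z \<omega>)"
      using lim by (intro AE_I2 tendsto_intros) auto
  qed auto
  moreover have "(CLINT \<omega>|M. iexp (t * Zn n \<omega>)) = exp (\<i> * (t * expectation (Zn n)) - t\<^sup>2 * variance (Zn n) / 2)" for n
  proof -
    have "variance (\<lambda>\<omega>. t * Zn n \<omega>) = t\<^sup>2 * variance (Zn n)"
      by (simp add: right_diff_distrib[symmetric] power_mult_distrib)
    then show ?thesis using gaussian_rv_char[OF gauss[OF L_scale[OF Zn, of t n]]] by simp
  qed
  moreover have "(\<lambda>n. exp (\<i> * (t * expectation (Zn n)) - complex_of_real (t\<^sup>2 * variance (Zn n) / 2))) \<longlonglongrightarrow> exp (\<i> * (t * expectation Z) - complex_of_real (t\<^sup>2 * variance Z / 2))"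
    using e by (intro tendsto_intros v) auto
  ultimately show "(CLINT \<omega>|M. iexp (t * Z \<omega>)) = exp (\<i> * (t * expectation Z) - t\<^sup>2 * variance Z / 2)"
    by (simp add: LIMSEQ_unique)
qed

text \<open>Limits are those of sequences, pointwise on the whole probability space, which is
  exactly what difference quotients of the paths provide. The construction is applied once for each
  order of differentiation.\<close>

definition limits :: "('a \<Rightarrow> real) set" where
  "limits = {Z. \<exists>Zn. (\<forall>n::nat. Zn n \<in> L) \<and> (\<forall>\<omega>\<in>space M. (\<lambda>n. Zn n \<omega>) \<longlonglongrightarrow> Z \<omega>)}"

lemma L_subset_limits: "L \<subseteq> limits"
  unfolding limits_def by (force intro: exI[of _ "\<lambda>_. Z" for Z])

lemma gaussian_space_limits: "gaussian_space M limits"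
proof
  fix Z assume "Z \<in> limits"
  then show "gaussian_rv M Z" unfolding limits_def by (blast intro: gaussian_rv_limit)
next
  fix Z Z' and c :: real assume "Z \<in> limits" "Z' \<in> limits"
  then obtain Zn Zn' where "\<forall>n::nat. Zn n \<in> L" "\<forall>\<omega>\<in>space M. (\<lambda>n. Zn n \<omega>) \<longlonglongrightarrow> Z \<omega>"
    "\<forall>n::nat. Zn' n \<in> L" "\<forall>\<omega>\<in>space M. (\<lambda>n. Zn' n \<omega>) \<longlonglongrightarrow> Z' \<omega>" unfolding limits_def by blast
  then show "(\<lambda>\<omega>. Z \<omega> + c * Z' \<omega>) \<in> limits"
    unfolding limits_def
    by (auto intro!: exI[of _ "\<lambda>n \<omega>. Zn n \<omega> + c * Zn' n \<omega>"] lin tendsto_intros)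
qed (use nonempty L_subset_limits in auto)

end

lemma gaussian_space_span:
  assumes "prob_space P" and Y: "gaussian_process P T Y"
  shows "gaussian_space P {(\<lambda>\<omega>. \<Sum>t\<in>F. b t * Y t \<omega>) |F b. finite F \<and> F \<subseteq> T}"
    (is "gaussian_space P ?L")
proof -
  interpret prob_space P by fact
  show ?thesis
  proof
    fix Z assume "Z \<in> ?L"
    then show "gaussian_rv P Z" using Y by (auto simp: gaussian_process_def)
  next
    fix Z Z' and c :: real assume "Z \<in> ?L" "Z' \<in> ?L"
    then obtain F b F' b' where Z: "Z = (\<lambda>\<omega>. \<Sum>t\<in>F. b t * Y t \<omega>)" "finite F" "F \<subseteq> T"
      and Z': "Z' = (\<lambda>\<omega>. \<Sum>t\<in>F'. b' t * Y t \<omega>)" "finite F'" "F' \<subseteq> T" by auto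
    define d where "d t = (if t \<in> F then b t else 0) + c * (if t \<in> F' then b' t else 0)" for t
    have "(\<lambda>\<omega>. Z \<omega> + c * Z' \<omega>) = (\<lambda>\<omega>. \<Sum>t\<in>F \<union> F'. d t * Y t \<omega>)"
    proof
      fix \<omega>
      have "Z \<omega> = (\<Sum>t\<in>F \<union> F'. (if t \<in> F then b t else 0) * Y t \<omega>)"
        unfolding Z(1) using Z Z' by (intro sum.mono_neutral_cong_left) auto
      moreover have "Z' \<omega> = (\<Sum>t\<in>F \<union> F'. (if t \<in> F' then b' t else 0) * Y t \<omega>)"
        unfolding Z'(1) using Z Z' by (intro sum.mono_neutral_cong_left) auto
      ultimately show "Z \<omega> + c * Z' \<omega> = (\<Sum>t\<in>F \<union> F'. d t * Y t \<omega>)"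
        by (simp add: d_def distrib_right sum.distrib sum_distrib_left mult.assoc)
    qed
    then show "(\<lambda>\<omega>. Z \<omega> + c * Z' \<omega>) \<in> ?L" using Z Z' by blast
  next
    show "?L \<noteq> {}" by blast
  qed
qed


section \<open>The area formula\<close>

text \<open>The library proves the change of variables theorem for well-ordered index types only. Copying an
  arbitrary finite index type to a well-ordered one removes this restriction.\<close>

typedef 'n idx = "UNIV :: 'n set" ..
instance idx :: (finite) finite
proof
  have "(UNIV :: 'a idx set) = Abs_idx ` UNIV" by (metis UNIV_eq_I Abs_idx_cases imageI)
  then show "finite (UNIV :: 'a idx set)" by (metis finite_imageI finite)
qed
instantiation idx :: (finite) wellorder
begin
definition less_eq_idx :: "'a idx \<Rightarrow> 'a idx \<Rightarrow> bool" where
  "x \<le> y \<longleftrightarrow> to_nat_on (UNIV :: 'a set) (Rep_idx x) \<le> to_nat_on (UNIV :: 'a set) (Rep_idx y)"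
definition less_idx :: "'a idx \<Rightarrow> 'a idx \<Rightarrow> bool" where
  "x < y \<longleftrightarrow> to_nat_on (UNIV :: 'a set) (Rep_idx x) < to_nat_on (UNIV :: 'a set) (Rep_idx y)"
instance
proof
  fix x y z :: "'a idx"
  have inj: "inj (to_nat_on (UNIV::'a set))" by (simp add: inj_on_to_nat_on)
  show "x \<le> y \<Longrightarrow> y \<le> x \<Longrightarrow> x = y"
    using injD[OF inj, of "Rep_idx x" "Rep_idx y"] by (simp add: less_eq_idx_def Rep_idx_inject)
next
  fix P :: "'a idx \<Rightarrow> bool" and a :: "'a idx"
  assume step: "\<And>x. (\<And>y. y < x \<Longrightarrow> P y) \<Longrightarrow> P x"
  show "P a"
  proof (induction a rule: measure_induct_rule[where f = "\<lambda>x. to_nat_on (UNIV :: 'a set) (Rep_idx x)"])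
    case (less x)
    then show ?case by - (rule step, simp add: less_idx_def)
  qed
qed (auto simp: less_eq_idx_def less_idx_def)
end


definition to_idx :: "real^'n \<Rightarrow> real^('n idx)" where "to_idx x = (\<chi> i. x $ Rep_idx i)"
definition of_idx :: "real^('n idx) \<Rightarrow> real^'n" where "of_idx y = (\<chi> i. y $ Abs_idx i)"

lemma Rep_Abs_idx [simp]: "Rep_idx (Abs_idx i) = i" by (simp add: Abs_idx_inverse)
lemma Abs_Rep_idx [simp]: "Abs_idx (Rep_idx i) = i" by (rule Rep_idx_inverse)
lemma of_to_idx [simp]: "of_idx (to_idx x) = x" by (simp add: to_idx_def of_idx_def vec_eq_iff)
lemma to_of_idx [simp]: "to_idx (of_idx x) = x" by (simp add: to_idx_def of_idx_def vec_eq_iff)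

lemma bij_Rep_idx: "bij (Rep_idx :: 'n idx \<Rightarrow> 'n)"
  by (rule o_bij[where g = Abs_idx]) auto
lemma bij_Abs_idx: "bij (Abs_idx :: 'n \<Rightarrow> 'n idx)"
  by (rule o_bij[where g = Rep_idx]) auto

lemma bounded_linear_to_idx: "bounded_linear (to_idx :: real^'n::finite \<Rightarrow> _)"
  by (intro linear_conv_bounded_linear[THEN iffD1] linearI) (auto simp: to_idx_def vec_eq_iff)
lemma bounded_linear_of_idx: "bounded_linear (of_idx :: _ \<Rightarrow> real^'n::finite)"
  by (intro linear_conv_bounded_linear[THEN iffD1] linearI) (auto simp: of_idx_def vec_eq_iff)

lemma continuous_to_idx: "continuous_on S (to_idx :: real^'n::finite \<Rightarrow> _)"
  using bounded_linear_to_idx by (rule linear_continuous_on)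
lemma continuous_of_idx: "continuous_on S (of_idx :: _ \<Rightarrow> real^'n::finite)"
  using bounded_linear_of_idx by (rule linear_continuous_on)

lemma measurable_to_idx [measurable]: "(to_idx :: real^'n::finite \<Rightarrow> _) \<in> borel_measurable borel"
  using continuous_to_idx by (rule borel_measurable_continuous_onI)
lemma measurable_of_idx [measurable]: "(of_idx :: _ \<Rightarrow> real^'n::finite) \<in> borel_measurable borel"
  using continuous_of_idx by (rule borel_measurable_continuous_onI)

lemma prod_Basis_cart: "(\<Prod>b\<in>Basis. f (b :: real^'n::finite)) = (\<Prod>i\<in>UNIV. f (axis i 1))"
proof -
  have "Basis = range (\<lambda>i. axis i (1::real) :: real^'n)" by (auto simp: Basis_vec_def)
  moreover have "inj (\<lambda>i. axis i (1::real) :: real^'n)" by (auto simp: inj_on_def axis_eq_axis)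
  ultimately show ?thesis by (metis (no_types, lifting) prod.reindex o_apply prod.cong)
qed

lemma distr_to_idx: "distr lborel borel (to_idx :: real^'n::finite \<Rightarrow> _) = lborel"
proof (rule lborel_eqI[symmetric])
  fix l u :: "real^('n idx)" assume lu: "\<And>b. b \<in> Basis \<Longrightarrow> l \<bullet> b \<le> u \<bullet> b"
  have le: "l $ i \<le> u $ i" for i using lu[of "axis i 1"] by (simp add: inner_axis axis_in_Basis_iff)
  have "to_idx -` box l u = box (of_idx l) (of_idx u :: real^'n)"
    by (auto simp: mem_box_cart to_idx_def of_idx_def) (metis Rep_Abs_idx Abs_Rep_idx)+
  moreover have "of_idx l \<bullet> b \<le> of_idx u \<bullet> b" if "b \<in> Basis" for b :: "real^'n"
    using that le by (auto simp: Basis_vec_def inner_axis of_idx_def)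
  ultimately have "emeasure (distr lborel borel to_idx) (box l u) = (\<Prod>b\<in>Basis. (of_idx u - of_idx l :: real^'n) \<bullet> b)"
    by (simp add: emeasure_distr emeasure_lborel_box)
  also have "(\<Prod>b\<in>Basis. (of_idx u - of_idx l :: real^'n) \<bullet> b) = (\<Prod>i\<in>UNIV. u $ Abs_idx i - l $ Abs_idx (i::'n))"
    by (simp add: prod_Basis_cart inner_axis of_idx_def)
  also have "\<dots> = (\<Prod>i\<in>UNIV. u $ i - l $ i)"
    by (rule prod.reindex_bij_betw[OF bij_Abs_idx])
  also have "\<dots> = (\<Prod>b\<in>Basis. (u - l) \<bullet> b)"
    by (simp add: prod_Basis_cart inner_axis)
  finally show "emeasure (distr lborel borel (to_idx :: real^'n \<Rightarrow> _)) (box l u) = (\<Prod>b\<in>Basis. (u - l) \<bullet> b)" .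
qed simp

text \<open>Relabelling carries a transposition to a transposition, so writing \<open>p\<close> as a
  product of transpositions settles the parity. A determinant over the copied index type is a sum
  over the permutations of that type, which is where the signs have to be compared.\<close>

lemma sign_conj_idx:
  fixes p :: "'n::finite \<Rightarrow> 'n"
  assumes "p permutes UNIV"
  shows "sign (Abs_idx \<circ> p \<circ> Rep_idx) = sign p"
proof -
  have "permutation (Abs_idx \<circ> p \<circ> Rep_idx) \<and> sign (Abs_idx \<circ> p \<circ> Rep_idx) = sign p"
    using finite assms
  proof (induction rule: permutes_rev_induct)
    case id
    have "Abs_idx \<circ> id \<circ> Rep_idx = (id :: 'n idx \<Rightarrow> _)" by auto
    then show ?case by (simp only: sign_id permutation_id simp_thms)
  next
    case (swap a b p)
    have eq: "Abs_idx \<circ> (p \<circ> Transposition.transpose a b) \<circ> Rep_idx = (Abs_idx \<circ> p \<circ> Rep_idx) \<circ> Transposition.transpose (Abs_idx a) (Abs_idx b)"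
    proof
      fix i :: "'n idx"
      show "(Abs_idx \<circ> (p \<circ> Transposition.transpose a b) \<circ> Rep_idx) i = ((Abs_idx \<circ> p \<circ> Rep_idx) \<circ> Transposition.transpose (Abs_idx a) (Abs_idx b)) i"
        by (auto simp: Transposition.transpose_def)
    qed
    have sg: "sign (Transposition.transpose (Abs_idx a) (Abs_idx b)) = sign (Transposition.transpose a b)"
      by (simp only: sign_swap_id Abs_idx_inject[OF UNIV_I UNIV_I])
    have "permutation p"
      unfolding permutation_permutes using swap.hyps by (intro exI[of _ UNIV]) simp
    note s1 = sign_compose[OF this permutation_swap_id, of a b]
    note s2 = sign_compose[OF conjunct1[OF swap.IH] permutation_swap_id, of "Abs_idx a" "Abs_idx b"]
    have "permutation ((Abs_idx \<circ> p \<circ> Rep_idx) \<circ> Transposition.transpose (Abs_idx a) (Abs_idx b))"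
      by (rule permutation_compose[OF conjunct1[OF swap.IH] permutation_swap_id])
    moreover have "sign ((Abs_idx \<circ> p \<circ> Rep_idx) \<circ> Transposition.transpose (Abs_idx a) (Abs_idx b)) = sign (p \<circ> Transposition.transpose a b)"
      unfolding s1 s2 sg conjunct2[OF swap.IH] ..
    ultimately have "permutation ((Abs_idx \<circ> p \<circ> Rep_idx) \<circ> Transposition.transpose (Abs_idx a) (Abs_idx b)) \<and>
      sign ((Abs_idx \<circ> p \<circ> Rep_idx) \<circ> Transposition.transpose (Abs_idx a) (Abs_idx b)) = sign (p \<circ> Transposition.transpose a b)" by (rule conjI)
    then show ?case unfolding eq by blast
  qed
  then show ?thesis by simp
qed

lemma det_reindex_idx:
  fixes A :: "real^'n::finite^'n"
  shows "det (\<chi> i j. A $ Rep_idx i $ Rep_idx j) = det A"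
proof -
  let ?c = "\<lambda>p. Abs_idx \<circ> p \<circ> Rep_idx"
  have bij: "bij_betw ?c {p. p permutes (UNIV::'n set)} {p. p permutes (UNIV::'n idx set)}"
  proof (rule bij_betwI[where g = "\<lambda>q. Rep_idx \<circ> q \<circ> Abs_idx"])
    show "?c \<in> {p. p permutes (UNIV::'n set)} \<rightarrow> {p. p permutes (UNIV::'n idx set)}"
      using bij_Rep_idx bij_Abs_idx by (auto intro!: bij_comp bij_imp_permutes dest: permutes_bij)
    show "(\<lambda>q. Rep_idx \<circ> q \<circ> Abs_idx) \<in> {p. p permutes (UNIV::'n idx set)} \<rightarrow> {p. p permutes (UNIV::'n set)}"
      using bij_Rep_idx bij_Abs_idx by (auto intro!: bij_comp bij_imp_permutes dest: permutes_bij)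
  qed (auto simp: fun_eq_iff)
  have "det (\<chi> i j. A $ Rep_idx i $ Rep_idx j) =
    (\<Sum>q | q permutes (UNIV::'n idx set). of_int (sign q) * (\<Prod>i\<in>UNIV. A $ Rep_idx i $ Rep_idx (q i)))"
    by (simp add: det_def)
  also have "\<dots> = (\<Sum>p | p permutes (UNIV::'n set). of_int (sign (?c p)) * (\<Prod>i\<in>UNIV. A $ Rep_idx i $ Rep_idx (?c p i)))"
    by (rule sum.reindex_bij_betw[OF bij, symmetric])
  also have "\<dots> = (\<Sum>p | p permutes (UNIV::'n set). of_int (sign p) * (\<Prod>i\<in>UNIV. A $ i $ p i))"
  proof (rule sum.cong)
    fix p assume "p \<in> {p. p permutes (UNIV::'n set)}"
    moreover have "(\<Prod>i\<in>UNIV. A $ Rep_idx i $ p (Rep_idx i)) = (\<Prod>i\<in>UNIV. A $ i $ p i)"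
      by (rule prod.reindex_bij_betw[OF bij_Rep_idx])
    ultimately show "of_int (sign (?c p)) * (\<Prod>i\<in>UNIV. A $ Rep_idx i $ Rep_idx (?c p i)) = of_int (sign p) * (\<Prod>i\<in>UNIV. A $ i $ p i)"
      by (simp add: sign_conj_idx)
  qed simp
  finally show ?thesis by (simp add: det_def)
qed

lemma det_matrix_conj_idx:
  fixes f :: "real^'n::finite \<Rightarrow> real^'n"
  shows "det (matrix (\<lambda>h. to_idx (f (of_idx h)))) = det (matrix f)"
proof -
  have [simp]: "of_idx (axis j 1) = axis (Rep_idx j) 1" for j :: "'n idx"
    by (auto simp: of_idx_def axis_def vec_eq_iff)
  have "matrix (\<lambda>h. to_idx (f (of_idx h))) = (\<chi> i j. matrix f $ Rep_idx i $ Rep_idx j)"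
    by (simp add: matrix_def to_idx_def vec_eq_iff)
  then show ?thesis by (simp add: det_reindex_idx)
qed

lemma emeasure_lborel_to_idx_image:
  assumes [measurable]: "B \<in> sets borel"
  shows "to_idx ` B \<in> sets borel" "emeasure lborel (to_idx ` (B :: (real^'n::finite) set)) = emeasure lborel B"
proof -
  have eq: "to_idx ` B = of_idx -` B \<inter> space borel" by (auto intro!: image_eqI[where x = "of_idx _"])
  show b[measurable]: "to_idx ` B \<in> sets borel" unfolding eq by measurable
  have "to_idx -` to_idx ` B = B" by (auto dest: arg_cong[where f = of_idx])
  then show "emeasure lborel (to_idx ` B) = emeasure lborel B"
    by (subst distr_to_idx[symmetric], subst emeasure_distr) (use b in auto)
qed

lemma has_derivative_conj_idx:
  fixes f :: "real^'n::finite \<Rightarrow> real^'n"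
  assumes "(f has_derivative f') (at (of_idx y) within S)"
  shows "((\<lambda>y. to_idx (f (of_idx y))) has_derivative (\<lambda>h. to_idx (f' (of_idx h)))) (at y within to_idx ` S)"
proof -
  have S: "of_idx ` to_idx ` S = S" by (auto simp: image_image)
  have "(of_idx has_derivative of_idx) (at y within to_idx ` S)"
    by (rule bounded_linear_imp_has_derivative[OF bounded_linear_of_idx])
  then have "((\<lambda>y. f (of_idx y)) has_derivative (\<lambda>h. f' (of_idx h))) (at y within to_idx ` S)"
    using has_derivative_in_compose[of of_idx of_idx y "to_idx ` S" f f'] assms S by simp
  then show ?thesis by (rule bounded_linear.has_derivative[OF bounded_linear_to_idx])
qed

text \<open>The change of variables theorem relates finite quantities: the integral exists with
  value m exactly when the image has finite measure m. For values in [0, \<infinity>] the infinite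
  case follows by contraposition.\<close>

lemma emeasure_lborel_image_wo:
  fixes f :: "real^'n::{finite,wellorder} \<Rightarrow> real^'n::_"
  assumes S: "S \<in> sets borel" "f ` S \<in> sets borel"
    and der: "\<And>x. x \<in> S \<Longrightarrow> (f has_derivative f' x) (at x within S)"
    and inj: "inj_on f S"
    and meas: "(\<lambda>x. indicator S x * \<bar>det (matrix (f' x))\<bar>) \<in> borel_measurable borel"
  shows "emeasure lborel (f ` S) = (\<integral>\<^sup>+x. ennreal (indicator S x * \<bar>det (matrix (f' x))\<bar>) \<partial>lborel)"
proof -
  let ?g = "\<lambda>x. indicator S x * \<bar>det (matrix (f' x))\<bar>"
  note [measurable] = meas
  have SL: "S \<in> sets lebesgue" using S by auto
  note key = has_measure_differentiable_image[OF SL der inj]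
  have restr: "((\<lambda>x. \<bar>det (matrix (f' x))\<bar>) has_integral m) S \<longleftrightarrow> (?g has_integral m) UNIV" for m
  proof -
    have "?g = (\<lambda>x. if x \<in> S then \<bar>det (matrix (f' x))\<bar> else 0)" by auto
    then show ?thesis by (simp only: has_integral_restrict_UNIV)
  qed
  show ?thesis
  proof (cases "(\<integral>\<^sup>+x. ennreal (?g x) \<partial>lborel) = \<infinity>")
    case False
    then have "integrable lborel ?g"
      by (intro integrableI_bounded) (auto simp: less_top[symmetric])
    then have "(?g has_integral (\<integral>x. ?g x \<partial>lborel)) UNIV"
      by (rule has_integral_integral_lborel)
    then have "f ` S \<in> lmeasurable \<and> measure lebesgue (f ` S) = (\<integral>x. ?g x \<partial>lborel)"
      using key restr by blast
    then have "emeasure lebesgue (f ` S) = ennreal (\<integral>x. ?g x \<partial>lborel)"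
      by (simp add: emeasure_eq_measure2)
    also have "\<dots> = (\<integral>\<^sup>+x. ennreal (?g x) \<partial>lborel)"
      using \<open>integrable lborel ?g\<close> by (intro nn_integral_eq_integral[symmetric]) auto
    finally show ?thesis using S by simp
  next
    case True
    have "emeasure lborel (f ` S) = \<infinity>"
    proof (rule ccontr)
      assume "emeasure lborel (f ` S) \<noteq> \<infinity>"
      then have "f ` S \<in> lmeasurable" using S by (simp add: fmeasurable_def less_top)
      then have "(?g has_integral (measure lebesgue (f ` S))) UNIV" using key restr by blast
      then have "(\<integral>\<^sup>+x. ennreal (?g x) \<partial>lborel) = ennreal (measure lebesgue (f ` S))"
        by (intro nn_integral_has_integral_lborel) auto
      then show False using True by simp
    qed
    then show ?thesis using True by simp
  qed
qed

lemma emeasure_lborel_image: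
  fixes f :: "real^'n::finite \<Rightarrow> real^'n"
  assumes S: "S \<in> sets borel" "f ` S \<in> sets borel"
    and der: "\<And>x. x \<in> S \<Longrightarrow> (f has_derivative f' x) (at x within S)"
    and inj: "inj_on f S"
    and meas[measurable]: "(\<lambda>x. indicator S x * \<bar>det (matrix (f' x))\<bar>) \<in> borel_measurable borel"
  shows "emeasure lborel (f ` S) = (\<integral>\<^sup>+x. ennreal (indicator S x * \<bar>det (matrix (f' x))\<bar>) \<partial>lborel)"
proof -
  let ?f = "\<lambda>y. to_idx (f (of_idx y))" and ?f' = "\<lambda>y h. to_idx (f' (of_idx y) (of_idx h))" and ?S = "to_idx ` S"
  have im: "?f ` ?S = to_idx ` f ` S" by (auto simp: image_image)
  have ind: "indicator ?S y = (indicator S (of_idx y) :: real)" for y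
    by (auto simp: indicator_def intro!: image_eqI[where x = "of_idx y"])
  have "emeasure lborel (f ` S) = emeasure lborel (?f ` ?S)"
    using emeasure_lborel_to_idx_image[OF S(2)] by (simp add: im)
  also have "\<dots> = (\<integral>\<^sup>+y. ennreal (indicator ?S y * \<bar>det (matrix (?f' y))\<bar>) \<partial>lborel)"
  proof (rule emeasure_lborel_image_wo)
    show "?S \<in> sets borel" "?f ` ?S \<in> sets borel"
      using emeasure_lborel_to_idx_image S unfolding im by auto
    show "(?f has_derivative ?f' y) (at y within ?S)" if "y \<in> ?S" for y
      by (rule has_derivative_conj_idx) (use that der in auto)
    show "inj_on ?f ?S"
      using inj by (auto simp: inj_on_def dest!: arg_cong[where f = of_idx])
    have "(\<lambda>y. indicator S (of_idx y) * \<bar>det (matrix (f' (of_idx y)))\<bar>) \<in> borel_measurable borel"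
      using measurable_compose[OF measurable_of_idx meas] by simp
    then show "(\<lambda>y. indicator ?S y * \<bar>det (matrix (?f' y))\<bar>) \<in> borel_measurable borel"
      by (simp add: ind det_matrix_conj_idx)
  qed
  also have "\<dots> = (\<integral>\<^sup>+y. ennreal (indicator S (of_idx y) * \<bar>det (matrix (f' (of_idx y)))\<bar>) \<partial>distr lborel borel to_idx)"
    by (simp add: ind det_matrix_conj_idx distr_to_idx)
  also have "\<dots> = (\<integral>\<^sup>+x. ennreal (indicator S x * \<bar>det (matrix (f' x))\<bar>) \<partial>lborel)"
    using measurable_compose[OF measurable_of_idx meas] by (subst nn_integral_distr) auto
  finally show ?thesis .
qed

text \<open>Compactness of \<open>S\<close> makes the image compact, hence Borel, so that the
  negligibility given by Sard's theorem becomes a statement about \<open>lborel\<close>.\<close>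

lemma sard_compact:
  fixes f :: "real^'n::finite \<Rightarrow> real^'n"
  assumes S: "compact S"
    and der: "\<And>x. x \<in> S \<Longrightarrow> (f has_derivative f' x) (at x within S)"
    and zero: "\<And>x. x \<in> S \<Longrightarrow> det (matrix (f' x)) = 0"
  shows "f ` S \<in> sets borel" "emeasure lborel (f ` S) = 0"
proof -
  let ?f = "\<lambda>y. to_idx (f (of_idx y))" and ?f' = "\<lambda>y h. to_idx (f' (of_idx y) (of_idx h))" and ?S = "to_idx ` S"
  have im: "?f ` ?S = to_idx ` f ` S" by (auto simp: image_image)
  have "continuous_on S f"
    using der by (meson continuous_on_eq_continuous_within has_derivative_continuous)
  then have "compact (f ` S)" using S by (rule compact_continuous_image)
  then show b: "f ` S \<in> sets borel" by (rule borel_compact)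
  have "negligible (?f ` ?S)"
  proof (rule baby_Sard)
    show "(?f has_derivative ?f' y) (at y within ?S)" if "y \<in> ?S" for y
      by (rule has_derivative_conj_idx) (use that der in auto)
    show "rank (matrix (?f' y)) < CARD('n idx)" if "y \<in> ?S" for y
      using that zero by (subst det_eq_0_rank[symmetric]) (auto simp: det_matrix_conj_idx)
  qed simp
  then have "emeasure lborel (?f ` ?S) = 0"
    using emeasure_lborel_to_idx_image(1)[OF b]
    unfolding im by (simp add: negligible_iff_null_sets null_sets_def)
  then show "emeasure lborel (f ` S) = 0"
    using emeasure_lborel_to_idx_image(2)[OF b] im by simp
qed

text \<open>Both sides integrate \<open>h\<close> against a measure on the target: Lebesgue measure
  restricted to the image of \<open>S\<close>, and the image under \<open>f\<close> of the weight
  |det f'| on \<open>S\<close>. They agree on a Borel set B by the measure formula for the part of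
  \<open>S\<close> that \<open>f\<close> maps into B.\<close>

lemma nn_integral_lborel_image:
  fixes f :: "real^'n::finite \<Rightarrow> real^'n"
  assumes S[measurable]: "S \<in> sets borel"
    and im: "\<And>T. T \<in> sets borel \<Longrightarrow> T \<subseteq> S \<Longrightarrow> f ` T \<in> sets borel"
    and der: "\<And>x. x \<in> S \<Longrightarrow> (f has_derivative f' x) (at x within S)"
    and inj: "inj_on f S"
    and meas[measurable]: "(\<lambda>x. indicator S x * \<bar>det (matrix (f' x))\<bar>) \<in> borel_measurable borel"
    and h[measurable]: "h \<in> borel_measurable borel"
  shows "(\<integral>\<^sup>+v. h v * indicator (f ` S) v \<partial>lborel) = (\<integral>\<^sup>+x. ennreal (indicator S x * \<bar>det (matrix (f' x))\<bar>) * h (f x) \<partial>lborel)"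
proof -
  \<comment> \<open>Nothing is known about \<open>f\<close> outside \<open>S\<close>; the extension
    by 0 is Borel on the whole space, and the weight vanishes wherever it may differ from
    \<open>f\<close>.\<close>
  define F where "F x = (if x \<in> S then f x else 0)" for x
  have "continuous_on S f"
    using der by (meson continuous_on_eq_continuous_within has_derivative_continuous)
  then have F[measurable]: "F \<in> borel_measurable borel"
    unfolding F_def[abs_def] using S by (subst measurable_restrict_space_iff[symmetric]) (auto intro: borel_measurable_continuous_on_restrict)
  let ?d = "\<lambda>x. ennreal (indicator S x * \<bar>det (matrix (f' x))\<bar>)"
  have [measurable]: "f ` S \<in> sets borel" by (rule im) auto
  have "distr (density lborel ?d) borel F = density lborel (indicator (f ` S))"
  proof (rule measure_eqI)
    fix B assume "B \<in> sets (distr (density lborel ?d) borel F)"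
    then have B[measurable]: "B \<in> sets borel" by simp
    let ?T = "S \<inter> F -` B"
    have T[measurable]: "?T \<in> sets borel" using measurable_sets[OF F B] by auto
    have fT: "f ` ?T = f ` S \<inter> B" by (auto simp: F_def split: if_splits)
    have ind: "indicator ?T x * \<bar>det (matrix (f' x))\<bar> = indicator S x * \<bar>det (matrix (f' x))\<bar> * indicator (F -` B) x" for x
      by (auto simp: indicator_def)
    have "emeasure (distr (density lborel ?d) borel F) B = (\<integral>\<^sup>+x. ?d x * indicator (F -` B) x \<partial>lborel)"
      using measurable_sets[OF F B] by (simp add: emeasure_distr emeasure_density)
    also have "\<dots> = (\<integral>\<^sup>+x. ennreal (indicator ?T x * \<bar>det (matrix (f' x))\<bar>) \<partial>lborel)"
      by (intro nn_integral_cong) (auto simp: indicator_def)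
    also have "\<dots> = emeasure lborel (f ` ?T)"
    proof (rule emeasure_lborel_image[symmetric])
      show "f ` ?T \<in> sets borel" by (rule im) auto
      show "(f has_derivative f' x) (at x within ?T)" if "x \<in> ?T" for x
        by (rule has_derivative_subset[OF der]) (use that in auto)
      show "inj_on f ?T" by (rule inj_on_subset[OF inj]) auto
      show "(\<lambda>x. indicator ?T x * \<bar>det (matrix (f' x))\<bar>) \<in> borel_measurable borel"
        unfolding ind using measurable_sets[OF F B] by (intro borel_measurable_times meas borel_measurable_indicator) auto
    qed simp
    also have "\<dots> = emeasure (density lborel (indicator (f ` S))) B"
      unfolding fT by (rule emeasure_restricted[symmetric]) auto
    finally show "emeasure (distr (density lborel ?d) borel F) B = emeasure (density lborel (indicator (f ` S))) B" .
  qed simp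
  then have "(\<integral>\<^sup>+v. h v \<partial>distr (density lborel ?d) borel F) = (\<integral>\<^sup>+v. h v \<partial>density lborel (indicator (f ` S)))"
    by simp
  moreover have "(\<integral>\<^sup>+v. h v \<partial>distr (density lborel ?d) borel F) = (\<integral>\<^sup>+x. ?d x * h (F x) \<partial>lborel)"
    by (simp add: nn_integral_distr nn_integral_density)
  moreover have "(\<integral>\<^sup>+x. ?d x * h (F x) \<partial>lborel) = (\<integral>\<^sup>+x. ?d x * h (f x) \<partial>lborel)"
    by (intro nn_integral_cong) (auto simp: F_def indicator_def)
  ultimately show ?thesis by (simp add: nn_integral_density mult.commute)
qed

text \<open>An invertible derivative at the point and continuity of the derivative in operator norm
  give injectivity nearby. Continuity of \<open>A\<close> refers to the norm of matrices, so the
  operator norm is first bounded by a multiple of that norm.\<close>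

lemma C1_locally_injective:
  fixes f :: "real^'n::finite \<Rightarrow> real^'n" and A :: "real^'n \<Rightarrow> real^'n^'n"
  assumes V: "open V" and aV: "a \<in> V"
    and der: "\<And>x. x \<in> V \<Longrightarrow> (f has_derivative (\<lambda>h. A x *v h)) (at x)"
    and cont: "continuous_on V A" and nz: "det (A a) \<noteq> 0"
  obtains r where "r > 0" "ball a r \<subseteq> V" "inj_on f (ball a r)"
proof -
    obtain A' where "A' ** A a = mat 1"
      using nz invertible_det_nz[of "A a"] by (auto simp: invertible_def)
    then have inv: "(\<lambda>h. A' *v h) \<circ> (\<lambda>h. A a *v h) = id"
      by (auto simp: fun_eq_iff matrix_vector_mul_assoc)
    obtain r where "r > 0" "ball a r \<subseteq> V" "inj_on f (ball a r)"
    proof (rule has_derivative_locally_injective[where f = f and f' = "\<lambda>x h. A x *v h" and g' = "\<lambda>h. A' *v h" and a = a and S = V])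
      fix e :: real assume e: "e > 0"
      obtain B where B: "B > 0" "\<And>(M::real^'n^'n). onorm (\<lambda>v. M *v v) \<le> B * norm M"
      proof
        let ?B = "real CARD('n) * real CARD('n) + 1"
        show "?B > 0" by (simp add: add_nonneg_pos)
        fix M :: "real^'n^'n"
        have "onorm (\<lambda>v. M *v v) \<le> real CARD('n) * real CARD('n) * norm M"
          by (rule onorm_le_matrix_component) (rule order_trans[OF component_le_norm_cart Finite_Cartesian_Product.norm_nth_le])
        also have "\<dots> \<le> ?B * norm M" by (intro mult_right_mono) auto
        finally show "onorm (\<lambda>v. M *v v) \<le> ?B * norm M" .
      qed
      have "isCont A a" using cont aV V by (simp add: continuous_on_eq_continuous_at)
      moreover have "e / B > 0" using e B(1) by simp
      ultimately have "\<exists>d>0. \<forall>x. dist x a < d \<longrightarrow> dist (A x) (A a) < e / B"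
        unfolding continuous_at_eps_delta by blast
      then obtain d where d: "d > 0" "\<And>x. dist x a < d \<Longrightarrow> dist (A x) (A a) < e / B" by blast
      have "onorm (\<lambda>v. A x *v v - A a *v v) < e" if "dist a x < d" for x
      proof -
        have "(\<lambda>v. A x *v v - A a *v v) = (\<lambda>v. (A x - A a) *v v)"
          by (simp add: matrix_vector_mult_diff_rdistrib)
        then have "onorm (\<lambda>v. A x *v v - A a *v v) \<le> B * norm (A x - A a)" using B(2)[of "A x - A a"] by simp
        also have "\<dots> < e" using d(2)[of x] that B(1) by (simp add: dist_norm norm_minus_commute field_simps)
        finally show ?thesis .
      qed
      then show "\<exists>d>0. \<forall>x. dist a x < d \<longrightarrow> onorm (\<lambda>v. A x *v v - A a *v v) < e" using d(1) by blast
    qed (use aV V inv der in \<open>auto simp: matrix_vector_mul_bounded_linear\<close>)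
  then show ?thesis by (rule that)
qed

text \<open>Around each point of \<open>T\<close> the map is injective, so by Lindelof countably
  many domains of injectivity, made disjoint, cover \<open>T\<close>. On each piece the change of
  variables formula applies, and the sum of the indicators of the images of the pieces counts the
  solutions of f t = v in \<open>T\<close>.\<close>

theorem area_formula:
  fixes f :: "real^'n::finite \<Rightarrow> real^'n" and A :: "real^'n \<Rightarrow> real^'n^'n"
  assumes V: "open V"
    and der: "\<And>x. x \<in> V \<Longrightarrow> (f has_derivative (\<lambda>h. A x *v h)) (at x)"
    and cont: "continuous_on V A"
    and T: "T \<in> sets borel" "T \<subseteq> V" and nz: "\<And>x. x \<in> T \<Longrightarrow> det (A x) \<noteq> 0"
    and h[measurable]: "h \<in> borel_measurable borel"
  shows "(\<integral>\<^sup>+v. h v * emeasure (count_space UNIV) {t\<in>T. f t = v} \<partial>lborel) =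
    (\<integral>\<^sup>+x. indicator T x * (ennreal \<bar>det (A x)\<bar> * h (f x)) \<partial>lborel)"
proof -
  have contf: "continuous_on V f"
    using der by (meson continuous_at_imp_continuous_on has_derivative_continuous)
  have "\<exists>r>0. ball a r \<subseteq> V \<and> inj_on f (ball a r)" if a: "a \<in> T" for a
  proof -
    have aV: "a \<in> V" using T a by auto
    obtain r where "r > 0" "ball a r \<subseteq> V" "inj_on f (ball a r)"
      by (rule C1_locally_injective[OF V aV der cont nz[OF a]])
    then show ?thesis by blast
  qed
  then have "\<forall>a\<in>T. \<exists>r. r > 0 \<and> ball a r \<subseteq> V \<and> inj_on f (ball a r)" by blast
  from bchoice[OF this] obtain r where r: "\<And>a. a \<in> T \<Longrightarrow> r a > 0 \<and> ball a (r a) \<subseteq> V \<and> inj_on f (ball a (r a))" by blast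
  obtain F' where F': "F' \<subseteq> (\<lambda>a. ball a (r a)) ` T" "countable F'" "\<Union>F' = \<Union>((\<lambda>a. ball a (r a)) ` T)"
    by (rule Lindelof[of "(\<lambda>a. ball a (r a)) ` T"]) auto
  \<comment> \<open>The inserted empty set keeps the enumerated family nonempty even when
    \<open>T\<close> is empty.\<close>
  define C where "C = from_nat_into (insert {} F')"
  have rC: "range C = insert {} F'" unfolding C_def using F'(2) by (intro range_from_nat_into) auto
  have C: "open (C i)" "C i \<subseteq> V" "inj_on f (C i)" for i
  proof -
    have "C i \<in> insert {} F'" using rC by blast
    then consider "C i = {}" | a where "a \<in> T" "C i = ball a (r a)" using F'(1) by auto
    then show "open (C i)" "C i \<subseteq> V" "inj_on f (C i)" using r by (cases; auto)+
  qed
  have TC: "T \<subseteq> (\<Union>i. C i)" unfolding rC using F'(3) r by force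
  define S where "S i = T \<inter> disjointed C i" for i
  have [measurable]: "C i \<in> sets borel" for i using C by auto
  have SC: "S i \<subseteq> C i" for i using disjointed_subset[of C i] by (auto simp: S_def)
  have Sb[measurable]: "S i \<in> sets borel" for i
  proof -
    have "range (disjointed C) \<subseteq> sets borel" by (rule sets.range_disjointed_sets) (use C in auto)
    then show ?thesis unfolding S_def using T by auto
  qed
  have disj: "disjoint_family S"
    using disjoint_family_disjointed[of C] by (auto simp: disjoint_family_on_def S_def)
  have US: "(\<Union>i. S i) = T" unfolding S_def using TC UN_disjointed_eq[of C] by blast
  \<comment> \<open>By invariance of domain the restriction of \<open>f\<close> to the open set
    \<open>C i\<close> has an open image and a continuous inverse, and images of Borel sets are
    preimages under that inverse.\<close>
  have im: "f ` B \<in> sets borel" if "B \<in> sets borel" "B \<subseteq> C i" for B i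
  proof -
    obtain g where g: "homeomorphism (C i) (f ` C i) f g"
      by (rule invariance_of_domain_homeomorphism[of "C i" f]) (use continuous_on_subset[OF contf C(2)] C in auto)
    have o: "open (f ` C i)" by (rule invariance_of_domain) (use continuous_on_subset[OF contf C(2)] C in auto)
    have "continuous_on (f ` C i) g" using g by (simp add: homeomorphism_def)
    then have gm: "g \<in> borel_measurable (restrict_space borel (f ` C i))"
      by (rule borel_measurable_continuous_on_restrict)
    have "f ` B = g -` B \<inter> space (restrict_space borel (f ` C i))"
    proof (intro set_eqI iffI)
      fix v assume "v \<in> f ` B"
      then obtain t where "t \<in> B" "v = f t" by blast
      moreover then have "t \<in> C i" "g (f t) = t" using g that(2) by (auto simp: homeomorphism_def)
      ultimately show "v \<in> g -` B \<inter> space (restrict_space borel (f ` C i))"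
        by (simp add: space_restrict_space)
    next
      fix v assume "v \<in> g -` B \<inter> space (restrict_space borel (f ` C i))"
      then have "g v \<in> B" "v = f (g v)" using g by (auto simp: homeomorphism_def space_restrict_space)
      then show "v \<in> f ` B" by blast
    qed
    then have "f ` B \<in> sets (restrict_space borel (f ` C i))" using gm that by simp
    then show ?thesis using o by (auto simp: sets_restrict_space)
  qed
  have cnt: "emeasure (count_space UNIV) {t\<in>T. f t = v} = (\<Sum>i. indicator (f ` S i) v)" for v
  proof -
    have "{t\<in>T. f t = v} = (\<Union>i. {t\<in>S i. f t = v})" using US by auto
    moreover have "(\<Sum>i. emeasure (count_space UNIV) {t\<in>S i. f t = v}) = emeasure (count_space UNIV) (\<Union>i. {t\<in>S i. f t = v})"
      using disj by (intro suminf_emeasure) (auto simp: disjoint_family_on_def)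
    moreover have "emeasure (count_space UNIV) {t\<in>S i. f t = v} = indicator (f ` S i) v" for i
    proof (cases "v \<in> f ` S i")
      case True
      then obtain t where "t \<in> S i" "f t = v" by auto
      then have "{t\<in>S i. f t = v} = {t}" using C(3)[of i] SC[of i] by (auto simp: inj_on_def)
      then show ?thesis using True by simp
    next
      case False
      then have "{t\<in>S i. f t = v} = {}" by auto
      then show ?thesis using False by (simp only: emeasure_empty) simp
    qed
    ultimately show ?thesis by simp
  qed
  have [measurable]: "f ` S i \<in> sets borel" for i by (rule im[OF _ SC]) simp
  have detm: "(\<lambda>x. indicator (S i) x * \<bar>det (A x)\<bar>) \<in> borel_measurable borel" for i
  proof -
    have "continuous_on V (\<lambda>x. \<bar>det (A x)\<bar>)"
      using cont unfolding det_def by (intro continuous_intros) (auto intro!: continuous_intros)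
    then have "(\<lambda>x. \<bar>det (A x)\<bar>) \<in> borel_measurable (restrict_space borel V)"
      by (rule borel_measurable_continuous_on_restrict)
    then have "(\<lambda>x. indicator V x *\<^sub>R \<bar>det (A x)\<bar>) \<in> borel_measurable borel"
      using V by (subst (asm) borel_measurable_restrict_space_iff) auto
    then have "(\<lambda>x. indicator (S i) x * (indicator V x *\<^sub>R \<bar>det (A x)\<bar>)) \<in> borel_measurable borel" by measurable
    moreover have "indicator (S i) x * (indicator V x *\<^sub>R \<bar>det (A x)\<bar>) = indicator (S i) x * \<bar>det (A x)\<bar>" for x
      using SC[of i] C(2)[of i] by (auto simp: indicator_def)
    ultimately show ?thesis by (simp only:)
  qed
  have "(\<integral>\<^sup>+v. h v * emeasure (count_space UNIV) {t\<in>T. f t = v} \<partial>lborel) = (\<integral>\<^sup>+v. (\<Sum>i. h v * indicator (f ` S i) v) \<partial>lborel)"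
    unfolding cnt by simp
  also have "\<dots> = (\<Sum>i. \<integral>\<^sup>+v. h v * indicator (f ` S i) v \<partial>lborel)"
    by (rule nn_integral_suminf) measurable
  also have "\<dots> = (\<Sum>i. \<integral>\<^sup>+x. ennreal (indicator (S i) x * \<bar>det (A x)\<bar>) * h (f x) \<partial>lborel)"
  proof (intro arg_cong[where f = suminf] ext)
    fix i
    have "(\<integral>\<^sup>+v. h v * indicator (f ` S i) v \<partial>lborel) = (\<integral>\<^sup>+x. ennreal (indicator (S i) x * \<bar>det (matrix (\<lambda>h. A x *v h))\<bar>) * h (f x) \<partial>lborel)"
    proof (rule nn_integral_lborel_image)
      show "f ` B \<in> sets borel" if "B \<in> sets borel" "B \<subseteq> S i" for B using im[of B i] that SC[of i] by auto
      show "(f has_derivative (\<lambda>h. A x *v h)) (at x within S i)" if "x \<in> S i" for x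
        using der[of x] SC[of i] C(2)[of i] that by (auto intro: has_derivative_at_withinI)
      show "inj_on f (S i)" using C(3) SC by (rule inj_on_subset)
    qed (use detm in auto)
    then show "(\<integral>\<^sup>+v. h v * indicator (f ` S i) v \<partial>lborel) = (\<integral>\<^sup>+x. ennreal (indicator (S i) x * \<bar>det (A x)\<bar>) * h (f x) \<partial>lborel)"
      by simp
  qed
  also have "\<dots> = (\<integral>\<^sup>+x. (\<Sum>i. ennreal (indicator (S i) x * \<bar>det (A x)\<bar>) * h (f x)) \<partial>lborel)"
  proof (rule nn_integral_suminf[symmetric])
    fix i
    define F where "F x = (if x \<in> S i then f x else 0)" for x
    have "continuous_on (S i) f" using contf SC[of i] C(2)[of i] by (meson continuous_on_subset order_trans)
    then have [measurable]: "F \<in> borel_measurable borel"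
      unfolding F_def[abs_def] by (subst measurable_restrict_space_iff[symmetric]) (auto intro: borel_measurable_continuous_on_restrict)
    note [measurable] = detm[of i]
    have "(\<lambda>x. ennreal (indicator (S i) x * \<bar>det (A x)\<bar>) * h (F x)) \<in> borel_measurable lborel" by measurable
    moreover have "(\<lambda>x. ennreal (indicator (S i) x * \<bar>det (A x)\<bar>) * h (F x)) = (\<lambda>x. ennreal (indicator (S i) x * \<bar>det (A x)\<bar>) * h (f x))"
      by (auto simp: F_def indicator_def)
    ultimately show "(\<lambda>x. ennreal (indicator (S i) x * \<bar>det (A x)\<bar>) * h (f x)) \<in> borel_measurable lborel" by simp
  qed
  also have "\<dots> = (\<integral>\<^sup>+x. indicator T x * (ennreal \<bar>det (A x)\<bar> * h (f x)) \<partial>lborel)"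
  proof (intro nn_integral_cong)
    fix x
    have "ennreal (indicator (S i) x * \<bar>det (A x)\<bar>) * h (f x) = indicator (S i) x * (ennreal \<bar>det (A x)\<bar> * h (f x))" for i
      by (auto simp: indicator_def)
    moreover have "(\<Sum>i. indicator (S i) x :: ennreal) = indicator T x"
      using suminf_indicator[OF disj, of x] US by simp
    ultimately show "(\<Sum>i. ennreal (indicator (S i) x * \<bar>det (A x)\<bar>) * h (f x)) = indicator T x * (ennreal \<bar>det (A x)\<bar> * h (f x))"
      by simp
  qed
  finally show ?thesis .
qed


section \<open>Measurability of counting functions\<close>

text \<open>Compactness replaces an existential over an uncountable set by countable operations: on
  a closed ball a nonnegative continuous function has a zero exactly when it takes arbitrarily small
  values on a countable dense subset of the open ball.\<close>

lemma measurable_zero_cball: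
  fixes g :: "'w \<Rightarrow> 'a::euclidean_space \<Rightarrow> real"
  assumes cont: "\<And>\<omega>. \<omega> \<in> space N \<Longrightarrow> continuous_on V (g \<omega>)"
    and meas: "\<And>t. t \<in> V \<Longrightarrow> (\<lambda>\<omega>. g \<omega> t) \<in> borel_measurable N"
    and nonneg: "\<And>\<omega> t. 0 \<le> g \<omega> t"
    and K: "cball q r \<subseteq> V" "r > 0"
  shows "{\<omega>\<in>space N. \<exists>t\<in>cball q r. g \<omega> t = 0} \<in> sets N"
proof -
  obtain D :: "'a set" where D: "countable D" "\<And>X. open X \<Longrightarrow> X \<noteq> {} \<Longrightarrow> \<exists>d\<in>D. d \<in> X"
    using countable_dense_setE by blast
  have "(\<exists>t\<in>cball q r. g \<omega> t = 0) \<longleftrightarrow> (\<forall>n::nat. \<exists>t\<in>D \<inter> ball q r. g \<omega> t < 1 / (real n + 1))" if w: "\<omega> \<in> space N" for \<omega>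
  proof
    assume "\<exists>t\<in>cball q r. g \<omega> t = 0"
    then obtain t where t: "t \<in> cball q r" "g \<omega> t = 0" by auto
    show "\<forall>n::nat. \<exists>t\<in>D \<inter> ball q r. g \<omega> t < 1 / (real n + 1)"
    proof
      fix n :: nat
      have "(0::real) < 1 / (real n + 1)" by simp
      then obtain d where d: "d > 0" "\<And>s. s \<in> V \<Longrightarrow> dist s t < d \<Longrightarrow> dist (g \<omega> s) (g \<omega> t) < 1 / (real n + 1)"
        using cont[OF w] t K unfolding continuous_on_iff by (meson subsetD)
      have "t \<in> closure (ball q r)" using t K by simp
      then have "ball q r \<inter> ball t d \<noteq> {}"
        using d(1) by (metis centre_in_ball disjoint_iff open_ball open_Int_closure_eq_empty)
      then obtain s where s: "s \<in> D" "s \<in> ball q r \<inter> ball t d" using D(2)[of "ball q r \<inter> ball t d"] by auto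
      then have "s \<in> V" using K by (auto simp: subset_eq)
      then have "g \<omega> s < 1 / (real n + 1)" using d(2)[of s] s t(2) nonneg[of \<omega> s] by (simp add: dist_real_def dist_commute)
      then show "\<exists>t\<in>D \<inter> ball q r. g \<omega> t < 1 / (real n + 1)" using s by auto
    qed
  next
    assume *: "\<forall>n::nat. \<exists>t\<in>D \<inter> ball q r. g \<omega> t < 1 / (real n + 1)"
    have "continuous_on (cball q r) (g \<omega>)" using cont[OF w] K(1) by (rule continuous_on_subset)
    then obtain x where x: "x \<in> cball q r" "\<And>y. y \<in> cball q r \<Longrightarrow> g \<omega> x \<le> g \<omega> y"
      using continuous_attains_inf[of "cball q r" "g \<omega>"] K(2) by auto
    have "g \<omega> x < 1 / (real n + 1)" for n :: nat using * x(2) by (meson IntE ball_subset_cball order_le_less_trans subsetD)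
    then have "g \<omega> x \<le> 0" by (metis add.commute nat_approx_posE not_le less_asym of_nat_Suc)
    then show "\<exists>t\<in>cball q r. g \<omega> t = 0" using x(1) nonneg[of \<omega> x] by force
  qed
  then have "{\<omega>\<in>space N. \<exists>t\<in>cball q r. g \<omega> t = 0} = {\<omega>\<in>space N. \<forall>n::nat. \<exists>t\<in>D \<inter> ball q r. g \<omega> t < 1 / (real n + 1)}" by auto
  also have "\<dots> = (\<Inter>n::nat. \<Union>t\<in>D \<inter> ball q r. {\<omega>\<in>space N. g \<omega> t < 1 / (real n + 1)})" by auto
  also have "\<dots> \<in> sets N"
  proof -
    have m: "{\<omega>\<in>space N. g \<omega> t < 1 / (real n + 1)} \<in> sets N" if "t \<in> D \<inter> ball q r" for t n
    proof -
      have "t \<in> V" using that K by auto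
      note [measurable] = meas[OF this]
      show ?thesis by measurable
    qed
    show ?thesis
      using m D(1) by (intro sets.countable_INT image_subsetI sets.countable_UN') auto
  qed
  finally show ?thesis .
qed

text \<open>The number of zeros in \<open>S\<close> is the supremum, over finite disjoint families
  of small closed balls in \<open>S\<close>, of the number of balls that contain a zero. Centres in
  a countable dense set and radii 1/(n+1) leave countably many families, and each ball contributes a
  measurable indicator.\<close>

lemma measurable_count_zeros_open:
  fixes g :: "'w \<Rightarrow> 'a::euclidean_space \<Rightarrow> real"
  assumes cont: "\<And>\<omega>. \<omega> \<in> space N \<Longrightarrow> continuous_on V (g \<omega>)"
    and meas: "\<And>t. t \<in> V \<Longrightarrow> (\<lambda>\<omega>. g \<omega> t) \<in> borel_measurable N"
    and nonneg: "\<And>\<omega> t. 0 \<le> g \<omega> t"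
    and S: "open S" "S \<subseteq> V"
  shows "(\<lambda>\<omega>. emeasure (count_space UNIV) {t\<in>S. g \<omega> t = 0}) \<in> borel_measurable N"
proof -
  obtain D :: "'a set" where D: "countable D" "\<And>X. open X \<Longrightarrow> X \<noteq> {} \<Longrightarrow> \<exists>d\<in>D. d \<in> X"
    using countable_dense_setE by blast
  define K :: "'a \<times> nat \<Rightarrow> 'a set" where "K p = cball (fst p) (1 / (real (snd p) + 1))" for p
  define \<F> where "\<F> = {F. finite F \<and> F \<subseteq> D \<times> UNIV \<and> (\<forall>p\<in>F. K p \<subseteq> S) \<and> disjoint_family_on K F}"
  define E where "E p = {\<omega>\<in>space N. \<exists>t\<in>K p. g \<omega> t = 0}" for p
  have Fc: "countable \<F>"
    by (rule countable_subset[OF _ countable_Collect_finite_subset[of "D \<times> UNIV"]]) (use D in \<open>auto simp: \<F>_def\<close>)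
  have Em: "E p \<in> sets N" if "K p \<subseteq> S" for p
    unfolding E_def K_def by (rule measurable_zero_cball[OF cont meas nonneg]) (use that S in \<open>auto simp: K_def\<close>)
  have "(\<lambda>\<omega>. SUP F\<in>\<F>. \<Sum>p\<in>F. indicator (E p) \<omega> :: ennreal) \<in> borel_measurable N"
    by (intro borel_measurable_SUP Fc borel_measurable_sum borel_measurable_indicator Em) (auto simp: \<F>_def)
  moreover have "(SUP F\<in>\<F>. \<Sum>p\<in>F. indicator (E p) \<omega> :: ennreal) = emeasure (count_space UNIV) {t\<in>S. g \<omega> t = 0}" (is "?s = ?c")
    if w: "\<omega> \<in> space N" for \<omega>
  proof (rule antisym)
    show "?s \<le> ?c"
    proof (rule SUP_least)
      fix F assume F: "F \<in> \<F>"
      have "(\<Sum>p\<in>F. indicator (E p) \<omega> :: ennreal) \<le> (\<Sum>p\<in>F. emeasure (count_space UNIV) {t\<in>K p. g \<omega> t = 0})"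
      proof (rule sum_mono)
        fix p assume "p \<in> F"
        show "(indicator (E p) \<omega> :: ennreal) \<le> emeasure (count_space UNIV) {t\<in>K p. g \<omega> t = 0}"
        proof (cases "\<omega> \<in> E p")
          case True
          then obtain t where "t \<in> K p" "g \<omega> t = 0" by (auto simp: E_def)
          then have "emeasure (count_space UNIV) {t} \<le> emeasure (count_space UNIV) {t\<in>K p. g \<omega> t = 0}"
            by (intro emeasure_mono) auto
          then show ?thesis using True by simp
        qed simp
      qed
      also have "\<dots> = emeasure (count_space UNIV) (\<Union>p\<in>F. {t\<in>K p. g \<omega> t = 0})"
      proof (rule sum_emeasure)
        show "disjoint_family_on (\<lambda>p. {t\<in>K p. g \<omega> t = 0}) F"
          unfolding disjoint_family_on_def
        proof (intro ballI impI)
          fix m n assume "m \<in> F" "n \<in> F" "m \<noteq> n"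
          then have "K m \<inter> K n = {}" using F by (simp add: \<F>_def disjoint_family_on_def)
          then show "{t\<in>K m. g \<omega> t = 0} \<inter> {t\<in>K n. g \<omega> t = 0} = {}" by blast
        qed
      qed (use F in \<open>auto simp: \<F>_def\<close>)
      also have "\<dots> \<le> ?c" using F by (intro emeasure_mono) (auto simp: \<F>_def)
      finally show "(\<Sum>p\<in>F. indicator (E p) \<omega> :: ennreal) \<le> ?c" .
    qed
  next
    have fin: "of_nat (card A) \<le> ?s" if A: "finite A" "A \<subseteq> {t\<in>S. g \<omega> t = 0}" for A
    proof -
      have "\<forall>\<^sub>F e in at_right 0. \<forall>a\<in>A. (cball a e \<subseteq> S \<and> (\<forall>b\<in>A. a \<noteq> b \<longrightarrow> e < dist a b))"
      proof (intro eventually_ball_finite[OF A(1)] ballI eventually_conj)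
        fix a assume a: "a \<in> A"
        have "a \<in> S" using a A(2) by auto
        then obtain e where e: "e > 0" "cball a e \<subseteq> S" using S(1) by (meson open_contains_cball)
        then show "\<forall>\<^sub>F e in at_right 0. cball a e \<subseteq> S"
          by (intro eventually_at_rightI[of 0 e]) (auto simp: subset_eq)
        fix b
        show "\<forall>\<^sub>F e in at_right 0. a \<noteq> b \<longrightarrow> e < dist a b"
          by (cases "a = b") (auto intro!: eventually_at_rightI[of 0 "dist a b"])
      qed
      then have "\<forall>\<^sub>F e in at_right (0::real). 0 < e \<and> (\<forall>a\<in>A. (cball a e \<subseteq> S \<and> (\<forall>b\<in>A. a \<noteq> b \<longrightarrow> e < dist a b)))"
        by (intro eventually_conj eventually_at_right_less)
      from eventually_happens'[OF _ this] obtain e where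
        e: "e > 0" "\<And>a. a \<in> A \<Longrightarrow> cball a e \<subseteq> S" "\<And>a b. a \<in> A \<Longrightarrow> b \<in> A \<Longrightarrow> a \<noteq> b \<Longrightarrow> e < dist a b"
        by auto
      \<comment> \<open>With each centre closer than 1/(n+1) to its point, two balls that meet would
        bring their points within 4/(n+1) < e of each other, against the separation by e.\<close>
      obtain n :: nat where n: "1 / (real n + 1) < e / 4" using nat_approx_posE[of "e / 4"] e(1) by (auto simp: add.commute)
      have "\<exists>q\<in>D. q \<in> ball a (1 / (real n + 1))" for a by (rule D(2)) auto
      then obtain q where q: "\<And>a. q a \<in> D" "\<And>a. dist a (q a) < 1 / (real n + 1)" by (metis mem_ball)
      define F where "F = (\<lambda>a. (q a, n)) ` A"
      have disj: "K (q a, n) \<inter> K (q b, n) = {}" if "a \<in> A" "b \<in> A" "a \<noteq> b" for a b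
      proof (rule ccontr)
        assume "K (q a, n) \<inter> K (q b, n) \<noteq> {}"
        then obtain t where "dist (q a) t \<le> 1 / (real n + 1)" "dist (q b) t \<le> 1 / (real n + 1)" by (auto simp: K_def)
        then have "dist a b \<le> 4 * (1 / (real n + 1))"
          using q(2)[of a] q(2)[of b] dist_triangle[of a b "q a"] dist_triangle[of "q a" b t] dist_triangle[of t b "q b"]
          by (simp add: dist_commute)
        then show False using e(3)[OF that] n by linarith
      qed
      have aK: "a \<in> K (q a, n)" for a using q(2)[of a] by (simp add: K_def dist_commute less_imp_le)
      have inj: "inj_on (\<lambda>a. (q a, n)) A"
      proof (rule inj_onI)
        fix a b assume ab: "a \<in> A" "b \<in> A" "(q a, n) = (q b, n)"
        then have "a \<in> K (q a, n) \<inter> K (q b, n)" using aK[of a] by simp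
        then show "a = b" using disj[OF ab(1,2)] by (cases "a = b") simp_all
      qed
      have "F \<in> \<F>"
      proof -
        have "K (q a, n) \<subseteq> S" if "a \<in> A" for a
        proof
          fix t assume "t \<in> K (q a, n)"
          then have "dist (q a) t \<le> 1 / (real n + 1)" by (simp add: K_def)
          then have "dist a t \<le> e" using q(2)[of a] dist_triangle[of a t "q a"] n e(1) by simp
          then show "t \<in> S" using e(2)[OF that] by auto
        qed
        moreover have "disjoint_family_on K F"
          unfolding disjoint_family_on_def
        proof (intro ballI impI)
          fix x y assume "x \<in> F" "y \<in> F" "x \<noteq> y"
          then obtain a b where "x = (q a, n)" "y = (q b, n)" "a \<in> A" "b \<in> A" "a \<noteq> b" by (auto simp: F_def)
          then show "K x \<inter> K y = {}" using disj by simp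
        qed
        ultimately show ?thesis using A(1) q(1) by (auto simp: \<F>_def F_def)
      qed
      moreover have "(\<Sum>p\<in>F. indicator (E p) \<omega> :: ennreal) = of_nat (card A)"
      proof -
        have "(\<Sum>p\<in>F. indicator (E p) \<omega> :: ennreal) = (\<Sum>p\<in>F. 1)"
          using aK A(2) w by (intro sum.cong) (auto simp: F_def E_def indicator_def)
        then show ?thesis using inj by (simp add: F_def card_image)
      qed
      ultimately show ?thesis
        using SUP_upper[of F \<F> "\<lambda>F. \<Sum>p\<in>F. indicator (E p) \<omega> :: ennreal"] by (simp only:)
    qed
    show "?c \<le> ?s"
    proof (cases "finite {t\<in>S. g \<omega> t = 0}")
      case True
      then show ?thesis using fin[OF True] by simp
    next
      case False
      have *: "of_nat k \<le> ?s" for k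
        using infinite_arbitrarily_large[OF False, of k] fin by auto
      have "?s = top"
      proof (rule ccontr)
        assume h: "?s \<noteq> top"
        obtain k where "?s < of_nat k"
          using ennreal_Ex_less_of_nat[OF top.not_eq_extremum[THEN iffD1, OF h]] by blast
        then show False using leD[OF *[of k]] by blast
      qed
      then show ?thesis by (simp only: top_greatest)
    qed
  qed
  ultimately show ?thesis by (simp cong: measurable_cong)
qed

text \<open>Open sets generate the Borel sets and are stable under intersection, but the complement
  step of the induction subtracts counts and so needs them finite. The count is therefore taken
  inside the interiors of an exhaustion by compact sets, where \<open>fin\<close> applies, and the
  exhaustion is removed by monotone convergence.\<close>

lemma measurable_count_borel:
  fixes Z :: "'w \<Rightarrow> 'a::euclidean_space set"
  assumes V: "open V" and meas: "\<And>S. open S \<Longrightarrow> S \<subseteq> V \<Longrightarrow> (\<lambda>\<omega>. emeasure (count_space UNIV) (Z \<omega> \<inter> S)) \<in> borel_measurable N"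
    and fin: "\<And>\<omega> K. \<omega> \<in> space N \<Longrightarrow> compact K \<Longrightarrow> K \<subseteq> V \<Longrightarrow> finite (Z \<omega> \<inter> K)"
    and T: "T \<in> sets borel" "T \<subseteq> V"
  shows "(\<lambda>\<omega>. emeasure (count_space UNIV) (Z \<omega> \<inter> T)) \<in> borel_measurable N"
proof -
  obtain C where C: "\<And>n. compact (C n)" "\<And>n. C n \<subseteq> V" "\<And>n. C n \<subseteq> interior (C (Suc n))" "\<Union>(range C) = V"
    using open_Union_compact_subsets[OF V] by metis
  let ?c = "emeasure (count_space UNIV)"
  have j: "(\<lambda>\<omega>. ?c (Z \<omega> \<inter> interior (C j) \<inter> T)) \<in> borel_measurable N" for j
  proof -
    have finj: "finite (Z \<omega> \<inter> interior (C j) \<inter> B)" if "\<omega> \<in> space N" for \<omega> B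
      by (rule finite_subset[OF _ fin[OF that C(1)[of j] C(2)[of j]]]) (use interior_subset in blast)
    have "Int_stable (Collect (open :: 'a set \<Rightarrow> bool))" by (auto simp: Int_stable_def)
    moreover have "Collect (open :: 'a set \<Rightarrow> bool) \<subseteq> Pow UNIV" by simp
    moreover have "T \<in> sigma_sets UNIV (Collect open)" using T(1) by (simp add: sets_borel)
    ultimately show ?thesis
    proof (induction rule: sigma_sets_induct_disjoint)
      case (basic A)
      have "interior (C j) \<inter> A \<subseteq> V" using C(2)[of j] interior_subset[of "C j"] by blast
      then show ?case using meas[of "interior (C j) \<inter> A"] basic by (simp add: Int_assoc open_Int)
    next
      case (compl A)
      have "?c (Z \<omega> \<inter> interior (C j) \<inter> (UNIV - A)) = ?c (Z \<omega> \<inter> interior (C j)) - ?c (Z \<omega> \<inter> interior (C j) \<inter> A)" if "\<omega> \<in> space N" for \<omega>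
      proof -
        have "Z \<omega> \<inter> interior (C j) \<inter> (UNIV - A) = Z \<omega> \<inter> interior (C j) - Z \<omega> \<inter> interior (C j) \<inter> A" by auto
        then show ?thesis using finj[OF that, of A] by (simp only:) (rule emeasure_Diff, auto)
      qed
      moreover have "(\<lambda>\<omega>. ?c (Z \<omega> \<inter> interior (C j)) - ?c (Z \<omega> \<inter> interior (C j) \<inter> A)) \<in> borel_measurable N"
      proof (rule borel_measurable_minus_ennreal)
        show "(\<lambda>\<omega>. ?c (Z \<omega> \<inter> interior (C j))) \<in> borel_measurable N"
          using C(2)[of j] interior_subset[of "C j"] by (intro meas) auto
      qed (rule compl)
      ultimately show ?case by (simp cong: measurable_cong)
    next
      case (union A)
      have "?c (Z \<omega> \<inter> interior (C j) \<inter> (\<Union>i. A i)) = (\<Sum>i. ?c (Z \<omega> \<inter> interior (C j) \<inter> A i))" for \<omega>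
      proof -
        have "Z \<omega> \<inter> interior (C j) \<inter> (\<Union>i. A i) = (\<Union>i. Z \<omega> \<inter> interior (C j) \<inter> A i)" by auto
        then show ?thesis
          using union(1) by (simp only:) (intro suminf_emeasure[symmetric]; auto simp: disjoint_family_on_def)
      qed
      then show ?case using union by simp
    qed simp
  qed
  have "?c (Z \<omega> \<inter> T) = (SUP j. ?c (Z \<omega> \<inter> interior (C j) \<inter> T))" for \<omega>
  proof -
    have "interior (C j) \<subseteq> interior (C (Suc j))" for j using C(3)[of j] interior_subset[of "C j"] by blast
    then have "incseq (\<lambda>j. Z \<omega> \<inter> interior (C j) \<inter> T)" by (intro incseq_SucI) blast
    moreover have "Z \<omega> \<inter> T = (\<Union>j. Z \<omega> \<inter> interior (C j) \<inter> T)" using T(2) C(3,4) by blast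
    ultimately show ?thesis by (simp add: SUP_emeasure_incseq)
  qed
  then show ?thesis using j by simp
qed

text \<open>Continuity in t lets the point be replaced by the first member of a dense sequence
  within distance 1/(n+1). The approximant involves only countably many values of t, so it is
  jointly measurable, and it converges as n grows.\<close>

lemma measurable_caratheodory:
  fixes f :: "'w \<Rightarrow> 'a::euclidean_space \<Rightarrow> 'b::{metric_space, second_countable_topology}"
  assumes V: "open V" and cont: "\<And>\<omega>. \<omega> \<in> space N \<Longrightarrow> continuous_on V (f \<omega>)"
    and meas: "\<And>t. t \<in> V \<Longrightarrow> (\<lambda>\<omega>. f \<omega> t) \<in> borel_measurable N"
  shows "(\<lambda>p. if fst p \<in> V then f (snd p) (fst p) else c) \<in> borel_measurable (borel \<Otimes>\<^sub>M N)"
proof -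
  obtain D :: "'a set" where D: "countable D" "\<And>X. open X \<Longrightarrow> X \<noteq> {} \<Longrightarrow> \<exists>d\<in>D. d \<in> X"
    using countable_dense_setE by blast
  have "D \<noteq> {}" using D(2)[of UNIV] by auto
  define d where "d = from_nat_into D"
  have dense: "\<exists>k. dist t (d k) < 1 / (real n + 1)" for t n
  proof -
    obtain y where y: "y \<in> D" "y \<in> ball t (1 / (real n + 1))" using D(2)[of "ball t (1 / (real n + 1))"] by auto
    then show ?thesis using from_nat_into_surj[OF D(1), of y] by (auto simp: d_def)
  qed
  define k where "k n t = (LEAST k. dist t (d k) < 1 / (real n + 1))" for n t
  have k: "dist t (d (k n t)) < 1 / (real n + 1)" for n t
    unfolding k_def using dense by (rule LeastI_ex)
  have [measurable]: "k n \<in> measurable borel (count_space UNIV)" for n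
    unfolding k_def[abs_def] by measurable
  have [measurable]: "V \<in> sets borel" using V by simp
  have F: "(\<lambda>p. if d m \<in> V then f (snd p) (d m) else c) \<in> borel_measurable ((borel :: 'a measure) \<Otimes>\<^sub>M N)" for m
  proof (cases "d m \<in> V")
    case True
    then show ?thesis using measurable_compose[OF measurable_snd meas[OF True]] by simp
  qed simp
  show ?thesis
  proof (rule borel_measurable_LIMSEQ_metric)
    fix n
    show "(\<lambda>p. if fst p \<in> V then (if d (k n (fst p)) \<in> V then f (snd p) (d (k n (fst p))) else c) else c) \<in> borel_measurable (borel \<Otimes>\<^sub>M N)"
    proof (rule measurable_If)
      show "(\<lambda>p. (if d (k n (fst p)) \<in> V then f (snd p) (d (k n (fst p))) else c)) \<in> borel_measurable (borel \<Otimes>\<^sub>M N)"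
        by (rule measurable_compose_countable[OF F]) measurable
    qed measurable
  next
    fix p :: "'a \<times> 'w" assume "p \<in> space (borel \<Otimes>\<^sub>M N)"
    then have w: "snd p \<in> space N" by (auto simp: space_pair_measure)
    show "(\<lambda>n. if fst p \<in> V then (if d (k n (fst p)) \<in> V then f (snd p) (d (k n (fst p))) else c) else c)
      \<longlonglongrightarrow> (if fst p \<in> V then f (snd p) (fst p) else c)"
    proof (cases "fst p \<in> V")
      case True
      have lim: "(\<lambda>n. d (k n (fst p))) \<longlonglongrightarrow> fst p"
      proof (rule metric_LIMSEQ_I)
        fix r :: real assume "r > 0"
        then obtain N where N: "1 / (real N + 1) < r" using nat_approx_posE[of r] by (auto simp: add.commute)
        have "dist (d (k n (fst p))) (fst p) < r" if "n \<ge> N" for n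
        proof -
          have "1 / (real n + 1) \<le> 1 / (real N + 1)" using that by (simp add: frac_le)
          then show ?thesis using k[of "fst p" n] N by (simp add: dist_commute)
        qed
        then show "\<exists>no. \<forall>n\<ge>no. dist (d (k n (fst p))) (fst p) < r" by blast
      qed
      have ev: "\<forall>\<^sub>F n in sequentially. d (k n (fst p)) \<in> V"
        using lim V True by (rule topological_tendstoD)
      have "isCont (f (snd p)) (fst p)" using cont[OF w] V True by (simp add: continuous_on_eq_continuous_at)
      then have "(\<lambda>n. f (snd p) (d (k n (fst p)))) \<longlonglongrightarrow> f (snd p) (fst p)"
        using lim by (rule isCont_tendsto_compose)
      then have "(\<lambda>n. if d (k n (fst p)) \<in> V then f (snd p) (d (k n (fst p))) else c) \<longlonglongrightarrow> f (snd p) (fst p)"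
        by (rule Lim_transform_eventually) (use ev in \<open>auto elim: eventually_mono\<close>)
      then show ?thesis using True by simp
    qed simp
  qed
qed


section \<open>Regression\<close>

context gaussian_space
begin

lemma expectation_cos: "Z \<in> L \<Longrightarrow> expectation (\<lambda>\<omega>. cos (Z \<omega>)) = cos (expectation Z) * exp (- covar Z Z / 2)"
  and expectation_sin: "Z \<in> L \<Longrightarrow> expectation (\<lambda>\<omega>. sin (Z \<omega>)) = sin (expectation Z) * exp (- covar Z Z / 2)"
proof -
  assume Z: "Z \<in> L"
  have "Complex (expectation (\<lambda>\<omega>. cos (Z \<omega>))) (expectation (\<lambda>\<omega>. sin (Z \<omega>))) = exp (\<i> * expectation Z - covar Z Z / 2)"
    using gaussian_rv_char[OF gauss[OF Z]] integral_iexp_eq[OF finite_measure_axioms L_measurable[OF Z]]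
    by (simp add: covar_def power2_eq_square)
  then show "expectation (\<lambda>\<omega>. cos (Z \<omega>)) = cos (expectation Z) * exp (- covar Z Z / 2)"
    "expectation (\<lambda>\<omega>. sin (Z \<omega>)) = sin (expectation Z) * exp (- covar Z Z / 2)"
    by (auto simp: complex_eq_iff Re_exp Im_exp mult.commute)
qed

text \<open>The regression residuals of the Gaussian space with respect to \<open>X\<close>; jointly they are independent
  of \<open>X\<close>.\<close>

definition uncorr :: "('a \<Rightarrow> 'e::euclidean_space) \<Rightarrow> ('a \<Rightarrow> real) set" where
  "uncorr X = {Z\<in>L. \<forall>b. covar Z (\<lambda>\<omega>. X \<omega> \<bullet> b) = 0}"

text \<open>All residuals are collected in one sigma-algebra so that functionals of infinitely many
  of them, such as the number of solutions of an equation for the whole residual field, can be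
  separated from \<open>X\<close>.\<close>

definition uncorr_algebra :: "('a \<Rightarrow> 'e::euclidean_space) \<Rightarrow> 'a measure" where
  "uncorr_algebra X = sigma (space M) {Z -` B \<inter> space M |Z B. Z \<in> uncorr X \<and> B \<in> sets borel}"

lemma space_uncorr_algebra[simp]: "space (uncorr_algebra X) = space M"
  unfolding uncorr_algebra_def by (rule space_measure_of) auto

lemma sets_uncorr_algebra: "sets (uncorr_algebra X) = sigma_sets (space M) {Z -` B \<inter> space M |Z B. Z \<in> uncorr X \<and> B \<in> sets borel}"
  unfolding uncorr_algebra_def by (rule sets_measure_of) auto

lemma uncorr_measurable: "Z \<in> uncorr X \<Longrightarrow> Z \<in> borel_measurable (uncorr_algebra X)"
  by (rule measurableI) (auto simp: sets_uncorr_algebra intro!: sigma_sets.Basic)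

lemma subalgebra_uncorr: "subalgebra M (uncorr_algebra X)"
  unfolding subalgebra_def sets_uncorr_algebra
  by (auto simp: uncorr_def intro!: sets.sigma_sets_subset measurable_sets[OF L_measurable])

lemma measurable_uncorr_algebra: "f \<in> measurable (uncorr_algebra X) N \<Longrightarrow> f \<in> measurable M N"
  using measurable_from_subalg[OF subalgebra_uncorr] .

lemma uncorr_lin:
  assumes X: "\<And>b. (\<lambda>\<omega>. X \<omega> \<bullet> b) \<in> L" and Z: "Z \<in> uncorr X" "Z' \<in> uncorr X"
  shows "(\<lambda>\<omega>. Z \<omega> + c * Z' \<omega>) \<in> uncorr X"
  using assms by (auto simp: uncorr_def lin covar_lin)

lemma L_vector_measurable:
  fixes X :: "'a \<Rightarrow> 'e::euclidean_space"
  assumes X: "\<And>b. (\<lambda>\<omega>. X \<omega> \<bullet> b) \<in> L"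
  shows "X \<in> borel_measurable M"
  using L_measurable[OF X] by (subst borel_measurable_euclidean_space) auto

text \<open>The law of the pair, with the first component seen only through
  \<open>uncorr_algebra X\<close>, is compared with a product measure by
  \<open>finite_measure_eqI_trig\<close>. For \<open>Z\<close> uncorrelated with \<open>X\<close>
  the variance of Z + X \<bullet> b is the sum of the variances, so the Gaussian formulas for the
  means of sine and cosine factor exactly as they do under the product.\<close>

theorem uncorr_independent:
  fixes X :: "'a \<Rightarrow> 'e::euclidean_space"
  assumes X: "\<And>b. (\<lambda>\<omega>. X \<omega> \<bullet> b) \<in> L"
    and Phi[measurable]: "Phi \<in> borel_measurable (uncorr_algebra X \<Otimes>\<^sub>M borel)"
  shows "(\<integral>\<^sup>+\<omega>. Phi (\<omega>, X \<omega>) \<partial>M) = (\<integral>\<^sup>+\<omega>. \<integral>\<^sup>+v. Phi (\<omega>, v) \<partial>distr M borel X \<partial>M)"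
proof -
  let ?G = "uncorr_algebra X"
  define Q where "Q = restr_to_subalg M ?G"
  define LX where "LX = distr M borel X"
  have Xm[measurable]: "X \<in> borel_measurable M" by (rule L_vector_measurable[OF X])
  have sQ[measurable_cong]: "sets Q = sets ?G" unfolding Q_def by (rule sets_restr_to_subalg[OF subalgebra_uncorr])
  have spQ[simp]: "space Q = space M" by (simp add: Q_def space_restr_to_subalg)
  have sLX[measurable_cong, simp]: "sets LX = sets borel" by (simp add: LX_def)
  have idm[measurable]: "(\<lambda>\<omega>. \<omega>) \<in> measurable M ?G"
    using measurable_uncorr_algebra[of "\<lambda>\<omega>. \<omega>" X ?G] by simp
  interpret Q: prob_space Q unfolding Q_def
    by (rule prob_space_restr_to_subalg[OF subalgebra_uncorr prob_space_axioms])
  interpret LX: prob_space LX unfolding LX_def by (rule prob_space_distr) simp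
  interpret QL: pair_prob_space Q LX ..
  define mu where "mu = distr M (?G \<Otimes>\<^sub>M borel) (\<lambda>\<omega>. (\<omega>, X \<omega>))"
  define nu where "nu = Q \<Otimes>\<^sub>M LX"
  \<comment> \<open>The choices b = 0 and Z = 0 recover the residuals and the coordinates of
    \<open>X\<close>, so these functions generate the product sigma-algebra.\<close>
  define Zs where "Zs = {\<lambda>p. Z (fst p) + snd p \<bullet> (b::'e) |Z b. Z \<in> uncorr X}"
  have zero: "(\<lambda>_. 0) \<in> uncorr X" using L_zero covar_zero[OF X] by (simp add: uncorr_def)
  have s_mu: "sets mu = sets (?G \<Otimes>\<^sub>M borel)" and s_nu: "sets nu = sets (?G \<Otimes>\<^sub>M borel)"
    unfolding mu_def nu_def using sQ by (auto intro!: sets_pair_measure_cong)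
  have sp_mu: "space mu = space M \<times> UNIV" unfolding mu_def by (simp add: space_pair_measure)
  have Zs_meas: "W \<in> borel_measurable (?G \<Otimes>\<^sub>M borel)" if "W \<in> Zs" for W
  proof -
    from that obtain Z b where W: "W = (\<lambda>p. Z (fst p) + snd p \<bullet> b)" "Z \<in> uncorr X" by (auto simp: Zs_def)
    note [measurable] = uncorr_measurable[OF W(2)]
    have "(\<lambda>v::'e. v \<bullet> b) \<in> borel_measurable borel"
      by (intro borel_measurable_continuous_onI continuous_intros)
    from measurable_compose[OF measurable_snd this]
    have "(\<lambda>p. snd p \<bullet> b) \<in> borel_measurable (?G \<Otimes>\<^sub>M borel)" .
    then show ?thesis unfolding W(1) by (intro borel_measurable_add) simp_all
  qed
  have "mu = nu"
  proof (rule finite_measure_eqI_trig[where Zs = Zs])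
    show "Zs \<noteq> {}" using zero by (auto simp: Zs_def)
  next
    fix W W' and c :: real assume "W \<in> Zs" "W' \<in> Zs"
    then obtain Z b Z' b' where W: "W = (\<lambda>p. Z (fst p) + snd p \<bullet> b)" "Z \<in> uncorr X" "W' = (\<lambda>p. Z' (fst p) + snd p \<bullet> b')" "Z' \<in> uncorr X"
      by (auto simp: Zs_def)
    have "(\<lambda>p. W p + c * W' p) = (\<lambda>p. (Z (fst p) + c * Z' (fst p)) + snd p \<bullet> (b + c *\<^sub>R b'))"
      by (auto simp: W algebra_simps inner_add_right)
    then show "(\<lambda>p. W p + c * W' p) \<in> Zs" unfolding Zs_def
      by (intro CollectI exI[of _ "\<lambda>\<omega>. Z \<omega> + c * Z' \<omega>"] exI[of _ "b + c *\<^sub>R b'"] conjI uncorr_lin[OF X W(2,4)])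
  next
    let ?gen = "{W -` B \<inter> space mu |W B. W \<in> Zs \<and> B \<in> sets borel}"
    show "sets mu = sigma_sets (space mu) ?gen"
    proof
      show "sigma_sets (space mu) ?gen \<subseteq> sets mu"
        using Zs_meas measurable_cong_sets[OF s_mu refl, of borel] by (intro sets.sigma_sets_subset) (auto intro!: measurable_sets)
      define SG where "SG = sigma (space mu) ?gen"
      have spSG: "space SG = space mu" unfolding SG_def by (rule space_measure_of) auto
      have setsSG: "sets SG = sigma_sets (space mu) ?gen" unfolding SG_def by (rule sets_measure_of) auto
      have WSG: "W \<in> borel_measurable SG" if "W \<in> Zs" for W
        using that by (intro measurableI) (auto simp: setsSG spSG intro!: sigma_sets.Basic)
      have 1: "fst \<in> measurable SG ?G"
        unfolding uncorr_algebra_def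
      proof (rule measurable_sigma_sets[OF sets_measure_of])
        fix A assume "A \<in> {Z -` B \<inter> space M |Z B. Z \<in> uncorr X \<and> B \<in> sets borel}"
        then obtain Z B where A: "A = Z -` B \<inter> space M" "Z \<in> uncorr X" "B \<in> sets borel" by auto
        have "(\<lambda>p. Z (fst p) + snd p \<bullet> (0::'e)) \<in> Zs" unfolding Zs_def
          by (intro CollectI exI[of _ Z] exI[of _ 0] conjI A(2) refl)
        from measurable_sets[OF WSG[OF this] A(3)]
        have "(\<lambda>p. Z (fst p)) -` B \<inter> space SG \<in> sets SG" by simp
        moreover have "fst -` A \<inter> space SG = (\<lambda>p. Z (fst p)) -` B \<inter> space SG"
          by (auto simp: A spSG sp_mu)
        ultimately show "fst -` A \<inter> space SG \<in> sets SG" by simp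
      qed (auto simp: spSG sp_mu)
      have 2: "snd \<in> borel_measurable SG"
      proof (subst borel_measurable_euclidean_space, intro ballI)
        fix b :: 'e
        have "(\<lambda>p. 0 + snd p \<bullet> b) \<in> Zs" unfolding Zs_def
          by (intro CollectI exI[of _ "\<lambda>_. 0"] exI[of _ b] conjI zero refl)
        from WSG[OF this] show "(\<lambda>p. snd p \<bullet> b) \<in> borel_measurable SG" by simp
      qed
      have "(\<lambda>p. (fst p, snd p)) \<in> measurable SG (?G \<Otimes>\<^sub>M borel)" using 1 2 by measurable
      then have id: "(\<lambda>p. p) \<in> measurable SG mu" using measurable_cong_sets[OF refl s_mu, of SG] by simp
      show "sets mu \<subseteq> sigma_sets (space mu) ?gen"
      proof
        fix A assume A: "A \<in> sets mu"
        have "(\<lambda>p. p) -` A \<inter> space SG \<in> sets SG" using id A by (rule measurable_sets)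
        moreover have "(\<lambda>p. p) -` A \<inter> space SG = A" using sets.sets_into_space[OF A] by (auto simp: spSG)
        ultimately show "A \<in> sigma_sets (space mu) ?gen" by (simp add: setsSG)
      qed
    qed
  next
    have fmu: "prob_space mu" unfolding mu_def by (rule prob_space_distr) simp
    have fnu: "prob_space nu" unfolding nu_def by (rule QL.prob_space_axioms)
    have "(\<integral>p. cos (W p) \<partial>mu) = (\<integral>p. cos (W p) \<partial>nu) \<and> (\<integral>p. sin (W p) \<partial>mu) = (\<integral>p. sin (W p) \<partial>nu)" if "W \<in> Zs" for W
    proof -
      from that obtain Z b where W: "W = (\<lambda>p. Z (fst p) + snd p \<bullet> b)" and Z: "Z \<in> uncorr X" by (auto simp: Zs_def)
      let ?Y = "\<lambda>\<omega>. X \<omega> \<bullet> b"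
      note [measurable] = Zs_meas[OF that, unfolded W] uncorr_measurable[OF Z]
      have ZL: "Z \<in> L" and Z0: "covar Z ?Y = 0" using Z by (auto simp: uncorr_def)
      have mm: "(\<integral>p. h (Z (fst p) + snd p \<bullet> b) \<partial>mu) = expectation (\<lambda>\<omega>. h (Z \<omega> + ?Y \<omega>))"
        if [measurable]: "h \<in> borel_measurable borel" for h :: "real \<Rightarrow> real"
        unfolding mu_def by (subst integral_distr) auto
      have prodi: "(\<integral>p. f (Z (fst p)) * g (snd p \<bullet> b) \<partial>nu) = expectation (\<lambda>\<omega>. f (Z \<omega>)) * expectation (\<lambda>\<omega>. g (?Y \<omega>))"
        and prodii: "integrable nu (\<lambda>p. f (Z (fst p)) * g (snd p \<bullet> b))"
        if [measurable]: "f \<in> borel_measurable borel" "g \<in> borel_measurable borel" and fg: "\<And>x. \<bar>f x\<bar> \<le> 1" "\<And>x. \<bar>g x\<bar> \<le> 1" for f g :: "real \<Rightarrow> real"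
      proof -
        have ab: "\<bar>f x * g y\<bar> \<le> 1" for x y using mult_mono[OF fg(1)[of x] fg(2)[of y]] by (simp add: abs_mult)
        have i: "integrable (Q \<Otimes>\<^sub>M LX) (\<lambda>(\<omega>, v). f (Z \<omega>) * g (v \<bullet> b))"
          by (rule QL.integrable_const_bound[where B = 1]) (use ab in auto)
        then show "integrable nu (\<lambda>p. f (Z (fst p)) * g (snd p \<bullet> b))" by (simp add: nu_def case_prod_beta')
        have "(\<integral>p. f (Z (fst p)) * g (snd p \<bullet> b) \<partial>nu) = (\<integral>p. (case p of (\<omega>, v) \<Rightarrow> f (Z \<omega>) * g (v \<bullet> b)) \<partial>(Q \<Otimes>\<^sub>M LX))"
          by (simp add: nu_def case_prod_beta')
        also have "\<dots> = (\<integral>\<omega>. \<integral>v. f (Z \<omega>) * g (v \<bullet> b) \<partial>LX \<partial>Q)"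
          using QL.integral_fst[OF i] by simp
        also have "\<dots> = (\<integral>\<omega>. f (Z \<omega>) \<partial>Q) * (\<integral>v. g (v \<bullet> b) \<partial>LX)" by simp
        also have "(\<integral>\<omega>. f (Z \<omega>) \<partial>Q) = expectation (\<lambda>\<omega>. f (Z \<omega>))"
          unfolding Q_def by (rule integral_subalgebra2[OF subalgebra_uncorr]) simp
        also have "(\<integral>v. g (v \<bullet> b) \<partial>LX) = expectation (\<lambda>\<omega>. g (?Y \<omega>))"
          unfolding LX_def by (rule integral_distr) auto
        finally show "(\<integral>p. f (Z (fst p)) * g (snd p \<bullet> b) \<partial>nu) = expectation (\<lambda>\<omega>. f (Z \<omega>)) * expectation (\<lambda>\<omega>. g (?Y \<omega>))" .
      qed
      have ZY: "(\<lambda>\<omega>. Z \<omega> + ?Y \<omega>) \<in> L" by (rule L_add[OF ZL X])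
      have "covar (\<lambda>\<omega>. Z \<omega> + ?Y \<omega>) (\<lambda>\<omega>. Z \<omega> + ?Y \<omega>) = covar Z Z + covar ?Y ?Y"
        using covar_add[OF ZL X ZY, of b] covar_add[OF ZL X ZL, of b] covar_add[OF ZL X X, of b b] Z0
        by (simp add: covar_sym)
      then have ex: "exp (- covar (\<lambda>\<omega>. Z \<omega> + ?Y \<omega>) (\<lambda>\<omega>. Z \<omega> + ?Y \<omega>) / 2) = exp (- covar Z Z / 2) * exp (- covar ?Y ?Y / 2)"
        by (simp add: exp_add[symmetric] add_divide_distrib)
      have em: "expectation (\<lambda>\<omega>. Z \<omega> + ?Y \<omega>) = expectation Z + expectation ?Y"
        using L_integrable[OF ZL] L_integrable[OF X] by simp
      have "(\<integral>p. cos (W p) \<partial>nu) = (\<integral>p. cos (Z (fst p)) * cos (snd p \<bullet> b) - sin (Z (fst p)) * sin (snd p \<bullet> b) \<partial>nu)"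
        by (simp add: W cos_add)
      also have "\<dots> = expectation (\<lambda>\<omega>. cos (Z \<omega>)) * expectation (\<lambda>\<omega>. cos (?Y \<omega>)) - expectation (\<lambda>\<omega>. sin (Z \<omega>)) * expectation (\<lambda>\<omega>. sin (?Y \<omega>))"
        by (subst Bochner_Integration.integral_diff) (auto intro!: prodii simp: prodi)
      also have "\<dots> = (\<integral>p. cos (W p) \<partial>mu)"
        by (simp only: W mm[OF borel_measurable_cos] expectation_cos[OF ZY] expectation_cos[OF ZL] expectation_cos[OF X] expectation_sin[OF ZL] expectation_sin[OF X] ex em)
          (simp add: cos_add algebra_simps)
      finally have c: "(\<integral>p. cos (W p) \<partial>mu) = (\<integral>p. cos (W p) \<partial>nu)" ..
      have "(\<integral>p. sin (W p) \<partial>nu) = (\<integral>p. sin (Z (fst p)) * cos (snd p \<bullet> b) + cos (Z (fst p)) * sin (snd p \<bullet> b) \<partial>nu)"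
        by (simp add: W sin_add)
      also have "\<dots> = expectation (\<lambda>\<omega>. sin (Z \<omega>)) * expectation (\<lambda>\<omega>. cos (?Y \<omega>)) + expectation (\<lambda>\<omega>. cos (Z \<omega>)) * expectation (\<lambda>\<omega>. sin (?Y \<omega>))"
        by (subst Bochner_Integration.integral_add) (auto intro!: prodii simp: prodi)
      also have "\<dots> = (\<integral>p. sin (W p) \<partial>mu)"
        by (simp only: W mm[OF borel_measurable_sin] expectation_sin[OF ZY] expectation_cos[OF ZL] expectation_cos[OF X] expectation_sin[OF ZL] expectation_sin[OF X] ex em)
          (simp add: sin_add algebra_simps)
      finally show ?thesis using c by simp
    qed
    moreover have "Zs \<subseteq> borel_measurable mu" using Zs_meas measurable_cong_sets[OF s_mu refl, of borel] by blast
    ultimately show "same_trig Zs mu nu"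
      using fmu fnu s_mu s_nu by (auto simp: same_trig_def prob_space_def)
  qed
  then have "(\<integral>\<^sup>+p. Phi p \<partial>mu) = (\<integral>\<^sup>+p. Phi p \<partial>nu)" by simp
  moreover have "(\<integral>\<^sup>+p. Phi p \<partial>mu) = (\<integral>\<^sup>+\<omega>. Phi (\<omega>, X \<omega>) \<partial>M)"
    unfolding mu_def by (subst nn_integral_distr) auto
  moreover have "(\<integral>\<^sup>+p. Phi p \<partial>nu) = (\<integral>\<^sup>+\<omega>. \<integral>\<^sup>+v. Phi (\<omega>, v) \<partial>LX \<partial>Q)"
  proof -
    have "Phi \<in> borel_measurable (Q \<Otimes>\<^sub>M LX)"
      using Phi s_nu unfolding nu_def by (subst measurable_cong_sets[OF s_nu[unfolded nu_def] refl])
    then show ?thesis unfolding nu_def by (rule LX.nn_integral_fst[symmetric])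
  qed
  moreover have "(\<integral>\<^sup>+\<omega>. \<integral>\<^sup>+v. Phi (\<omega>, v) \<partial>LX \<partial>Q) = (\<integral>\<^sup>+\<omega>. \<integral>\<^sup>+v. Phi (\<omega>, v) \<partial>LX \<partial>M)"
    unfolding Q_def
  proof (rule nn_integral_subalgebra2[OF subalgebra_uncorr])
    have "(\<lambda>(\<omega>, v). Phi (\<omega>, v)) \<in> borel_measurable (?G \<Otimes>\<^sub>M LX)"
      using Phi by (simp cong: measurable_cong_sets)
    then show "(\<lambda>\<omega>. \<integral>\<^sup>+v. Phi (\<omega>, v) \<partial>LX) \<in> borel_measurable ?G"
      by (rule LX.borel_measurable_nn_integral)
  qed
  ultimately show ?thesis by (simp add: LX_def)
qed

end


section \<open>The Gaussian density with unit covariance\<close>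

lemma prod_lborel_integral:
  fixes h :: "'e::euclidean_space \<Rightarrow> real \<Rightarrow> 'b::{real_normed_field, banach, second_countable_topology}"
  assumes h: "\<And>b. b \<in> Basis \<Longrightarrow> integrable lborel (h b)"
  shows "integrable lborel (\<lambda>x::'e. \<Prod>b\<in>Basis. h b (x \<bullet> b))"
    "(\<integral>x. (\<Prod>b\<in>Basis. h b (x \<bullet> b)) \<partial>lborel) = (\<Prod>b\<in>Basis. (\<integral>t. h b t \<partial>lborel))"
proof -
  interpret product_sigma_finite "\<lambda>_::'e. lborel :: real measure" ..
  let ?P = "\<Pi>\<^sub>M b\<in>(Basis::'e set). (lborel :: real measure)"
  let ?T = "\<lambda>f. \<Sum>b\<in>(Basis::'e set). f b *\<^sub>R b"
  have T: "?T \<in> measurable ?P borel" by measurable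
  have hm: "(\<lambda>x::'e. \<Prod>b\<in>Basis. h b (x \<bullet> b)) \<in> borel_measurable borel"
  proof (rule borel_measurable_prod)
    fix b :: 'e assume b: "b \<in> Basis"
    have "h b \<in> borel_measurable borel" using borel_measurable_integrable[OF h[OF b]] by simp
    then show "(\<lambda>x. h b (x \<bullet> b)) \<in> borel_measurable borel" by measurable
  qed
  have eq: "(\<Prod>b\<in>Basis. h b (?T f \<bullet> b)) = (\<Prod>b\<in>Basis. h b (f b))" for f
    by (intro prod.cong refl) simp
  show "integrable lborel (\<lambda>x::'e. \<Prod>b\<in>Basis. h b (x \<bullet> b))"
    using h product_integrable_prod[of Basis h]
    by (subst lborel_eq, subst integrable_distr_eq[OF T hm]) (simp add: eq)
  have "(\<integral>x. (\<Prod>b\<in>Basis. h b (x \<bullet> b)) \<partial>lborel) = (\<integral>f. (\<Prod>b\<in>Basis. h b (?T f \<bullet> b)) \<partial>?P)"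
    by (subst lborel_eq, rule integral_distr[OF T hm])
  also have "\<dots> = (\<Prod>b\<in>Basis. (\<integral>t. h b t \<partial>lborel))"
    unfolding eq using h by (intro product_integral_prod) auto
  finally show "(\<integral>x. (\<Prod>b\<in>Basis. h b (x \<bullet> b)) \<partial>lborel) = (\<Prod>b\<in>Basis. (\<integral>t. h b t \<partial>lborel))" .
qed

text \<open>The density of a Gaussian vector with mean \<open>m\<close> and unit covariance, written
  as a product over the basis so that its integrals reduce to one-dimensional ones.\<close>

definition unit_gauss :: "'e::euclidean_space \<Rightarrow> 'e \<Rightarrow> real" where
  "unit_gauss m x = (\<Prod>b\<in>Basis. normal_density (m \<bullet> b) 1 (x \<bullet> b))"

lemma unit_gauss_bounds: "0 < unit_gauss m x" "unit_gauss m x \<le> 1"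
proof -
  show "0 < unit_gauss m x" unfolding unit_gauss_def by (intro prod_pos ballI normal_density_pos) simp
  have "normal_density a 1 t \<le> 1" for a t
  proof -
    have "1 \<le> sqrt (2 * pi)" by (rule real_le_rsqrt) (use pi_gt3 in simp)
    moreover have "normal_density a 1 t = 1 / sqrt (2 * pi) * exp (- (t - a)\<^sup>2 / 2)"
      by (simp add: normal_density_def)
    moreover have "1 / sqrt (2 * pi) * exp (- (t - a)\<^sup>2 / 2) \<le> 1" if "1 \<le> sqrt (2 * pi)"
      by (rule mult_le_one) (use that in auto)
    ultimately show ?thesis by (simp only:)
  qed
  then show "unit_gauss m x \<le> 1"
    unfolding unit_gauss_def by (intro prod_le_1) (auto simp: normal_density_nonneg)
qed

lemma continuous_normal_density: "continuous_on S (\<lambda>x. normal_density m s (f x))" if "continuous_on S f"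
  using that unfolding normal_density_def divide_inverse by (intro continuous_intros) 

lemma continuous_unit_gauss [continuous_intros]: "continuous_on S f \<Longrightarrow> continuous_on S (\<lambda>x. unit_gauss m (f x))"
  unfolding unit_gauss_def by (intro continuous_intros continuous_normal_density)

lemma measurable_unit_gauss [measurable]: "unit_gauss m \<in> borel_measurable borel"
  by (intro borel_measurable_continuous_onI continuous_intros)

lemma integral_normal_iexp:
  fixes m c :: real
  shows "integrable lborel (\<lambda>t. complex_of_real (normal_density m 1 t) * iexp (c * t))"
  "(CLINT t|lborel. normal_density m 1 t * iexp (c * t)) = exp (\<i> * (c * m) - c\<^sup>2 / 2)"
proof -
  let ?N = "density lborel (\<lambda>x. ennreal (normal_density m 1 x))"
  interpret N: prob_space ?N by (rule prob_space_normal_density) simp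
  have D: "distributed ?N lborel (\<lambda>x. x) (\<lambda>x. ennreal (normal_density m 1 x))"
    by (auto simp: distributed_def distr_id2)
  have E: "N.expectation (\<lambda>x. x) = m" and V: "N.expectation (\<lambda>x. (x - m)\<^sup>2) = 1"
    using N.normal_distributed_expectation[OF _ D] N.normal_distributed_variance[OF _ D] by auto
  have g: "gaussian_rv ?N (\<lambda>x. c * x)"
  proof (cases "c = 0")
    case False
    have "distributed ?N lborel (\<lambda>x. 0 + c * x) (\<lambda>x. ennreal (normal_density (0 + c * m) (\<bar>c\<bar> * 1) x))"
      by (rule N.normal_density_affine) (use D False in auto)
    then show ?thesis using False unfolding gaussian_rv_def
      by (intro conjI disjI2 exI[of _ "c * m"] exI[of _ "\<bar>c\<bar>"]) auto
  qed (auto simp: gaussian_rv_def)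
  have sq: "(c * x - c * m)\<^sup>2 = c\<^sup>2 * (x - m)\<^sup>2" for x by (simp add: right_diff_distrib[symmetric] power_mult_distrib)
  have "(CLINT x|?N. iexp (c * x)) = exp (\<i> * (c * m) - c\<^sup>2 / 2)"
    using N.gaussian_rv_char[OF g] E V by (simp add: sq)
  moreover have "(CLINT x|?N. iexp (c * x)) = (CLINT t|lborel. normal_density m 1 t *\<^sub>R iexp (c * t))"
    by (rule integral_density) auto
  ultimately have "(CLINT t|lborel. normal_density m 1 t *\<^sub>R iexp (c * t)) = exp (\<i> * (c * m) - c\<^sup>2 / 2)"
    by (simp only:)
  then show "(CLINT t|lborel. normal_density m 1 t * iexp (c * t)) = exp (\<i> * (c * m) - c\<^sup>2 / 2)"
    by (simp only: scaleR_conv_of_real)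
  have "integrable ?N (\<lambda>x. iexp (c * x))" by (rule N.integrable_const_bound[where B = 1]) auto
  then have "integrable lborel (\<lambda>t. normal_density m 1 t *\<^sub>R iexp (c * t))"
    by (subst (asm) integrable_density) auto
  then show "integrable lborel (\<lambda>t. complex_of_real (normal_density m 1 t) * iexp (c * t))"
    by (simp only: scaleR_conv_of_real)
qed

lemma integral_unit_gauss_iexp:
  fixes m c :: "'e::euclidean_space"
  shows "integrable lborel (\<lambda>x. complex_of_real (unit_gauss m x) * iexp (c \<bullet> x))"
    "(CLINT x|lborel. unit_gauss m x * iexp (c \<bullet> x)) = exp (\<i> * (c \<bullet> m) - (c \<bullet> c) / 2)"
proof -
  have eq: "(\<Prod>b\<in>Basis. complex_of_real (normal_density (m \<bullet> b) 1 (x \<bullet> b)) * iexp ((c \<bullet> b) * (x \<bullet> b))) = complex_of_real (unit_gauss m x) * iexp (c \<bullet> x)" for x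
    by (simp add: prod.distrib unit_gauss_def exp_sum[symmetric] sum_distrib_left[symmetric] euclidean_inner[of c x])
  note P = prod_lborel_integral[of "\<lambda>b t. complex_of_real (normal_density (m \<bullet> b) 1 t) * iexp ((c \<bullet> b) * t)", OF integral_normal_iexp(1), unfolded eq]
  show "integrable lborel (\<lambda>x. complex_of_real (unit_gauss m x) * iexp (c \<bullet> x))" by (rule P)
  have "(\<Prod>b\<in>Basis. exp (\<i> * ((c \<bullet> b) * (m \<bullet> b)) - (c \<bullet> b)\<^sup>2 / 2)) = exp (\<i> * (c \<bullet> m) - (c \<bullet> c) / 2)"
    by (simp add: exp_sum[symmetric] sum_subtractf sum_distrib_left[symmetric] euclidean_inner[of c m] euclidean_inner[of c c] power2_eq_square sum_divide_distrib[symmetric])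
  then show "(CLINT x|lborel. unit_gauss m x * iexp (c \<bullet> x)) = exp (\<i> * (c \<bullet> m) - (c \<bullet> c) / 2)"
    by (simp only: P(2) integral_normal_iexp(2))
qed

lemma prob_space_unit_gauss: "prob_space (density lborel (\<lambda>x. ennreal (unit_gauss m x)))"
proof
  \<comment> \<open>The total mass is the characteristic function at 0.\<close>
  have I: "integrable lborel (\<lambda>x. complex_of_real (unit_gauss m x))"
      "(CLINT x|lborel. complex_of_real (unit_gauss m x)) = 1"
    using integral_unit_gauss_iexp[of m 0] by simp_all
  have i: "integrable lborel (unit_gauss m)" using integrable_Re[OF I(1)] by simp
  have e: "(\<integral>x. unit_gauss m x \<partial>lborel) = 1" using I(2) integral_Re[OF I(1)] by simp
  have "emeasure (density lborel (\<lambda>x. ennreal (unit_gauss m x))) (space (density lborel (\<lambda>x. ennreal (unit_gauss m x)))) = (\<integral>\<^sup>+x. ennreal (unit_gauss m x) \<partial>lborel)"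
    by (simp add: emeasure_density)
  also have "\<dots> = 1"
    using i e unit_gauss_bounds(1)[of m] by (subst nn_integral_eq_integral) (auto intro: less_imp_le)
  finally show "emeasure (density lborel (\<lambda>x. ennreal (unit_gauss m x))) (space (density lborel (\<lambda>x. ennreal (unit_gauss m x)))) = 1" .
qed


text \<open>Gram-Schmidt for the inner product \<open>x \<bullet> (C *v y)\<close>: a further vector
  is found orthogonal to the vectors \<open>C *v v i\<close>, which are too few to span, and is
  normalised. The rows of \<open>T\<close> are the resulting basis, so T C T^t is the identity and
  \<open>T\<close> is invertible.\<close>

lemma orthonormal_matrix_exists:
  fixes C :: "real^'n::finite^'n"
  assumes sym: "\<And>x y. x \<bullet> (C *v y) = y \<bullet> (C *v x)" and pos: "\<And>x. x \<noteq> 0 \<Longrightarrow> x \<bullet> (C *v x) > 0"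
  obtains T :: "real^'n^'n" where "det T \<noteq> 0" "\<And>i j. T $ i \<bullet> (C *v (T $ j)) = (if i = j then 1 else 0)"
proof -
  have "\<exists>v :: 'n \<Rightarrow> real^'n. \<forall>i\<in>I. \<forall>j\<in>I. v i \<bullet> (C *v v j) = (if i = j then 1 else 0)" for I
  proof (induction I rule: finite_induct[OF finite])
    case 1 then show ?case by simp
  next
    case (2 k I)
    then obtain v :: "'n \<Rightarrow> real^'n" where v: "\<And>i j. i \<in> I \<Longrightarrow> j \<in> I \<Longrightarrow> v i \<bullet> (C *v v j) = (if i = j then 1 else 0)" by auto
    let ?S = "(\<lambda>i. C *v v i) ` I"
    have "dim ?S \<le> card ?S" using 2 by (intro dim_le_card') auto
    also have "\<dots> \<le> card I" using 2 by (intro card_image_le) auto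
    also have "card I < CARD('n)" using 2 by (intro psubset_card_mono) auto
    finally have "dim ?S < DIM(real^'n)" by simp
    then obtain x where x: "x \<noteq> 0" "\<And>y. y \<in> span ?S \<Longrightarrow> orthogonal x y"
      using orthogonal_to_subspace_exists by blast
    define c where "c = sqrt (x \<bullet> (C *v x))"
    have c: "c > 0" "c\<^sup>2 = x \<bullet> (C *v x)" using pos[OF x(1)] by (auto simp: c_def)
    define w where "w = (\<lambda>i. if i = k then x /\<^sub>R c else v i)"
    have x0: "x \<bullet> (C *v v i) = 0" if "i \<in> I" for i
      using x(2)[OF span_base, of "C *v v i"] that by (auto simp: orthogonal_def)
    have ww: "w i \<bullet> (C *v w j) = (if i = j then 1 else 0)" if ij: "i \<in> insert k I" "j \<in> insert k I" for i j
    proof (cases "i = k"; cases "j = k")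
      assume "i = k" "j = k"
      moreover have "x \<bullet> (C *v x) = c * c" using c(2) by (simp add: power2_eq_square)
      ultimately show ?thesis using c(1) by (simp add: w_def matrix_vector_mult_scaleR field_simps)
    next
      assume "i = k" "j \<noteq> k"
      then show ?thesis using ij x0[of j] by (auto simp: w_def)
    next
      assume "i \<noteq> k" "j = k"
      then show ?thesis using ij x0[of i] by (auto simp: w_def sym[of "v i"] matrix_vector_mult_scaleR)
    next
      assume "i \<noteq> k" "j \<noteq> k"
      then show ?thesis using ij v by (auto simp: w_def)
    qed
    then show ?case by blast
  qed
  from this[of UNIV] obtain v :: "'n \<Rightarrow> real^'n" where v: "\<And>i j. v i \<bullet> (C *v v j) = (if i = j then 1 else 0)" by auto
  define T :: "real^'n^'n" where "T = (\<chi> i. v i)"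
  have T: "T $ i \<bullet> (C *v (T $ j)) = (if i = j then 1 else 0)" for i j by (simp add: T_def v)
  have "(T ** (C ** transpose T)) $ i $ j = (mat 1 :: real^'n^'n) $ i $ j" for i j
  proof -
    have "(C ** transpose T) $ l $ j = (C *v (T $ j)) $ l" for l
      by (simp add: matrix_matrix_mult_def matrix_vector_mult_def transpose_def)
    then have "(T ** (C ** transpose T)) $ i $ j = T $ i \<bullet> (C *v (T $ j))"
      by (simp add: matrix_matrix_mult_def[of T] inner_vec_def)
    then show ?thesis by (simp add: T mat_def)
  qed
  then have "T ** (C ** transpose T) = mat 1" by (simp add: vec_eq_iff)
  then have "det T * det (C ** transpose T) = 1" by (metis det_mul det_I)
  then have "det T \<noteq> 0" by auto
  then show ?thesis using T that by blast
qed


context gaussian_space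
begin

lemma covar_inner_sum:
  fixes X :: "'a \<Rightarrow> 'e::euclidean_space"
  assumes X: "\<And>b. (\<lambda>\<omega>. X \<omega> \<bullet> b) \<in> L" and W: "W \<in> L"
  shows "covar (\<lambda>\<omega>. X \<omega> \<bullet> v) W = (\<Sum>b\<in>Basis. (v \<bullet> b) * covar (\<lambda>\<omega>. X \<omega> \<bullet> b) W)"
proof -
  have "(\<lambda>\<omega>. X \<omega> \<bullet> v) = (\<lambda>\<omega>. \<Sum>b\<in>Basis. (v \<bullet> b) * (X \<omega> \<bullet> b))"
    by (auto simp: euclidean_inner[of "X _" v] mult.commute)
  then show ?thesis using X W by (simp add: covar_sum covar_scale L_scale)
qed

lemma covar_linear:
  fixes X :: "'a \<Rightarrow> 'e::euclidean_space"
  assumes X: "\<And>b. (\<lambda>\<omega>. X \<omega> \<bullet> b) \<in> L" and W: "W \<in> L"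
  shows "linear (\<lambda>v. covar (\<lambda>\<omega>. X \<omega> \<bullet> v) W)"
proof (rule linearI)
  note eq = covar_inner_sum[OF X W]
  show "covar (\<lambda>\<omega>. X \<omega> \<bullet> (v + w)) W = covar (\<lambda>\<omega>. X \<omega> \<bullet> v) W + covar (\<lambda>\<omega>. X \<omega> \<bullet> w) W" for v w
    unfolding eq[of "v + w"] eq[of v] eq[of w] by (simp add: inner_add_left sum.distrib distrib_right)
  show "covar (\<lambda>\<omega>. X \<omega> \<bullet> (c *\<^sub>R v)) W = c *\<^sub>R covar (\<lambda>\<omega>. X \<omega> \<bullet> v) W" for c v
    unfolding eq[of "c *\<^sub>R v"] eq[of v] by (simp add: sum_distrib_left mult.assoc)
qed

lemma covar_nonneg: "0 \<le> covar Z Z"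
  unfolding covar_def by (rule integral_nonneg_AE) simp

lemma covar_cauchy_schwarz:
  assumes "Z \<in> L" "W \<in> L"
  shows "(covar Z W)\<^sup>2 \<le> covar Z Z * covar W W"
proof -
  have "integrable M (\<lambda>\<omega>. (V \<omega> - expectation V)\<^sup>2)" if "V \<in> L" for V
    using L_integrable[OF that] L_square_integrable[OF that] by (simp add: power2_diff)
  then show ?thesis
    using expectation_cauchy_schwarz[of "\<lambda>\<omega>. Z \<omega> - expectation Z" "\<lambda>\<omega>. W \<omega> - expectation W"] assms L_measurable
    by (simp add: covar_def power2_eq_square)
qed

text \<open>Links the vector-valued covariance operator of the statement to the scalar covariances
  in which the Gaussian space is handled.\<close>

lemma cov_op_inner:
  fixes X :: "'a \<Rightarrow> 'e::euclidean_space" and Y :: "'a \<Rightarrow> 'f::euclidean_space"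
  assumes X: "\<And>b. (\<lambda>\<omega>. X \<omega> \<bullet> b) \<in> L" and Y: "\<And>b. (\<lambda>\<omega>. Y \<omega> \<bullet> b) \<in> L"
  shows "cov_op M Y X v \<bullet> w = covar (\<lambda>\<omega>. X \<omega> \<bullet> v) (\<lambda>\<omega>. Y \<omega> \<bullet> w)"
proof -
  have i: "integrable M Z" if "\<And>b. (\<lambda>\<omega>. Z \<omega> \<bullet> b) \<in> L" for Z :: "'a \<Rightarrow> 'g::euclidean_space"
  proof -
    have "integrable M (\<lambda>\<omega>. \<Sum>b\<in>Basis. (Z \<omega> \<bullet> b) *\<^sub>R b)"
      using L_integrable[OF that] by (intro Bochner_Integration.integrable_sum integrable_scaleR_left) auto
    then show ?thesis by (simp add: euclidean_representation)
  qed
  have e: "expectation (\<lambda>\<omega>. Z \<omega> \<bullet> b) = (\<integral>\<omega>. Z \<omega> \<partial>M) \<bullet> b" if "\<And>b. (\<lambda>\<omega>. Z \<omega> \<bullet> b) \<in> L" for Z :: "'a \<Rightarrow> 'g::euclidean_space" and b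
    by (rule integral_inner_left) (rule i[OF that])
  let ?f = "\<lambda>\<omega>. ((X \<omega> - (\<integral>\<omega>'. X \<omega>' \<partial>M)) \<bullet> v) *\<^sub>R (Y \<omega> - (\<integral>\<omega>'. Y \<omega>' \<partial>M))"
  have "integrable M (\<lambda>\<omega>. \<Sum>b\<in>Basis. (((X \<omega> - (\<integral>\<omega>'. X \<omega>' \<partial>M)) \<bullet> v) * ((Y \<omega> - (\<integral>\<omega>'. Y \<omega>' \<partial>M)) \<bullet> b)) *\<^sub>R b)"
    using L_mult_integrable[OF X Y] L_integrable[OF X] L_integrable[OF Y]
    by (intro Bochner_Integration.integrable_sum integrable_scaleR_left)
      (auto simp: inner_diff_left algebra_simps)
  moreover have "(\<Sum>b\<in>Basis. (((X \<omega> - (\<integral>\<omega>'. X \<omega>' \<partial>M)) \<bullet> v) * ((Y \<omega> - (\<integral>\<omega>'. Y \<omega>' \<partial>M)) \<bullet> b)) *\<^sub>R b) = ?f \<omega>" for \<omega>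
    by (simp add: scaleR_scaleR[symmetric] scaleR_sum_right[symmetric] euclidean_representation del: scaleR_scaleR)
  ultimately have "integrable M ?f" by simp
  then have "cov_op M Y X v \<bullet> w = expectation (\<lambda>\<omega>. ?f \<omega> \<bullet> w)"
    unfolding cov_op_def using integral_inner_left[of w M ?f] by (simp only:)
  then show ?thesis by (simp add: covar_def e[OF X] e[OF Y] inner_diff_left)
qed

text \<open>If the variance in direction \<open>v\<close> vanished, Cauchy-Schwarz would annihilate
  all covariances with that direction, and \<open>v\<close> would be a nonzero vector in the kernel
  of the bijective covariance operator.\<close>

lemma nondegenerate_covar_pos:
  fixes X :: "'a \<Rightarrow> 'e::euclidean_space"
  assumes X: "\<And>b. (\<lambda>\<omega>. X \<omega> \<bullet> b) \<in> L" and nd: "nondegenerate M X" and v: "v \<noteq> 0"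
  shows "0 < covar (\<lambda>\<omega>. X \<omega> \<bullet> v) (\<lambda>\<omega>. X \<omega> \<bullet> v)"
proof (rule ccontr)
  assume "\<not> ?thesis"
  then have 0: "covar (\<lambda>\<omega>. X \<omega> \<bullet> v) (\<lambda>\<omega>. X \<omega> \<bullet> v) = 0" using covar_nonneg[of "\<lambda>\<omega>. X \<omega> \<bullet> v"] by simp
  have "cov_op M X X v \<bullet> w = 0" for w
    using covar_cauchy_schwarz[OF X X, of v w] 0 by (simp add: cov_op_inner[OF X X])
  then have "cov_op M X X v = 0" by (metis inner_eq_zero_iff)
  moreover have "cov_op M X X 0 = 0" by (simp add: cov_op_def)
  ultimately show False using nd v unfolding nondegenerate_def by (metis bij_is_inj injD)
qed

lemma cov_op_linear:
  fixes X :: "'a \<Rightarrow> 'e::euclidean_space" and Y :: "'a \<Rightarrow> 'f::euclidean_space"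
  assumes X: "\<And>b. (\<lambda>\<omega>. X \<omega> \<bullet> b) \<in> L" and Y: "\<And>b. (\<lambda>\<omega>. Y \<omega> \<bullet> b) \<in> L"
  shows "linear (cov_op M Y X)"
proof (rule linearI)
  note lin = covar_linear[OF X Y]
  show "cov_op M Y X (v + w) = cov_op M Y X v + cov_op M Y X w" for v w
    by (rule euclidean_eqI) (simp only: inner_add_left cov_op_inner[OF X Y] linear_add[OF lin])
  show "cov_op M Y X (c *\<^sub>R v) = c *\<^sub>R cov_op M Y X v" for c v
    by (rule euclidean_eqI) (simp only: inner_scaleR_left cov_op_inner[OF X Y] linear_scale[OF lin] real_scaleR_def)
qed

text \<open>The coefficient \<open>A\<close> is such that the residual V - A W is uncorrelated with
  \<open>W\<close>. The residual therefore belongs to \<open>uncorr W\<close> and is independent of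
  \<open>W\<close>, and freezing the value of \<open>W\<close> turns the regression version of the
  conditional law into a genuine disintegration.\<close>

theorem regression:
  fixes V :: "'a \<Rightarrow> 'z::euclidean_space" and W :: "'a \<Rightarrow> 'y::euclidean_space"
  assumes V: "\<And>b. (\<lambda>\<omega>. V \<omega> \<bullet> b) \<in> L" and W: "\<And>b. (\<lambda>\<omega>. W \<omega> \<bullet> b) \<in> L"
    and nd: "nondegenerate M W"
  shows "linear (regression_coeff M V W)"
    "H \<in> borel_measurable (borel \<Otimes>\<^sub>M borel) \<Longrightarrow>
     (\<integral>\<^sup>+\<omega>. H (V \<omega>, W \<omega>) \<partial>M) = (\<integral>\<^sup>+w. \<integral>\<^sup>+m. H (m, w) \<partial>cond_law M V W w \<partial>distr M borel W)"
    "cond_law M V W w = distr M borel (\<lambda>\<omega>. regression_coeff M V W w + (V \<omega> - regression_coeff M V W (W \<omega>)))"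
proof -
  let ?C = "cov_op M W W" and ?A = "regression_coeff M V W"
  have C: "linear ?C" by (rule cov_op_linear[OF W W])
  have bij: "bij ?C" using nd by (simp add: nondegenerate_def)
  have iC: "linear (inv ?C)" using C bij by (intro inj_linear_imp_inv_linear bij_is_inj)
  have A_eq: "?A = cov_op M V W \<circ> inv ?C" by (auto simp: regression_coeff_def)
  show A: "linear ?A" unfolding A_eq by (rule linear_compose[OF iC cov_op_linear[OF W V]])
  have Am[measurable]: "?A \<in> borel_measurable borel"
    by (intro borel_measurable_continuous_onI linear_continuous_on A[unfolded linear_conv_bounded_linear])
  have Vm[measurable]: "V \<in> borel_measurable M" and Wm[measurable]: "W \<in> borel_measurable M"
    using L_vector_measurable V W by blast+
  define R where "R \<omega> = V \<omega> - ?A (W \<omega>)" for \<omega>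
  have AW: "?A (W \<omega>) \<bullet> a = (\<Sum>e\<in>Basis. (?A e \<bullet> a) * (W \<omega> \<bullet> e))" for \<omega> a
  proof -
    have "?A (W \<omega>) = ?A (\<Sum>e\<in>Basis. (W \<omega> \<bullet> e) *\<^sub>R e)" by (simp add: euclidean_representation)
    also have "\<dots> = (\<Sum>e\<in>Basis. (W \<omega> \<bullet> e) *\<^sub>R ?A e)" by (simp add: linear_sum[OF A] linear_scale[OF A])
    finally show ?thesis by (simp add: inner_sum_left mult.commute)
  qed
  have AWL: "(\<lambda>\<omega>. ?A (W \<omega>) \<bullet> a) \<in> L" for a unfolding AW by (intro L_sum L_scale W)
  have RL: "(\<lambda>\<omega>. R \<omega> \<bullet> a) \<in> L" for a unfolding R_def inner_diff_left by (rule L_diff[OF V AWL])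
  have Run: "(\<lambda>\<omega>. R \<omega> \<bullet> a) \<in> uncorr W" for a
  proof -
    have "covar (\<lambda>\<omega>. R \<omega> \<bullet> a) (\<lambda>\<omega>. W \<omega> \<bullet> b) = 0" for b
    proof -
      let ?g = "\<lambda>v. covar (\<lambda>\<omega>. W \<omega> \<bullet> v) (\<lambda>\<omega>. V \<omega> \<bullet> a)"
      have g: "linear (\<lambda>v. ?g (inv ?C v))" using linear_compose[OF iC covar_linear[OF W V]] by (simp add: o_def)
      have "covar (\<lambda>\<omega>. ?A (W \<omega>) \<bullet> a) (\<lambda>\<omega>. W \<omega> \<bullet> b) = (\<Sum>e\<in>Basis. (?A e \<bullet> a) * covar (\<lambda>\<omega>. W \<omega> \<bullet> e) (\<lambda>\<omega>. W \<omega> \<bullet> b))"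
        unfolding AW by (simp add: covar_sum covar_scale L_scale W)
      \<comment> \<open>Symmetry of the covariance exchanges the roles of \<open>e\<close> and
        \<open>b\<close>; summing over the basis then rebuilds \<open>?C b\<close>, which
        \<open>inv ?C\<close> cancels.\<close>
      also have "\<dots> = (\<Sum>e\<in>Basis. (?C b \<bullet> e) * ?g (inv ?C e))"
        by (intro sum.cong refl) (simp add: regression_coeff_def cov_op_inner[OF W V] cov_op_inner[OF W W] covar_sym mult.commute)
      also have "\<dots> = ?g (inv ?C (\<Sum>e\<in>Basis. (?C b \<bullet> e) *\<^sub>R e))"
        by (simp add: linear_sum[OF g] linear_scale[OF g])
      also have "\<dots> = ?g b" using bij by (simp add: euclidean_representation bij_is_inj)
      finally have "covar (\<lambda>\<omega>. ?A (W \<omega>) \<bullet> a) (\<lambda>\<omega>. W \<omega> \<bullet> b) = covar (\<lambda>\<omega>. V \<omega> \<bullet> a) (\<lambda>\<omega>. W \<omega> \<bullet> b)"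
        by (simp add: covar_sym)
      then show ?thesis unfolding R_def inner_diff_left by (simp add: covar_diff[OF V AWL W])
    qed
    then show ?thesis using RL by (simp add: uncorr_def)
  qed
  have Rm[measurable]: "R \<in> borel_measurable (uncorr_algebra W)"
    using uncorr_measurable[OF Run] by (intro borel_measurable_euclidean_space[THEN iffD2]) auto
  then have Rm'[measurable]: "R \<in> borel_measurable M" by (rule measurable_uncorr_algebra)
  show claw: "cond_law M V W w = distr M borel (\<lambda>\<omega>. ?A w + (V \<omega> - ?A (W \<omega>)))" for w
    by (simp add: cond_law_def)
  assume [measurable]: "H \<in> borel_measurable (borel \<Otimes>\<^sub>M borel)"
  have "(\<integral>\<^sup>+\<omega>. H (V \<omega>, W \<omega>) \<partial>M) = (\<integral>\<^sup>+\<omega>. (case (\<omega>, W \<omega>) of (\<omega>, w) \<Rightarrow> H (?A w + R \<omega>, w)) \<partial>M)"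
    by (simp add: R_def)
  also have "\<dots> = (\<integral>\<^sup>+\<omega>. \<integral>\<^sup>+w. H (?A w + R \<omega>, w) \<partial>distr M borel W \<partial>M)"
    by (subst uncorr_independent[OF W]) auto
  also have "\<dots> = (\<integral>\<^sup>+w. \<integral>\<^sup>+\<omega>. H (?A w + R \<omega>, w) \<partial>M \<partial>distr M borel W)"
  proof -
    interpret W: prob_space "distr M borel W" by (rule prob_space_distr) simp
    interpret pair_sigma_finite M "distr M borel W" ..
    show ?thesis by (rule Fubini'[symmetric]) auto
  qed
  also have "\<dots> = (\<integral>\<^sup>+w. \<integral>\<^sup>+m. H (m, w) \<partial>cond_law M V W w \<partial>distr M borel W)"
    unfolding claw by (simp add: nn_integral_distr R_def)
  finally show "(\<integral>\<^sup>+\<omega>. H (V \<omega>, W \<omega>) \<partial>M) = (\<integral>\<^sup>+w. \<integral>\<^sup>+m. H (m, w) \<partial>cond_law M V W w \<partial>distr M borel W)" .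
qed

end


section \<open>Second order conditions\<close>

text \<open>The mean value theorem, applied to a difference in direction \<open>w\<close> and then
  to the gradient in direction \<open>u\<close>, writes the mixed second difference as t^2 times the
  Hessian form at one intermediate point.\<close>

lemma mixed_difference_bound:
  fixes f :: "real^'n::finite \<Rightarrow> real" and D :: "real^'n \<Rightarrow> real^'n" and H :: "real^'n \<Rightarrow> real^'n^'n"
  assumes der1: "\<And>x. x \<in> ball s r \<Longrightarrow> (f has_derivative (\<lambda>h. D x \<bullet> h)) (at x)"
    and der2: "\<And>x. x \<in> ball s r \<Longrightarrow> (D has_derivative (\<lambda>h. H x *v h)) (at x)"
    and bound: "\<And>x. x \<in> ball s r \<Longrightarrow> \<bar>(H x *v u) \<bullet> w - (H s *v u) \<bullet> w\<bar> \<le> e"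
    and t: "0 < t" "t * (norm u + norm w) < r"
  shows "\<bar>f (s + t *\<^sub>R u + t *\<^sub>R w) - f (s + t *\<^sub>R u) - f (s + t *\<^sub>R w) + f s - t\<^sup>2 * ((H s *v u) \<bullet> w)\<bar> \<le> t\<^sup>2 * e"
proof -
  have inb: "s + a *\<^sub>R u + b *\<^sub>R w \<in> ball s r" if "0 \<le> a" "a \<le> t" "0 \<le> b" "b \<le> t" for a b
  proof -
    have "norm (a *\<^sub>R u + b *\<^sub>R w) \<le> a * norm u + b * norm w"
      using norm_triangle_ineq[of "a *\<^sub>R u" "b *\<^sub>R w"] that by simp
    also have "\<dots> \<le> t * norm u + t * norm w" using that by (intro add_mono mult_right_mono) auto
    also have "\<dots> < r" using t by (simp add: distrib_left)
    finally have "norm ((s + a *\<^sub>R u + b *\<^sub>R w) - s) < r" by (simp add: algebra_simps)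
    then show ?thesis by (metis dist_commute dist_norm mem_ball)
  qed
  define g where "g b = f (s + t *\<^sub>R u + b *\<^sub>R w) - f (s + b *\<^sub>R w)" for b
  have g': "(g has_real_derivative (D (s + t *\<^sub>R u + b *\<^sub>R w) - D (s + b *\<^sub>R w)) \<bullet> w) (at b)" if b: "0 \<le> b" "b \<le> t" for b
  proof -
    have d1: "((\<lambda>b. s + t *\<^sub>R u + b *\<^sub>R w) has_derivative (\<lambda>h. h *\<^sub>R w)) (at b)"
      and d2: "((\<lambda>b. s + b *\<^sub>R w) has_derivative (\<lambda>h. h *\<^sub>R w)) (at b)"
      by (auto intro!: derivative_eq_intros)
    have "s + b *\<^sub>R w \<in> ball s r" using inb[of 0 b] b t by simp
    then have "((\<lambda>b. f (s + t *\<^sub>R u + b *\<^sub>R w) - f (s + b *\<^sub>R w)) has_derivative (\<lambda>h. D (s + t *\<^sub>R u + b *\<^sub>R w) \<bullet> (h *\<^sub>R w) - D (s + b *\<^sub>R w) \<bullet> (h *\<^sub>R w))) (at b)"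
      using inb[of t b] b t by (intro has_derivative_diff has_derivative_compose[OF d1 der1] has_derivative_compose[OF d2 der1]) auto
    then show ?thesis
      unfolding has_field_derivative_def g_def[abs_def]
      by (rule has_derivative_eq_rhs) (auto simp: inner_diff_left algebra_simps)
  qed
  obtain b where b: "0 < b" "b < t" and gb: "g t - g 0 = (t - 0) * ((D (s + t *\<^sub>R u + b *\<^sub>R w) - D (s + b *\<^sub>R w)) \<bullet> w)"
    using MVT2[of 0 t g "\<lambda>b. (D (s + t *\<^sub>R u + b *\<^sub>R w) - D (s + b *\<^sub>R w)) \<bullet> w"] g' t by auto
  define k where "k a = D (s + a *\<^sub>R u + b *\<^sub>R w) \<bullet> w" for a
  have k': "(k has_real_derivative (H (s + a *\<^sub>R u + b *\<^sub>R w) *v u) \<bullet> w) (at a)" if a: "0 \<le> a" "a \<le> t" for a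
  proof -
    have d1: "((\<lambda>a. s + a *\<^sub>R u + b *\<^sub>R w) has_derivative (\<lambda>h. h *\<^sub>R u)) (at a)"
      by (auto intro!: derivative_eq_intros)
    have "((\<lambda>a. D (s + a *\<^sub>R u + b *\<^sub>R w)) has_derivative (\<lambda>h. H (s + a *\<^sub>R u + b *\<^sub>R w) *v (h *\<^sub>R u))) (at a)"
      by (rule has_derivative_compose[OF d1 der2]) (use inb a b in auto)
    then have "(k has_derivative (\<lambda>h. (H (s + a *\<^sub>R u + b *\<^sub>R w) *v (h *\<^sub>R u)) \<bullet> w)) (at a)"
      unfolding k_def[abs_def] by (rule has_derivative_inner_left)
    then show ?thesis
      unfolding has_field_derivative_def
      by (rule has_derivative_eq_rhs) (auto simp: matrix_vector_mult_scaleR)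
  qed
  obtain a where a: "0 < a" "a < t" and ka: "k t - k 0 = (t - 0) * ((H (s + a *\<^sub>R u + b *\<^sub>R w) *v u) \<bullet> w)"
    using MVT2[of 0 t k "\<lambda>a. (H (s + a *\<^sub>R u + b *\<^sub>R w) *v u) \<bullet> w"] k' t by auto
  have "f (s + t *\<^sub>R u + t *\<^sub>R w) - f (s + t *\<^sub>R u) - f (s + t *\<^sub>R w) + f s = g t - g 0" by (simp add: g_def)
  also have "\<dots> = t\<^sup>2 * ((H (s + a *\<^sub>R u + b *\<^sub>R w) *v u) \<bullet> w)"
    using gb ka by (simp add: k_def inner_diff_left power2_eq_square)
  finally have "f (s + t *\<^sub>R u + t *\<^sub>R w) - f (s + t *\<^sub>R u) - f (s + t *\<^sub>R w) + f s - t\<^sup>2 * ((H s *v u) \<bullet> w)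
    = t\<^sup>2 * ((H (s + a *\<^sub>R u + b *\<^sub>R w) *v u) \<bullet> w - (H s *v u) \<bullet> w)" by (simp add: right_diff_distrib)
  then show ?thesis
    using bound[OF inb[of a b]] a b by (simp add: abs_mult mult_left_mono)
qed

text \<open>The mixed second difference does not change when \<open>u\<close> and \<open>w\<close>
  are exchanged, and it is t^2 times either form up to an error t^2 e.\<close>

lemma hessian_symmetric:
  fixes f :: "real^'n::finite \<Rightarrow> real" and D :: "real^'n \<Rightarrow> real^'n" and H :: "real^'n \<Rightarrow> real^'n^'n"
  assumes V: "open V" "s \<in> V"
    and der1: "\<And>x. x \<in> V \<Longrightarrow> (f has_derivative (\<lambda>h. D x \<bullet> h)) (at x)"
    and der2: "\<And>x. x \<in> V \<Longrightarrow> (D has_derivative (\<lambda>h. H x *v h)) (at x)"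
    and cont: "continuous_on V H"
  shows "(H s *v u) \<bullet> w = (H s *v w) \<bullet> u"
proof (rule ccontr)
  define m where "m u w = (H s *v u) \<bullet> w" for u w
  assume "\<not> ?thesis"
  then have ne: "\<bar>m u w - m w u\<bar> > 0" by (simp add: m_def)
  \<comment> \<open>Two approximations within e allow the forms to differ by 2 e, which is only half
    of their assumed distance.\<close>
  define e where "e = \<bar>m u w - m w u\<bar> / 4"
  have e: "e > 0" using ne by (simp add: e_def)
  have cb: "\<exists>r>0. \<forall>x\<in>ball s r. \<bar>(H x *v u) \<bullet> w - (H s *v u) \<bullet> w\<bar> \<le> e" for u w
  proof -
    have "continuous_on V (\<lambda>x. (H x *v u) \<bullet> w)"
      unfolding matrix_vector_mult_def inner_vec_def
      by (simp, intro continuous_intros cont)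
    then have "isCont (\<lambda>x. (H x *v u) \<bullet> w) s" using V by (simp add: continuous_on_eq_continuous_at)
    then obtain d where "d > 0" "\<And>x. dist x s < d \<Longrightarrow> dist ((H x *v u) \<bullet> w) ((H s *v u) \<bullet> w) < e"
      unfolding continuous_at_eps_delta using e by blast
    then show ?thesis by (intro exI[of _ d]) (auto simp: dist_real_def dist_commute less_imp_le)
  qed
  obtain r1 where r1: "r1 > 0" "\<And>x. x \<in> ball s r1 \<Longrightarrow> \<bar>(H x *v u) \<bullet> w - (H s *v u) \<bullet> w\<bar> \<le> e" using cb[of u w] by auto
  obtain r2 where r2: "r2 > 0" "\<And>x. x \<in> ball s r2 \<Longrightarrow> \<bar>(H x *v w) \<bullet> u - (H s *v w) \<bullet> u\<bar> \<le> e" using cb[of w u] by auto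
  obtain r3 where r3: "r3 > 0" "ball s r3 \<subseteq> V" using V by (meson open_contains_ball)
  define r where "r = min r1 (min r2 r3)"
  have r: "r > 0" "ball s r \<subseteq> V" using r1 r2 r3 by (auto simp: r_def)
  define K where "K = norm u + norm w + 1"
  define t where "t = r / K / 2"
  have N: "K > 0" using norm_ge_zero[of u] norm_ge_zero[of w] unfolding K_def by linarith
  have t: "0 < t" using r N by (simp add: t_def)
  have "t * (norm u + norm w) \<le> t * K" using t by (simp add: K_def)
  also have "\<dots> = r / 2" using N by (simp add: t_def)
  also have "\<dots> < r" using r by simp
  finally have tr: "t * (norm u + norm w) < r" "t * (norm w + norm u) < r" by (simp_all add: add.commute)
  let ?\<Delta> = "f (s + t *\<^sub>R u + t *\<^sub>R w) - f (s + t *\<^sub>R u) - f (s + t *\<^sub>R w) + f s"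
  have 1: "\<bar>?\<Delta> - t\<^sup>2 * m u w\<bar> \<le> t\<^sup>2 * e"
    unfolding m_def by (rule mixed_difference_bound[where r = r and D = D]) (use der1 der2 r r1 tr t in \<open>auto simp: r_def\<close>)
  have "\<bar>(f (s + t *\<^sub>R w + t *\<^sub>R u) - f (s + t *\<^sub>R w) - f (s + t *\<^sub>R u) + f s) - t\<^sup>2 * m w u\<bar> \<le> t\<^sup>2 * e"
    unfolding m_def by (rule mixed_difference_bound[where r = r and D = D]) (use der1 der2 r r2 tr t in \<open>auto simp: r_def\<close>)
  moreover have "s + t *\<^sub>R w + t *\<^sub>R u = s + t *\<^sub>R u + t *\<^sub>R w" by simp
  ultimately have 2: "\<bar>?\<Delta> - t\<^sup>2 * m w u\<bar> \<le> t\<^sup>2 * e" by (simp only:)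
  have "t\<^sup>2 * \<bar>m u w - m w u\<bar> = \<bar>t\<^sup>2 * m u w - t\<^sup>2 * m w u\<bar>" by (simp add: abs_mult right_diff_distrib[symmetric])
  also have "\<dots> \<le> t\<^sup>2 * e + t\<^sup>2 * e" using 1 2 by linarith
  also have "\<dots> = t\<^sup>2 * (2 * e)" by simp
  finally have "\<bar>m u w - m w u\<bar> \<le> 2 * e" using t by (simp add: mult_le_cancel_left)
  then show False using ne by (simp add: e_def)
qed

text \<open>The mean value theorem produces the gradient at an intermediate point s + \<theta> h,
  and near a critical point this gradient is \<theta> H h up to \<theta> e |h|. The factor \<theta>
  is thus the unknown intermediate position rather than 1/2, which suffices because only the sign of
  the form is used later; in return the gradient is assumed differentiable at \<open>s\<close>
  alone.\<close>

lemma second_order_expansion: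
  fixes f :: "real^'n::finite \<Rightarrow> real" and D :: "real^'n \<Rightarrow> real^'n" and H :: "real^'n^'n"
  assumes V: "open V" "s \<in> V"
    and der1: "\<And>x. x \<in> V \<Longrightarrow> (f has_derivative (\<lambda>h. D x \<bullet> h)) (at x)"
    and der2: "(D has_derivative (\<lambda>h. H *v h)) (at s)"
    and crit: "D s = 0" and e: "e > 0"
  obtains r where "r > 0" "ball s r \<subseteq> V"
    "\<And>h. norm h < r \<Longrightarrow> \<exists>\<theta>. 0 < \<theta> \<and> \<theta> < 1 \<and> \<bar>f (s + h) - f s - \<theta> * (h \<bullet> (H *v h))\<bar> \<le> e * \<theta> * (norm h)\<^sup>2"
proof -
  obtain d where d: "d > 0" "\<And>y. norm (y - s) < d \<Longrightarrow> norm (D y - D s - H *v (y - s)) \<le> e * norm (y - s)"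
    using der2 e unfolding has_derivative_at_alt by metis
  obtain r0 where r0: "r0 > 0" "ball s r0 \<subseteq> V" using V by (meson open_contains_ball)
  define r where "r = min d r0"
  have r: "r > 0" "ball s r \<subseteq> V" using d r0 by (auto simp: r_def)
  show ?thesis
  proof (rule that[OF r])
    fix h :: "real^'n" assume h: "norm h < r"
    define g where "g t = f (s + t *\<^sub>R h)" for t
    have inb: "norm (t *\<^sub>R h) < r" if "0 \<le> t" "t \<le> 1" for t
      using that h mult_right_mono[of t 1 "norm h"] by simp
    have g': "(g has_real_derivative D (s + t *\<^sub>R h) \<bullet> h) (at t)" if t: "0 \<le> t" "t \<le> 1" for t
    proof -
      have "((\<lambda>t. s + t *\<^sub>R h) has_derivative (\<lambda>k. k *\<^sub>R h)) (at t)" by (auto intro!: derivative_eq_intros)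
      moreover have "s + t *\<^sub>R h \<in> V" using inb[OF t] r(2) by (auto simp: dist_norm)
      ultimately have "((\<lambda>t. f (s + t *\<^sub>R h)) has_derivative (\<lambda>k. D (s + t *\<^sub>R h) \<bullet> (k *\<^sub>R h))) (at t)"
        by (intro has_derivative_compose[OF _ der1])
      then show ?thesis
        unfolding has_field_derivative_def g_def[abs_def] by (rule has_derivative_eq_rhs) auto
    qed
    obtain t where t: "0 < t" "t < 1" and gt: "g 1 - g 0 = (1 - 0) * (D (s + t *\<^sub>R h) \<bullet> h)"
      using MVT2[of 0 1 g "\<lambda>t. D (s + t *\<^sub>R h) \<bullet> h"] g' by auto
    have "norm (D (s + t *\<^sub>R h) - H *v (t *\<^sub>R h)) \<le> e * norm (t *\<^sub>R h)"
      using d(2)[of "s + t *\<^sub>R h"] inb[of t] t crit by (simp add: r_def)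
    then have "norm (D (s + t *\<^sub>R h) - t *\<^sub>R (H *v h)) \<le> e * (t * norm h)"
      using t by (simp add: matrix_vector_mult_scaleR)
    then have "\<bar>(D (s + t *\<^sub>R h) - t *\<^sub>R (H *v h)) \<bullet> h\<bar> \<le> e * (t * norm h) * norm h"
      using Cauchy_Schwarz_ineq2[of "D (s + t *\<^sub>R h) - t *\<^sub>R (H *v h)" h] mult_right_mono[of _ _ "norm h"]
      by (meson norm_ge_zero order_trans)
    then have "\<bar>f (s + h) - f s - t * (h \<bullet> (H *v h))\<bar> \<le> e * t * (norm h)\<^sup>2"
      using gt by (simp add: g_def inner_diff_left inner_diff_right inner_commute power2_eq_square mult.assoc)
    then show "\<exists>\<theta>. 0 < \<theta> \<and> \<theta> < 1 \<and> \<bar>f (s + h) - f s - \<theta> * (h \<bullet> (H *v h))\<bar> \<le> e * \<theta> * (norm h)\<^sup>2"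
      using t by blast
  qed
qed

lemma local_max_semidefinite:
  fixes f :: "real^'n::finite \<Rightarrow> real" and D :: "real^'n \<Rightarrow> real^'n" and H :: "real^'n^'n"
  assumes V: "open V" "s \<in> V"
    and der1: "\<And>x. x \<in> V \<Longrightarrow> (f has_derivative (\<lambda>h. D x \<bullet> h)) (at x)"
    and der2: "(D has_derivative (\<lambda>h. H *v h)) (at s)"
    and lm: "\<And>x. x \<in> V \<Longrightarrow> f x \<le> f s"
  shows "D s = 0" "v \<bullet> (H *v v) \<le> 0"
proof -
  have "(\<lambda>h. D s \<bullet> h) = (\<lambda>h. 0)"
    by (rule differential_zero_maxmin[OF V(2,1) der1[OF V(2)]]) (use lm in auto)
  then have "D s \<bullet> D s = 0" by metis
  then show crit: "D s = 0" by simp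
  show "v \<bullet> (H *v v) \<le> 0"
  proof (rule ccontr)
    assume q: "\<not> v \<bullet> (H *v v) \<le> 0"
    then have v: "v \<noteq> 0" by auto
    \<comment> \<open>Half of the assumed positive Rayleigh quotient, so that the error of the
      expansion cannot outweigh the quadratic term.\<close>
    define e where "e = (v \<bullet> (H *v v)) / (norm v)\<^sup>2 / 2"
    have e: "e > 0" using q v by (simp add: e_def)
    obtain r where r: "r > 0" "ball s r \<subseteq> V" "\<And>h. norm h < r \<Longrightarrow> \<exists>\<theta>. 0 < \<theta> \<and> \<theta> < 1 \<and> \<bar>f (s + h) - f s - \<theta> * (h \<bullet> (H *v h))\<bar> \<le> e * \<theta> * (norm h)\<^sup>2"
      using second_order_expansion[OF V der1 der2 crit e] by blast
    define c where "c = r / norm v / 2"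
    have c: "c > 0" "norm (c *\<^sub>R v) < r" using r(1) v by (auto simp: c_def)
    obtain \<theta> where th: "0 < \<theta>" "\<bar>f (s + c *\<^sub>R v) - f s - \<theta> * ((c *\<^sub>R v) \<bullet> (H *v (c *\<^sub>R v)))\<bar> \<le> e * \<theta> * (norm (c *\<^sub>R v))\<^sup>2"
      using r(3)[OF c(2)] by blast
    have "s + c *\<^sub>R v \<in> V" using r(2) c(2) by (auto simp: dist_norm)
    then have "f (s + c *\<^sub>R v) \<le> f s" by (rule lm)
    then have "\<theta> * ((c *\<^sub>R v) \<bullet> (H *v (c *\<^sub>R v))) \<le> e * \<theta> * (norm (c *\<^sub>R v))\<^sup>2" using th(2) by linarith
    then have "\<theta> * c\<^sup>2 * (v \<bullet> (H *v v)) \<le> \<theta> * c\<^sup>2 * (e * (norm v)\<^sup>2)"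
      using c(1) by (simp add: matrix_vector_mult_scaleR power_mult_distrib power2_eq_square algebra_simps)
    then have "v \<bullet> (H *v v) \<le> e * (norm v)\<^sup>2" using th(1) c(1) by (simp add: mult_le_cancel_left)
    then show False using q v by (simp add: e_def)
  qed
qed

text \<open>If the form vanished at \<open>v\<close>, then w = H v would be nonzero and, by
  symmetry, the form at v + t w would be 2 t |w|^2 + O(t^2), which is positive for small t >
  0.\<close>

lemma negative_semidefinite_det_nonzero:
  fixes H :: "real^'n::finite^'n"
  assumes sym: "\<And>u w. (H *v u) \<bullet> w = (H *v w) \<bullet> u" and nsd: "\<And>v. v \<bullet> (H *v v) \<le> 0" and det: "det H \<noteq> 0" and v: "v \<noteq> 0"
  shows "v \<bullet> (H *v v) < 0"
proof (rule ccontr)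
  assume "\<not> ?thesis"
  then have q: "v \<bullet> (H *v v) = 0" using nsd[of v] by simp
  define w where "w = H *v v"
  have "w \<noteq> 0"
    using det v unfolding w_def by (metis invertible_det_nz matrix_left_invertible_ker invertible_def)
  define k where "k = w \<bullet> (H *v w)"
  have le: "2 * t * (w \<bullet> w) + t\<^sup>2 * k \<le> 0" for t
  proof -
    have "(v + t *\<^sub>R w) \<bullet> (H *v (v + t *\<^sub>R w)) = v \<bullet> (H *v v) + t * (v \<bullet> (H *v w)) + t * (w \<bullet> (H *v v)) + t\<^sup>2 * k"
      by (simp add: matrix_vector_right_distrib matrix_vector_mult_scaleR inner_add_left inner_add_right power2_eq_square k_def algebra_simps)
    moreover have "v \<bullet> (H *v w) = w \<bullet> w" using sym[of w v] by (simp add: w_def inner_commute)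
    ultimately show ?thesis using nsd[of "v + t *\<^sub>R w"] q by (simp add: w_def)
  qed
  have ww: "w \<bullet> w > 0" using \<open>w \<noteq> 0\<close> by simp
  \<comment> \<open>Chosen so that |t k| \<le> |w|^2: the quadratic term then cannot compensate the
    linear one. The summand 1 avoids division by 0.\<close>
  define t where "t = (w \<bullet> w) / (\<bar>k\<bar> + 1)"
  have t: "t > 0" using ww by (simp add: t_def)
  have "2 * (w \<bullet> w) + t * k \<le> 0" using le[of t] t by (simp add: power2_eq_square mult.assoc mult_le_0_iff flip: distrib_left) (metis distrib_left mult.commute mult.left_commute mult_le_0_iff not_less)
  moreover have "\<bar>t * k\<bar> \<le> w \<bullet> w"
  proof -
    have "\<bar>t * k\<bar> = t * \<bar>k\<bar>" using t by (simp add: abs_mult)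
    also have "\<dots> \<le> t * (\<bar>k\<bar> + 1)" using t by simp
    also have "\<dots> = w \<bullet> w" by (simp add: t_def)
    finally show ?thesis .
  qed
  ultimately show False using ww by linarith
qed

text \<open>Compactness of the unit sphere makes negativity uniform, and homogeneity extends the
  bound to all vectors.\<close>

lemma negative_definite_bound:
  fixes H :: "real^'n::finite^'n"
  assumes nd: "\<And>v. v \<noteq> 0 \<Longrightarrow> v \<bullet> (H *v v) < 0"
  obtains c where "c > 0" "\<And>v. v \<bullet> (H *v v) \<le> - c * (norm v)\<^sup>2"
proof -
  have cont: "continuous_on UNIV (\<lambda>v. v \<bullet> (H *v v))"
    by (intro continuous_intros linear_continuous_on matrix_vector_mul_bounded_linear)
  obtain z where z: "z \<in> sphere 0 1" "\<And>y. y \<in> sphere (0::real^'n) 1 \<Longrightarrow> y \<bullet> (H *v y) \<le> z \<bullet> (H *v z)"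
    using continuous_attains_sup[of "sphere (0::real^'n) 1" "\<lambda>v. v \<bullet> (H *v v)"] continuous_on_subset[OF cont] by auto
  show ?thesis
  proof (rule that[of "- (z \<bullet> (H *v z))"])
    have "z \<noteq> 0" using z(1) by auto
    then show "- (z \<bullet> (H *v z)) > 0" using nd[of z] by simp
    fix v :: "real^'n"
    show "v \<bullet> (H *v v) \<le> - (- (z \<bullet> (H *v z))) * (norm v)\<^sup>2"
    proof (cases "v = 0")
      case False
      define y where "y = v /\<^sub>R norm v"
      have v: "v = norm v *\<^sub>R y" using False by (simp add: y_def)
      have "y \<in> sphere 0 1" using False by (simp add: y_def)
      then have "y \<bullet> (H *v y) \<le> z \<bullet> (H *v z)" by (rule z(2))
      then have "(norm v)\<^sup>2 * (y \<bullet> (H *v y)) \<le> (norm v)\<^sup>2 * (z \<bullet> (H *v z))" by (intro mult_left_mono) auto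
      moreover have "v \<bullet> (H *v v) = (norm v)\<^sup>2 * (y \<bullet> (H *v y))"
        by (subst (1 2) v) (simp only: matrix_vector_mult_scaleR inner_scaleR_left inner_scaleR_right power2_eq_square mult.assoc)
      ultimately show ?thesis by (simp add: mult.commute)
    qed simp
  qed
qed

lemma negative_definite_local_max:
  fixes f :: "real^'n::finite \<Rightarrow> real" and D :: "real^'n \<Rightarrow> real^'n" and H :: "real^'n^'n"
  assumes V: "open V" "s \<in> V"
    and der1: "\<And>x. x \<in> V \<Longrightarrow> (f has_derivative (\<lambda>h. D x \<bullet> h)) (at x)"
    and der2: "(D has_derivative (\<lambda>h. H *v h)) (at s)"
    and crit: "D s = 0" and nd: "\<And>v. v \<noteq> 0 \<Longrightarrow> v \<bullet> (H *v v) < 0"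
  obtains r where "r > 0" "ball s r \<subseteq> V" "\<And>x. x \<in> ball s r \<Longrightarrow> f x \<le> f s"
proof -
  obtain c where c: "c > 0" "\<And>v. v \<bullet> (H *v v) \<le> - c * (norm v)\<^sup>2" using negative_definite_bound[OF nd] by blast
  obtain r where r: "r > 0" "ball s r \<subseteq> V" "\<And>h. norm h < r \<Longrightarrow> \<exists>\<theta>. 0 < \<theta> \<and> \<theta> < 1 \<and> \<bar>f (s + h) - f s - \<theta> * (h \<bullet> (H *v h))\<bar> \<le> c * \<theta> * (norm h)\<^sup>2"
    using second_order_expansion[OF V der1 der2 crit c(1)] by blast
  show ?thesis
  proof (rule that[OF r(1,2)])
    fix x assume "x \<in> ball s r"
    then have "norm (x - s) < r" by (simp add: dist_norm norm_minus_commute)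
    from r(3)[OF this] obtain \<theta> where th: "0 < \<theta>" "\<bar>f x - f s - \<theta> * ((x - s) \<bullet> (H *v (x - s)))\<bar> \<le> c * \<theta> * (norm (x - s))\<^sup>2" by auto
    have "\<theta> * ((x - s) \<bullet> (H *v (x - s))) \<le> \<theta> * (- c * (norm (x - s))\<^sup>2)" using c(2) th(1) by (intro mult_left_mono) auto
    then show "f x \<le> f s" using th(2) by (simp add: algebra_simps)
  qed
qed


section \<open>Gaussian densities and conditional laws\<close>

context gaussian_space
begin

text \<open>Both measures have the characteristic function exp(i c.m - c.c/2), where m collects the
  means of the coordinates, and the linear functionals generate the Borel sets.\<close>

lemma white_law:
  fixes X :: "'a \<Rightarrow> 'e::euclidean_space"
  assumes X: "\<And>b. (\<lambda>\<omega>. X \<omega> \<bullet> b) \<in> L"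
    and white: "\<And>b b'. b \<in> Basis \<Longrightarrow> b' \<in> Basis \<Longrightarrow> covar (\<lambda>\<omega>. X \<omega> \<bullet> b) (\<lambda>\<omega>. X \<omega> \<bullet> b') = (if b = b' then 1 else 0)"
  shows "\<exists>m. distr M borel X = density lborel (\<lambda>x. ennreal (unit_gauss m x))"
proof
  define m where "m = (\<Sum>b\<in>Basis. expectation (\<lambda>\<omega>. X \<omega> \<bullet> b) *\<^sub>R b)"
  let ?G = "density lborel (\<lambda>x. ennreal (unit_gauss m x))"
  have Xm[measurable]: "X \<in> borel_measurable M" by (rule L_vector_measurable[OF X])
  define Zs where "Zs = {\<lambda>x. x \<bullet> c |c::'e. True}"
  interpret G: prob_space ?G by (rule prob_space_unit_gauss)
  interpret D: prob_space "distr M borel X" by (rule prob_space_distr) simp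
  have in_m[measurable]: "(\<lambda>x::'e. x \<bullet> c) \<in> borel_measurable borel" for c
    by (intro borel_measurable_continuous_onI continuous_intros)
  have ex: "expectation (\<lambda>\<omega>. X \<omega> \<bullet> c) = c \<bullet> m" for c
  proof -
    have "expectation (\<lambda>\<omega>. X \<omega> \<bullet> c) = expectation (\<lambda>\<omega>. \<Sum>b\<in>Basis. (X \<omega> \<bullet> b) * (c \<bullet> b))"
      by (simp add: euclidean_inner[of "X _" c])
    also have "\<dots> = (\<Sum>b\<in>Basis. expectation (\<lambda>\<omega>. X \<omega> \<bullet> b) * (c \<bullet> b))"
      using L_integrable[OF X] by simp
    finally show ?thesis by (simp add: m_def inner_sum_right)
  qed
  have cv: "covar (\<lambda>\<omega>. X \<omega> \<bullet> c) (\<lambda>\<omega>. X \<omega> \<bullet> c) = c \<bullet> c" for c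
  proof -
    have "covar (\<lambda>\<omega>. X \<omega> \<bullet> c) (\<lambda>\<omega>. X \<omega> \<bullet> c) = (\<Sum>b\<in>Basis. (c \<bullet> b) * covar (\<lambda>\<omega>. X \<omega> \<bullet> c) (\<lambda>\<omega>. X \<omega> \<bullet> b))"
      by (subst covar_inner_sum[OF X X]) (simp add: covar_sym)
    also have "\<dots> = (\<Sum>b\<in>Basis. (c \<bullet> b) * (c \<bullet> b))"
    proof (intro sum.cong refl)
      fix b :: 'e assume b: "b \<in> Basis"
      have "covar (\<lambda>\<omega>. X \<omega> \<bullet> c) (\<lambda>\<omega>. X \<omega> \<bullet> b) = (\<Sum>b'\<in>Basis. (c \<bullet> b') * (if b' = b then 1 else 0))"
        using b by (subst covar_inner_sum[OF X X]) (auto intro!: sum.cong simp: white)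
      then show "(c \<bullet> b) * covar (\<lambda>\<omega>. X \<omega> \<bullet> c) (\<lambda>\<omega>. X \<omega> \<bullet> b) = (c \<bullet> b) * (c \<bullet> b)"
        using b by (simp add: if_distrib cong: if_cong)
    qed
    finally show ?thesis by (simp add: euclidean_inner[of c c])
  qed
  show "distr M borel X = ?G"
  proof (rule finite_measure_eqI_trig[where Zs = Zs])
    show "Zs \<noteq> {}" by (auto simp: Zs_def)
    fix Z Z' and a :: real assume "Z \<in> Zs" "Z' \<in> Zs"
    then obtain c c' where "Z = (\<lambda>x. x \<bullet> c)" "Z' = (\<lambda>x. x \<bullet> c')" by (auto simp: Zs_def)
    then have "(\<lambda>x. Z x + a * Z' x) = (\<lambda>x. x \<bullet> (c + a *\<^sub>R c'))" by (auto simp: inner_add_right)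
    then show "(\<lambda>x. Z x + a * Z' x) \<in> Zs" by (auto simp: Zs_def)
  next
    let ?gen = "{Z -` B \<inter> space (distr M borel X) |Z B. Z \<in> Zs \<and> B \<in> sets borel}"
    have Zm: "Z \<in> borel_measurable borel" if "Z \<in> Zs" for Z using that by (auto simp: Zs_def)
    show "sets (distr M borel X) = sigma_sets (space (distr M borel X)) ?gen"
    proof
      have "?gen \<subseteq> sets borel"
      proof clarify
        fix Z B assume "Z \<in> Zs" "B \<in> sets (borel :: real measure)"
        then show "Z -` B \<inter> space (distr M borel X) \<in> sets borel"
          using measurable_sets[OF Zm, of Z B] by simp
      qed
      then have "sigma_sets (space borel) ?gen \<subseteq> sets borel" by (rule sets.sigma_sets_subset)
      then show "sigma_sets (space (distr M borel X)) ?gen \<subseteq> sets (distr M borel X)" by simp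
      define SG where "SG = sigma UNIV ?gen"
      have spSG: "space SG = UNIV" unfolding SG_def by (rule space_measure_of) auto
      have setsSG: "sets SG = sigma_sets UNIV ?gen" unfolding SG_def by (rule sets_measure_of) auto
      have "(\<lambda>x::'e. x) \<in> borel_measurable SG"
      proof (rule borel_measurable_euclidean_space[THEN iffD2], intro ballI measurableI)
        fix b :: 'e and B assume "B \<in> sets (borel :: real measure)"
        moreover have "(\<lambda>x. x \<bullet> b) \<in> Zs" by (auto simp: Zs_def)
        ultimately have "(\<lambda>x. x \<bullet> b) -` B \<inter> space (distr M borel X) \<in> ?gen" by blast
        then show "(\<lambda>x. x \<bullet> b) -` B \<inter> space SG \<in> sets SG" by (auto simp: setsSG spSG intro: sigma_sets.Basic)
      qed simp
      from measurable_sets[OF this] have "A \<in> sigma_sets UNIV ?gen" if "A \<in> sets borel" for A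
        using that by (auto simp: setsSG spSG)
      then show "sets (distr M borel X) \<subseteq> sigma_sets (space (distr M borel X)) ?gen" by auto
    qed
  next
    have "(\<integral>x. cos (x \<bullet> c) \<partial>distr M borel X) = (\<integral>x. cos (x \<bullet> c) \<partial>?G) \<and> (\<integral>x. sin (x \<bullet> c) \<partial>distr M borel X) = (\<integral>x. sin (x \<bullet> c) \<partial>?G)" for c
    proof -
      have "(CLINT x|?G. iexp (x \<bullet> c)) = (CLINT x|lborel. unit_gauss m x *\<^sub>R iexp (x \<bullet> c))"
        using unit_gauss_bounds(1)[of m] by (intro integral_density) (auto intro: less_imp_le)
      also have "\<dots> = exp (\<i> * (c \<bullet> m) - (c \<bullet> c) / 2)"
        using integral_unit_gauss_iexp(2)[of m c] by (simp add: scaleR_conv_of_real inner_commute)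
      finally have "Complex (\<integral>x. cos (x \<bullet> c) \<partial>?G) (\<integral>x. sin (x \<bullet> c) \<partial>?G) = exp (\<i> * (c \<bullet> m) - (c \<bullet> c) / 2)"
        by (subst (asm) integral_iexp_eq) (auto intro: G.finite_measure_axioms)
      then have "(\<integral>x. cos (x \<bullet> c) \<partial>?G) = cos (c \<bullet> m) * exp (- (c \<bullet> c) / 2)" "(\<integral>x. sin (x \<bullet> c) \<partial>?G) = sin (c \<bullet> m) * exp (- (c \<bullet> c) / 2)"
        by (auto simp: complex_eq_iff Re_exp Im_exp mult.commute)
      moreover have "(\<integral>x. cos (x \<bullet> c) \<partial>distr M borel X) = cos (c \<bullet> m) * exp (- (c \<bullet> c) / 2)"
        "(\<integral>x. sin (x \<bullet> c) \<partial>distr M borel X) = sin (c \<bullet> m) * exp (- (c \<bullet> c) / 2)"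
        using expectation_cos[OF X, of c] expectation_sin[OF X, of c] by (simp_all add: integral_distr ex cv)
      ultimately show ?thesis by simp
    qed
    then show "same_trig Zs (distr M borel X) ?G"
      using D.finite_measure_axioms G.finite_measure_axioms by (auto simp: same_trig_def Zs_def)
  qed
qed

lemma whitening:
  fixes X :: "'a \<Rightarrow> real^'n::finite"
  assumes X: "\<And>b. (\<lambda>\<omega>. X \<omega> \<bullet> b) \<in> L" and pos: "\<And>v. v \<noteq> 0 \<Longrightarrow> 0 < covar (\<lambda>\<omega>. X \<omega> \<bullet> v) (\<lambda>\<omega>. X \<omega> \<bullet> v)"
  obtains T :: "real^'n^'n" where "det T \<noteq> 0" "\<And>b. (\<lambda>\<omega>. (T *v X \<omega>) \<bullet> b) \<in> L"
    "\<And>i j. covar (\<lambda>\<omega>. (T *v X \<omega>) $ i) (\<lambda>\<omega>. (T *v X \<omega>) $ j) = (if i = j then 1 else 0)"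
proof -
  define C :: "real^'n^'n" where "C = (\<chi> i j. covar (\<lambda>\<omega>. X \<omega> \<bullet> axis i 1) (\<lambda>\<omega>. X \<omega> \<bullet> axis j 1))"
  have Cxy: "x \<bullet> (C *v y) = covar (\<lambda>\<omega>. X \<omega> \<bullet> x) (\<lambda>\<omega>. X \<omega> \<bullet> y)" for x y
  proof -
    have s: "covar (\<lambda>\<omega>. X \<omega> \<bullet> v) W = (\<Sum>i\<in>UNIV. v $ i * covar (\<lambda>\<omega>. X \<omega> \<bullet> axis i 1) W)" if W: "W \<in> L" for v W
    proof -
      have "(\<lambda>\<omega>. X \<omega> \<bullet> v) = (\<lambda>\<omega>. \<Sum>i\<in>UNIV. v $ i * (X \<omega> \<bullet> axis i 1))"
        by (auto simp: inner_vec_def[of _ v] inner_axis mult.commute)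
      then show ?thesis using X W by (simp add: covar_sum covar_scale L_scale)
    qed
    have "covar (\<lambda>\<omega>. X \<omega> \<bullet> x) (\<lambda>\<omega>. X \<omega> \<bullet> y) = (\<Sum>i\<in>UNIV. x $ i * covar (\<lambda>\<omega>. X \<omega> \<bullet> y) (\<lambda>\<omega>. X \<omega> \<bullet> axis i 1))"
      unfolding s[OF X, of x y] by (simp add: covar_sym)
    also have "\<dots> = (\<Sum>i\<in>UNIV. x $ i * (\<Sum>j\<in>UNIV. y $ j * covar (\<lambda>\<omega>. X \<omega> \<bullet> axis j 1) (\<lambda>\<omega>. X \<omega> \<bullet> axis i 1)))"
      unfolding s[OF X, of y] ..
    also have "\<dots> = x \<bullet> (C *v y)"
      by (simp add: inner_vec_def matrix_vector_mult_def C_def covar_sym mult.commute)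
    finally show ?thesis ..
  qed
  obtain T :: "real^'n^'n" where T: "det T \<noteq> 0" "\<And>i j. T $ i \<bullet> (C *v (T $ j)) = (if i = j then 1 else 0)"
    by (rule orthonormal_matrix_exists[of C]) (auto simp: Cxy pos covar_sym)
  have TX: "(T *v X \<omega>) $ i = X \<omega> \<bullet> T $ i" for \<omega> i
    by (simp add: matrix_vector_mult_def inner_vec_def mult.commute)
  show ?thesis
  proof (rule that[OF T(1)])
    show "(\<lambda>\<omega>. (T *v X \<omega>) \<bullet> b) \<in> L" for b
    proof -
      have "(\<lambda>\<omega>. (T *v X \<omega>) \<bullet> b) = (\<lambda>\<omega>. \<Sum>i\<in>UNIV. b $ i * (X \<omega> \<bullet> T $ i))"
        by (auto simp: inner_vec_def[of _ b] TX mult.commute)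
      then show ?thesis by (simp add: L_sum L_scale X)
    qed
    show "covar (\<lambda>\<omega>. (T *v X \<omega>) $ i) (\<lambda>\<omega>. (T *v X \<omega>) $ j) = (if i = j then 1 else 0)" for i j
      unfolding TX Cxy[symmetric] by (rule T(2))
  qed
qed

lemma white_law_cart:
  fixes X :: "'a \<Rightarrow> real^'n::finite"
  assumes X: "\<And>b. (\<lambda>\<omega>. X \<omega> \<bullet> b) \<in> L" and white: "\<And>i j. covar (\<lambda>\<omega>. X \<omega> $ i) (\<lambda>\<omega>. X \<omega> $ j) = (if i = j then 1 else 0)"
  shows "\<exists>m. distr M borel X = density lborel (\<lambda>x. ennreal (unit_gauss m x))"
  by (rule white_law[OF X]) (auto simp: Basis_vec_def inner_axis white axis_eq_axis)

text \<open>The density with unit covariance is pulled back along a whitening matrix. Continuity and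
  the bound \<open>B\<close> are recorded because the density will later be evaluated at a single
  point by means of dominated convergence.\<close>

lemma gaussian_vector_density:
  fixes X :: "'a \<Rightarrow> real^'n::finite"
  assumes X: "\<And>b. (\<lambda>\<omega>. X \<omega> \<bullet> b) \<in> L" and pos: "\<And>v. v \<noteq> 0 \<Longrightarrow> 0 < covar (\<lambda>\<omega>. X \<omega> \<bullet> v) (\<lambda>\<omega>. X \<omega> \<bullet> v)"
  obtains p B where "continuous_on UNIV p" "\<And>x. 0 \<le> p x" "\<And>x. p x \<le> B" "distr M borel X = density lborel (\<lambda>x. ennreal (p x))"
proof -
  obtain T :: "real^'n^'n" where T: "det T \<noteq> 0" "\<And>b. (\<lambda>\<omega>. (T *v X \<omega>) \<bullet> b) \<in> L"
    "\<And>i j. covar (\<lambda>\<omega>. (T *v X \<omega>) $ i) (\<lambda>\<omega>. (T *v X \<omega>) $ j) = (if i = j then 1 else 0)"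
    using whitening[OF X pos] by blast
  obtain m where m: "distr M borel (\<lambda>\<omega>. T *v X \<omega>) = density lborel (\<lambda>x. ennreal (unit_gauss m x))"
    using white_law_cart[OF T(2,3)] by blast
  obtain T' where T': "T' ** T = mat 1" "T ** T' = mat 1"
    using T(1) invertible_det_nz[of T] by (auto simp: invertible_def)
  have cT: "continuous_on S ((*v) N)" for N :: "real^'n^'n" and S by (intro linear_continuous_on matrix_vector_mul_bounded_linear)
  have [measurable]: "(*v) N \<in> borel_measurable borel" for N :: "real^'n^'n" by (intro borel_measurable_continuous_onI cT)
  have [measurable]: "X \<in> borel_measurable M" by (rule L_vector_measurable[OF X])
  have TT[simp]: "T' *v (T *v x) = x" "T *v (T' *v x) = x" for x using T' by (simp_all add: matrix_vector_mul_assoc)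
  have TB: "(*v) T ` B = (*v) T' -` B" for B by (auto intro!: image_eqI[where x = "T' *v _"])
  define p where "p x = \<bar>det T\<bar> * unit_gauss m (T *v x)" for x
  have "distr M borel X = density lborel (\<lambda>x. ennreal (p x))"
  proof (rule measure_eqI)
    fix B assume "B \<in> sets (distr M borel X)"
    then have [measurable]: "B \<in> sets borel" by simp
    have TBm[measurable]: "(*v) T ` B' \<in> sets borel" if [measurable]: "B' \<in> sets borel" for B'
      using measurable_sets[of "(*v) T'" borel borel B'] unfolding TB by simp
    have "emeasure (distr M borel X) B = emeasure M (X -` B \<inter> space M)" by (rule emeasure_distr) auto
    also have "X -` B \<inter> space M = (\<lambda>\<omega>. T *v X \<omega>) -` ((*v) T ` B) \<inter> space M" unfolding TB by auto
    also have "emeasure M \<dots> = emeasure (distr M borel (\<lambda>\<omega>. T *v X \<omega>)) ((*v) T ` B)" by (rule emeasure_distr[symmetric]) auto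
    also have "\<dots> = (\<integral>\<^sup>+v. ennreal (unit_gauss m v) * indicator ((*v) T ` B) v \<partial>lborel)"
      unfolding m by (rule emeasure_density) auto
    also have "\<dots> = (\<integral>\<^sup>+x. ennreal (indicator B x * \<bar>det (matrix ((*v) T))\<bar>) * ennreal (unit_gauss m (T *v x)) \<partial>lborel)"
    proof (rule nn_integral_lborel_image)
      show "((*v) T has_derivative (*v) T) (at x within B)" for x
        by (rule bounded_linear_imp_has_derivative[OF matrix_vector_mul_bounded_linear])
      show "inj_on ((*v) T) B" by (rule inj_on_inverseI[where g = "(*v) T'"]) simp
    qed auto
    also have "\<dots> = (\<integral>\<^sup>+x. ennreal (p x) * indicator B x \<partial>lborel)"
      by (intro nn_integral_cong) (auto simp: p_def ennreal_mult' indicator_def)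
    also have "\<dots> = emeasure (density lborel (\<lambda>x. ennreal (p x))) B"
      unfolding p_def by (rule emeasure_density[symmetric]) auto
    finally show "emeasure (distr M borel X) B = emeasure (density lborel (\<lambda>x. ennreal (p x))) B" .
  qed simp
  moreover have "continuous_on UNIV p" unfolding p_def[abs_def] by (intro continuous_intros cT)
  moreover have "0 \<le> p x" "p x \<le> \<bar>det T\<bar>" for x
    using unit_gauss_bounds[of m "T *v x"] by (auto simp: p_def less_imp_le mult_left_le)
  ultimately show ?thesis using that by blast
qed

end

text \<open>A nonempty open set is not negligible. This is how identities obtained from integrals,
  hence only almost everywhere, are brought to an individual point.\<close>

lemma AE_lborel_continuous_eq:
  fixes f g :: "'e::euclidean_space \<Rightarrow> 'b::t2_space"
  assumes "continuous_on UNIV f" "continuous_on UNIV g" and ae: "AE x in lborel. f x = g x"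
  shows "f x = g x"
proof (rule ccontr)
  assume ne: "f x \<noteq> g x"
  have o: "open {x. f x \<noteq> g x}" using assms(1,2) by (rule open_Collect_neq)
  obtain N where N: "N \<in> null_sets lborel" "{x. f x \<noteq> g x} \<subseteq> N" using ae by (auto elim!: AE_E simp: null_sets_def)
  then have "negligible N" by (simp add: negligible_iff_null_sets null_sets_completionI)
  then have "negligible {x. f x \<noteq> g x}" using N(2) by (rule negligible_subset)
  then show False using open_not_negligible[OF o] ne by blast
qed

lemma (in prob_space) joint_density_eqI:
  assumes p: "continuous_on UNIV p" "\<And>y. 0 \<le> p y" "distributed M lborel W (\<lambda>y. ennreal (p y))"
  shows "joint_density M W = p"
  unfolding joint_density_def
proof (rule the_equality)
  fix q assume q: "continuous_on UNIV q \<and> (\<forall>y. 0 \<le> q y) \<and> distributed M lborel W (\<lambda>y. ennreal (q y))"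
  have "density lborel (\<lambda>y. ennreal (q y)) = density lborel (\<lambda>y. ennreal (p y))"
    using p(3) q by (simp add: distributed_def)
  moreover have [measurable]: "p \<in> borel_measurable borel" "q \<in> borel_measurable borel"
    using q p(1) by (auto intro: borel_measurable_continuous_onI)
  ultimately have "AE y in lborel. ennreal (q y) = ennreal (p y)"
    by (intro sigma_finite_measure.density_unique[OF sigma_finite_lborel]) auto
  then have "AE y in lborel. q y = p y" using q p(2) by (auto simp: ennreal_inj)
  then show "q = p" using AE_lborel_continuous_eq[of q p] q p(1) by blast
qed (use p in auto)

text \<open>Indicators of open sets are increasing limits of the continuous functions min(1, k
  dist(x, complement)), and open sets form an intersection-stable generator.\<close>

lemma finite_measure_eqI_continuous:
  fixes M N :: "'e::metric_space measure"
  assumes sM: "sets M = sets borel" and sN: "sets N = sets borel" and "finite_measure M"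
    and eq: "\<And>h. continuous_on UNIV h \<Longrightarrow> (\<And>x. 0 \<le> h x) \<Longrightarrow> (\<And>x. h x \<le> (1::real)) \<Longrightarrow> (\<integral>\<^sup>+x. ennreal (h x) \<partial>M) = (\<integral>\<^sup>+x. ennreal (h x) \<partial>N)"
  shows "M = N"
proof (rule measure_eqI_generator_eq[where E = "Collect open" and \<Omega> = UNIV and A = "\<lambda>_. UNIV"])
  interpret finite_measure M by fact
  show "emeasure M (UNIV) \<noteq> \<infinity>" by simp
  fix X :: "'e set" assume "X \<in> Collect open"
  then have X: "open X" by simp
  \<comment> \<open>The whole space is treated apart because \<open>infdist\<close> to the empty set
    is 0.\<close>
  define h where "h k x = (if X = UNIV then 1 else min 1 (real k * infdist x (- X)))" for k :: nat and x
  have hc: "continuous_on UNIV (h k)" for k unfolding h_def[abs_def] by (cases "X = UNIV") (auto intro!: continuous_intros)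
  have h01: "0 \<le> h k x" "h k x \<le> 1" for k x by (auto simp: h_def infdist_nonneg)
  have inc: "incseq (\<lambda>k. ennreal (h k x))" for x
    by (auto simp: incseq_def h_def intro!: ennreal_leI min.mono mult_right_mono infdist_nonneg)
  have sup: "(SUP k. ennreal (h k x)) = indicator X x" for x
  proof (cases "x \<in> X")
    case True
    have "\<exists>k. h k x = 1"
    proof (cases "X = UNIV")
      case False
      then have "infdist x (- X) > 0"
        using X True by (metis ComplD Compl_empty_eq closed_Compl double_complement in_closed_iff_infdist_zero infdist_nonneg less_le)
      then obtain k :: nat where "1 \<le> real k * infdist x (- X)" by (metis reals_Archimedean3 less_imp_le)
      then have "h k x = 1" using False by (simp add: h_def)
      then show ?thesis by blast
    qed (simp add: h_def)
    then obtain k where k: "h k x = 1" by blast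
    have "ennreal (h k x) \<le> (SUP k. ennreal (h k x))" by (rule SUP_upper) simp
    moreover have "(SUP k. ennreal (h k x)) \<le> 1" using h01 by (intro SUP_least) simp
    ultimately show ?thesis using k True by simp
  next
    case False
    then have "h k x = 0" for k by (auto simp: h_def)
    then show ?thesis using False by simp
  qed
  have em: "emeasure K X = (SUP k. \<integral>\<^sup>+x. ennreal (h k x) \<partial>K)" if s: "sets K = sets borel" for K
  proof -
    have hm: "h k \<in> borel_measurable K" for k
      using borel_measurable_continuous_onI[OF hc[of k]] measurable_cong_sets[OF s refl] by blast
    have "emeasure K X = (\<integral>\<^sup>+x. indicator X x \<partial>K)" using X s by simp
    also have "\<dots> = (\<integral>\<^sup>+x. (SUP k. ennreal (h k x)) \<partial>K)" by (simp add: sup)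
    also have "\<dots> = (SUP k. \<integral>\<^sup>+x. ennreal (h k x) \<partial>K)"
      using inc hm by (intro nn_integral_monotone_convergence_SUP) (auto simp: incseq_def le_fun_def)
    finally show ?thesis .
  qed
  show "emeasure M X = emeasure N X"
    unfolding em[OF sM] em[OF sN] using eq[OF hc h01] by simp
qed (use sM sN in \<open>auto simp: Int_stable_def sets_borel\<close>)


context gaussian_space
begin

lemma nondegenerateI:
  fixes X :: "'a \<Rightarrow> 'e::euclidean_space"
  assumes X: "\<And>b. (\<lambda>\<omega>. X \<omega> \<bullet> b) \<in> L" and pos: "\<And>v. v \<noteq> 0 \<Longrightarrow> 0 < covar (\<lambda>\<omega>. X \<omega> \<bullet> v) (\<lambda>\<omega>. X \<omega> \<bullet> v)"
  shows "nondegenerate M X"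
proof -
  note lin = cov_op_linear[OF X X]
  have "inj (cov_op M X X)"
    unfolding linear_injective_0[OF lin]
  proof (intro allI impI)
    fix v assume "cov_op M X X v = 0"
    then have "covar (\<lambda>\<omega>. X \<omega> \<bullet> v) (\<lambda>\<omega>. X \<omega> \<bullet> v) = 0" using cov_op_inner[OF X X, of v v] by simp
    then show "v = 0" using pos[of v] by force
  qed
  then show ?thesis
    unfolding nondegenerate_def bij_def using linear_injective_imp_surjective[OF lin] by blast
qed

lemma uncorr_vector_measurable:
  fixes R :: "'a \<Rightarrow> 'e::euclidean_space"
  assumes "\<And>w. (\<lambda>\<omega>. R \<omega> \<bullet> w) \<in> uncorr X"
  shows "R \<in> borel_measurable (uncorr_algebra X)"
  using uncorr_measurable[OF assms] by (intro borel_measurable_euclidean_space[THEN iffD2]) auto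

text \<open>Regression of \<open>Y\<close> on \<open>Z\<close> splits the density into that of
  \<open>Z\<close> and a one-dimensional normal density of the residual, shifted by \<alpha> z. In
  this form the normal factor depends on z through a translation in x, which makes integrals over x
  continuous in z.\<close>

lemma pair_density:
  fixes Y :: "'a \<Rightarrow> real" and Z :: "'a \<Rightarrow> real^'n::finite"
  assumes Y: "Y \<in> L" and Z: "\<And>b. (\<lambda>\<omega>. Z \<omega> \<bullet> b) \<in> L"
    and nd: "nondegenerate M (\<lambda>\<omega>. (Y \<omega>, Z \<omega>))"
  obtains \<alpha> pZ C \<mu> \<sigma> where "linear \<alpha>" "continuous_on UNIV pZ" "\<And>z. 0 \<le> pZ z" "\<And>z. pZ z \<le> C" "0 < \<sigma>"
    "joint_density M (\<lambda>\<omega>. (Y \<omega>, Z \<omega>)) = (\<lambda>(x, z). pZ z * normal_density \<mu> \<sigma> (x - \<alpha> z))"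
    "distr M borel (\<lambda>\<omega>. (Y \<omega>, Z \<omega>)) = density lborel (\<lambda>(x, z). ennreal (pZ z * normal_density \<mu> \<sigma> (x - \<alpha> z)))"
proof -
  let ?W = "\<lambda>\<omega>. (Y \<omega>, Z \<omega>)"
  have W: "(\<lambda>\<omega>. ?W \<omega> \<bullet> b) \<in> L" for b using L_add[OF L_scale[OF Y, of "fst b"] Z[of "snd b"]] by (simp add: inner_prod_def mult.commute)
  note pos = nondegenerate_covar_pos[OF W nd]
  have posZ: "0 < covar (\<lambda>\<omega>. Z \<omega> \<bullet> v) (\<lambda>\<omega>. Z \<omega> \<bullet> v)" if "v \<noteq> 0" for v
    using pos[of "(0, v)"] that by (simp add: inner_prod_def zero_prod_def)
  have [measurable]: "Y \<in> borel_measurable M" "Z \<in> borel_measurable M" using Y L_measurable L_vector_measurable[OF Z] by auto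
  have ndZ: "nondegenerate M Z" by (rule nondegenerateI[OF Z posZ])
  obtain pZ C where pZ: "continuous_on UNIV pZ" "\<And>z. 0 \<le> pZ z" "\<And>z. pZ z \<le> C" "distr M borel Z = density lborel (\<lambda>z. ennreal (pZ z))"
    using gaussian_vector_density[OF Z posZ] by blast
  define \<alpha> where "\<alpha> = regression_coeff M Y Z"
  have Y': "(\<lambda>\<omega>. Y \<omega> \<bullet> b) \<in> L" for b using L_scale[OF Y, of b] by (simp add: mult.commute)
  note reg = regression[OF Y' Z ndZ, folded \<alpha>_def]
  have al: "linear \<alpha>" by (rule reg(1))
  have alc: "continuous_on S \<alpha>" for S by (intro linear_continuous_on al[unfolded linear_conv_bounded_linear])
  then have [measurable]: "\<alpha> \<in> borel_measurable borel" by (intro borel_measurable_continuous_onI)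
  have [measurable]: "pZ \<in> borel_measurable borel" using pZ by (intro borel_measurable_continuous_onI) auto
  define R where "R \<omega> = Y \<omega> - \<alpha> (Z \<omega>)" for \<omega>
  have [measurable]: "R \<in> borel_measurable M" unfolding R_def[abs_def] by measurable
  \<comment> \<open>Represents \<alpha> as an inner product, so that the residual is the pair (Y, Z)
    tested against (1, - a') and nondegeneracy of the pair makes its variance positive.\<close>
  define a' where "a' = (\<chi> i. \<alpha> (axis i 1))"
  have al_eq: "\<alpha> z = z \<bullet> a'" for z
  proof -
    have "\<alpha> z = \<alpha> (\<Sum>i\<in>UNIV. z $ i *\<^sub>R axis i 1)"
      by (simp add: basis_expansion[of z, unfolded scalar_mult_eq_scaleR])
    also have "\<dots> = (\<Sum>i\<in>UNIV. z $ i * \<alpha> (axis i 1))" by (simp add: linear_sum[OF al] linear_scale[OF al])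
    finally show ?thesis by (simp add: a'_def inner_vec_def)
  qed
  have R_eq: "R = (\<lambda>\<omega>. ?W \<omega> \<bullet> (1, - a'))" by (auto simp: R_def al_eq inner_prod_def)
  have RL: "R \<in> L" unfolding R_eq by (rule W)
  have "covar R R > 0" using pos[of "(1, - a')"] unfolding R_eq by (simp add: zero_prod_def)
  \<comment> \<open>\<open>gaussian_rv\<close> admits constants; positive variance excludes them and
    leaves the case with a density.\<close>
  moreover have "covar R R = 0" if c: "AE \<omega> in M. R \<omega> = c" for c
  proof -
    have "expectation R = expectation (\<lambda>_. c)" by (rule integral_cong_AE) (use c in auto)
    then have "expectation R = c" by (simp add: prob_space)
    then have "covar R R = expectation (\<lambda>_. 0)" unfolding covar_def by (intro integral_cong_AE) (use c in auto)
    then show ?thesis by simp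
  qed
  ultimately obtain \<mu> \<sigma> where s: "0 < \<sigma>" and D: "distributed M lborel R (\<lambda>x. ennreal (normal_density \<mu> \<sigma> x))"
    using gauss[OF RL] unfolding gaussian_rv_def by force
  let ?n = "normal_density \<mu> \<sigma>"
  have nint: "(\<integral>\<^sup>+\<omega>. f (R \<omega>) \<partial>M) = (\<integral>\<^sup>+x. ennreal (?n x) * f x \<partial>lborel)" if "f \<in> borel_measurable borel" for f
    using distributed_nn_integral[OF D, of f] that by simp
  have key: "(\<integral>\<^sup>+\<omega>. H (Y \<omega>, Z \<omega>) \<partial>M) = (\<integral>\<^sup>+z. ennreal (pZ z) * (\<integral>\<^sup>+x. ennreal (?n (x - \<alpha> z)) * H (x, z) \<partial>lborel) \<partial>lborel)"
    if Hm[measurable]: "H \<in> borel_measurable (borel \<Otimes>\<^sub>M borel)" for H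
  proof -
    have "(\<integral>\<^sup>+m. H (m, z) \<partial>cond_law M Y Z z) = (\<integral>\<^sup>+x. ennreal (?n (x - \<alpha> z)) * H (x, z) \<partial>lborel)" for z
    proof -
      have "(\<integral>\<^sup>+m. H (m, z) \<partial>cond_law M Y Z z) = (\<integral>\<^sup>+\<omega>. H (\<alpha> z + R \<omega>, z) \<partial>M)"
        unfolding reg(3) R_def[symmetric] by (simp add: nn_integral_distr)
      also have "\<dots> = (\<integral>\<^sup>+x. ennreal (?n x) * H (\<alpha> z + x, z) \<partial>lborel)"
        by (rule nint[of "\<lambda>x. H (\<alpha> z + x, z)"]) measurable
      also have "\<dots> = (\<integral>\<^sup>+x. ennreal (?n (x - \<alpha> z)) * H (x, z) \<partial>lborel)"
        by (subst nn_integral_real_affine[where c = 1 and t = "\<alpha> z"]) auto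
      finally show ?thesis .
    qed
    then have "(\<integral>\<^sup>+\<omega>. H (Y \<omega>, Z \<omega>) \<partial>M) = (\<integral>\<^sup>+z. (\<integral>\<^sup>+x. ennreal (?n (x - \<alpha> z)) * H (x, z) \<partial>lborel) \<partial>distr M borel Z)"
      using reg(2)[of "\<lambda>p. H p"] by simp
    then show ?thesis unfolding pZ(4) by (subst (asm) nn_integral_density) auto
  qed
  let ?p = "\<lambda>(x, z). pZ z * ?n (x - \<alpha> z)"
  have pm[measurable]: "?p \<in> borel_measurable borel" unfolding borel_prod[symmetric] by measurable
  have dist: "distr M borel ?W = density lborel (\<lambda>w. ennreal (?p w))"
  proof (rule measure_eqI)
    fix A assume "A \<in> sets (distr M borel ?W)"
    then have Am: "A \<in> sets borel" by simp
    then have A[measurable]: "A \<in> sets (borel \<Otimes>\<^sub>M borel)" unfolding borel_prod .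
    have Wm: "?W \<in> borel_measurable M" by (rule L_vector_measurable[OF W])
    have "emeasure (distr M borel ?W) A = (\<integral>\<^sup>+w. indicator A w \<partial>distr M borel ?W)" using Am by simp
    also have "\<dots> = (\<integral>\<^sup>+\<omega>. indicator A (?W \<omega>) \<partial>M)" using Am by (intro nn_integral_distr[OF Wm]) simp
    also have "\<dots> = (\<integral>\<^sup>+z. ennreal (pZ z) * (\<integral>\<^sup>+x. ennreal (?n (x - \<alpha> z)) * indicator A (x, z) \<partial>lborel) \<partial>lborel)"
      by (rule key) measurable
    also have "\<dots> = (\<integral>\<^sup>+z. (\<integral>\<^sup>+x. ennreal (?p (x, z)) * indicator A (x, z) \<partial>lborel) \<partial>lborel)"
      using pZ(2) s by (simp add: nn_integral_cmult[symmetric] ennreal_mult' mult.assoc normal_density_nonneg)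
    also have "\<dots> = (\<integral>\<^sup>+w. ennreal (?p w) * indicator A w \<partial>(lborel \<Otimes>\<^sub>M lborel))"
      by (rule lborel_pair.nn_integral_snd[of "\<lambda>w. ennreal (?p w) * indicator A w"]) measurable
    also have "\<dots> = emeasure (density lborel (\<lambda>w. ennreal (?p w))) A"
      unfolding lborel_prod using Am pm by (intro emeasure_density[symmetric]) auto
    finally show "emeasure (distr M borel ?W) A = emeasure (density lborel (\<lambda>w. ennreal (?p w))) A" .
  qed simp
  have "joint_density M ?W = ?p"
  proof (rule joint_density_eqI)
    show "continuous_on UNIV ?p"
      unfolding case_prod_beta'
      by (intro continuous_intros continuous_normal_density continuous_on_compose2[OF pZ(1)] continuous_on_compose2[OF alc[of UNIV]]) auto
    show "0 \<le> ?p y" for y using pZ(2) s by (auto simp: case_prod_beta' normal_density_nonneg)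
    have "distr M lborel ?W = distr M borel ?W" by (rule distr_cong) auto
    then show "distributed M lborel ?W (\<lambda>y. ennreal (?p y))"
      using dist L_vector_measurable[OF W] pm by (auto simp: distributed_def)
  qed
  moreover have "(\<lambda>w. ennreal (?p w)) = (\<lambda>(x, z). ennreal (pZ z * ?n (x - \<alpha> z)))" by auto
  ultimately show ?thesis using that[OF al pZ(1-3) s] dist by simp
qed

end


section \<open>Comparison of two conditional laws at the value 0\<close>

context gaussian_space
begin

text \<open>The law of (Y, V) is disintegrated along the values z of \<open>Z\<close> twice: by
  regression on (Y, Z), which gives the right side, and by regression on \<xi> followed by the
  substitution z = RZ + b v, which gives the left side. Both reproduce the same integrals over z and
  therefore agree for almost every z, while the statement concerns z = 0. For bounded continuous
  test functions both are continuous in z, so they agree at 0; the finite measures that they define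
  there are then equal, which covers every measurable \<open>H\<close>, bounded or not.\<close>

theorem conditional_identity:
  fixes Y :: "'a \<Rightarrow> real" and Z :: "'a \<Rightarrow> real^'n::finite" and V :: "'a \<Rightarrow> 'z::euclidean_space"
    and \<xi> :: "'a \<Rightarrow> real^'n" and b B :: "real^'n^'n" and c :: "real^'n \<Rightarrow> 'z"
  assumes Y: "Y \<in> L" and Z: "\<And>w. (\<lambda>\<omega>. Z \<omega> \<bullet> w) \<in> L" and V: "\<And>w. (\<lambda>\<omega>. V \<omega> \<bullet> w) \<in> L"
    and nd: "nondegenerate M (\<lambda>\<omega>. (Y \<omega>, Z \<omega>))"
    and xi: "\<And>w. (\<lambda>\<omega>. \<xi> \<omega> \<bullet> w) \<in> L" and xi_law: "distr M borel \<xi> = density lborel (\<lambda>x. ennreal (unit_gauss m x))"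
    and RY: "RY \<in> uncorr \<xi>" and RZ: "\<And>w. (\<lambda>\<omega>. RZ \<omega> \<bullet> w) \<in> uncorr \<xi>" and RV: "\<And>w. (\<lambda>\<omega>. RV \<omega> \<bullet> w) \<in> uncorr \<xi>"
    and Yeq: "\<And>\<omega>. Y \<omega> = RY \<omega> + a \<bullet> \<xi> \<omega>" and Zeq: "\<And>\<omega>. Z \<omega> = RZ \<omega> + b *v \<xi> \<omega>" and Veq: "\<And>\<omega>. V \<omega> = RV \<omega> + c (\<xi> \<omega>)"
    and c: "linear c" and B: "B ** b = mat 1" "b ** B = mat 1"
    and H: "H \<in> borel_measurable (borel \<Otimes>\<^sub>M borel)"
  shows "(\<integral>\<^sup>+\<omega>. ennreal (unit_gauss m (- (B *v RZ \<omega>)) / \<bar>det b\<bar>) * H (RY \<omega> - a \<bullet> (B *v RZ \<omega>), RV \<omega> - c (B *v RZ \<omega>)) \<partial>M) =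
    (\<integral>\<^sup>+x. (\<integral>\<^sup>+v. H (x, v) \<partial>cond_law M V (\<lambda>\<omega>. (Y \<omega>, Z \<omega>)) (x, 0)) * ennreal (joint_density M (\<lambda>\<omega>. (Y \<omega>, Z \<omega>)) (x, 0)) \<partial>lborel)"
proof -
  let ?W = "\<lambda>\<omega>. (Y \<omega>, Z \<omega>)"
  have W: "(\<lambda>\<omega>. ?W \<omega> \<bullet> b) \<in> L" for b using L_add[OF L_scale[OF Y, of "fst b"] Z[of "snd b"]] by (simp add: inner_prod_def mult.commute)
  define A where "A = regression_coeff M V ?W"
  note reg = regression[OF V W nd, folded A_def]
  have A: "linear A" by (rule reg(1))
  have Ac: "continuous_on S A" for S by (intro linear_continuous_on A[unfolded linear_conv_bounded_linear])
  then have [measurable]: "A \<in> borel_measurable borel" by (intro borel_measurable_continuous_onI)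
  then have A2[measurable]: "A \<in> borel_measurable (borel \<Otimes>\<^sub>M borel)" by (simp add: borel_prod)
  have [measurable]: "Y \<in> borel_measurable M" "Z \<in> borel_measurable M" "V \<in> borel_measurable M" "\<xi> \<in> borel_measurable M"
    using Y L_measurable L_vector_measurable[OF Z] L_vector_measurable[OF V] L_vector_measurable[OF xi] by auto
  define Res where "Res \<omega> = V \<omega> - A (?W \<omega>)" for \<omega>
  have [measurable]: "Res \<in> borel_measurable M" unfolding Res_def[abs_def] by measurable
  obtain \<alpha> pZ C \<mu> \<sigma> where al: "linear \<alpha>" and pZ: "continuous_on UNIV pZ" "\<And>z. 0 \<le> pZ z" "\<And>z. pZ z \<le> C" and s: "0 < \<sigma>"
    and jd: "joint_density M ?W = (\<lambda>(x, z). pZ z * normal_density \<mu> \<sigma> (x - \<alpha> z))"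
    and dens: "distr M borel ?W = density lborel (\<lambda>(x, z). ennreal (pZ z * normal_density \<mu> \<sigma> (x - \<alpha> z)))"
    by (rule pair_density[OF Y Z nd]) (rule that)
  let ?n = "normal_density \<mu> \<sigma>"
  have n0: "0 \<le> ?n x" for x using s by (simp add: normal_density_nonneg)
  have alc: "continuous_on S \<alpha>" for S by (intro linear_continuous_on al[unfolded linear_conv_bounded_linear])
  then have [measurable]: "\<alpha> \<in> borel_measurable borel" by (intro borel_measurable_continuous_onI)
  have [measurable]: "pZ \<in> borel_measurable borel" using pZ by (intro borel_measurable_continuous_onI) auto
  have cc: "continuous_on S c" for S by (intro linear_continuous_on c[unfolded linear_conv_bounded_linear])
  then have [measurable]: "c \<in> borel_measurable borel" by (intro borel_measurable_continuous_onI)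
  have Nc: "continuous_on S ((*v) N)" for N :: "real^'n^'n" and S by (intro linear_continuous_on matrix_vector_mul_bounded_linear)
  then have [measurable]: "(*v) N \<in> borel_measurable borel" for N :: "real^'n^'n" by (intro borel_measurable_continuous_onI)
  have RYg[measurable]: "RY \<in> borel_measurable (uncorr_algebra \<xi>)" by (rule uncorr_measurable[OF RY])
  have RZg[measurable]: "RZ \<in> borel_measurable (uncorr_algebra \<xi>)" by (rule uncorr_vector_measurable[OF RZ])
  have RVg[measurable]: "RV \<in> borel_measurable (uncorr_algebra \<xi>)" by (rule uncorr_vector_measurable[OF RV])
  have [measurable]: "RY \<in> borel_measurable M" "RZ \<in> borel_measurable M" "RV \<in> borel_measurable M"
    by (rule measurable_uncorr_algebra[OF RYg], rule measurable_uncorr_algebra[OF RZg], rule measurable_uncorr_algebra[OF RVg])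
  have "det B * det b = 1" using B(1) by (metis det_mul det_I)
  then have db: "\<bar>det b\<bar> > 0" by auto
  have Bb[simp]: "B *v (b *v v) = v" "b *v (B *v v) = v" for v using B by (simp_all add: matrix_vector_mul_assoc)

  \<comment> \<open>The kernels of the two disintegrations, densities included. \<open>K\<close>
    freezes the value z of \<open>Z\<close> in the regression on (Y, Z); \<open>K'\<close> solves z
    = RZ + b \<xi> for \<xi>, that is, puts \<xi> = B (z - RZ).\<close>
  define K where "K h z = (\<integral>\<^sup>+x. \<integral>\<^sup>+\<omega>. ennreal (pZ z * ?n (x - \<alpha> z)) * h (x, A (x, z) + Res \<omega>) \<partial>M \<partial>lborel)" for h z
  define K' where "K' h z = (\<integral>\<^sup>+\<omega>. ennreal (unit_gauss m (B *v (z - RZ \<omega>)) / \<bar>det b\<bar>) * h (RY \<omega> + a \<bullet> (B *v (z - RZ \<omega>)), RV \<omega> + c (B *v (z - RZ \<omega>))) \<partial>M)" for h z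

  have Krhs: "(\<integral>\<^sup>+x. (\<integral>\<^sup>+v. h (x, v) \<partial>cond_law M V ?W (x, z)) * ennreal (joint_density M ?W (x, z)) \<partial>lborel) = K h z"
    if [measurable]: "h \<in> borel_measurable (borel \<Otimes>\<^sub>M borel)" for h z
    unfolding K_def reg(3) Res_def[symmetric] jd prod.case
  proof (intro nn_integral_cong)
    fix x
    have "(\<integral>\<^sup>+v. h (x, v) \<partial>distr M borel (\<lambda>\<omega>. A (x, z) + Res \<omega>)) = (\<integral>\<^sup>+\<omega>. h (x, A (x, z) + Res \<omega>) \<partial>M)"
      by (rule nn_integral_distr) measurable
    moreover have "(\<integral>\<^sup>+\<omega>. ennreal (pZ z * ?n (x - \<alpha> z)) * h (x, A (x, z) + Res \<omega>) \<partial>M) = ennreal (pZ z * ?n (x - \<alpha> z)) * (\<integral>\<^sup>+\<omega>. h (x, A (x, z) + Res \<omega>) \<partial>M)"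
      by (rule nn_integral_cmult) measurable
    ultimately show "(\<integral>\<^sup>+v. h (x, v) \<partial>distr M borel (\<lambda>\<omega>. A (x, z) + Res \<omega>)) * ennreal (pZ z * ?n (x - \<alpha> z)) = (\<integral>\<^sup>+\<omega>. ennreal (pZ z * ?n (x - \<alpha> z)) * h (x, A (x, z) + Res \<omega>) \<partial>M)"
      by (simp only: mult.commute)
  qed

  have eqK: "(\<integral>\<^sup>+\<omega>. f (Z \<omega>) * h (Y \<omega>, V \<omega>) \<partial>M) = (\<integral>\<^sup>+z. f z * K h z \<partial>lborel)"
    and Km: "K h \<in> borel_measurable borel"
    if [measurable]: "f \<in> borel_measurable borel" "h \<in> borel_measurable (borel \<Otimes>\<^sub>M borel)" for f h
  proof -
    have "(\<lambda>p. \<integral>\<^sup>+\<omega>. ennreal (pZ (fst p) * ?n (snd p - \<alpha> (fst p))) * h (snd p, A (snd p, fst p) + Res \<omega>) \<partial>M) \<in> borel_measurable (borel \<Otimes>\<^sub>M lborel)"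
      by measurable
    then have "(\<lambda>z. \<integral>\<^sup>+x. (\<lambda>p. \<integral>\<^sup>+\<omega>. ennreal (pZ (fst p) * ?n (snd p - \<alpha> (fst p))) * h (snd p, A (snd p, fst p) + Res \<omega>) \<partial>M) (z, x) \<partial>lborel) \<in> borel_measurable borel"
      by (rule lborel.borel_measurable_nn_integral_fst)
    then show "K h \<in> borel_measurable borel" by (simp add: K_def[abs_def])
    let ?H = "\<lambda>q. f (snd (snd q)) * h (fst (snd q), fst q)"
    have "?H \<in> borel_measurable (borel \<Otimes>\<^sub>M (borel \<Otimes>\<^sub>M borel))" by measurable
    then have Hm: "?H \<in> borel_measurable (borel \<Otimes>\<^sub>M borel)" by (simp add: borel_prod)
    have "(\<integral>\<^sup>+\<omega>. f (Z \<omega>) * h (Y \<omega>, V \<omega>) \<partial>M) = (\<integral>\<^sup>+w. \<integral>\<^sup>+v. ?H (v, w) \<partial>cond_law M V ?W w \<partial>distr M borel ?W)"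
      using reg(2)[OF Hm] by simp
    also have "\<dots> = (\<integral>\<^sup>+w. \<integral>\<^sup>+\<omega>. f (snd w) * h (fst w, A w + Res \<omega>) \<partial>M \<partial>distr M borel ?W)"
      unfolding reg(3) Res_def[symmetric] by (simp add: nn_integral_distr)
    also have "\<dots> = (\<integral>\<^sup>+w. (case w of (x, z) \<Rightarrow> ennreal (pZ z * ?n (x - \<alpha> z))) * (\<integral>\<^sup>+\<omega>. f (snd w) * h (fst w, A w + Res \<omega>) \<partial>M) \<partial>lborel)"
      unfolding dens
    proof (rule nn_integral_density)
      have "(\<lambda>(x, z). ennreal (pZ z * ?n (x - \<alpha> z))) \<in> borel_measurable (borel \<Otimes>\<^sub>M borel)" by measurable
      then show "(\<lambda>(x, z). ennreal (pZ z * ?n (x - \<alpha> z))) \<in> borel_measurable lborel" by (simp add: borel_prod)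
      have "(\<lambda>w. \<integral>\<^sup>+\<omega>. f (snd w) * h (fst w, A w + Res \<omega>) \<partial>M) \<in> borel_measurable (borel \<Otimes>\<^sub>M borel)" by measurable
      then show "(\<lambda>w. \<integral>\<^sup>+\<omega>. f (snd w) * h (fst w, A w + Res \<omega>) \<partial>M) \<in> borel_measurable lborel" by (simp add: borel_prod)
    qed
    also have "\<dots> = (\<integral>\<^sup>+z. \<integral>\<^sup>+x. ennreal (pZ z * ?n (x - \<alpha> z)) * (\<integral>\<^sup>+\<omega>. f z * h (x, A (x, z) + Res \<omega>) \<partial>M) \<partial>lborel \<partial>lborel)"
      unfolding lborel_prod[symmetric] by (subst lborel_pair.nn_integral_snd[symmetric]) auto
    also have "\<dots> = (\<integral>\<^sup>+z. f z * K h z \<partial>lborel)"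
    proof (intro nn_integral_cong)
      fix z
      have "f z * K h z = (\<integral>\<^sup>+x. f z * (\<integral>\<^sup>+\<omega>. ennreal (pZ z * ?n (x - \<alpha> z)) * h (x, A (x, z) + Res \<omega>) \<partial>M) \<partial>lborel)"
        unfolding K_def by (rule nn_integral_cmult[symmetric]) measurable
      also have "\<dots> = (\<integral>\<^sup>+x. ennreal (pZ z * ?n (x - \<alpha> z)) * (\<integral>\<^sup>+\<omega>. f z * h (x, A (x, z) + Res \<omega>) \<partial>M) \<partial>lborel)"
      proof (intro nn_integral_cong)
        fix x
        have "(\<integral>\<^sup>+\<omega>. ennreal (pZ z * ?n (x - \<alpha> z)) * h (x, A (x, z) + Res \<omega>) \<partial>M) = ennreal (pZ z * ?n (x - \<alpha> z)) * (\<integral>\<^sup>+\<omega>. h (x, A (x, z) + Res \<omega>) \<partial>M)"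
          by (rule nn_integral_cmult) measurable
        moreover have "(\<integral>\<^sup>+\<omega>. f z * h (x, A (x, z) + Res \<omega>) \<partial>M) = f z * (\<integral>\<^sup>+\<omega>. h (x, A (x, z) + Res \<omega>) \<partial>M)"
          by (rule nn_integral_cmult) measurable
        ultimately show "f z * (\<integral>\<^sup>+\<omega>. ennreal (pZ z * ?n (x - \<alpha> z)) * h (x, A (x, z) + Res \<omega>) \<partial>M) = ennreal (pZ z * ?n (x - \<alpha> z)) * (\<integral>\<^sup>+\<omega>. f z * h (x, A (x, z) + Res \<omega>) \<partial>M)"
          by (simp only: mult.left_commute)
      qed
      finally show "(\<integral>\<^sup>+x. ennreal (pZ z * ?n (x - \<alpha> z)) * (\<integral>\<^sup>+\<omega>. f z * h (x, A (x, z) + Res \<omega>) \<partial>M) \<partial>lborel) = f z * K h z" ..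
    qed
    finally show "(\<integral>\<^sup>+\<omega>. f (Z \<omega>) * h (Y \<omega>, V \<omega>) \<partial>M) = (\<integral>\<^sup>+z. f z * K h z \<partial>lborel)" .
  qed

  have eqK': "(\<integral>\<^sup>+\<omega>. f (Z \<omega>) * h (Y \<omega>, V \<omega>) \<partial>M) = (\<integral>\<^sup>+z. f z * K' h z \<partial>lborel)"
    and Km': "K' h \<in> borel_measurable borel"
    if [measurable]: "f \<in> borel_measurable borel" "h \<in> borel_measurable (borel \<Otimes>\<^sub>M borel)" for f h
  proof -
    let ?k = "\<lambda>z \<omega>. ennreal (unit_gauss m (B *v (z - RZ \<omega>)) / \<bar>det b\<bar>) * h (RY \<omega> + a \<bullet> (B *v (z - RZ \<omega>)), RV \<omega> + c (B *v (z - RZ \<omega>)))"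
    have km[measurable]: "(\<lambda>(z, \<omega>). ?k z \<omega>) \<in> borel_measurable (borel \<Otimes>\<^sub>M M)" by measurable
    show "K' h \<in> borel_measurable borel" unfolding K'_def[abs_def] by measurable
    have "(\<integral>\<^sup>+\<omega>. f (Z \<omega>) * h (Y \<omega>, V \<omega>) \<partial>M) = (\<integral>\<^sup>+\<omega>. (case (\<omega>, \<xi> \<omega>) of (\<omega>, v) \<Rightarrow> f (RZ \<omega> + b *v v) * h (RY \<omega> + a \<bullet> v, RV \<omega> + c v)) \<partial>M)"
      by (simp add: Yeq Zeq Veq)
    also have "\<dots> = (\<integral>\<^sup>+\<omega>. \<integral>\<^sup>+v. f (RZ \<omega> + b *v v) * h (RY \<omega> + a \<bullet> v, RV \<omega> + c v) \<partial>distr M borel \<xi> \<partial>M)"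
      by (subst uncorr_independent[OF xi]) auto
    also have "\<dots> = (\<integral>\<^sup>+\<omega>. \<integral>\<^sup>+z. f z * ?k z \<omega> \<partial>lborel \<partial>M)"
    proof (rule nn_integral_cong)
      fix \<omega>
      let ?h = "\<lambda>z. f z * ?k z \<omega>"
      have [measurable]: "?h \<in> borel_measurable borel" by measurable
      have im: "(\<lambda>v. RZ \<omega> + b *v v) ` T = (\<lambda>z. B *v (z - RZ \<omega>)) -` T" for T
        by (auto intro!: image_eqI[where x = "B *v (_ - RZ \<omega>)"])
      have "(\<integral>\<^sup>+z. ?h z \<partial>lborel) = (\<integral>\<^sup>+z. ?h z * indicator ((\<lambda>v. RZ \<omega> + b *v v) ` UNIV) z \<partial>lborel)" by (simp add: im)
      also have "\<dots> = (\<integral>\<^sup>+v. ennreal (indicator UNIV v * \<bar>det (matrix ((*v) b))\<bar>) * ?h (RZ \<omega> + b *v v) \<partial>lborel)"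
      proof (rule nn_integral_lborel_image)
        fix T :: "(real^'n) set" assume "T \<in> sets borel"
        then show "(\<lambda>v. RZ \<omega> + b *v v) ` T \<in> sets borel"
          using measurable_sets[of "\<lambda>z. B *v (z - RZ \<omega>)" borel borel T] unfolding im by simp
      next
        show "((\<lambda>v. RZ \<omega> + b *v v) has_derivative (*v) b) (at x within UNIV)" for x
        proof -
          have "((*v) b has_derivative (*v) b) (at x within UNIV)"
            by (rule bounded_linear_imp_has_derivative[OF matrix_vector_mul_bounded_linear])
          from has_derivative_add[OF has_derivative_const[of "RZ \<omega>"] this] show ?thesis by simp
        qed
        show "inj_on (\<lambda>v. RZ \<omega> + b *v v) UNIV" by (rule inj_on_inverseI[where g = "\<lambda>z. B *v (z - RZ \<omega>)"]) simp
      qed auto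
      also have "\<dots> = (\<integral>\<^sup>+v. ennreal (unit_gauss m v) * (f (RZ \<omega> + b *v v) * h (RY \<omega> + a \<bullet> v, RV \<omega> + c v)) \<partial>lborel)"
      proof (rule nn_integral_cong)
        fix v
        have eq: "ennreal \<bar>det b\<bar> * ennreal (unit_gauss m v / \<bar>det b\<bar>) = ennreal (unit_gauss m v)"
          using db unit_gauss_bounds(1)[of m v] by (subst ennreal_mult[symmetric]) (auto simp: less_imp_le)
        show "ennreal (indicator UNIV v * \<bar>det (matrix ((*v) b))\<bar>) * ?h (RZ \<omega> + b *v v) = ennreal (unit_gauss m v) * (f (RZ \<omega> + b *v v) * h (RY \<omega> + a \<bullet> v, RV \<omega> + c v))"
          by (subst eq[symmetric]) (simp add: ac_simps)
      qed
      also have "\<dots> = (\<integral>\<^sup>+v. f (RZ \<omega> + b *v v) * h (RY \<omega> + a \<bullet> v, RV \<omega> + c v) \<partial>distr M borel \<xi>)"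
        unfolding xi_law by (subst nn_integral_density) auto
      finally show "(\<integral>\<^sup>+v. f (RZ \<omega> + b *v v) * h (RY \<omega> + a \<bullet> v, RV \<omega> + c v) \<partial>distr M borel \<xi>) = (\<integral>\<^sup>+z. ?h z \<partial>lborel)" ..
    qed
    also have "\<dots> = (\<integral>\<^sup>+z. \<integral>\<^sup>+\<omega>. f z * ?k z \<omega> \<partial>M \<partial>lborel)"
    proof -
      interpret pair_sigma_finite lborel M ..
      show ?thesis by (rule Fubini') measurable
    qed
    also have "\<dots> = (\<integral>\<^sup>+z. f z * K' h z \<partial>lborel)"
      unfolding K'_def by (intro nn_integral_cong nn_integral_cmult) measurable
    finally show "(\<integral>\<^sup>+\<omega>. f (Z \<omega>) * h (Y \<omega>, V \<omega>) \<partial>M) = (\<integral>\<^sup>+z. f z * K' h z \<partial>lborel)" .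
  qed

  have cont_eq: "K (\<lambda>p. ennreal (h p)) 0 = K' (\<lambda>p. ennreal (h p)) 0"
    if hc: "continuous_on UNIV h" and h0: "\<And>p. 0 \<le> h p" and h1: "\<And>p. h p \<le> (1::real)" for h :: "real \<times> 'z \<Rightarrow> real"
  proof (rule AE_lborel_continuous_eq)
    have [measurable]: "h \<in> borel_measurable (borel \<Otimes>\<^sub>M borel)"
      unfolding borel_prod by (rule borel_measurable_continuous_onI[OF hc])
    let ?h = "\<lambda>p. ennreal (h p)"
    have hm: "?h \<in> borel_measurable (borel \<Otimes>\<^sub>M borel)" by measurable
    have "density lborel (K ?h) = density lborel (K' ?h)"
    proof (rule measure_eqI)
      fix S assume "S \<in> sets (density lborel (K ?h))"
      then have [measurable]: "S \<in> sets borel" by simp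
      have "(\<integral>\<^sup>+z. indicator S z * K ?h z \<partial>lborel) = (\<integral>\<^sup>+z. indicator S z * K' ?h z \<partial>lborel)"
        using eqK[OF _ hm, of "indicator S"] eqK'[OF _ hm, of "indicator S"] by simp
      then show "emeasure (density lborel (K ?h)) S = emeasure (density lborel (K' ?h)) S"
        using Km[OF _ hm, of "\<lambda>_. 0"] Km'[OF _ hm, of "\<lambda>_. 0"] by (simp add: emeasure_density mult.commute)
    qed simp
    then show "AE z in lborel. K ?h z = K' ?h z"
      using Km[OF _ hm, of "\<lambda>_. 0"] Km'[OF _ hm, of "\<lambda>_. 0"]
      by (intro sigma_finite_measure.density_unique[OF sigma_finite_lborel]) auto
    have seq: "(\<lambda>k. h (u k)) \<longlonglongrightarrow> h v" if "u \<longlonglongrightarrow> v" for u v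
      using that hc by (metis UNIV_I continuous_on_tendsto_compose eventually_sequentially)
    have seqA: "(\<lambda>k. A (u k)) \<longlonglongrightarrow> A v" if "u \<longlonglongrightarrow> v" for u v
      by (rule bounded_linear.tendsto[OF A[unfolded linear_conv_bounded_linear] that])
    have seqal: "(\<lambda>k. \<alpha> (u k)) \<longlonglongrightarrow> \<alpha> v" if "u \<longlonglongrightarrow> v" for u v
      by (rule bounded_linear.tendsto[OF al[unfolded linear_conv_bounded_linear] that])
    have seqc: "(\<lambda>k. c (u k)) \<longlonglongrightarrow> c v" if "u \<longlonglongrightarrow> v" for u v
      by (rule bounded_linear.tendsto[OF c[unfolded linear_conv_bounded_linear] that])
    have seqB: "(\<lambda>k. B *v (u k)) \<longlonglongrightarrow> B *v v" if "u \<longlonglongrightarrow> v" for u v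
      by (rule bounded_linear.tendsto[OF matrix_vector_mul_bounded_linear that])
    have seqpZ: "(\<lambda>k. pZ (u k)) \<longlonglongrightarrow> pZ v" if "u \<longlonglongrightarrow> v" for u v
      using continuous_on_tendsto_compose[OF pZ(1) that] by simp
    have seqg: "(\<lambda>k. unit_gauss m (u k)) \<longlonglongrightarrow> unit_gauss m v" if "u \<longlonglongrightarrow> v" for u v
      using continuous_on_tendsto_compose[OF continuous_unit_gauss[OF continuous_on_id, of UNIV m] that] by simp
    \<comment> \<open>After the shift of x by \<alpha> z the normal density no longer involves z,
      and \<open>C * ?n x\<close> dominates the integrand for all z at once.\<close>
    have K2: "K ?h z = (\<integral>\<^sup>+x. \<integral>\<^sup>+\<omega>. ennreal (pZ z * ?n x * h (\<alpha> z + x, A (\<alpha> z + x, z) + Res \<omega>)) \<partial>M \<partial>lborel)" for z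
    proof -
      have "K ?h z = (\<integral>\<^sup>+x. \<integral>\<^sup>+\<omega>. ennreal (pZ z * ?n x) * h (\<alpha> z + x, A (\<alpha> z + x, z) + Res \<omega>) \<partial>M \<partial>lborel)"
        unfolding K_def by (subst nn_integral_real_affine[where c = 1 and t = "\<alpha> z"]) auto
      then show ?thesis using pZ(2) n0 h0 by (simp add: ennreal_mult')
    qed
    show "continuous_on UNIV (K ?h)"
    proof (rule continuous_on_sequentiallyI)
      fix u :: "nat \<Rightarrow> real^'n" and z assume u: "u \<longlonglongrightarrow> z"
      have inner: "(\<lambda>k. \<integral>\<^sup>+\<omega>. ennreal (pZ (u k) * ?n x * h (\<alpha> (u k) + x, A (\<alpha> (u k) + x, u k) + Res \<omega>)) \<partial>M)
          \<longlonglongrightarrow> (\<integral>\<^sup>+\<omega>. ennreal (pZ z * ?n x * h (\<alpha> z + x, A (\<alpha> z + x, z) + Res \<omega>)) \<partial>M)" for x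
      proof (rule nn_integral_dominated_convergence[where w = "\<lambda>_. ennreal (C * ?n x)"])
        have "pZ z' * ?n x * h p \<le> C * ?n x" for z' p
          using mult_left_le[OF h1[of p], of "pZ z' * ?n x"] mult_right_mono[OF pZ(3)[of z'] n0[of x]] n0[of x] pZ(2)[of z']
          by (meson mult_nonneg_nonneg order_trans)
        then show "AE \<omega> in M. ennreal (pZ (u j) * ?n x * h (\<alpha> (u j) + x, A (\<alpha> (u j) + x, u j) + Res \<omega>)) \<le> ennreal (C * ?n x)" for j
          by (intro AE_I2 ennreal_leI) simp
        show "AE \<omega> in M. (\<lambda>k. ennreal (pZ (u k) * ?n x * h (\<alpha> (u k) + x, A (\<alpha> (u k) + x, u k) + Res \<omega>)))
           \<longlonglongrightarrow> ennreal (pZ z * ?n x * h (\<alpha> z + x, A (\<alpha> z + x, z) + Res \<omega>))"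
          by (intro AE_I2 tendsto_ennrealI tendsto_intros seq seqA seqal seqpZ u)
      qed (auto simp: emeasure_space_1 ennreal_mult_less_top)
      show "(\<lambda>k. K ?h (u k)) \<longlonglongrightarrow> K ?h z"
        unfolding K2
      proof (rule nn_integral_dominated_convergence[where w = "\<lambda>x. ennreal (C * ?n x)"])
        have "pZ z' * ?n x * h p \<le> C * ?n x" for z' p x
          using mult_left_le[OF h1[of p], of "pZ z' * ?n x"] mult_right_mono[OF pZ(3)[of z'] n0[of x]] n0[of x] pZ(2)[of z']
          by (meson mult_nonneg_nonneg order_trans)
        then have "(\<integral>\<^sup>+\<omega>. ennreal (pZ (u j) * ?n x * h (\<alpha> (u j) + x, A (\<alpha> (u j) + x, u j) + Res \<omega>)) \<partial>M) \<le> (\<integral>\<^sup>+\<omega>. ennreal (C * ?n x) \<partial>M)" for j x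
          by (intro nn_integral_mono ennreal_leI) simp
        then show "AE x in lborel. (\<integral>\<^sup>+\<omega>. ennreal (pZ (u j) * ?n x * h (\<alpha> (u j) + x, A (\<alpha> (u j) + x, u j) + Res \<omega>)) \<partial>M) \<le> ennreal (C * ?n x)" for j
          by (simp add: emeasure_space_1)
        have "C \<ge> 0" using pZ(2)[of 0] pZ(3)[of 0] by linarith
        then have "(\<integral>\<^sup>+x. ennreal (C * ?n x) \<partial>lborel) = ennreal C"
          using s by (simp add: ennreal_mult' nn_integral_cmult nn_integral_eq_integral[OF integrable_normal_density] normal_density_nonneg integral_normal_density)
        then show "(\<integral>\<^sup>+x. ennreal (C * ?n x) \<partial>lborel) < \<infinity>" by simp
      qed (use inner in auto)
    qed
    show "continuous_on UNIV (K' ?h)"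
    proof (rule continuous_on_sequentiallyI)
      fix u :: "nat \<Rightarrow> real^'n" and z assume u: "u \<longlonglongrightarrow> z"
      have K'2: "K' ?h z = (\<integral>\<^sup>+\<omega>. ennreal (unit_gauss m (B *v (z - RZ \<omega>)) / \<bar>det b\<bar> * h (RY \<omega> + a \<bullet> (B *v (z - RZ \<omega>)), RV \<omega> + c (B *v (z - RZ \<omega>)))) \<partial>M)" for z
        unfolding K'_def using unit_gauss_bounds(1)[of m]
        by (intro nn_integral_cong ennreal_mult[symmetric] h0) (simp add: less_imp_le)
      show "(\<lambda>k. K' ?h (u k)) \<longlonglongrightarrow> K' ?h z"
        unfolding K'2
      proof (rule nn_integral_dominated_convergence[where w = "\<lambda>_. ennreal (1 / \<bar>det b\<bar>)"])
        have "unit_gauss m v / \<bar>det b\<bar> * h p \<le> 1 / \<bar>det b\<bar>" for v p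
        proof -
          have "unit_gauss m v * h p \<le> 1" using unit_gauss_bounds[of m v] h0[of p] h1[of p] by (intro mult_le_one) (auto simp: less_imp_le)
          then show ?thesis using db by (simp add: divide_right_mono)
        qed
        then show "AE \<omega> in M. ennreal (unit_gauss m (B *v (u j - RZ \<omega>)) / \<bar>det b\<bar> * h (RY \<omega> + a \<bullet> (B *v (u j - RZ \<omega>)), RV \<omega> + c (B *v (u j - RZ \<omega>)))) \<le> ennreal (1 / \<bar>det b\<bar>)" for j
          by (intro AE_I2 ennreal_leI) simp
        show "AE \<omega> in M. (\<lambda>k. ennreal (unit_gauss m (B *v (u k - RZ \<omega>)) / \<bar>det b\<bar> * h (RY \<omega> + a \<bullet> (B *v (u k - RZ \<omega>)), RV \<omega> + c (B *v (u k - RZ \<omega>)))))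
          \<longlonglongrightarrow> ennreal (unit_gauss m (B *v (z - RZ \<omega>)) / \<bar>det b\<bar> * h (RY \<omega> + a \<bullet> (B *v (z - RZ \<omega>)), RV \<omega> + c (B *v (z - RZ \<omega>))))"
          using db by (intro AE_I2 tendsto_ennrealI tendsto_intros seq seqc seqB seqg u) auto
      qed (auto simp: emeasure_space_1)
    qed
  qed

  \<comment> \<open>The two kernels at z = 0 as measures on pairs: \<open>K\<close> and
    \<open>K'\<close> at 0 are the integrals of the test function against them.\<close>
  define \<kappa> where "\<kappa> = distr (density (lborel \<Otimes>\<^sub>M M) (\<lambda>q. ennreal (pZ 0 * ?n (fst q)))) borel (\<lambda>q. (fst q, A (fst q, 0) + Res (snd q)))"
  define \<kappa>' where "\<kappa>' = distr (density M (\<lambda>\<omega>. ennreal (unit_gauss m (- (B *v RZ \<omega>)) / \<bar>det b\<bar>))) borel (\<lambda>\<omega>. (RY \<omega> - a \<bullet> (B *v RZ \<omega>), RV \<omega> - c (B *v RZ \<omega>)))"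
  have al0: "\<alpha> 0 = 0" using al by (rule linear_0)
  have Bneg: "B *v (0 - v) = - (B *v v)" for v by (simp add: linear_neg[OF matrix_vector_mul_linear])
  have kap: "(\<integral>\<^sup>+p. h p \<partial>\<kappa>) = K h 0" if hm[measurable]: "h \<in> borel_measurable (borel \<Otimes>\<^sub>M borel)" for h
  proof -
    have hb: "h \<in> borel_measurable borel" using hm by (simp add: borel_prod)
    have "(\<lambda>q. (fst q, A (fst q, 0) + Res (snd q))) \<in> measurable (density (lborel \<Otimes>\<^sub>M M) (\<lambda>q. ennreal (pZ 0 * ?n (fst q)))) (borel \<Otimes>\<^sub>M borel)" by measurable
    then have "(\<integral>\<^sup>+p. h p \<partial>\<kappa>) = (\<integral>\<^sup>+q. h (fst q, A (fst q, 0) + Res (snd q)) \<partial>density (lborel \<Otimes>\<^sub>M M) (\<lambda>q. ennreal (pZ 0 * ?n (fst q))))"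
      unfolding \<kappa>_def borel_prod by (rule nn_integral_distr) (use hb in simp)
    also have "\<dots> = (\<integral>\<^sup>+q. ennreal (pZ 0 * ?n (fst q)) * h (fst q, A (fst q, 0) + Res (snd q)) \<partial>(lborel \<Otimes>\<^sub>M M))"
      by (rule nn_integral_density) measurable
    also have "\<dots> = K h 0"
      unfolding K_def al0 by (subst nn_integral_fst[symmetric]) auto
    finally show ?thesis .
  qed
  have kap': "(\<integral>\<^sup>+p. h p \<partial>\<kappa>') = K' h 0" if hm[measurable]: "h \<in> borel_measurable (borel \<Otimes>\<^sub>M borel)" for h
  proof -
    have hb: "h \<in> borel_measurable borel" using hm by (simp add: borel_prod)
    have "(\<lambda>\<omega>. (RY \<omega> - a \<bullet> (B *v RZ \<omega>), RV \<omega> - c (B *v RZ \<omega>))) \<in> measurable (density M (\<lambda>\<omega>. ennreal (unit_gauss m (- (B *v RZ \<omega>)) / \<bar>det b\<bar>))) (borel \<Otimes>\<^sub>M borel)" by measurable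
    then have "(\<integral>\<^sup>+p. h p \<partial>\<kappa>') = (\<integral>\<^sup>+\<omega>. h (RY \<omega> - a \<bullet> (B *v RZ \<omega>), RV \<omega> - c (B *v RZ \<omega>)) \<partial>density M (\<lambda>\<omega>. ennreal (unit_gauss m (- (B *v RZ \<omega>)) / \<bar>det b\<bar>)))"
      unfolding \<kappa>'_def borel_prod by (rule nn_integral_distr) (use hb in simp)
    also have "\<dots> = (\<integral>\<^sup>+\<omega>. ennreal (unit_gauss m (- (B *v RZ \<omega>)) / \<bar>det b\<bar>) * h (RY \<omega> - a \<bullet> (B *v RZ \<omega>), RV \<omega> - c (B *v RZ \<omega>)) \<partial>M)"
      by (rule nn_integral_density) measurable
    also have "\<dots> = K' h 0" unfolding K'_def Bneg by (simp add: linear_neg[OF c])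
    finally show ?thesis .
  qed
  have "\<kappa> = \<kappa>'"
  proof (rule finite_measure_eqI_continuous)
    have "emeasure \<kappa> (space \<kappa>) = (\<integral>\<^sup>+p. 1 \<partial>\<kappa>)" by simp
    also have "\<dots> = K (\<lambda>_. 1) 0" by (rule kap) measurable
    also have "\<dots> = (\<integral>\<^sup>+x. ennreal (pZ 0 * ?n x) \<partial>lborel)" by (simp add: K_def al0 emeasure_space_1)
    also have "\<dots> = ennreal (pZ 0)"
      using s pZ(2)[of 0] by (simp add: ennreal_mult' nn_integral_cmult nn_integral_eq_integral[OF integrable_normal_density] normal_density_nonneg integral_normal_density)
    finally show "finite_measure \<kappa>" by (intro finite_measureI) simp
    fix h :: "real \<times> 'z \<Rightarrow> real" assume h: "continuous_on UNIV h" "\<And>x. 0 \<le> h x" "\<And>x. h x \<le> 1"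
    have hm: "(\<lambda>p. ennreal (h p)) \<in> borel_measurable (borel \<Otimes>\<^sub>M borel)"
      using borel_measurable_continuous_onI[OF h(1)] unfolding borel_prod by measurable
    show "(\<integral>\<^sup>+p. ennreal (h p) \<partial>\<kappa>) = (\<integral>\<^sup>+p. ennreal (h p) \<partial>\<kappa>')"
      unfolding kap[OF hm] kap'[OF hm] by (rule cont_eq[OF h])
  qed (auto simp: \<kappa>_def \<kappa>'_def)
  then have "K H 0 = K' H 0" using kap[OF H] kap'[OF H] by simp
  moreover have "K' H 0 = (\<integral>\<^sup>+\<omega>. ennreal (unit_gauss m (- (B *v RZ \<omega>)) / \<bar>det b\<bar>) * H (RY \<omega> - a \<bullet> (B *v RZ \<omega>), RV \<omega> - c (B *v RZ \<omega>)) \<partial>M)"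
    unfolding K'_def Bneg by (simp add: linear_neg[OF c])
  ultimately show ?thesis using Krhs[OF H, of 0] by simp
qed

end


section \<open>The Rice formula on open sets\<close>

text \<open>The condition \<rho> > 0 is open, whereas zeros of continuous functions express closed
  conditions. So the count is the increasing limit over j of the counts with \<rho> \<ge> 1/(j+1).
  For each j the solutions are closed in \<open>V\<close> and isolated by local injectivity, hence
  finite in compact sets, as the passage from open to Borel sets requires.\<close>

lemma measurable_count_regular:
  fixes W :: "'w \<Rightarrow> 'e::euclidean_space \<Rightarrow> 'e" and \<rho> :: "'w \<Rightarrow> 'e \<Rightarrow> real"
  assumes V: "open V"
    and Wc: "\<And>\<omega>. \<omega> \<in> space N \<Longrightarrow> continuous_on V (W \<omega>)" and Wm: "\<And>t. t \<in> V \<Longrightarrow> (\<lambda>\<omega>. W \<omega> t) \<in> borel_measurable N"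
    and rc: "\<And>\<omega>. \<omega> \<in> space N \<Longrightarrow> continuous_on V (\<rho> \<omega>)" and rm: "\<And>t. t \<in> V \<Longrightarrow> (\<lambda>\<omega>. \<rho> \<omega> t) \<in> borel_measurable N"
    and inj: "\<And>\<omega> t. \<omega> \<in> space N \<Longrightarrow> t \<in> V \<Longrightarrow> 0 < \<rho> \<omega> t \<Longrightarrow> \<exists>r>0. inj_on (W \<omega>) (ball t r)"
    and S: "S \<in> sets borel" "S \<subseteq> V"
  shows "(\<lambda>p. emeasure (count_space UNIV) {t\<in>S. W (fst p) t = snd p \<and> 0 < \<rho> (fst p) t}) \<in> borel_measurable (N \<Otimes>\<^sub>M borel)"
proof -
  let ?c = "emeasure (count_space UNIV)"
  \<comment> \<open>A nonnegative function, continuous in t, whose zeros are the solutions with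
    \<rho> \<ge> 1/(j+1).\<close>
  define g where "g j p t = norm (W (fst p) t - snd p) + max 0 (1 / (real j + 1) - \<rho> (fst p) t)" for j :: nat and p t
  define Z where "Z j p = {t\<in>V. g j p t = 0}" for j p
  have Z_iff: "t \<in> Z j p \<longleftrightarrow> t \<in> V \<and> W (fst p) t = snd p \<and> 1 / (real j + 1) \<le> \<rho> (fst p) t" for j p t
    by (auto simp: Z_def g_def add_nonneg_eq_0_iff)
  have gc: "continuous_on V (g j p)" if "p \<in> space (N \<Otimes>\<^sub>M borel)" for j p
    unfolding g_def[abs_def] using that by (intro continuous_intros Wc rc) (auto simp: space_pair_measure)
  have gm: "(\<lambda>p. g j p t) \<in> borel_measurable (N \<Otimes>\<^sub>M borel)" if t: "t \<in> V" for j t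
  proof -
    note [measurable] = Wm[OF t] rm[OF t]
    show ?thesis unfolding g_def by measurable
  qed
  have g0: "0 \<le> g j p t" for j p t by (simp add: g_def)
  have j: "(\<lambda>p. ?c (Z j p \<inter> S)) \<in> borel_measurable (N \<Otimes>\<^sub>M borel)" for j
  proof (rule measurable_count_borel[OF V _ _ S])
    fix T assume T: "open T" "T \<subseteq> V"
    have "(\<lambda>p. ?c {t\<in>T. g j p t = 0}) \<in> borel_measurable (N \<Otimes>\<^sub>M borel)"
      by (rule measurable_count_zeros_open[OF gc gm g0 T])
    moreover have "{t\<in>T. g j p t = 0} = Z j p \<inter> T" for p using T by (auto simp: Z_def)
    ultimately show "(\<lambda>p. ?c (Z j p \<inter> T)) \<in> borel_measurable (N \<Otimes>\<^sub>M borel)" by simp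
  next
    fix p :: "'w \<times> 'e" and K assume p: "p \<in> space (N \<Otimes>\<^sub>M borel)" and K: "compact K" "K \<subseteq> V"
    show "finite (Z j p \<inter> K)"
    proof (rule ccontr)
      assume inf: "infinite (Z j p \<inter> K)"
      \<comment> \<open>An accumulation point in K is itself a solution by continuity, and local
        injectivity at it forbids further solutions nearby.\<close>
      obtain x where x: "x \<in> K" "x islimpt (Z j p \<inter> K)"
        using Heine_Borel_imp_Bolzano_Weierstrass[OF K(1) inf] by auto
      have xV: "x \<in> V" using x K by auto
      have wN: "fst p \<in> space N" using p by (auto simp: space_pair_measure)
      have ic: "isCont (g j p) x" using gc[OF p] V xV by (simp add: continuous_on_eq_continuous_at)
      from x(2)[unfolded islimpt_sequential] obtain s where
        s: "\<forall>n. s n \<in> Z j p \<inter> K - {x}" "s \<longlonglongrightarrow> x" by (elim exE conjE)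
      have "(\<lambda>n. g j p (s n)) \<longlonglongrightarrow> g j p x" by (rule isCont_tendsto_compose[OF ic s(2)])
      moreover have "g j p (s n) = 0" for n using s(1) by (auto simp: Z_def)
      ultimately have "g j p x = 0" by (simp add: LIMSEQ_const_iff)
      then have xZ: "x \<in> Z j p" using xV by (simp add: Z_def)
      have "0 < 1 / (real j + 1)" by simp
      then have "0 < \<rho> (fst p) x" using xZ unfolding Z_iff by linarith
      then obtain r where r: "r > 0" "inj_on (W (fst p)) (ball x r)" using inj[OF wN xV] by blast
      obtain y where y: "y \<in> Z j p \<inter> K" "y \<noteq> x" "dist y x < r"
        using x(2) r(1) unfolding islimpt_approachable by blast
      have "W (fst p) y = W (fst p) x" using y(1) xZ unfolding Int_iff Z_iff by simp
      then have "y = x" using inj_onD[OF r(2)] y(3) r(1) by (simp add: dist_commute)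
      then show False using y(2) by simp
    qed
  qed
  have "?c {t\<in>S. W (fst p) t = snd p \<and> 0 < \<rho> (fst p) t} = (SUP j. ?c (Z j p \<inter> S))" for p
  proof -
    have "Z j p \<subseteq> Z (Suc j) p" for j
    proof
      fix t assume "t \<in> Z j p"
      moreover have "1 / (real (Suc j) + 1) \<le> 1 / (real j + 1)" by (simp add: frac_le)
      ultimately show "t \<in> Z (Suc j) p" unfolding Z_iff by linarith
    qed
    then have "incseq (\<lambda>j. Z j p \<inter> S)" by (intro incseq_SucI) blast
    moreover have "{t\<in>S. W (fst p) t = snd p \<and> 0 < \<rho> (fst p) t} = (\<Union>j. Z j p \<inter> S)"
    proof (intro set_eqI iffI)
      fix t assume t: "t \<in> {t\<in>S. W (fst p) t = snd p \<and> 0 < \<rho> (fst p) t}"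
      then obtain j :: nat where "1 / (real j + 1) < \<rho> (fst p) t" using nat_approx_posE[of "\<rho> (fst p) t"] by (auto simp: add.commute)
      then have "t \<in> Z j p \<inter> S" using t S by (auto simp: Z_iff)
      then show "t \<in> (\<Union>j. Z j p \<inter> S)" by blast
    next
      fix t assume "t \<in> (\<Union>j. Z j p \<inter> S)"
      then obtain j where j: "t \<in> Z j p" "t \<in> S" by blast
      have "0 < 1 / (real j + 1)" by simp
      also have "\<dots> \<le> \<rho> (fst p) t" using j(1) unfolding Z_iff by blast
      finally show "t \<in> {t\<in>S. W (fst p) t = snd p \<and> 0 < \<rho> (fst p) t}" using j unfolding Z_iff by blast
    qed
    ultimately show ?thesis by (simp add: SUP_emeasure_incseq)
  qed
  then show ?thesis using j by simp
qed

section \<open>Matrix-valued functions and the Hessians that are counted\<close>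

lemma matrix_vector_norm_bound:
  obtains K where "K > 0" "\<And>(N::real^'m::finite^'n::finite) v. norm (N *v v) \<le> norm N * norm v * K"
proof (rule that)
  let ?K = "real CARD('n) * real CARD('m) + 1"
  show "?K > 0" by (simp add: add_nonneg_pos)
  fix N :: "real^'m^'n" and v :: "real^'m"
  have "norm (N *v v) \<le> onorm ((*v) N) * norm v"
    by (rule onorm[OF matrix_vector_mul_bounded_linear])
  also have "onorm ((*v) N) \<le> real CARD('n) * real CARD('m) * norm N"
    by (rule onorm_le_matrix_component) (rule order_trans[OF component_le_norm_cart Finite_Cartesian_Product.norm_nth_le])
  also have "real CARD('n) * real CARD('m) * norm N * norm v \<le> ?K * norm N * norm v"
    by (intro mult_right_mono) auto
  finally show "norm (N *v v) \<le> norm N * norm v * ?K" by (simp add: mult_right_mono ac_simps)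
qed

text \<open>In the product rule the derivative of \<open>B\<close> would be multiplied by G t = 0.
  Indeed (B y - B t) G y is a quantity tending to 0 times one of order |y - t|, so continuity of
  \<open>B\<close> at the point is enough.\<close>

lemma has_derivative_mult_vanishing:
  fixes B :: "'e::euclidean_space \<Rightarrow> real^'m::finite^'n::finite" and G :: "'e \<Rightarrow> real^'m"
  assumes B: "isCont B t" and G: "(G has_derivative G') (at t)" and G0: "G t = 0"
  shows "((\<lambda>y. B y *v G y) has_derivative (\<lambda>h. B t *v G' h)) (at t)"
proof -
  have lin: "((\<lambda>y. B t *v G y) has_derivative (\<lambda>h. B t *v G' h)) (at t)"
    by (rule bounded_linear.has_derivative[OF matrix_vector_mul_bounded_linear G])
  have "((\<lambda>y. (B y - B t) *v G y) has_derivative (\<lambda>h. 0)) (at t)"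
    unfolding has_derivative_at_within
  proof (intro conjI bounded_linear_zero)
    obtain K where K: "K > 0" "\<And>(N::real^'m^'n) v. norm (N *v v) \<le> norm N * norm v * K"
      using matrix_vector_norm_bound by blast
    obtain e C where e: "e > 0" and C: "\<And>y. norm (y - t) < e \<Longrightarrow> norm (G y - G t) \<le> C * norm (y - t)"
    proof -
      have bl: "bounded_linear G'" using G by (rule has_derivative_bounded_linear)
      obtain d where d: "d > 0" "\<And>y. norm (y - t) < d \<Longrightarrow> norm (G y - G t - G' (y - t)) \<le> 1 * norm (y - t)"
        using G unfolding has_derivative_at_alt by (metis zero_less_one)
      have "norm (G y - G t) \<le> (1 + onorm G') * norm (y - t)" if "norm (y - t) < d" for y
      proof -
        have "norm (G y - G t) \<le> norm (G y - G t - G' (y - t)) + norm (G' (y - t))" by (metis diff_add_cancel norm_triangle_ineq)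
        also have "\<dots> \<le> 1 * norm (y - t) + onorm G' * norm (y - t)" using d(2)[OF that] onorm[OF bl] by (intro add_mono) auto
        finally show ?thesis by (simp add: distrib_right)
      qed
      then show ?thesis using that d(1) by blast
    qed
    have "((\<lambda>y. K * \<bar>C\<bar> * norm (B y - B t)) \<longlongrightarrow> K * \<bar>C\<bar> * norm (B t - B t)) (at t)"
      using B unfolding isCont_def by (intro tendsto_intros)
    then have lim: "((\<lambda>y. K * \<bar>C\<bar> * norm (B y - B t)) \<longlongrightarrow> 0) (at t)" by simp
    show "((\<lambda>y. ((B y - B t) *v G y - (B t - B t) *v G t - 0) /\<^sub>R norm (y - t)) \<longlongrightarrow> 0) (at t within UNIV)"
    proof (rule Lim_null_comparison[OF _ lim])
      have ev: "\<forall>\<^sub>F y in at t. dist y t < e" using e by (auto simp: eventually_at)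
      show "\<forall>\<^sub>F y in at t. norm (((B y - B t) *v G y - (B t - B t) *v G t - 0) /\<^sub>R norm (y - t)) \<le> K * \<bar>C\<bar> * norm (B y - B t)"
      proof (rule eventually_mp[OF _ ev])
        show "\<forall>\<^sub>F y in at t. dist y t < e \<longrightarrow> norm (((B y - B t) *v G y - (B t - B t) *v G t - 0) /\<^sub>R norm (y - t)) \<le> K * \<bar>C\<bar> * norm (B y - B t)"
          unfolding eventually_at
        proof (intro exI[of _ 1] conjI ballI impI)
          fix y assume y: "y \<noteq> t \<and> dist y t < 1" "dist y t < e"
          have yt: "norm (y - t) > 0" using y by simp
          have "norm ((B y - B t) *v G y) \<le> norm (B y - B t) * norm (G y) * K" by (rule K(2))
          also have "\<dots> \<le> norm (B y - B t) * (\<bar>C\<bar> * norm (y - t)) * K"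
          proof -
            have "norm (G y) \<le> C * norm (y - t)" using C[of y] y(2) G0 by (simp add: dist_norm)
            also have "\<dots> \<le> \<bar>C\<bar> * norm (y - t)" by (intro mult_right_mono) auto
            finally show ?thesis using K(1) by (intro mult_right_mono mult_left_mono) auto
          qed
          finally have "norm ((B y - B t) *v G y) \<le> (K * \<bar>C\<bar> * norm (B y - B t)) * norm (y - t)" by (simp add: ac_simps)
          then show "norm (((B y - B t) *v G y - (B t - B t) *v G t - 0) /\<^sub>R norm (y - t)) \<le> K * \<bar>C\<bar> * norm (B y - B t)"
            using yt by (simp add: divide_le_eq inverse_eq_divide)
        qed simp
      qed
    qed
  qed
  from has_derivative_add[OF lin this] show ?thesis by (simp add: matrix_vector_mult_diff_rdistrib)
qed

lemma continuous_on_det: "continuous_on S A \<Longrightarrow> continuous_on S (\<lambda>x. det (A x :: real^'n::finite^'n))"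
  unfolding det_def by (intro continuous_intros) (auto intro!: continuous_intros)

text \<open>Cramer's rule writes the entries of the inverse as quotients of determinants, which are
  continuous in the entries of the matrix.\<close>

lemma continuous_matrix_inverse:
  fixes b :: "'e::topological_space \<Rightarrow> real^'n::finite^'n"
  assumes c: "continuous_on S b" and nz: "\<And>t. t \<in> S \<Longrightarrow> det (b t) \<noteq> 0"
  obtains B where "continuous_on S B" "\<And>t. t \<in> S \<Longrightarrow> B t ** b t = mat 1" "\<And>t. t \<in> S \<Longrightarrow> b t ** B t = mat 1"
proof -
  define B where "B t = (\<chi> k j. det (\<chi> i l. if l = k then (axis j 1 :: real^'n) $ i else b t $ i $ l) / det (b t))" for t
  have "continuous_on S (\<lambda>t. if l = k then (axis j 1 :: real^'n) $ i else b t $ i $ l)" for k j l i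
    by (cases "l = k") (auto intro!: continuous_intros c)
  then have cl: "continuous_on S (\<lambda>t. (\<chi> i l. if l = k then (axis j 1 :: real^'n) $ i else b t $ i $ l) :: real^'n^'n)" for k j
    by (intro continuous_on_vec_lambda)
  then have "continuous_on S B"
    unfolding B_def[abs_def] by (intro continuous_on_vec_lambda continuous_on_divide continuous_on_det cl c) (use nz in auto)
  moreover have r: "b t ** B t = mat 1" if t: "t \<in> S" for t
  proof -
    have "b t *v (\<chi> k. B t $ k $ j) = axis j 1" for j
      unfolding cramer[OF nz[OF t]] by (simp add: B_def)
    then have "(b t ** B t) $ i $ j = (mat 1 :: real^'n^'n) $ i $ j" for i j
      by (simp add: vec_eq_iff matrix_vector_mult_def matrix_matrix_mult_def mat_def axis_def)
    then show ?thesis by (simp add: vec_eq_iff)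
  qed
  moreover have "B t ** b t = mat 1" if "t \<in> S" for t using r[OF that] by (simp add: matrix_left_right_inverse)
  ultimately show ?thesis using that by blast
qed

lemma abs_det_minus: "\<bar>det (- (M :: real^'n::finite^'n))\<bar> = \<bar>det M\<bar>"
proof -
  have neg: "(- mat 1) ** N = - N" for N :: "real^'n^'n"
  proof -
    have "(- mat 1) ** N = - (mat 1 ** N)" by (simp add: vec_eq_iff matrix_matrix_mult_def sum_negf)
    then show ?thesis by simp
  qed
  then have "- M = (- mat 1) ** M" by simp
  moreover have "(- mat 1 :: real^'n^'n) ** (- mat 1) = mat 1"
    by (simp add: neg)
  then have "det (- mat 1 :: real^'n^'n) * det (- mat 1 :: real^'n^'n) = 1" by (metis det_mul det_I)
  then have "\<bar>det (- mat 1 :: real^'n^'n)\<bar> = 1" by (metis abs_mult abs_one abs_square_eq_1 power2_eq_square)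
  ultimately show ?thesis by (metis abs_mult det_mul mult_1)
qed

text \<open>The matrices on which \<open>delta k\<close> does not vanish. They form an open set, so
  the restriction to such Hessians is stable under small changes.\<close>

definition good :: "nat \<Rightarrow> real^'n::finite^'n \<Rightarrow> bool" where
  "good k M \<longleftrightarrow> (k = 1 \<longrightarrow> negative_definite M) \<and> det M \<noteq> 0"

lemma delta_eq: "delta k M = \<bar>det M\<bar> * of_bool (good k M)"
  by (auto simp: delta_def good_def)

text \<open>A negative definite form satisfies a uniform bound by - c |v|^2, and negativity survives
  perturbations of norm below c / K, where K compares the matrix norm with the operator
  norm.\<close>

lemma open_good: "open {M :: real^'n::finite^'n. good k M}"
proof -
  have 1: "open {M :: real^'n^'n. det M \<noteq> 0}"
    by (rule open_Collect_neq) (auto intro: continuous_on_det continuous_on_id)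
  have "open {M :: real^'n^'n. negative_definite M}"
    unfolding open_dist
  proof
    fix M :: "real^'n^'n" assume "M \<in> {M. negative_definite M}"
    then obtain c where c: "c > 0" "\<And>v. v \<bullet> (M *v v) \<le> - c * (norm v)\<^sup>2"
      using negative_definite_bound[of M] unfolding negative_definite_def by blast
    obtain K where K: "K > 0" "\<And>(N::real^'n^'n) v. norm (N *v v) \<le> norm N * norm v * K"
      using matrix_vector_norm_bound by blast
    have "negative_definite M'" if "dist M' M < c / K" for M'
      unfolding negative_definite_def
    proof (intro allI impI)
      fix v :: "real^'n" assume v: "v \<noteq> 0"
      have "v \<bullet> (M' *v v) = v \<bullet> (M *v v) + v \<bullet> ((M' - M) *v v)"
        by (simp add: matrix_vector_mult_diff_rdistrib inner_diff_right)
      also have "v \<bullet> ((M' - M) *v v) \<le> norm v * norm ((M' - M) *v v)" by (rule norm_cauchy_schwarz)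
      also have "\<dots> \<le> norm v * (norm (M' - M) * norm v * K)" by (intro mult_left_mono K(2)) auto
      also have "\<dots> = (norm (M' - M) * K) * (norm v)\<^sup>2" by (simp add: power2_eq_square)
      also have "\<dots> < c * (norm v)\<^sup>2"
        using that K(1) v by (intro mult_strict_right_mono) (auto simp: dist_norm field_simps)
      finally show "v \<bullet> (M' *v v) < 0" using c(2)[of v] by linarith
    qed
    then show "\<exists>e>0. \<forall>y. dist y M < e \<longrightarrow> y \<in> {M. negative_definite M}"
      using c(1) K(1) by (intro exI[of _ "c / K"]) auto
  qed
  then show ?thesis using 1 by (cases "k = 1") (auto simp: good_def Collect_conj_eq open_Int)
qed

text \<open>Turns membership in an open set into positivity of a continuous function, the form in
  which the counting lemma takes its open condition.\<close>

definition good_dist :: "nat \<Rightarrow> real^'n::finite^'n \<Rightarrow> real" where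
  "good_dist k M = infdist M (- {M. good k M})"

lemma good_dist_pos_iff: "0 < good_dist k M \<longleftrightarrow> good k (M :: real^'n::finite^'n)"
proof -
  have "closed (- {M :: real^'n^'n. good k M})" using open_good[of k] by (simp add: closed_def)
  \<comment> \<open>The complement has to be nonempty, since \<open>infdist\<close> to the empty set
    is 0; the zero matrix is a member.\<close>
  moreover have "det (0 :: real^'n^'n) = 0"
    by (rule det_zero_row(1)[of undefined]) (simp add: row_def vec_eq_iff)
  then have "(0 :: real^'n^'n) \<in> - {M. good k M}" by (simp add: good_def)
  ultimately have "M \<in> - {M. good k M} \<longleftrightarrow> good_dist k M = 0"
    unfolding good_dist_def using in_closed_iff_infdist_zero by blast
  then show ?thesis using infdist_nonneg[of M "- {M. good k M}"] unfolding good_dist_def by auto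
qed

lemma continuous_good_dist: "continuous_on S f \<Longrightarrow> continuous_on S (\<lambda>x. good_dist k (f x))"
  unfolding good_dist_def by (intro continuous_intros)

lemma measurable_good [measurable]: "Measurable.pred borel (good k :: real^'n::finite^'n \<Rightarrow> bool)"
  using borel_open[OF open_good[of k]] by (simp add: pred_def)

lemma measurable_det [measurable]: "(det :: real^'n::finite^'n \<Rightarrow> real) \<in> borel_measurable borel"
  by (intro borel_measurable_continuous_onI continuous_on_det continuous_on_id)

lemma measurable_delta [measurable]: "(delta k :: real^'n::finite^'n \<Rightarrow> real) \<in> borel_measurable borel"
  unfolding delta_eq[abs_def] by measurable


text \<open>The rank-one matrix brings a linear functional of N h into the form of an inner product
  with \<open>N\<close>, the form in which the Hessian is assumed to lie in the Gaussian
  space.\<close>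

lemma matrix_vector_inner: "((N :: real^'n::finite^'m::finite) *v h) \<bullet> i = N \<bullet> (\<chi> k l. i $ k * h $ l)"
  by (simp add: inner_vec_def matrix_vector_mult_def sum_distrib_left sum_distrib_right mult_ac)

lemma matrix_vector_mult_uminus: "(- N) *v h = - (N *v h)" for N :: "real^'n::finite^'m::finite"
  by (simp add: vec_eq_iff matrix_vector_mult_def sum_negf)

section \<open>Regression of a random field on a white vector\<close>

context gaussian_space
begin

text \<open>The regression coefficient of \<open>X\<close> on \<xi>, assembled from its components.
  As \<xi> will have unit covariance, no inverse of a covariance operator enters.\<close>

definition coef :: "('a \<Rightarrow> real^'n::finite) \<Rightarrow> ('a \<Rightarrow> 'e::euclidean_space) \<Rightarrow> real^'n \<Rightarrow> 'e" where
  "coef \<xi> X v = (\<Sum>b\<in>Basis. covar (\<lambda>\<omega>. X \<omega> \<bullet> b) (\<lambda>\<omega>. \<xi> \<omega> \<bullet> v) *\<^sub>R b)"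

lemma coef_inner:
  assumes xi: "\<And>w. (\<lambda>\<omega>. \<xi> \<omega> \<bullet> w) \<in> L" and X: "\<And>w. (\<lambda>\<omega>. X \<omega> \<bullet> w) \<in> L"
  shows "coef \<xi> X v \<bullet> w = covar (\<lambda>\<omega>. X \<omega> \<bullet> w) (\<lambda>\<omega>. \<xi> \<omega> \<bullet> v)"
  unfolding coef_def inner_sum_left covar_inner_sum[OF X xi, of w v]
  by (simp add: inner_commute mult.commute)

lemma linear_coef:
  assumes xi: "\<And>w. (\<lambda>\<omega>. \<xi> \<omega> \<bullet> w) \<in> L" and X: "\<And>w. (\<lambda>\<omega>. X \<omega> \<bullet> w) \<in> L"
  shows "linear (coef \<xi> X)"
proof (rule linearI)
  have lin: "linear (\<lambda>v. covar (\<lambda>\<omega>. X \<omega> \<bullet> w) (\<lambda>\<omega>. \<xi> \<omega> \<bullet> v))" for w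
    using covar_linear[OF xi X, of w] by (simp add: covar_sym)
  show "coef \<xi> X (v + v') = coef \<xi> X v + coef \<xi> X v'" for v v'
    by (rule euclidean_eqI) (simp only: inner_add_left coef_inner[OF xi X] linear_add[OF lin])
  show "coef \<xi> X (c *\<^sub>R v) = c *\<^sub>R coef \<xi> X v" for c v
    by (rule euclidean_eqI) (simp only: inner_scaleR_left coef_inner[OF xi X] linear_scale[OF lin] real_scaleR_def)
qed

lemma residual_uncorr:
  assumes xi: "\<And>w. (\<lambda>\<omega>. \<xi> \<omega> \<bullet> w) \<in> L" and X: "\<And>w. (\<lambda>\<omega>. X \<omega> \<bullet> w) \<in> L"
    and white: "\<And>v w. covar (\<lambda>\<omega>. \<xi> \<omega> \<bullet> v) (\<lambda>\<omega>. \<xi> \<omega> \<bullet> w) = v \<bullet> w"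
  shows "(\<lambda>\<omega>. (X \<omega> - coef \<xi> X (\<xi> \<omega>)) \<bullet> w) \<in> uncorr \<xi>"
proof -
  let ?k = "\<lambda>b. covar (\<lambda>\<omega>. X \<omega> \<bullet> w) (\<lambda>\<omega>. \<xi> \<omega> \<bullet> b)"
  have eq: "coef \<xi> X (\<xi> \<omega>) \<bullet> w = (\<Sum>b\<in>Basis. ?k b * (\<xi> \<omega> \<bullet> b))" for \<omega>
    unfolding coef_inner[OF xi X] by (subst (1 2) covar_sym, subst covar_inner_sum[OF xi X]) (simp add: mult.commute covar_sym)
  have cL: "(\<lambda>\<omega>. coef \<xi> X (\<xi> \<omega>) \<bullet> w) \<in> L" unfolding eq by (intro L_sum L_scale xi)
  have "covar (\<lambda>\<omega>. coef \<xi> X (\<xi> \<omega>) \<bullet> w) (\<lambda>\<omega>. \<xi> \<omega> \<bullet> v) = ?k v" for v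
  proof -
    have "covar (\<lambda>\<omega>. coef \<xi> X (\<xi> \<omega>) \<bullet> w) (\<lambda>\<omega>. \<xi> \<omega> \<bullet> v) = (\<Sum>b\<in>Basis. ?k b * (b \<bullet> v))"
      unfolding eq by (simp add: covar_sum covar_scale L_scale xi white)
    also have "\<dots> = ?k v"
      using covar_inner_sum[OF xi X, of v w] by (simp add: covar_sym inner_commute mult.commute)
    finally show ?thesis .
  qed
  then show ?thesis
    unfolding uncorr_def inner_diff_left by (auto simp: covar_diff[OF X cL xi] intro: L_diff X cL)
qed

end

text \<open>The open set \<open>G\<close> will be the interior of a chart image. Value, gradient and
  Hessian at all points lie in one Gaussian space, so that their regressions on one fixed vector can
  be studied as functions of the point.\<close>

locale c2_gaussian_field = gaussian_space M L for M :: "'a measure" and L +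
  fixes G :: "(real^'n::finite) set" and Y :: "real^'n \<Rightarrow> 'a \<Rightarrow> real"
    and D :: "real^'n \<Rightarrow> 'a \<Rightarrow> real^'n" and H :: "real^'n \<Rightarrow> 'a \<Rightarrow> real^'n^'n"
  assumes G: "open G"
    and Y_L: "\<And>s. s \<in> G \<Longrightarrow> Y s \<in> L" and D_L: "\<And>s w. s \<in> G \<Longrightarrow> (\<lambda>\<omega>. D s \<omega> \<bullet> w) \<in> L"
    and H_L: "\<And>s w. s \<in> G \<Longrightarrow> (\<lambda>\<omega>. H s \<omega> \<bullet> w) \<in> L"
    and Y_der: "\<And>\<omega> s. \<omega> \<in> space M \<Longrightarrow> s \<in> G \<Longrightarrow> ((\<lambda>s. Y s \<omega>) has_derivative (\<lambda>h. D s \<omega> \<bullet> h)) (at s)"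
    and D_der: "\<And>\<omega> s. \<omega> \<in> space M \<Longrightarrow> s \<in> G \<Longrightarrow> ((\<lambda>s. D s \<omega>) has_derivative (\<lambda>h. H s \<omega> *v h)) (at s)"
    and H_cont: "\<And>\<omega>. \<omega> \<in> space M \<Longrightarrow> continuous_on G (\<lambda>s. H s \<omega>)"
    and nondeg: "\<And>s. s \<in> G \<Longrightarrow> nondegenerate M (\<lambda>\<omega>. (Y s \<omega>, D s \<omega>))"
begin

lemma Y_inner_L: "s \<in> G \<Longrightarrow> (\<lambda>\<omega>. Y s \<omega> \<bullet> w) \<in> L"
  using L_scale[OF Y_L, of s w] by (simp add: mult.commute)

lemma Y_cont: "\<omega> \<in> space M \<Longrightarrow> continuous_on G (\<lambda>s. Y s \<omega>)"
  using Y_der by (meson continuous_at_imp_continuous_on has_derivative_continuous)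

lemma D_cont: "\<omega> \<in> space M \<Longrightarrow> continuous_on G (\<lambda>s. D s \<omega>)"
  using D_der by (meson continuous_at_imp_continuous_on has_derivative_continuous)

text \<open>Every path is continuous, and covariances with a fixed vector pass to pointwise limits
  inside the Gaussian space.\<close>

lemma covar_continuous:
  fixes X :: "real^'n \<Rightarrow> 'a \<Rightarrow> 'e::euclidean_space"
  assumes X: "\<And>s w. s \<in> G \<Longrightarrow> (\<lambda>\<omega>. X s \<omega> \<bullet> w) \<in> L"
    and cont: "\<And>\<omega>. \<omega> \<in> space M \<Longrightarrow> continuous_on G (\<lambda>s. X s \<omega>)" and xi: "\<And>w. (\<lambda>\<omega>. \<xi> \<omega> \<bullet> w) \<in> L"
  shows "continuous_on G (\<lambda>s. coef \<xi> (X s) v)"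
proof -
  have "continuous_on G (\<lambda>s. coef \<xi> (X s) v \<bullet> b)" for b
  proof (rule continuous_on_sequentiallyI)
    fix u s assume u: "\<forall>n. u n \<in> G" "s \<in> G" "u \<longlonglongrightarrow> s"
    have "(\<lambda>n. covar (\<lambda>\<omega>. X (u n) \<omega> \<bullet> b) (\<lambda>\<omega>. \<xi> \<omega> \<bullet> v)) \<longlonglongrightarrow> covar (\<lambda>\<omega>. X s \<omega> \<bullet> b) (\<lambda>\<omega>. \<xi> \<omega> \<bullet> v)"
    proof (rule covar_limit[OF X _ X xi])
      fix \<omega> assume "\<omega> \<in> space M"
      then have "(\<lambda>n. X (u n) \<omega>) \<longlonglongrightarrow> X s \<omega>"
        using cont u by (intro continuous_on_tendsto_compose[OF cont u(3) u(2)]) auto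
      then show "(\<lambda>n. X (u n) \<omega> \<bullet> b) \<longlonglongrightarrow> X s \<omega> \<bullet> b" by (intro tendsto_intros)
    qed (use u in auto)
    then show "(\<lambda>n. coef \<xi> (X (u n)) v \<bullet> b) \<longlonglongrightarrow> coef \<xi> (X s) v \<bullet> b"
      using u by (simp add: coef_inner[OF xi X])
  qed
  then show ?thesis by (subst continuous_on_componentwise) auto
qed

text \<open>Differentiation under the covariance: the remainder quotients of \<open>D\<close> along
  a sequence belong to \<open>L\<close> and tend to 0 for each outcome, so by
  \<open>covar_limit\<close> their covariances with \<xi> tend to 0.\<close>

lemma coef_D_derivative:
  assumes xi: "\<And>w. (\<lambda>\<omega>. \<xi> \<omega> \<bullet> w) \<in> L" and s: "s \<in> G"
  shows "((\<lambda>s. coef \<xi> (D s) v) has_derivative (\<lambda>h. coef \<xi> (H s) v *v h)) (at s)"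
proof -
  have "((\<lambda>s. coef \<xi> (D s) v) has_derivative (\<lambda>h. coef \<xi> (H s) v *v h)) (at s within G)"
  proof (subst has_derivative_componentwise_within, intro ballI)
    fix b :: "real^'n" assume "b \<in> Basis"
    let ?P = "\<lambda>h. \<chi> k l. b $ k * h $ l"
    have bl: "bounded_linear (\<lambda>h. (coef \<xi> (H s) v *v h) \<bullet> b)"
      by (intro bounded_linear_inner_left_comp matrix_vector_mul_bounded_linear)
    show "((\<lambda>s. coef \<xi> (D s) v \<bullet> b) has_derivative (\<lambda>h. (coef \<xi> (H s) v *v h) \<bullet> b)) (at s within G)"
      unfolding has_derivative_at_within
    proof (intro conjI bl)
      show "((\<lambda>y. (coef \<xi> (D y) v \<bullet> b - coef \<xi> (D s) v \<bullet> b - (coef \<xi> (H s) v *v (y - s)) \<bullet> b) /\<^sub>R norm (y - s)) \<longlongrightarrow> 0) (at s within G)"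
        unfolding tendsto_at_iff_sequentially
      proof (intro allI impI)
        fix u assume u: "\<forall>i. u i \<in> G - {s}" "u \<longlonglongrightarrow> s"
        define Zn where "Zn n \<omega> = inverse (norm (u n - s)) * (D (u n) \<omega> \<bullet> b - D s \<omega> \<bullet> b - H s \<omega> \<bullet> ?P (u n - s))" for n \<omega>
        have ZnL: "Zn n \<in> L" for n
          unfolding Zn_def[abs_def] using u s by (intro L_scale L_diff D_L H_L) auto
        have lim: "(\<lambda>n. Zn n \<omega>) \<longlonglongrightarrow> 0" if w: "\<omega> \<in> space M" for \<omega>
        proof -
          have "((\<lambda>y. (D y \<omega> - D s \<omega> - H s \<omega> *v (y - s)) /\<^sub>R norm (y - s)) \<longlongrightarrow> 0) (at s)"
            using D_der[OF w s] unfolding has_derivative_at_within by simp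
          then have "((\<lambda>y. (D y \<omega> - D s \<omega> - H s \<omega> *v (y - s)) /\<^sub>R norm (y - s)) \<circ> u) \<longlonglongrightarrow> 0"
            using u unfolding tendsto_at_iff_sequentially by auto
          then have "(\<lambda>n. ((D (u n) \<omega> - D s \<omega> - H s \<omega> *v (u n - s)) /\<^sub>R norm (u n - s)) \<bullet> b) \<longlonglongrightarrow> 0 \<bullet> b"
            unfolding o_def by (intro tendsto_intros)
          then show ?thesis by (simp add: Zn_def inner_diff_left matrix_vector_inner)
        qed
        have "(\<lambda>n. covar (Zn n) (\<lambda>\<omega>. \<xi> \<omega> \<bullet> v)) \<longlonglongrightarrow> covar (\<lambda>_. 0) (\<lambda>\<omega>. \<xi> \<omega> \<bullet> v)"
          by (rule covar_limit[OF ZnL lim L_zero xi])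
        moreover have "covar (Zn n) (\<lambda>\<omega>. \<xi> \<omega> \<bullet> v) = (coef \<xi> (D (u n)) v \<bullet> b - coef \<xi> (D s) v \<bullet> b - (coef \<xi> (H s) v *v (u n - s)) \<bullet> b) /\<^sub>R norm (u n - s)" for n
        proof -
          have un: "u n \<in> G" using u by auto
          show ?thesis
            unfolding Zn_def[abs_def] matrix_vector_inner coef_inner[OF xi D_L[OF un]] coef_inner[OF xi D_L[OF s]] coef_inner[OF xi H_L[OF s]]
            by (simp add: covar_scale covar_diff L_diff D_L un s H_L xi)
        qed
        ultimately show "((\<lambda>y. (coef \<xi> (D y) v \<bullet> b - coef \<xi> (D s) v \<bullet> b - (coef \<xi> (H s) v *v (y - s)) \<bullet> b) /\<^sub>R norm (y - s)) \<circ> u) \<longlonglongrightarrow> 0"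
          by (simp add: o_def covar_zero xi)
      qed
    qed
  qed
  then show ?thesis using at_within_open[OF s G] by simp
qed

end

text \<open>\<open>\<xi>\<close> is the gradient at a fixed point, whitened. On \<open>V\<close> the gradient is \<open>b t *v (\<xi> - W t)\<close>, where
  \<open>W t\<close> is independent of \<open>\<xi>\<close>, so that its zeros are the solutions of \<open>W t = \<xi>\<close>. \<open>Yt\<close> and \<open>Mt\<close> are functions of
  the residuals which agree with the value and the Hessian at these zeros.\<close>

locale whitened_field = c2_gaussian_field +
  fixes \<xi> :: "'a \<Rightarrow> real^'n" and m :: "real^'n" and V :: "(real^'n) set" and B :: "real^'n \<Rightarrow> real^'n^'n"
  assumes xi: "\<And>w. (\<lambda>\<omega>. \<xi> \<omega> \<bullet> w) \<in> L"
    and white: "\<And>v w. covar (\<lambda>\<omega>. \<xi> \<omega> \<bullet> v) (\<lambda>\<omega>. \<xi> \<omega> \<bullet> w) = v \<bullet> w"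
    and xi_law: "distr M borel \<xi> = density lborel (\<lambda>x. ennreal (unit_gauss m x))"
    and V: "open V" "V \<subseteq> G" and B_cont: "continuous_on V B"
    and B1: "\<And>t. t \<in> V \<Longrightarrow> B t ** matrix (coef \<xi> (D t)) = mat 1" and B2: "\<And>t. t \<in> V \<Longrightarrow> matrix (coef \<xi> (D t)) ** B t = mat 1"
begin

definition a where "a t = (\<Sum>b\<in>Basis. coef \<xi> (Y t) b *\<^sub>R b)"
definition b where "b t = matrix (coef \<xi> (D t))"
definition RY where "RY t \<omega> = Y t \<omega> - a t \<bullet> \<xi> \<omega>"
definition RD where "RD t \<omega> = D t \<omega> - coef \<xi> (D t) (\<xi> \<omega>)"
definition RH where "RH t \<omega> = H t \<omega> - coef \<xi> (H t) (\<xi> \<omega>)"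
definition W where "W t \<omega> = - (B t *v RD t \<omega>)"
definition Yt where "Yt t \<omega> = RY t \<omega> - a t \<bullet> (B t *v RD t \<omega>)"
definition Mt where "Mt t \<omega> = RH t \<omega> - coef \<xi> (H t) (B t *v RD t \<omega>)"
definition A where "A t \<omega> = - (B t ** Mt t \<omega>)"

lemma VG: "t \<in> V \<Longrightarrow> t \<in> G" using V by auto

lemma lin_D: "t \<in> V \<Longrightarrow> linear (coef \<xi> (D t))" by (rule linear_coef[OF xi D_L[OF VG]])
lemma lin_H: "t \<in> V \<Longrightarrow> linear (coef \<xi> (H t))" by (rule linear_coef[OF xi H_L[OF VG]])
lemma lin_Y: "t \<in> V \<Longrightarrow> linear (coef \<xi> (Y t))" by (rule linear_coef[OF xi Y_inner_L[OF VG]])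

lemma b_mult: "t \<in> V \<Longrightarrow> b t *v v = coef \<xi> (D t) v"
  unfolding b_def using matrix_vector_mul(2)[OF lin_D] by metis

lemma a_inner: assumes t: "t \<in> V" shows "a t \<bullet> v = coef \<xi> (Y t) v"
proof -
  have "coef \<xi> (Y t) v = coef \<xi> (Y t) (\<Sum>b\<in>Basis. (v \<bullet> b) *\<^sub>R b)" by (simp add: euclidean_representation)
  also have "\<dots> = (\<Sum>b\<in>Basis. (v \<bullet> b) * coef \<xi> (Y t) b)" by (simp add: linear_sum[OF lin_Y[OF t]] linear_scale[OF lin_Y[OF t]])
  finally show ?thesis
    unfolding a_def inner_sum_left inner_scaleR_left by (simp add: inner_commute[of v] mult.commute)
qed

lemma B_b: "t \<in> V \<Longrightarrow> B t *v (b t *v v) = v" and b_B: "t \<in> V \<Longrightarrow> b t *v (B t *v v) = v"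
  using B1 B2 by (simp_all add: matrix_vector_mul_assoc b_def)

lemma RY_uncorr: assumes t: "t \<in> V" shows "RY t \<in> uncorr \<xi>"
proof -
  have "(\<lambda>\<omega>. (Y t \<omega> - coef \<xi> (Y t) (\<xi> \<omega>)) \<bullet> 1) \<in> uncorr \<xi>"
    by (rule residual_uncorr[OF xi Y_inner_L[OF VG[OF t]] white])
  then show ?thesis by (simp add: RY_def[abs_def] a_inner[OF t])
qed

lemma RD_uncorr: "t \<in> V \<Longrightarrow> (\<lambda>\<omega>. RD t \<omega> \<bullet> w) \<in> uncorr \<xi>"
  unfolding RD_def by (rule residual_uncorr[OF xi D_L[OF VG] white])

lemma RH_uncorr: "t \<in> V \<Longrightarrow> (\<lambda>\<omega>. RH t \<omega> \<bullet> w) \<in> uncorr \<xi>"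
  unfolding RH_def by (rule residual_uncorr[OF xi H_L[OF VG] white])

lemma D_eq: "t \<in> V \<Longrightarrow> D t \<omega> = b t *v (\<xi> \<omega> - W t \<omega>)"
  by (simp add: W_def matrix_vector_right_distrib b_B RD_def b_mult[of t "\<xi> \<omega>"])

lemma D_zero_iff: "t \<in> V \<Longrightarrow> D t \<omega> = 0 \<longleftrightarrow> W t \<omega> = \<xi> \<omega>"
  using D_eq[of t \<omega>] B_b[of t "\<xi> \<omega> - W t \<omega>"] by auto

lemma Y_at_zero: "t \<in> V \<Longrightarrow> W t \<omega> = \<xi> \<omega> \<Longrightarrow> Yt t \<omega> = Y t \<omega>"
  using inner_minus_right[of "a t" "B t *v RD t \<omega>"] by (simp add: W_def Yt_def RY_def)

lemma H_at_zero: assumes t: "t \<in> V" and w: "W t \<omega> = \<xi> \<omega>" shows "Mt t \<omega> = H t \<omega>"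
proof -
  have "B t *v RD t \<omega> = - \<xi> \<omega>" using w by (simp add: W_def minus_equation_iff)
  then show ?thesis by (simp add: Mt_def RH_def linear_neg[OF lin_H[OF t]])
qed

text \<open>Since \<open>B\<close> is only known to be continuous, \<open>W\<close> cannot be
  differentiated as a product. With v0 = W t held fixed, W y = v0 - B y g(y), where g is the
  gradient with \<xi> replaced by v0; it vanishes at \<open>t\<close>, so
  \<open>has_derivative_mult_vanishing\<close> applies. The derivative of g at \<open>t\<close> is
  the Hessian with the same replacement, which is \<open>Mt t\<close>.\<close>

lemma W_derivative:
  assumes w: "\<omega> \<in> space M" and t: "t \<in> V"
  shows "((\<lambda>t. W t \<omega>) has_derivative (\<lambda>h. A t \<omega> *v h)) (at t)"
proof -
  define v0 where "v0 = W t \<omega>"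
  define g where "g y = D y \<omega> - coef \<xi> (D y) (\<xi> \<omega>) + coef \<xi> (D y) v0" for y
  have "(g has_derivative (\<lambda>h. H t \<omega> *v h - coef \<xi> (H t) (\<xi> \<omega>) *v h + coef \<xi> (H t) v0 *v h)) (at t)"
    unfolding g_def[abs_def] by (intro derivative_intros D_der[OF w VG[OF t]] coef_D_derivative[OF xi VG[OF t]])
  moreover have "H t \<omega> *v h - coef \<xi> (H t) (\<xi> \<omega>) *v h + coef \<xi> (H t) v0 *v h = Mt t \<omega> *v h" for h
    by (simp add: Mt_def RH_def v0_def W_def linear_neg[OF lin_H[OF t]] matrix_vector_mult_diff_rdistrib matrix_vector_mult_uminus)
  ultimately have g': "(g has_derivative (\<lambda>h. Mt t \<omega> *v h)) (at t)" by simp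
  have "coef \<xi> (D t) v0 = - RD t \<omega>" using b_B[OF t, of "RD t \<omega>"]
    by (simp add: v0_def W_def b_mult[OF t, symmetric] linear_neg[OF matrix_vector_mul_linear])
  then have g0: "g t = 0" by (simp add: g_def RD_def)
  have "isCont B t" using B_cont V(1) t by (simp add: continuous_on_eq_continuous_at)
  from has_derivative_mult_vanishing[OF this g' g0]
  have "((\<lambda>y. v0 - B y *v g y) has_derivative (\<lambda>h. 0 - B t *v (Mt t \<omega> *v h))) (at t)"
    by (intro derivative_intros)
  then have "((\<lambda>y. v0 - B y *v g y) has_derivative (\<lambda>h. A t \<omega> *v h)) (at t)"
    by (simp add: A_def matrix_vector_mul_assoc matrix_vector_mult_uminus)
  then show ?thesis
  proof (rule has_derivative_transform_within_open[OF _ V(1) t])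
    fix y assume y: "y \<in> V"
    have "g y = RD y \<omega> + b y *v v0" by (simp add: g_def RD_def b_mult[OF y])
    then show "v0 - B y *v g y = W y \<omega>" by (simp add: matrix_vector_right_distrib B_b[OF y] W_def)
  qed
qed

lemma W_cont: "\<omega> \<in> space M \<Longrightarrow> continuous_on V (\<lambda>t. W t \<omega>)"
  using W_derivative by (meson continuous_at_imp_continuous_on has_derivative_continuous)

lemma coef_compose_cont:
  fixes X :: "real^'n \<Rightarrow> 'a \<Rightarrow> 'e::euclidean_space"
  assumes X: "\<And>s w. s \<in> G \<Longrightarrow> (\<lambda>\<omega>. X s \<omega> \<bullet> w) \<in> L"
    and cont: "\<And>\<omega>. \<omega> \<in> space M \<Longrightarrow> continuous_on G (\<lambda>s. X s \<omega>)" and f: "continuous_on V f"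
  shows "continuous_on V (\<lambda>t. coef \<xi> (X t) (f t))"
proof -
  have "coef \<xi> (X t) (f t) = (\<Sum>b\<in>Basis. (f t \<bullet> b) *\<^sub>R coef \<xi> (X t) b)" if "t \<in> V" for t
  proof -
    note lin = linear_coef[OF xi X[OF VG[OF that]]]
    have "coef \<xi> (X t) (f t) = coef \<xi> (X t) (\<Sum>b\<in>Basis. (f t \<bullet> b) *\<^sub>R b)" by (simp add: euclidean_representation)
    then show ?thesis by (simp add: linear_sum[OF lin] linear_scale[OF lin])
  qed
  moreover have "continuous_on V (\<lambda>t. \<Sum>b\<in>Basis. (f t \<bullet> b) *\<^sub>R coef \<xi> (X t) b)"
    by (intro continuous_intros f continuous_on_subset[OF covar_continuous[OF X cont xi] V(2)])
  ultimately show ?thesis by (simp cong: continuous_on_cong)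
qed

lemma BRD_eq: "B t *v RD t \<omega> = - W t \<omega>" by (simp add: W_def)

lemma Mt_cont: assumes w: "\<omega> \<in> space M" shows "continuous_on V (\<lambda>t. Mt t \<omega>)"
  unfolding Mt_def RH_def BRD_eq
  by (intro continuous_intros continuous_on_subset[OF H_cont[OF w] V(2)] coef_compose_cont[OF H_L H_cont] W_cont[OF w])

lemma A_cont: "\<omega> \<in> space M \<Longrightarrow> continuous_on V (\<lambda>t. A t \<omega>)"
  unfolding A_def matrix_matrix_mult_def
  by (intro continuous_on_minus continuous_on_vec_lambda continuous_on_sum continuous_on_mult continuous_on_component B_cont Mt_cont)

lemma Yt_cont: assumes w: "\<omega> \<in> space M" shows "continuous_on V (\<lambda>t. Yt t \<omega>)"
proof -
  have "continuous_on V (\<lambda>t. Y t \<omega> - coef \<xi> (Y t) (\<xi> \<omega>) - coef \<xi> (Y t) (- W t \<omega>))"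
    by (intro continuous_intros continuous_on_subset[OF Y_cont[OF w] V(2)] coef_compose_cont[OF Y_inner_L Y_cont] W_cont[OF w])
  then show ?thesis by (rule continuous_on_cong[THEN iffD1, rotated 2]) (auto simp: Yt_def RY_def a_inner BRD_eq linear_neg[OF lin_Y])
qed

lemma det_b: assumes t: "t \<in> V" shows "det (b t) \<noteq> 0"
proof -
  have "det (B t) * det (b t) = 1" using B1[OF t] by (metis b_def det_mul det_I)
  then show ?thesis by auto
qed

lemma abs_det_A: assumes t: "t \<in> V" shows "\<bar>det (A t \<omega>)\<bar> = \<bar>det (Mt t \<omega>)\<bar> / \<bar>det (b t)\<bar>"
proof -
  have "det (B t) * det (b t) = 1" using B1[OF t] by (metis b_def det_mul det_I)
  then have "\<bar>det (B t)\<bar> = 1 / \<bar>det (b t)\<bar>" using det_b[OF t] by (simp add: field_simps abs_mult[symmetric])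
  then show ?thesis by (simp add: A_def abs_det_minus det_mul abs_mult)
qed

lemma RY_meas: "t \<in> V \<Longrightarrow> RY t \<in> borel_measurable (uncorr_algebra \<xi>)" by (rule uncorr_measurable[OF RY_uncorr])
lemma RD_meas: "t \<in> V \<Longrightarrow> RD t \<in> borel_measurable (uncorr_algebra \<xi>)" by (rule uncorr_vector_measurable[OF RD_uncorr])
lemma RH_meas: "t \<in> V \<Longrightarrow> RH t \<in> borel_measurable (uncorr_algebra \<xi>)" by (rule uncorr_vector_measurable[OF RH_uncorr])

lemma mult_meas: "(*v) N \<in> borel_measurable borel" for N :: "real^'n^'n"
  by (intro borel_measurable_continuous_onI linear_continuous_on matrix_vector_mul_bounded_linear)

lemma W_meas: assumes t: "t \<in> V" shows "W t \<in> borel_measurable (uncorr_algebra \<xi>)"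
proof -
  note [measurable] = RD_meas[OF t] mult_meas
  show ?thesis unfolding W_def[abs_def] by measurable
qed

lemma Yt_meas: assumes t: "t \<in> V" shows "Yt t \<in> borel_measurable (uncorr_algebra \<xi>)"
proof -
  note [measurable] = RD_meas[OF t] RY_meas[OF t] mult_meas
  show ?thesis unfolding Yt_def[abs_def] by measurable
qed

lemma Mt_meas: assumes t: "t \<in> V" shows "Mt t \<in> borel_measurable (uncorr_algebra \<xi>)"
proof -
  have [measurable]: "coef \<xi> (H t) \<in> borel_measurable borel"
    by (intro borel_measurable_continuous_onI linear_continuous_on lin_H[OF t, unfolded linear_conv_bounded_linear])
  note [measurable] = RD_meas[OF t] RH_meas[OF t] mult_meas
  show ?thesis unfolding Mt_def[abs_def] by measurable
qed

end


text \<open>The Rice integrand for one triple of value, gradient and Hessian, freed from charts;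
  \<open>rice_density_chart\<close> restores them.\<close>

definition rice_density ::
  "'a measure \<Rightarrow> real \<Rightarrow> nat \<Rightarrow> ('a \<Rightarrow> real) \<Rightarrow> ('a \<Rightarrow> real^'n::finite) \<Rightarrow> ('a \<Rightarrow> real^'n^'n) \<Rightarrow> ennreal" where
  "rice_density M u k y d h = (\<integral>\<^sup>+x\<in>{u<..}.
     ((\<integral>\<^sup>+N. ennreal (delta k N) \<partial>cond_law M h (\<lambda>\<omega>. (y \<omega>, d \<omega>)) (x, 0)) *
      ennreal (joint_density M (\<lambda>\<omega>. (y \<omega>, d \<omega>)) (x, 0))) \<partial>lborel)"

section \<open>The formula near one point\<close>

context whitened_field
begin

text \<open>For a fixed outcome this is the integrand over t in the area formula for
  \<open>W\<close>, with the density of \<xi> as weight: |det B| |det Mt| is the Jacobian of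
  \<open>W\<close>, and the indicator and \<open>delta k\<close> carry the conditions on value and
  Hessian.\<close>

definition Psi where
  "Psi u k t \<omega> = ennreal (unit_gauss m (W t \<omega>) * \<bar>det (B t)\<bar>) * (indicator {u<..} (Yt t \<omega>) * ennreal (delta k (Mt t \<omega>)))"

lemma abs_det_B: assumes t: "t \<in> V" shows "\<bar>det (B t)\<bar> = 1 / \<bar>det (b t)\<bar>"
proof -
  have "det (B t) * det (b t) = 1" using B1[OF t] by (metis b_def det_mul det_I)
  then show ?thesis using det_b[OF t] by (simp add: field_simps abs_mult[symmetric])
qed

text \<open>An instance of \<open>conditional_identity\<close>, for the function that is
  \<open>delta k\<close> of the Hessian where the value exceeds u and 0 elsewhere; its division by
  |det b| is multiplication by |det B|.\<close>

lemma rice_density_eq: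
  assumes t: "t \<in> V"
  shows "rice_density M u k (Y t) (D t) (H t) = (\<integral>\<^sup>+\<omega>. Psi u k t \<omega> \<partial>M)"
proof -
  let ?H = "\<lambda>(x, N). indicator {u<..} x * ennreal (delta k N)"
  have Hm: "?H \<in> borel_measurable (borel \<Otimes>\<^sub>M borel)" by measurable
  have "(\<integral>\<^sup>+\<omega>. Psi u k t \<omega> \<partial>M) = (\<integral>\<^sup>+\<omega>. ennreal (unit_gauss m (- (B t *v RD t \<omega>)) / \<bar>det (b t)\<bar>) * ?H (RY t \<omega> - a t \<bullet> (B t *v RD t \<omega>), RH t \<omega> - coef \<xi> (H t) (B t *v RD t \<omega>)) \<partial>M)"
    by (simp add: Psi_def abs_det_B[OF t] W_def Yt_def Mt_def)
  also have "\<dots> = (\<integral>\<^sup>+x. (\<integral>\<^sup>+v. ?H (x, v) \<partial>cond_law M (H t) (\<lambda>\<omega>. (Y t \<omega>, D t \<omega>)) (x, 0)) * ennreal (joint_density M (\<lambda>\<omega>. (Y t \<omega>, D t \<omega>)) (x, 0)) \<partial>lborel)"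
  proof (rule conditional_identity[OF Y_L[OF VG[OF t]] D_L[OF VG[OF t]] H_L[OF VG[OF t]] nondeg[OF VG[OF t]] xi xi_law RY_uncorr[OF t] RD_uncorr[OF t] RH_uncorr[OF t] _ _ _ lin_H[OF t] _ _ Hm])
    show "Y t \<omega> = RY t \<omega> + a t \<bullet> \<xi> \<omega>" for \<omega> by (simp add: RY_def)
    show "D t \<omega> = RD t \<omega> + b t *v \<xi> \<omega>" for \<omega> by (simp add: RD_def b_mult[OF t])
    show "H t \<omega> = RH t \<omega> + coef \<xi> (H t) (\<xi> \<omega>)" for \<omega> by (simp add: RH_def)
    show "B t ** b t = mat 1" "b t ** B t = mat 1" using B1[OF t] B2[OF t] by (simp_all add: b_def)
  qed
  also have "\<dots> = rice_density M u k (Y t) (D t) (H t)"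
    unfolding rice_density_def
  proof (intro nn_integral_cong)
    fix x
    have "(\<integral>\<^sup>+v. ?H (x, v) \<partial>cond_law M (H t) (\<lambda>\<omega>. (Y t \<omega>, D t \<omega>)) (x, 0)) = indicator {u<..} x * (\<integral>\<^sup>+v. ennreal (delta k v) \<partial>cond_law M (H t) (\<lambda>\<omega>. (Y t \<omega>, D t \<omega>)) (x, 0))"
      unfolding prod.case by (rule nn_integral_cmult) (simp add: cond_law_def)
    then show "(\<integral>\<^sup>+v. ?H (x, v) \<partial>cond_law M (H t) (\<lambda>\<omega>. (Y t \<omega>, D t \<omega>)) (x, 0)) * ennreal (joint_density M (\<lambda>\<omega>. (Y t \<omega>, D t \<omega>)) (x, 0)) =
      (\<integral>\<^sup>+v. ennreal (delta k v) \<partial>cond_law M (H t) (\<lambda>\<omega>. (Y t \<omega>, D t \<omega>)) (x, 0)) * ennreal (joint_density M (\<lambda>\<omega>. (Y t \<omega>, D t \<omega>)) (x, 0)) * indicator {u<..} x"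
      by (simp add: ac_simps)
  qed
  finally show ?thesis ..
qed

lemma meas_M: "t \<in> V \<Longrightarrow> W t \<in> borel_measurable M" "t \<in> V \<Longrightarrow> Yt t \<in> borel_measurable M" "t \<in> V \<Longrightarrow> Mt t \<in> borel_measurable M"
  using measurable_uncorr_algebra[OF W_meas] measurable_uncorr_algebra[OF Yt_meas] measurable_uncorr_algebra[OF Mt_meas] by auto

lemma Psi_measurable: "(\<lambda>(t, \<omega>). indicator V t * Psi u k t \<omega>) \<in> borel_measurable (borel \<Otimes>\<^sub>M M)"
proof -
  let ?W = "\<lambda>p. if fst p \<in> V then W (fst p) (snd p) else 0"
  let ?Y = "\<lambda>p. if fst p \<in> V then Yt (fst p) (snd p) else 0"
  let ?M = "\<lambda>p. if fst p \<in> V then Mt (fst p) (snd p) else 0"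
  have [measurable]: "?W \<in> borel_measurable (borel \<Otimes>\<^sub>M M)" "?Y \<in> borel_measurable (borel \<Otimes>\<^sub>M M)" "?M \<in> borel_measurable (borel \<Otimes>\<^sub>M M)"
    by (rule measurable_caratheodory[where f = "\<lambda>\<omega> t. W t \<omega>", OF V(1) W_cont meas_M(1)], assumption+,
        rule measurable_caratheodory[where f = "\<lambda>\<omega> t. Yt t \<omega>", OF V(1) Yt_cont meas_M(2)], assumption+,
        rule measurable_caratheodory[where f = "\<lambda>\<omega> t. Mt t \<omega>", OF V(1) Mt_cont meas_M(3)], assumption+)
  have [measurable]: "V \<in> sets borel" using V(1) by simp
  have [measurable]: "(\<lambda>t. if t \<in> V then det (B t) else 0) \<in> borel_measurable borel"
    by (rule borel_measurable_continuous_on_if) (auto intro: continuous_on_det B_cont)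
  have "(\<lambda>p. indicator V (fst p) * (ennreal (unit_gauss m (?W p) * \<bar>if fst p \<in> V then det (B (fst p)) else 0\<bar>) * (indicator {u<..} (?Y p) * ennreal (delta k (?M p))))) \<in> borel_measurable (borel \<Otimes>\<^sub>M M)"
    by measurable
  moreover have "(\<lambda>p. indicator V (fst p) * (ennreal (unit_gauss m (?W p) * \<bar>if fst p \<in> V then det (B (fst p)) else 0\<bar>) * (indicator {u<..} (?Y p) * ennreal (delta k (?M p))))) = (\<lambda>(t, \<omega>). indicator V t * Psi u k t \<omega>)"
  proof (rule ext)
    fix p show "indicator V (fst p) * (ennreal (unit_gauss m (?W p) * \<bar>if fst p \<in> V then det (B (fst p)) else 0\<bar>) * (indicator {u<..} (?Y p) * ennreal (delta k (?M p)))) = (case p of (t, \<omega>) \<Rightarrow> indicator V t * Psi u k t \<omega>)"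
      by (cases p, cases "fst p \<in> V") (simp_all add: Psi_def)
  qed
  ultimately show ?thesis by (simp only:)
qed

lemma rice_density_measurable: "(\<lambda>t. indicator V t * rice_density M u k (Y t) (D t) (H t)) \<in> borel_measurable borel"
proof -
  have "(\<lambda>t. \<integral>\<^sup>+\<omega>. indicator V t * Psi u k t \<omega> \<partial>M) \<in> borel_measurable borel"
    by (rule borel_measurable_nn_integral[OF Psi_measurable])
  moreover have "(\<integral>\<^sup>+\<omega>. indicator V t * Psi u k t \<omega> \<partial>M) = indicator V t * rice_density M u k (Y t) (D t) (H t)" for t
    by (cases "t \<in> V") (simp_all add: rice_density_eq)
  ultimately show ?thesis by simp
qed

lemma xi_meas: "\<xi> \<in> borel_measurable M" by (rule L_vector_measurable[OF xi])

lemma pair_meas: "(\<lambda>\<omega>. (\<omega>, \<xi> \<omega>)) \<in> measurable M (uncorr_algebra \<xi> \<Otimes>\<^sub>M borel)"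
proof -
  have [measurable]: "(\<lambda>\<omega>. \<omega>) \<in> measurable M (uncorr_algebra \<xi>)"
    using measurable_uncorr_algebra[of "\<lambda>\<omega>. \<omega>" \<xi> "uncorr_algebra \<xi>"] by simp
  note [measurable] = xi_meas
  show ?thesis by measurable
qed

lemma xi_integral:
  assumes Phi: "Phi \<in> borel_measurable (uncorr_algebra \<xi> \<Otimes>\<^sub>M borel)"
  shows "(\<integral>\<^sup>+\<omega>. Phi (\<omega>, \<xi> \<omega>) \<partial>M) = (\<integral>\<^sup>+\<omega>. \<integral>\<^sup>+v. ennreal (unit_gauss m v) * Phi (\<omega>, v) \<partial>lborel \<partial>M)"
  unfolding uncorr_independent[OF xi Phi] xi_law
proof (intro nn_integral_cong nn_integral_density)
  fix \<omega> assume "\<omega> \<in> space M"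
  then have "(\<lambda>v. Phi (\<omega>, v)) \<in> borel_measurable borel"
    using measurable_Pair2[OF Phi, of \<omega>] by simp
  then show "(\<lambda>v. Phi (\<omega>, v)) \<in> borel_measurable lborel" by simp
qed auto

lemma count_rice:
  assumes S: "S \<in> sets borel" "S \<subseteq> V"
  shows "(\<lambda>\<omega>. emeasure (count_space UNIV) {t\<in>S. D t \<omega> = 0 \<and> u < Y t \<omega> \<and> good k (H t \<omega>)}) \<in> borel_measurable M" (is ?m)
    and "(\<integral>\<^sup>+\<omega>. emeasure (count_space UNIV) {t\<in>S. D t \<omega> = 0 \<and> u < Y t \<omega> \<and> good k (H t \<omega>)} \<partial>M) =
      (\<integral>\<^sup>+t. indicator S t * rice_density M u k (Y t) (D t) (H t) \<partial>lborel)" (is ?i)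
proof -
  let ?c = "emeasure (count_space UNIV)"
  \<comment> \<open>Positivity of this one function, continuous in t, expresses both open
    conditions, a counted Hessian and a value above u, through the residuals alone.\<close>
  define \<rho> where "\<rho> \<omega> t = min (good_dist k (Mt t \<omega>)) (Yt t \<omega> - u)" for \<omega> t
  define Phi where "Phi p = ?c {t\<in>S. W t (fst p) = snd p \<and> 0 < \<rho> (fst p) t}" for p
  have rpos: "0 < \<rho> \<omega> t \<longleftrightarrow> good k (Mt t \<omega>) \<and> u < Yt t \<omega>" for \<omega> t
    using good_dist_pos_iff[of k "Mt t \<omega>"] by (auto simp: \<rho>_def)
  have rc: "continuous_on V (\<rho> \<omega>)" if "\<omega> \<in> space M" for \<omega>
    unfolding \<rho>_def[abs_def] by (intro continuous_intros continuous_good_dist Mt_cont Yt_cont that)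
  have detA: "det (A t \<omega>) \<noteq> 0" if "t \<in> V" "0 < \<rho> \<omega> t" for t \<omega>
    using abs_det_A[OF that(1), of \<omega>] that(2) det_b[OF that(1)] by (auto simp: rpos good_def)
  have Phi_m: "Phi \<in> borel_measurable (uncorr_algebra \<xi> \<Otimes>\<^sub>M borel)"
    unfolding Phi_def[abs_def]
  proof (rule measurable_count_regular[where W = "\<lambda>\<omega> t. W t \<omega>", OF V(1) _ W_meas _ _ _ S])
    show "\<exists>r>0. inj_on (\<lambda>t. W t \<omega>) (ball t r)" if w': "\<omega> \<in> space (uncorr_algebra \<xi>)" and tV: "t \<in> V" and tr: "0 < \<rho> \<omega> t" for \<omega> t
    proof -
      have w: "\<omega> \<in> space M" using w' by simp
      obtain r where "r > 0" "ball t r \<subseteq> V" "inj_on (\<lambda>t. W t \<omega>) (ball t r)"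
        by (rule C1_locally_injective[OF V(1) tV W_derivative[OF w] A_cont[OF w] detA[OF tV tr]])
      then show ?thesis by blast
    qed
    show "(\<lambda>\<omega>. \<rho> \<omega> t) \<in> borel_measurable (uncorr_algebra \<xi>)" if "t \<in> V" for t
    proof -
      have [measurable]: "good_dist k \<in> borel_measurable (borel :: (real^'n^'n) measure)"
        by (intro borel_measurable_continuous_onI continuous_good_dist continuous_on_id)
      note [measurable] = Mt_meas[OF that] Yt_meas[OF that]
      show ?thesis unfolding \<rho>_def by measurable
    qed
  qed (use W_cont rc in auto)
  have cnt: "?c {t\<in>S. D t \<omega> = 0 \<and> u < Y t \<omega> \<and> good k (H t \<omega>)} = Phi (\<omega>, \<xi> \<omega>)" for \<omega>
  proof -
    have "{t\<in>S. D t \<omega> = 0 \<and> u < Y t \<omega> \<and> good k (H t \<omega>)} = {t\<in>S. W t \<omega> = \<xi> \<omega> \<and> 0 < \<rho> \<omega> t}"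
      using S(2) by (auto simp: D_zero_iff rpos Y_at_zero H_at_zero subset_eq)
    then show ?thesis by (simp add: Phi_def)
  qed
  show ?m unfolding cnt by (rule measurable_compose[OF pair_meas Phi_m])
  have inner: "(\<integral>\<^sup>+v. ennreal (unit_gauss m v) * Phi (\<omega>, v) \<partial>lborel) = (\<integral>\<^sup>+t. indicator S t * Psi u k t \<omega> \<partial>lborel)"
    if w: "\<omega> \<in> space M" for \<omega>
  proof -
    \<comment> \<open>On this part of \<open>S\<close> the Jacobian of \<open>W\<close> does not
      vanish, as the area formula demands.\<close>
    let ?T = "S \<inter> (V \<inter> \<rho> \<omega> -` {0<..})"
    have "open (V \<inter> \<rho> \<omega> -` {0<..})" by (rule continuous_open_preimage[OF rc[OF w] V(1)]) simp
    then have T: "?T \<in> sets borel" "?T \<subseteq> V" using S by auto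
    have "Phi (\<omega>, v) = ?c {t\<in>?T. W t \<omega> = v}" for v
      using S(2) by (auto simp: Phi_def intro!: arg_cong[where f = ?c])
    then have "(\<integral>\<^sup>+v. ennreal (unit_gauss m v) * Phi (\<omega>, v) \<partial>lborel) = (\<integral>\<^sup>+v. ennreal (unit_gauss m v) * ?c {t\<in>?T. W t \<omega> = v} \<partial>lborel)" by simp
    also have "\<dots> = (\<integral>\<^sup>+t. indicator ?T t * (ennreal \<bar>det (A t \<omega>)\<bar> * ennreal (unit_gauss m (W t \<omega>))) \<partial>lborel)"
      by (rule area_formula[OF V(1) W_derivative[OF w] A_cont[OF w] T]) (use detA T in auto)
    also have "\<dots> = (\<integral>\<^sup>+t. indicator S t * Psi u k t \<omega> \<partial>lborel)"
    proof (intro nn_integral_cong)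
      fix t
      show "indicator ?T t * (ennreal \<bar>det (A t \<omega>)\<bar> * ennreal (unit_gauss m (W t \<omega>))) = indicator S t * Psi u k t \<omega>"
      proof (cases "t \<in> S")
        case True
        then have tV: "t \<in> V" using S by auto
        show ?thesis
        proof (cases "0 < \<rho> \<omega> t")
          case r: True
          then have "delta k (Mt t \<omega>) = \<bar>det (Mt t \<omega>)\<bar>" "u < Yt t \<omega>" by (auto simp: delta_eq rpos)
          moreover have "ennreal \<bar>det (A t \<omega>)\<bar> * ennreal (unit_gauss m (W t \<omega>)) = ennreal (unit_gauss m (W t \<omega>) * \<bar>det (B t)\<bar>) * ennreal \<bar>det (Mt t \<omega>)\<bar>"
            using unit_gauss_bounds(1)[of m "W t \<omega>"] unfolding abs_det_A[OF tV] abs_det_B[OF tV]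
            by (subst (1 2) ennreal_mult[symmetric]) (auto simp: less_imp_le)
          ultimately show ?thesis using True tV r by (simp add: Psi_def)
        next
          case r: False
          then have "delta k (Mt t \<omega>) = 0 \<or> \<not> u < Yt t \<omega>" by (auto simp: delta_eq rpos)
          then show ?thesis using r by (auto simp: Psi_def)
        qed
      qed simp
    qed
    finally show ?thesis .
  qed
  have "(\<integral>\<^sup>+\<omega>. ?c {t\<in>S. D t \<omega> = 0 \<and> u < Y t \<omega> \<and> good k (H t \<omega>)} \<partial>M) = (\<integral>\<^sup>+\<omega>. \<integral>\<^sup>+t. indicator S t * Psi u k t \<omega> \<partial>lborel \<partial>M)"
    unfolding cnt xi_integral[OF Phi_m] by (intro nn_integral_cong inner)
  also have "\<dots> = (\<integral>\<^sup>+t. \<integral>\<^sup>+\<omega>. indicator S t * Psi u k t \<omega> \<partial>M \<partial>lborel)"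
  proof -
    interpret pair_sigma_finite lborel M ..
    note [measurable] = Psi_measurable[of u k] S(1)
    have "(\<lambda>(t, \<omega>). indicator S t * (indicator V t * Psi u k t \<omega>)) \<in> borel_measurable (lborel \<Otimes>\<^sub>M M)"
      by measurable
    moreover have "(\<lambda>(t, \<omega>). indicator S t * (indicator V t * Psi u k t \<omega>)) = (\<lambda>(t, \<omega>). indicator S t * Psi u k t \<omega>)"
      using S(2) by (auto simp: fun_eq_iff indicator_def)
    ultimately show ?thesis by (intro Fubini') simp
  qed
  also have "\<dots> = (\<integral>\<^sup>+t. indicator S t * rice_density M u k (Y t) (D t) (H t) \<partial>lborel)"
  proof (intro nn_integral_cong)
    fix t show "(\<integral>\<^sup>+\<omega>. indicator S t * Psi u k t \<omega> \<partial>M) = indicator S t * rice_density M u k (Y t) (D t) (H t)"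
      using S(2) by (cases "t \<in> S") (auto simp: rice_density_eq subset_eq)
  qed
  finally show ?i .
qed

text \<open>By Sard's theorem the critical values of \<open>W\<close> are a null set, which the independent \<open>\<xi>\<close> almost surely
  avoids.\<close>

lemma AE_nondegenerate_zeros: "AE \<omega> in M. \<forall>t\<in>V. D t \<omega> = 0 \<longrightarrow> det (H t \<omega>) \<noteq> 0"
proof -
  let ?c = "emeasure (count_space UNIV)"
  \<comment> \<open>The zeros of g are the solutions of W t = v with singular \<open>Mt\<close>.
    This is a closed condition on an open set, so their number is measurable without any local
    finiteness.\<close>
  define g where "g p t = norm (W t (fst p) - snd p) + \<bar>det (Mt t (fst p))\<bar>" for p :: "'a \<times> (real^'n)" and t
  define Phi where "Phi p = ?c {t\<in>V. g p t = 0}" for p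
  have g_iff: "g p t = 0 \<longleftrightarrow> W t (fst p) = snd p \<and> det (Mt t (fst p)) = 0" for p t
    by (auto simp: g_def add_nonneg_eq_0_iff)
  have Phi_m: "Phi \<in> borel_measurable (uncorr_algebra \<xi> \<Otimes>\<^sub>M borel)"
    unfolding Phi_def[abs_def]
  proof (rule measurable_count_zeros_open[where V = V, OF _ _ _ V(1) order_refl])
    fix p assume "p \<in> space (uncorr_algebra \<xi> \<Otimes>\<^sub>M (borel :: (real^'n) measure))"
    then have "fst p \<in> space M" by (auto simp: space_pair_measure)
    then show "continuous_on V (g p)"
      unfolding g_def[abs_def] by (intro continuous_intros W_cont continuous_on_det Mt_cont)
  next
    fix t assume t: "t \<in> V"
    note [measurable] = W_meas[OF t] Mt_meas[OF t]
    show "(\<lambda>p. g p t) \<in> borel_measurable (uncorr_algebra \<xi> \<Otimes>\<^sub>M borel)"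
      unfolding g_def by measurable
  qed (simp add: g_def)
  have "(\<integral>\<^sup>+v. ennreal (unit_gauss m v) * Phi (\<omega>, v) \<partial>lborel) = 0" if w: "\<omega> \<in> space M" for \<omega>
  proof -
    obtain C where C: "\<And>n. compact (C n)" "\<And>n. C n \<subseteq> V" "\<And>n. C n \<subseteq> interior (C (Suc n))" "\<Union>(range C) = V"
      using open_Union_compact_subsets[OF V(1)] by metis
    \<comment> \<open>The singular points of \<open>W\<close> in \<open>V\<close> are the union of
      these countably many compact sets, to each of which \<open>sard_compact\<close>
      applies.\<close>
    define K where "K n = {t\<in>C n. det (Mt t \<omega>) = 0}" for n :: nat
    have K: "compact (K n)" for n
    proof -
      have "continuous_on (C n) (\<lambda>t. det (Mt t \<omega>))"
        by (intro continuous_on_det continuous_on_subset[OF Mt_cont[OF w] C(2)])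
      then have "closed (K n)" unfolding K_def
        by (rule continuous_closed_preimage_constant) (rule compact_imp_closed[OF C(1)])
      then have "compact (C n \<inter> K n)" using C(1) by (intro compact_Int_closed)
      moreover have "C n \<inter> K n = K n" by (auto simp: K_def)
      ultimately show ?thesis by simp
    qed
    have null: "(\<lambda>t. W t \<omega>) ` K n \<in> null_sets lborel" for n
    proof -
      have KV: "K n \<subseteq> V" using C(2)[of n] by (auto simp: K_def)
      have d: "((\<lambda>t. W t \<omega>) has_derivative (\<lambda>h. A t \<omega> *v h)) (at t within K n)" if "t \<in> K n" for t
        using W_derivative[OF w] that KV by (auto intro: has_derivative_at_withinI)
      have z: "det (matrix (\<lambda>h. A t \<omega> *v h)) = 0" if "t \<in> K n" for t
      proof -
        have "t \<in> V" "det (Mt t \<omega>) = 0" using that KV by (auto simp: K_def)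
        then show ?thesis using abs_det_A[of t \<omega>] by simp
      qed
      show ?thesis using sard_compact[OF K d z] by (simp add: null_sets_def)
    qed
    have "AE v in lborel. v \<notin> (\<Union>n. (\<lambda>t. W t \<omega>) ` K n)"
      by (rule AE_not_in) (use null in auto)
    then have "AE v in lborel. ennreal (unit_gauss m v) * Phi (\<omega>, v) = 0"
    proof (rule AE_mp, intro AE_I2 impI)
      fix v assume v: "v \<notin> (\<Union>n. (\<lambda>t. W t \<omega>) ` K n)"
      have "{t\<in>V. g (\<omega>, v) t = 0} = {}"
        using v C(4) by (auto simp: g_iff K_def)
      then have "Phi (\<omega>, v) = ?c ({} :: (real^'n) set)" unfolding Phi_def by (simp only:)
      then show "ennreal (unit_gauss m v) * Phi (\<omega>, v) = 0" by simp
    qed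
    then have "(\<integral>\<^sup>+v. ennreal (unit_gauss m v) * Phi (\<omega>, v) \<partial>lborel) = (\<integral>\<^sup>+v. 0 \<partial>(lborel :: (real^'n) measure))"
      by (rule nn_integral_cong_AE)
    then show ?thesis by simp
  qed
  then have "(\<integral>\<^sup>+\<omega>. Phi (\<omega>, \<xi> \<omega>) \<partial>M) = (\<integral>\<^sup>+\<omega>. 0 \<partial>M)"
    unfolding xi_integral[OF Phi_m] by (intro nn_integral_cong)
  then have "(\<integral>\<^sup>+\<omega>. Phi (\<omega>, \<xi> \<omega>) \<partial>M) = 0" by simp
  moreover have "(\<lambda>\<omega>. Phi (\<omega>, \<xi> \<omega>)) \<in> borel_measurable M" by (rule measurable_compose[OF pair_meas Phi_m])
  ultimately have "AE \<omega> in M. Phi (\<omega>, \<xi> \<omega>) = 0" by (simp add: nn_integral_0_iff_AE)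
  then show ?thesis
  proof (rule AE_mp, intro AE_I2 impI ballI)
    fix \<omega> t assume "Phi (\<omega>, \<xi> \<omega>) = 0" and t: "t \<in> V" "D t \<omega> = 0"
    then have e: "{t\<in>V. g (\<omega>, \<xi> \<omega>) t = 0} = {}"
      unfolding Phi_def by (simp add: emeasure_count_space_eq_0)
    have W: "W t \<omega> = \<xi> \<omega>" using t by (simp add: D_zero_iff)
    then have "det (Mt t \<omega>) \<noteq> 0" using e t by (auto simp: g_iff)
    then show "det (H t \<omega>) \<noteq> 0" using H_at_zero[OF t(1) W] by simp
  qed
qed

end

section \<open>From neighbourhoods to an open set\<close>

context c2_gaussian_field
begin

text \<open>At \<open>s\<close> itself the whitening matrix \<open>T\<close> is a left inverse of
  \<open>b s\<close>, because \<xi> is T applied to the gradient at \<open>s\<close> and has unit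
  covariance. The determinant of \<open>b\<close> is continuous, so \<open>b\<close> stays
  invertible on an open set around \<open>s\<close>, which is taken as \<open>V\<close>.\<close>

lemma whitened_exists:
  assumes s: "s \<in> G"
  obtains \<xi> m V B where "s \<in> V" "whitened_field M L G Y D H \<xi> m V B"
proof -
  have pos: "0 < covar (\<lambda>\<omega>. D s \<omega> \<bullet> v) (\<lambda>\<omega>. D s \<omega> \<bullet> v)" if "v \<noteq> 0" for v
  proof -
    have W: "(\<lambda>\<omega>. (Y s \<omega>, D s \<omega>) \<bullet> w) \<in> L" for w
      using L_add[OF L_scale[OF Y_L[OF s], of "fst w"] D_L[OF s, of "snd w"]] by (simp add: inner_prod_def mult.commute)
    show ?thesis using nondegenerate_covar_pos[OF W nondeg[OF s], of "(0, v)"] that by (simp add: inner_prod_def zero_prod_def)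
  qed
  obtain T :: "real^'n^'n" where T: "det T \<noteq> 0" "\<And>w. (\<lambda>\<omega>. (T *v D s \<omega>) \<bullet> w) \<in> L"
    "\<And>i j. covar (\<lambda>\<omega>. (T *v D s \<omega>) $ i) (\<lambda>\<omega>. (T *v D s \<omega>) $ j) = (if i = j then 1 else 0)"
    using whitening[OF D_L[OF s] pos] by blast
  define \<xi> where "\<xi> \<omega> = T *v D s \<omega>" for \<omega>
  have xi: "(\<lambda>\<omega>. \<xi> \<omega> \<bullet> w) \<in> L" for w unfolding \<xi>_def by (rule T(2))
  have wh: "covar (\<lambda>\<omega>. \<xi> \<omega> $ i) (\<lambda>\<omega>. \<xi> \<omega> $ j) = (if i = j then 1 else 0)" for i j unfolding \<xi>_def by (rule T(3))
  obtain m where m: "distr M borel \<xi> = density lborel (\<lambda>x. ennreal (unit_gauss m x))"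
    using white_law_cart[OF xi wh] by blast
  have white: "covar (\<lambda>\<omega>. \<xi> \<omega> \<bullet> v) (\<lambda>\<omega>. \<xi> \<omega> \<bullet> w) = v \<bullet> w" for v w
  proof -
    have bb: "covar (\<lambda>\<omega>. \<xi> \<omega> \<bullet> b) (\<lambda>\<omega>. \<xi> \<omega> \<bullet> b') = (if b = b' then 1 else 0)" if "b \<in> Basis" "b' \<in> Basis" for b b' :: "real^'n"
      using that by (auto simp: Basis_vec_def inner_axis wh axis_eq_axis)
    have "covar (\<lambda>\<omega>. \<xi> \<omega> \<bullet> v) (\<lambda>\<omega>. \<xi> \<omega> \<bullet> w) = (\<Sum>b\<in>Basis. (v \<bullet> b) * covar (\<lambda>\<omega>. \<xi> \<omega> \<bullet> w) (\<lambda>\<omega>. \<xi> \<omega> \<bullet> b))"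
      by (subst covar_inner_sum[OF xi xi]) (simp add: covar_sym)
    also have "\<dots> = (\<Sum>b\<in>Basis. (v \<bullet> b) * (w \<bullet> b))"
    proof (intro sum.cong refl)
      fix b :: "real^'n" assume b: "b \<in> Basis"
      have "covar (\<lambda>\<omega>. \<xi> \<omega> \<bullet> w) (\<lambda>\<omega>. \<xi> \<omega> \<bullet> b) = (\<Sum>b'\<in>Basis. (w \<bullet> b') * (if b' = b then 1 else 0))"
        using b by (subst covar_inner_sum[OF xi xi]) (auto intro!: sum.cong simp: bb)
      then show "(v \<bullet> b) * covar (\<lambda>\<omega>. \<xi> \<omega> \<bullet> w) (\<lambda>\<omega>. \<xi> \<omega> \<bullet> b) = (v \<bullet> b) * (w \<bullet> b)"
        using b by (simp add: if_distrib cong: if_cong)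
    qed
    finally show ?thesis by (simp add: euclidean_inner[of v w])
  qed
  define b where "b t = matrix (coef \<xi> (D t))" for t
  have bm: "b t *v v = coef \<xi> (D t) v" if "t \<in> G" for t v
    unfolding b_def using matrix_vector_mul(2)[OF linear_coef[OF xi D_L[OF that]]] by metis
  have bc: "continuous_on G b"
    unfolding b_def[abs_def] matrix_def
    by (intro continuous_on_vec_lambda continuous_on_component covar_continuous[OF D_L D_cont xi])
  have "T *v (b s *v v) = v" for v
  proof -
    have TX: "(T *v x) $ i = x \<bullet> T $ i" for x i by (simp add: matrix_vector_mult_def inner_vec_def mult.commute)
    have "(T *v (b s *v v)) $ i = v $ i" for i
    proof -
      have "(T *v (b s *v v)) $ i = covar (\<lambda>\<omega>. D s \<omega> \<bullet> T $ i) (\<lambda>\<omega>. \<xi> \<omega> \<bullet> v)"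
        unfolding TX bm[OF s] coef_inner[OF xi D_L[OF s]] ..
      also have "(\<lambda>\<omega>. D s \<omega> \<bullet> T $ i) = (\<lambda>\<omega>. \<xi> \<omega> \<bullet> axis i 1)" by (simp add: \<xi>_def inner_axis TX)
      also have "covar (\<lambda>\<omega>. \<xi> \<omega> \<bullet> axis i 1) (\<lambda>\<omega>. \<xi> \<omega> \<bullet> v) = axis i 1 \<bullet> v" by (rule white)
      also have "\<dots> = v $ i" by (simp add: inner_commute[of "axis i 1"] inner_axis)
      finally show ?thesis .
    qed
    then show ?thesis by (simp add: vec_eq_iff)
  qed
  then have "T ** b s = mat 1" by (simp add: matrix_eq matrix_vector_mul_assoc[symmetric])
  then have "det T * det (b s) = 1" by (metis det_mul det_I)
  then have dbs: "det (b s) \<noteq> 0" by auto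
  define V where "V = G \<inter> (\<lambda>t. det (b t)) -` (- {0})"
  have V: "open V" unfolding V_def by (rule continuous_open_preimage[OF continuous_on_det[OF bc] G]) auto
  have VG: "V \<subseteq> G" and sV: "s \<in> V" using s dbs by (auto simp: V_def)
  obtain B where B: "continuous_on V B" "\<And>t. t \<in> V \<Longrightarrow> B t ** b t = mat 1" "\<And>t. t \<in> V \<Longrightarrow> b t ** B t = mat 1"
    using continuous_matrix_inverse[OF continuous_on_subset[OF bc VG]] by (auto simp: V_def)
  have "whitened_field M L G Y D H \<xi> m V B"
    by unfold_locales (use xi white m V VG B in \<open>auto simp: b_def\<close>)
  then show ?thesis using that sV by blast
qed

text \<open>Both sides of the integral formula are countably additive in \<open>S\<close>, and
  Lindelof's theorem covers \<open>G\<close> by countably many whitened neighbourhoods; their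
  exceptional null sets are countably many too.\<close>

theorem rice_formula:
  shows "AE \<omega> in M. \<forall>t\<in>G. D t \<omega> = 0 \<longrightarrow> det (H t \<omega>) \<noteq> 0"
    and "(\<lambda>t. rice_density M u k (Y t) (D t) (H t) * indicator G t) \<in> borel_measurable borel"
    and "S \<in> sets borel \<Longrightarrow> S \<subseteq> G \<Longrightarrow> (\<lambda>\<omega>. emeasure (count_space UNIV) {t\<in>S. D t \<omega> = 0 \<and> u < Y t \<omega> \<and> good k (H t \<omega>)}) \<in> borel_measurable M"
    and "S \<in> sets borel \<Longrightarrow> S \<subseteq> G \<Longrightarrow> (\<integral>\<^sup>+\<omega>. emeasure (count_space UNIV) {t\<in>S. D t \<omega> = 0 \<and> u < Y t \<omega> \<and> good k (H t \<omega>)} \<partial>M) =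
      (\<integral>\<^sup>+t. rice_density M u k (Y t) (D t) (H t) * indicator S t \<partial>lborel)"
proof -
  let ?c = "emeasure (count_space UNIV)" and ?r = "\<lambda>t. rice_density M u k (Y t) (D t) (H t)"
  have "\<forall>s\<in>G. \<exists>V. s \<in> V \<and> (\<exists>\<xi> m B. whitened_field M L G Y D H \<xi> m V B)"
  proof
    fix s assume s: "s \<in> G"
    show "\<exists>V. s \<in> V \<and> (\<exists>\<xi> m B. whitened_field M L G Y D H \<xi> m V B)"
      by (rule whitened_exists[OF s]) blast
  qed
  from bchoice[OF this] obtain V where V: "\<forall>s\<in>G. s \<in> V s \<and> (\<exists>\<xi> m B. whitened_field M L G Y D H \<xi> m (V s) B)"
    by (elim exE)
  have VO: "open (V s)" "V s \<subseteq> G" if sG: "s \<in> G" for s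
  proof -
    obtain \<xi> m B where "whitened_field M L G Y D H \<xi> m (V s) B" using V sG by blast
    then interpret whitened_field M L G Y D H \<xi> m "V s" B .
    show "open (V s)" "V s \<subseteq> G" using V by auto
  qed
  obtain F where F: "F \<subseteq> V ` G" "countable F" "\<Union>F = \<Union>(V ` G)"
    by (rule Lindelof[of "V ` G"]) (use VO in auto)
  define C where "C = from_nat_into (insert {} F)"
  have rC: "range C = insert {} F" unfolding C_def using F(2) by (intro range_from_nat_into) auto
  have UV: "\<Union>(V ` G) = G"
  proof (intro equalityI subsetI)
    fix t assume t: "t \<in> G"
    with V have "t \<in> V t" by simp
    with t show "t \<in> \<Union>(V ` G)" by (rule UN_I)
  qed (elim UN_E, rule subsetD[OF VO(2)])
  have UC: "(\<Union>i. C i) = G" unfolding rC using F(3) UV by simp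
  have Ci: "C i = {} \<or> (\<exists>s\<in>G. C i = V s)" for i
  proof -
    have "C i \<in> insert {} F" using rC by blast
    then show ?thesis using F(1) by auto
  qed
  have Co: "open (C i)" for i using Ci[of i] VO by auto
  have nd: "AE \<omega> in M. \<forall>t\<in>C i. D t \<omega> = 0 \<longrightarrow> det (H t \<omega>) \<noteq> 0"
    and rm: "(\<lambda>t. indicator (C i) t * ?r t) \<in> borel_measurable borel" for i
  proof -
    consider "C i = {}" | s where "s \<in> G" "C i = V s" using Ci[of i] by auto
    then have "(AE \<omega> in M. \<forall>t\<in>C i. D t \<omega> = 0 \<longrightarrow> det (H t \<omega>) \<noteq> 0) \<and> (\<lambda>t. indicator (C i) t * ?r t) \<in> borel_measurable borel"
    proof cases
      case 2
      then obtain \<xi> m B where "whitened_field M L G Y D H \<xi> m (V s) B" using V by blast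
      then interpret whitened_field M L G Y D H \<xi> m "V s" B .
      show ?thesis using AE_nondegenerate_zeros rice_density_measurable 2 by simp
    qed simp
    then show "AE \<omega> in M. \<forall>t\<in>C i. D t \<omega> = 0 \<longrightarrow> det (H t \<omega>) \<noteq> 0"
      "(\<lambda>t. indicator (C i) t * ?r t) \<in> borel_measurable borel" by auto
  qed
  have cr: "(\<lambda>\<omega>. ?c {t\<in>S. D t \<omega> = 0 \<and> u < Y t \<omega> \<and> good k (H t \<omega>)}) \<in> borel_measurable M \<and>
    (\<integral>\<^sup>+\<omega>. ?c {t\<in>S. D t \<omega> = 0 \<and> u < Y t \<omega> \<and> good k (H t \<omega>)} \<partial>M) = (\<integral>\<^sup>+t. indicator S t * ?r t \<partial>lborel)"
    if S: "S \<in> sets borel" "S \<subseteq> C i" for S i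
  proof -
    consider "C i = {}" | s where "s \<in> G" "C i = V s" using Ci[of i] by auto
    then show ?thesis
    proof cases
      case 1
      then show ?thesis using S by simp
    next
      case 2
      then obtain \<xi> m B where "whitened_field M L G Y D H \<xi> m (V s) B" using V by blast
      then interpret whitened_field M L G Y D H \<xi> m "V s" B .
      show ?thesis using count_rice S 2 by blast
    qed
  qed
  show "AE \<omega> in M. \<forall>t\<in>G. D t \<omega> = 0 \<longrightarrow> det (H t \<omega>) \<noteq> 0"
  proof -
    have "AE \<omega> in M. \<forall>i. \<forall>t\<in>C i. D t \<omega> = 0 \<longrightarrow> det (H t \<omega>) \<noteq> 0" unfolding AE_all_countable using nd by blast
    then show ?thesis by (rule AE_mp) (use UC in \<open>auto intro!: AE_I2\<close>)
  qed
  have db: "disjointed C i \<in> sets borel" for i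
  proof -
    have "range (disjointed C) \<subseteq> sets borel" by (rule sets.range_disjointed_sets) (use Co in auto)
    then show ?thesis by auto
  qed
  have ds: "disjointed C i \<subseteq> C i" for i by (rule disjointed_subset)
  have dd: "disjoint_family (disjointed C)" by (rule disjoint_family_disjointed)
  have dU: "(\<Union>i. disjointed C i) = G" using UN_disjointed_eq[of C] UC by simp
  have ind: "indicator S t = (\<Sum>i. indicator (S \<inter> disjointed C i) t :: ennreal)" if "S \<subseteq> G" for S t
  proof -
    have "(\<Sum>i. indicator (S \<inter> disjointed C i) t :: ennreal) = indicator (\<Union>i. S \<inter> disjointed C i) t"
      by (rule suminf_indicator) (use dd in \<open>auto simp: disjoint_family_on_def\<close>)
    moreover have "(\<Union>i. S \<inter> disjointed C i) = S" using dU that by auto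
    ultimately show ?thesis by simp
  qed
  have rmi: "(\<lambda>t. indicator (S \<inter> disjointed C i) t * ?r t) \<in> borel_measurable borel" if [measurable]: "S \<in> sets borel" for S i
  proof -
    note [measurable] = rm[of i] db[of i]
    have "(\<lambda>t. indicator (S \<inter> disjointed C i) t * (indicator (C i) t * ?r t)) \<in> borel_measurable borel" by measurable
    moreover have "(\<lambda>t. indicator (S \<inter> disjointed C i) t * (indicator (C i) t * ?r t)) = (\<lambda>t. indicator (S \<inter> disjointed C i) t * ?r t)"
      using ds[of i] by (auto simp: indicator_def fun_eq_iff)
    ultimately show ?thesis by simp
  qed
  have rsum: "?r t * indicator S t = (\<Sum>i. indicator (S \<inter> disjointed C i) t * ?r t)" if "S \<subseteq> G" for S t
    unfolding ind[OF that] by (simp add: mult.commute)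
  show "(\<lambda>t. ?r t * indicator G t) \<in> borel_measurable borel"
    unfolding rsum[OF subset_refl] using rmi[OF borel_open[OF G]] by measurable
  assume S: "S \<in> sets borel" "S \<subseteq> G"
  have csum: "?c {t\<in>S. D t \<omega> = 0 \<and> u < Y t \<omega> \<and> good k (H t \<omega>)} = (\<Sum>i. ?c {t\<in>S \<inter> disjointed C i. D t \<omega> = 0 \<and> u < Y t \<omega> \<and> good k (H t \<omega>)})" for \<omega>
  proof -
    have "{t\<in>S. D t \<omega> = 0 \<and> u < Y t \<omega> \<and> good k (H t \<omega>)} = (\<Union>i. {t\<in>S \<inter> disjointed C i. D t \<omega> = 0 \<and> u < Y t \<omega> \<and> good k (H t \<omega>)})"
      using dU S(2) by auto
    moreover have "(\<Sum>i. ?c {t\<in>S \<inter> disjointed C i. D t \<omega> = 0 \<and> u < Y t \<omega> \<and> good k (H t \<omega>)}) = ?c (\<Union>i. {t\<in>S \<inter> disjointed C i. D t \<omega> = 0 \<and> u < Y t \<omega> \<and> good k (H t \<omega>)})"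
      by (rule suminf_emeasure) (use dd in \<open>auto simp: disjoint_family_on_def\<close>)
    ultimately show ?thesis by simp
  qed
  have Si: "S \<inter> disjointed C i \<in> sets borel" "S \<inter> disjointed C i \<subseteq> C i" for i using S db ds[of i] by auto
  note cri = cr[OF Si]
  have cm: "(\<lambda>\<omega>. ?c {t\<in>S \<inter> disjointed C i. D t \<omega> = 0 \<and> u < Y t \<omega> \<and> good k (H t \<omega>)}) \<in> borel_measurable M" for i
    using cri[of i] by blast
  show "(\<lambda>\<omega>. ?c {t\<in>S. D t \<omega> = 0 \<and> u < Y t \<omega> \<and> good k (H t \<omega>)}) \<in> borel_measurable M"
    unfolding csum using cm by measurable
  show "(\<integral>\<^sup>+\<omega>. ?c {t\<in>S. D t \<omega> = 0 \<and> u < Y t \<omega> \<and> good k (H t \<omega>)} \<partial>M) = (\<integral>\<^sup>+t. ?r t * indicator S t \<partial>lborel)"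
  proof -
    have "(\<integral>\<^sup>+\<omega>. ?c {t\<in>S. D t \<omega> = 0 \<and> u < Y t \<omega> \<and> good k (H t \<omega>)} \<partial>M) =
      (\<Sum>i. \<integral>\<^sup>+\<omega>. ?c {t\<in>S \<inter> disjointed C i. D t \<omega> = 0 \<and> u < Y t \<omega> \<and> good k (H t \<omega>)} \<partial>M)"
      unfolding csum by (rule nn_integral_suminf) (rule cm)
    also have "\<dots> = (\<Sum>i. \<integral>\<^sup>+t. indicator (S \<inter> disjointed C i) t * ?r t \<partial>lborel)"
      using cri by (intro suminf_cong) blast
    also have "\<dots> = (\<integral>\<^sup>+t. (\<Sum>i. indicator (S \<inter> disjointed C i) t * ?r t) \<partial>lborel)"
      by (rule nn_integral_suminf[symmetric]) (use rmi[OF S(1)] in simp)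
    finally show ?thesis unfolding rsum[OF S(2)] .
  qed
qed

end


section \<open>Derivatives of Gaussian processes\<close>

lemma directional_derivative_limit:
  fixes f :: "'a::real_normed_vector \<Rightarrow> real"
  assumes d: "(f has_derivative f') (at s)"
  shows "(\<lambda>n. real (Suc n) * (f (s + (1 / real (Suc n)) *\<^sub>R w) - f s)) \<longlonglongrightarrow> f' w"
proof -
  interpret f': bounded_linear f' by (rule has_derivative_bounded_linear[OF d])
  have a: "((\<lambda>t. s + t *\<^sub>R w) has_derivative (\<lambda>t. t *\<^sub>R w)) (at (0::real))"
    by (auto intro!: derivative_eq_intros)
  have "((\<lambda>t. f (s + t *\<^sub>R w)) has_derivative (\<lambda>t. f' (t *\<^sub>R w))) (at (0::real))"
    by (rule has_derivative_compose[OF a]) (use d in simp)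
  then have "((\<lambda>t. f (s + t *\<^sub>R w)) has_real_derivative f' w) (at 0)"
    by (simp add: has_field_derivative_def f'.scaleR mult_commute_abs)
  then have "((\<lambda>h. (f (s + h *\<^sub>R w) - f s) / h) \<longlongrightarrow> f' w) (at 0)" by (simp add: DERIV_def)
  moreover have "filterlim (\<lambda>n. 1 / real (Suc n)) (at 0) sequentially"
    unfolding filterlim_at using LIMSEQ_inverse_real_of_nat by (auto simp: inverse_eq_divide)
  ultimately have "((\<lambda>n. (f (s + (1 / real (Suc n)) *\<^sub>R w) - f s) / (1 / real (Suc n))) \<longlongrightarrow> f' w) sequentially"
    by (rule filterlim_compose)
  then show ?thesis by (simp add: mult.commute)
qed

context gaussian_space
begin

text \<open>A directional derivative is a pointwise limit of difference quotients, and these are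
  members of the linear space.\<close>

lemma derivative_in_limits:
  fixes f :: "'n::real_normed_vector \<Rightarrow> 'a \<Rightarrow> real"
  assumes G: "open G" "s \<in> G" and f: "\<And>t. t \<in> G \<Longrightarrow> f t \<in> L"
    and d: "\<And>\<omega>. \<omega> \<in> space M \<Longrightarrow> ((\<lambda>t. f t \<omega>) has_derivative f' \<omega>) (at s)"
  shows "(\<lambda>\<omega>. f' \<omega> w) \<in> limits"
proof -
  define t where "t n = s + (1 / real (Suc n)) *\<^sub>R w" for n
  \<comment> \<open>The shifted point is certain to lie in \<open>G\<close> only for large n; the
    zero function replaces the terms for which it does not.\<close>
  define Zn where "Zn n = (if t n \<in> G then (\<lambda>\<omega>. real (Suc n) * (f (t n) \<omega> - f s \<omega>)) else (\<lambda>_. 0))" for n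
  have "(\<lambda>n. s + (1 / real (Suc n)) *\<^sub>R w) \<longlonglongrightarrow> s + 0 *\<^sub>R w"
    by (intro tendsto_intros LIMSEQ_Suc lim_1_over_n)
  then have "t \<longlonglongrightarrow> s" by (simp add: t_def[abs_def])
  then have ev: "eventually (\<lambda>n. t n \<in> G) sequentially" using G by (rule topological_tendstoD)
  have "Zn n \<in> L" for n
    unfolding Zn_def using L_scale[OF L_diff[OF f f[OF G(2)]]] L_zero by simp
  moreover have "(\<lambda>n. Zn n \<omega>) \<longlonglongrightarrow> f' \<omega> w" if w: "\<omega> \<in> space M" for \<omega>
  proof (rule Lim_transform_eventually)
    show "(\<lambda>n. real (Suc n) * (f (t n) \<omega> - f s \<omega>)) \<longlonglongrightarrow> f' \<omega> w"
      unfolding t_def by (rule directional_derivative_limit[OF d[OF w]])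
    show "\<forall>\<^sub>F n in sequentially. real (Suc n) * (f (t n) \<omega> - f s \<omega>) = Zn n \<omega>"
      using ev by eventually_elim (simp add: Zn_def)
  qed
  ultimately show ?thesis unfolding limits_def by blast
qed

end

text \<open>Linear combinations of values form a Gaussian space; its limits contain the gradients,
  and the limits of those contain the Hessians. Two enlargements are made because a pointwise limit
  of limits need not be a single sequential limit.\<close>

theorem c2_gaussian_field_exists:
  fixes P :: "'w measure" and G :: "(real^'n::finite) set" and Y :: "real^'n \<Rightarrow> 'w \<Rightarrow> real"
    and D :: "real^'n \<Rightarrow> 'w \<Rightarrow> real^'n" and H :: "real^'n \<Rightarrow> 'w \<Rightarrow> real^'n^'n"
  assumes P: "prob_space P" and gp: "gaussian_process P G Y" and G: "open G"
    and Y_der: "\<And>\<omega> s. \<omega> \<in> space P \<Longrightarrow> s \<in> G \<Longrightarrow> ((\<lambda>s. Y s \<omega>) has_derivative (\<lambda>h. D s \<omega> \<bullet> h)) (at s)"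
    and D_der: "\<And>\<omega> s. \<omega> \<in> space P \<Longrightarrow> s \<in> G \<Longrightarrow> ((\<lambda>s. D s \<omega>) has_derivative (\<lambda>h. H s \<omega> *v h)) (at s)"
    and H_cont: "\<And>\<omega>. \<omega> \<in> space P \<Longrightarrow> continuous_on G (\<lambda>s. H s \<omega>)"
    and nondeg: "\<And>s. s \<in> G \<Longrightarrow> nondegenerate P (\<lambda>\<omega>. (Y s \<omega>, D s \<omega>))"
  shows "\<exists>L. c2_gaussian_field P L G Y D H"
proof -
  define L0 where "L0 = {(\<lambda>\<omega>. \<Sum>t\<in>F. b t * Y t \<omega>) |F b. finite F \<and> F \<subseteq> G}"
  have g0: "gaussian_space P L0" unfolding L0_def by (rule gaussian_space_span[OF P gp])
  define L1 where "L1 = gaussian_space.limits P L0"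
  have g1: "gaussian_space P L1" unfolding L1_def by (rule gaussian_space.gaussian_space_limits[OF g0])
  define L2 where "L2 = gaussian_space.limits P L1"
  have g2: "gaussian_space P L2" unfolding L2_def by (rule gaussian_space.gaussian_space_limits[OF g1])
  have L01: "L0 \<subseteq> L1" unfolding L1_def by (rule gaussian_space.L_subset_limits[OF g0])
  have L12: "L1 \<subseteq> L2" unfolding L2_def by (rule gaussian_space.L_subset_limits[OF g1])
  have Y0: "Y s \<in> L0" if "s \<in> G" for s
    unfolding L0_def using that by (intro CollectI exI[of _ "{s}"] exI[of _ "\<lambda>_. 1"]) auto
  have D1: "(\<lambda>\<omega>. D s \<omega> \<bullet> w) \<in> L1" if s: "s \<in> G" for s w
    unfolding L1_def by (rule gaussian_space.derivative_in_limits[OF g0 G s Y0 Y_der[OF _ s]])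
  have H2: "(\<lambda>\<omega>. (H s \<omega> *v v) \<bullet> w) \<in> L2" if s: "s \<in> G" for s v w
    unfolding L2_def
    by (rule gaussian_space.derivative_in_limits[OF g1 G s D1 has_derivative_inner_left[OF D_der[OF _ s]]])
  interpret gaussian_space P L2 by (rule g2)
  have "(\<lambda>\<omega>. H s \<omega> \<bullet> w) \<in> L2" if s: "s \<in> G" for s w
  proof -
    have "(H s \<omega> \<bullet> w) = (\<Sum>i\<in>UNIV. \<Sum>j\<in>UNIV. w $ i $ j * ((H s \<omega> *v axis j 1) \<bullet> axis i 1))" for \<omega>
      by (simp add: inner_vec_def[of "H s \<omega>"] inner_vec_def[of "H s \<omega> $ _"] inner_axis matrix_vector_mult_basis column_def mult.commute)
    then show ?thesis by (simp only:) (intro L_sum L_scale H2 s finite)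
  qed
  note H3 = this
  have Y2: "Y s \<in> L2" if "s \<in> G" for s using Y0[OF that] L01 L12 by (blast dest: subsetD)
  have D2: "(\<lambda>\<omega>. D s \<omega> \<bullet> w) \<in> L2" if "s \<in> G" for s w by (rule subsetD[OF L12 D1[OF that]])
  have "c2_gaussian_field P L2 G Y D H"
    by (intro c2_gaussian_field.intro c2_gaussian_field_axioms.intro)
      (rule g2 G Y2 D2 H3 Y_der D_der H_cont nondeg; assumption)+
  then show ?thesis by blast
qed


section \<open>Charts\<close>

lemma disjoint_borel_cover:
  assumes C: "countable C" "\<Union>C = A" "C \<subseteq> sets M"
  obtains E :: "nat \<Rightarrow> 'a set" where "\<And>i. E i \<in> sets M" "disjoint_family E" "(\<Union>i. E i) = A"
    "\<And>i. E i \<noteq> {} \<Longrightarrow> \<exists>c\<in>C. E i \<subseteq> c"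
proof -
  define B where "B = from_nat_into (insert {} C)"
  have rB: "range B = insert {} C" unfolding B_def using C(1) by (intro range_from_nat_into) auto
  have Bm: "range B \<subseteq> sets M" unfolding rB using C(3) by auto
  show ?thesis
  proof (rule that[of "disjointed B"])
    show "disjointed B i \<in> sets M" for i using sets.range_disjointed_sets[OF Bm] by auto
    show "(\<Union>i. disjointed B i) = A" unfolding UN_disjointed_eq using rB C(2) by simp
    show "\<exists>c\<in>C. disjointed B i \<subseteq> c" if "disjointed B i \<noteq> {}" for i
    proof -
      have "disjointed B i \<subseteq> B i" by (rule disjointed_subset)
      moreover have "B i \<in> insert {} C" using rB by blast
      ultimately show ?thesis using that by auto
    qed
  qed (rule disjoint_family_disjointed)
qed

lemma is_chartD:
  fixes c :: "('a, 'n::finite) chart"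
  assumes "is_chart U c"
  shows "openin U (chart_dom c)" and "inj_on (chart_map c) (chart_dom c)"
    and "openin U W \<Longrightarrow> W \<subseteq> chart_dom c \<Longrightarrow> openin (top_of_set (chart_img c)) (chart_map c ` W)"
    and "openin (top_of_set (chart_img c)) T \<Longrightarrow> openin U {t\<in>chart_dom c. chart_map c t \<in> T}"
proof -
  show o: "openin U (chart_dom c)" using assms by (simp add: is_chart_def)
  then have d: "topspace U \<inter> chart_dom c = chart_dom c" by (auto dest: openin_subset)
  have h: "homeomorphic_map (subtopology U (chart_dom c)) (top_of_set (chart_img c)) (chart_map c)"
    using assms by (simp add: is_chart_def)
  show "inj_on (chart_map c) (chart_dom c)" using h d by (simp add: homeomorphic_eq_everything_map)
  show "openin (top_of_set (chart_img c)) (chart_map c ` W)" if "openin U W" "W \<subseteq> chart_dom c"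
    using h that o by (auto simp: homeomorphic_eq_everything_map open_map_def openin_open_subtopology)
  show "openin U {t\<in>chart_dom c. chart_map c t \<in> T}" if T: "openin (top_of_set (chart_img c)) T"
  proof -
    have "continuous_map (subtopology U (chart_dom c)) (top_of_set (chart_img c)) (chart_map c)"
      using h by (simp add: homeomorphic_eq_everything_map)
    then have "openin (subtopology U (chart_dom c)) {t \<in> topspace (subtopology U (chart_dom c)). chart_map c t \<in> T}"
      by (rule openin_continuous_map_preimage) (rule T)
    then show ?thesis using o d by (simp add: openin_open_subtopology)
  qed
qed

locale manifold_with_atlas =
  fixes U :: "'a topology" and \<A> :: "('a, 'n::finite) chart set"
  assumes oriented: "oriented_manifold U \<A>"
begin

abbreviation I where "I \<equiv> manifold_interior \<A>"

lemma chart: "c \<in> \<A> \<Longrightarrow> is_chart U c" using oriented by (simp add: oriented_manifold_def smooth_atlas_def)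

lemma transition_smooth: "c \<in> \<A> \<Longrightarrow> c' \<in> \<A> \<Longrightarrow> smooth_on (transition c c') (overlap c c')"
  using oriented by (simp add: oriented_manifold_def smooth_atlas_def)

lemma dom_open: "c \<in> \<A> \<Longrightarrow> openin U (chart_dom c)" and chart_inj: "c \<in> \<A> \<Longrightarrow> inj_on (chart_map c) (chart_dom c)"
  using is_chartD[OF chart] by blast+

lemma inv_map: "c \<in> \<A> \<Longrightarrow> t \<in> chart_dom c \<Longrightarrow> chart_inv c (chart_map c t) = t"
  by (simp add: chart_inv_def inv_into_f_f chart_inj)

lemma map_inv: "s \<in> chart_img c \<Longrightarrow> chart_map c (chart_inv c s) = s"
  and inv_dom: "s \<in> chart_img c \<Longrightarrow> chart_inv c s \<in> chart_dom c"
  by (simp_all add: chart_inv_def chart_img_def f_inv_into_f inv_into_into)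

lemma open_map_interior:
  assumes c: "c \<in> \<A>" and W: "openin U W" "W \<subseteq> chart_dom c" "chart_map c ` W \<subseteq> interior (chart_img c)"
  shows "open (chart_map c ` W)"
proof -
  have "openin (top_of_set (interior (chart_img c))) (chart_map c ` W)"
    by (rule openin_subset_trans[OF is_chartD(3)[OF chart[OF c] W(1,2)] W(3) interior_subset])
  then show ?thesis by (rule openin_open_trans) simp
qed

lemma open_preimage:
  assumes c: "c \<in> \<A>" and T: "open T"
  shows "openin U {t\<in>chart_dom c. chart_map c t \<in> T}"
proof -
  have "openin U {t\<in>chart_dom c. chart_map c t \<in> chart_img c \<inter> T}"
    by (rule is_chartD(4)[OF chart[OF c]]) (use T in \<open>auto intro: openin_open_Int\<close>)
  moreover have "{t\<in>chart_dom c. chart_map c t \<in> chart_img c \<inter> T} = {t\<in>chart_dom c. chart_map c t \<in> T}"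
    by (auto simp: chart_img_def)
  ultimately show ?thesis by simp
qed

text \<open>That being interior does not depend on the chart is invariance of domain.\<close>

lemma interior_chart:
  assumes c: "c \<in> \<A>" and t: "t \<in> chart_dom c"
  shows "t \<in> I \<longleftrightarrow> chart_map c t \<in> interior (chart_img c)"
proof
  assume "t \<in> I"
  then obtain c' where c': "c' \<in> \<A>" "t \<in> chart_dom c'" "chart_map c' t \<in> interior (chart_img c')"
    by (auto simp: manifold_interior_def)
  define W where "W = chart_dom c \<inter> {t\<in>chart_dom c'. chart_map c' t \<in> interior (chart_img c')}"
  have W: "openin U W" unfolding W_def by (intro openin_Int dom_open c open_preimage c' open_interior)
  define T where "T = chart_map c' ` W"
  have T: "open T" unfolding T_def by (rule open_map_interior[OF c'(1) W]) (auto simp: W_def)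
  have eq: "transition c c' (chart_map c' w) = chart_map c w" if "w \<in> W" for w
    using inv_map[OF c'(1)] that by (auto simp: transition_def W_def)
  have "continuous_on (overlap c c') (transition c c')"
    using transition_smooth[OF c c'(1)] by (auto simp: smooth_on_def dest!: spec[of _ 0])
  then have "continuous_on T (transition c c')"
    by (rule continuous_on_subset) (auto simp: T_def W_def overlap_def)
  moreover have "inj_on (transition c c') T"
  proof (rule inj_onI)
    fix x y assume "x \<in> T" "y \<in> T" and xy: "transition c c' x = transition c c' y"
    then obtain v w where vw: "x = chart_map c' v" "y = chart_map c' w" "v \<in> W" "w \<in> W" by (auto simp: T_def)
    then have "chart_map c v = chart_map c w" using xy eq by simp
    then have "v = w" using inj_onD[OF chart_inj[OF c]] vw(3,4) by (auto simp: W_def)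
    then show "x = y" using vw by simp
  qed
  ultimately have "open (transition c c' ` T)" by (intro invariance_of_domain T)
  moreover have "transition c c' ` T = chart_map c ` W" unfolding T_def image_image using eq by auto
  moreover have "chart_map c ` W \<subseteq> chart_img c" by (auto simp: W_def chart_img_def)
  moreover have "chart_map c t \<in> chart_map c ` W" using t c' by (auto simp: W_def)
  ultimately show "chart_map c t \<in> interior (chart_img c)" by (metis interiorI)
qed (use assms in \<open>auto simp: manifold_interior_def\<close>)

lemma image_interior: "c \<in> \<A> \<Longrightarrow> chart_map c ` (chart_dom c \<inter> I) = interior (chart_img c)"
proof (intro equalityI subsetI)
  fix s assume c: "c \<in> \<A>" and s: "s \<in> interior (chart_img c)"
  then have si: "s \<in> chart_img c" using interior_subset by blast
  have "chart_inv c s \<in> chart_dom c \<inter> I" using interior_chart[OF c inv_dom[OF si]] s si by (simp add: map_inv inv_dom)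
  then show "s \<in> chart_map c ` (chart_dom c \<inter> I)" using map_inv[OF si] by (metis imageI)
qed (auto simp: interior_chart)

lemma chart_interior_eq: "c \<in> \<A> \<Longrightarrow> chart_dom c \<inter> I = {t\<in>chart_dom c. chart_map c t \<in> interior (chart_img c)}"
  by (auto simp: interior_chart)

lemma space_borel_of_top[simp]: "space (borel_of_top U) = topspace U"
  by (simp add: borel_of_top_def space_measure_of_conv)

lemma open_borel: "openin U W \<Longrightarrow> W \<in> sets (borel_of_top U)"
  unfolding borel_of_top_def by (intro in_measure_of) (auto dest: openin_subset)

lemma chart_interior_open: "c \<in> \<A> \<Longrightarrow> openin U (chart_dom c \<inter> I)"
  unfolding chart_interior_eq by (intro open_preimage) auto

lemma chart_interior_borel: "c \<in> \<A> \<Longrightarrow> chart_dom c \<inter> I \<in> sets (borel_of_top U)"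
  by (rule open_borel[OF chart_interior_open])

lemma I_eq: "I = (\<Union>c\<in>\<A>. chart_dom c \<inter> I)"
  by (auto simp: manifold_interior_def)

lemma I_open: "openin U I"
  by (subst I_eq, rule openin_Union) (elim imageE, hypsubst, rule chart_interior_open)

lemma chart_map_measurable:
  assumes c: "c \<in> \<A>"
  shows "chart_map c \<in> measurable (restrict_space (borel_of_top U) (chart_dom c \<inter> I)) borel"
proof (rule borel_measurableI)
  fix T :: "(real^'n) set" assume T: "open T"
  have "{t\<in>chart_dom c. chart_map c t \<in> T} \<in> sets (borel_of_top U)" by (rule open_borel[OF open_preimage[OF c T]])
  then have "(chart_dom c \<inter> I) \<inter> {t\<in>chart_dom c. chart_map c t \<in> T} \<in> sets (restrict_space (borel_of_top U) (chart_dom c \<inter> I))"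
    by (auto simp: sets_restrict_space)
  moreover have "chart_map c -` T \<inter> space (restrict_space (borel_of_top U) (chart_dom c \<inter> I)) = (chart_dom c \<inter> I) \<inter> {t\<in>chart_dom c. chart_map c t \<in> T}"
    using openin_subset[OF dom_open[OF c]] by (auto simp: space_restrict_space)
  ultimately show "chart_map c -` T \<inter> space (restrict_space (borel_of_top U) (chart_dom c \<inter> I)) \<in> sets (restrict_space (borel_of_top U) (chart_dom c \<inter> I))"
    by simp
qed

lemma chart_preimage_borel:
  assumes c: "c \<in> \<A>" and T: "T \<in> sets borel"
  shows "{t\<in>chart_dom c \<inter> I. chart_map c t \<in> T} \<in> sets (borel_of_top U)"
proof -
  have "chart_map c -` T \<inter> space (restrict_space (borel_of_top U) (chart_dom c \<inter> I)) \<in> sets (restrict_space (borel_of_top U) (chart_dom c \<inter> I))"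
    using measurable_sets[OF chart_map_measurable[OF c] T] .
  then have "chart_map c -` T \<inter> space (restrict_space (borel_of_top U) (chart_dom c \<inter> I)) \<in> sets (borel_of_top U)"
    using chart_interior_borel[OF c] by (subst (asm) sets_restrict_space_iff) (use sets.top[of "borel_of_top U"] in \<open>auto intro: sets.Int\<close>)
  moreover have "chart_map c -` T \<inter> space (restrict_space (borel_of_top U) (chart_dom c \<inter> I)) = {t\<in>chart_dom c \<inter> I. chart_map c t \<in> T}"
    using openin_subset[OF dom_open[OF c]] by (auto simp: space_restrict_space)
  ultimately show ?thesis by simp
qed

lemma chart_inv_vimage:
  assumes c: "c \<in> \<A>"
  shows "chart_inv c -` W \<inter> interior (chart_img c) = chart_map c ` (W \<inter> (chart_dom c \<inter> I))"
proof (intro equalityI subsetI)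
  fix s assume s: "s \<in> chart_inv c -` W \<inter> interior (chart_img c)"
  then have si: "s \<in> chart_img c" using interior_subset by blast
  have "chart_inv c s \<in> I" using interior_chart[OF c inv_dom[OF si]] s by (simp add: map_inv[OF si])
  then have "chart_inv c s \<in> W \<inter> (chart_dom c \<inter> I)" using s inv_dom[OF si] by simp
  then show "s \<in> chart_map c ` (W \<inter> (chart_dom c \<inter> I))" by (rule rev_image_eqI) (simp add: map_inv[OF si])
qed (auto simp: interior_chart[OF c, symmetric] inv_map[OF c])

text \<open>The image is the preimage under the inverse chart, whose measurability is checked on
  open sets: the chart carries their parts in the interior to open sets.\<close>

lemma chart_image_borel:
  assumes c: "c \<in> \<A>" and S: "S \<in> sets (borel_of_top U)" "S \<subseteq> chart_dom c \<inter> I"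
  shows "chart_map c ` S \<in> sets borel"
proof -
  let ?O = "interior (chart_img c)"
  have Oi: "s \<in> ?O \<Longrightarrow> s \<in> chart_img c" for s using interior_subset by blast
  have "chart_inv c \<in> measurable (restrict_space borel ?O) (sigma (topspace U) {S. openin U S})"
  proof (rule measurable_measure_of)
    show "{S. openin U S} \<subseteq> Pow (topspace U)" by (auto dest: openin_subset)
    show "chart_inv c \<in> space (restrict_space borel ?O) \<rightarrow> topspace U"
      using inv_dom[OF Oi] openin_subset[OF dom_open[OF c]] by (auto simp: space_restrict_space)
    fix W assume W: "W \<in> {S. openin U S}"
    have "chart_inv c -` W \<inter> space (restrict_space borel ?O) = chart_map c ` (W \<inter> (chart_dom c \<inter> I))"
      using chart_inv_vimage[OF c] by (simp add: space_restrict_space)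
    moreover have "open (chart_map c ` (W \<inter> (chart_dom c \<inter> I)))"
      using W by (intro open_map_interior[OF c] openin_Int chart_interior_open c) (use image_interior[OF c] in auto)
    moreover have "chart_map c ` (W \<inter> (chart_dom c \<inter> I)) \<subseteq> ?O" using image_interior[OF c] by auto
    ultimately show "chart_inv c -` W \<inter> space (restrict_space borel ?O) \<in> sets (restrict_space borel ?O)"
      by (subst sets_restrict_space_iff) auto
  qed
  from measurable_sets[OF this, of S] S(1)
  have "chart_inv c -` S \<inter> space (restrict_space borel ?O) \<in> sets (restrict_space borel ?O)"
    by (simp add: borel_of_top_def space_measure_of_conv)
  then have "chart_inv c -` S \<inter> ?O \<in> sets borel" by (subst (asm) sets_restrict_space_iff) (auto simp: space_restrict_space)
  moreover have "chart_inv c -` S \<inter> ?O = chart_map c ` S"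
    unfolding chart_inv_vimage[OF c] using S(2) by (simp add: inf.absorb1)
  ultimately show ?thesis by simp
qed

text \<open>Second countability makes \<open>U\<close> a Lindelof space, so countably many chart
  domains suffice; cutting them into disjoint Borel pieces allows expectations to be summed over
  charts.\<close>

lemma interior_cover:
  "\<exists>E :: nat \<Rightarrow> 'a set. (\<forall>i. E i \<in> sets (borel_of_top U)) \<and> disjoint_family E \<and> (\<Union>i. E i) = I \<and>
    (\<forall>i. E i \<noteq> {} \<longrightarrow> (\<exists>c\<in>\<A>. E i \<subseteq> chart_dom c \<inter> I))" (is "\<exists>E. ?P E")
proof -
  have "Lindelof_space U" using oriented by (auto simp: oriented_manifold_def intro: second_countable_imp_Lindelof_space)
  moreover have "\<Union>(chart_dom ` \<A>) = topspace U" using oriented by (auto simp: oriented_manifold_def smooth_atlas_def)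
  ultimately have "\<exists>V. countable V \<and> V \<subseteq> chart_dom ` \<A> \<and> \<Union>V = topspace U"
    unfolding Lindelof_space_def using dom_open by auto
  then obtain V where V: "countable V" "V \<subseteq> chart_dom ` \<A>" "\<Union>V = topspace U" by blast
  have C: "countable ((\<lambda>v. v \<inter> I) ` V)" "(\<Union>v\<in>V. v \<inter> I) = I" "(\<lambda>v. v \<inter> I) ` V \<subseteq> sets (borel_of_top U)"
    using V openin_subset[OF I_open] chart_interior_borel by auto
  show ?thesis
  proof (rule disjoint_borel_cover[OF C])
    fix E :: "nat \<Rightarrow> 'a set"
    assume E: "\<And>i. E i \<in> sets (borel_of_top U)" "disjoint_family E" "(\<Union>i. E i) = I"
      and sub: "\<And>i. E i \<noteq> {} \<Longrightarrow> \<exists>c\<in>(\<lambda>v. v \<inter> I) ` V. E i \<subseteq> c"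
    show "\<exists>E. ?P E"
    proof (intro exI[of _ E] conjI allI impI E)
      fix i assume "E i \<noteq> {}"
      from sub[OF this] obtain v where v: "v \<in> V" "E i \<subseteq> v \<inter> I" by auto
      then obtain c where "c \<in> \<A>" "v = chart_dom c" using V(2) by blast
      with v(2) show "\<exists>c\<in>\<A>. E i \<subseteq> chart_dom c \<inter> I" by metis
    qed
  qed
qed

end


section \<open>Critical points and local maxima in charts\<close>

lemma Ck2D:
  assumes "Ck_on 2 g T"
  shows "x \<in> T \<Longrightarrow> g differentiable (at x within T)"
    and "x \<in> T \<Longrightarrow> (\<lambda>x. frechet_derivative g (at x within T) v) differentiable (at x within T)"
    and "continuous_on T (\<lambda>x. frechet_derivative (\<lambda>x. frechet_derivative g (at x within T) v) (at x within T) w)"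
  using assms by (auto simp: numeral_2_eq_2)

lemma gradient_within_interior:
  fixes g :: "real^'n::finite \<Rightarrow> real"
  assumes g: "Ck_on 2 g T" and s: "s \<in> interior T"
  shows "(g has_derivative (\<lambda>h. gradient_within g T s \<bullet> h)) (at s)"
proof -
  let ?f = "frechet_derivative g (at s within T)"
  have sT: "s \<in> T" using s interior_subset by blast
  have d: "(g has_derivative ?f) (at s within T)" using Ck2D(1)[OF g sT] by (simp add: frechet_derivative_works)
  have lin: "linear ?f" using has_derivative_linear[OF d] .
  have "?f h = gradient_within g T s \<bullet> h" for h
  proof -
    have "?f h = ?f (\<Sum>i\<in>UNIV. h $ i *\<^sub>R axis i 1)"
      using basis_expansion[of h] by (simp add: scalar_mult_eq_scaleR)
    also have "\<dots> = (\<Sum>i\<in>UNIV. h $ i * ?f (axis i 1))" by (simp add: linear_sum[OF lin] linear_scale[OF lin])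
    finally show ?thesis by (simp add: inner_vec_def gradient_within_def mult.commute)
  qed
  then have "?f = (\<lambda>h. gradient_within g T s \<bullet> h)" by blast
  with d show ?thesis by (simp add: at_within_interior[OF s])
qed

text \<open>Class C2 supplies derivatives of the partial derivatives one at a time, whereas
  \<open>hessian_within\<close> differentiates the gradient as a vector. At interior points
  derivatives are unique, so the two agree entry by entry.\<close>

lemma
  fixes g :: "real^'n::finite \<Rightarrow> real"
  assumes g: "Ck_on 2 g T" and s: "s \<in> interior T"
  shows hessian_within_interior: "(gradient_within g T has_derivative (\<lambda>h. hessian_within g T s *v h)) (at s)"
    and hessian_within_component:
      "hessian_within g T s = (\<chi> i j. frechet_derivative (\<lambda>x. frechet_derivative g (at x within T) (axis i 1)) (at s within T) (axis j 1))"
proof -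
  let ?d = "\<lambda>i. frechet_derivative (\<lambda>x. frechet_derivative g (at x within T) (axis i 1)) (at s within T)"
  have sT: "s \<in> T" using s interior_subset by blast
  have "((\<lambda>x. frechet_derivative g (at x within T) (axis i 1)) has_derivative ?d i) (at s within T)" for i
    using Ck2D(2)[OF g sT] by (simp add: frechet_derivative_works)
  then have d: "(gradient_within g T has_derivative (\<lambda>h. \<chi> i. ?d i h)) (at s within T)"
    by (subst has_derivative_componentwise_within)
      (auto simp: Basis_vec_def inner_axis gradient_within_def)
  then have d': "(gradient_within g T has_derivative (\<lambda>h. \<chi> i. ?d i h)) (at s)" by (simp add: at_within_interior[OF s])
  have eq: "frechet_derivative (gradient_within g T) (at s within T) = (\<lambda>h. \<chi> i. ?d i h)"
    unfolding at_within_interior[OF s] using frechet_derivative_at[OF d'[unfolded at_within_interior[OF s]]] by simp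
  have "bounded_linear (\<lambda>h. \<chi> i. ?d i h)" by (rule has_derivative_bounded_linear[OF d])
  then have "(\<lambda>h. hessian_within g T s *v h) = (\<lambda>h. \<chi> i. ?d i h)"
    unfolding hessian_within_def eq by (rule matrix_vector_mul(3))
  then show "(gradient_within g T has_derivative (\<lambda>h. hessian_within g T s *v h)) (at s)" using d' by simp
  show "hessian_within g T s = (\<chi> i j. ?d i (axis j 1))"
    unfolding hessian_within_def eq by (simp add: matrix_def)
qed

lemma hessian_within_continuous:
  fixes g :: "real^'n::finite \<Rightarrow> real"
  assumes g: "Ck_on 2 g T"
  shows "continuous_on (interior T) (hessian_within g T)"
proof -
  have "continuous_on (interior T) (\<lambda>s. \<chi> i j. frechet_derivative (\<lambda>x. frechet_derivative g (at x within T) (axis i 1)) (at s within T) (axis j 1))"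
    by (intro continuous_on_vec_lambda continuous_on_subset[OF Ck2D(3)[OF g] interior_subset])
  then show ?thesis by (rule continuous_on_eq) (simp add: hessian_within_component[OF g])
qed

lemma emeasure_count_space_image:
  "inj_on f A \<Longrightarrow> emeasure (count_space UNIV) (f ` A) = emeasure (count_space UNIV) A"
  by (simp add: emeasure_count_space finite_image_iff card_image)

context manifold_with_atlas
begin

text \<open>A critical point is required to be critical in every chart containing it. By the chain
  rule through the transition map, a vanishing gradient in one chart forces a vanishing gradient in
  any other.\<close>

lemma critical_transfer:
  fixes f :: "'a \<Rightarrow> real"
  assumes c: "c \<in> \<A>" "c' \<in> \<A>" and t: "t \<in> chart_dom c" "t \<in> chart_dom c'" "t \<in> I"
    and C2: "\<And>c. c \<in> \<A> \<Longrightarrow> Ck_on 2 (\<lambda>s. f (chart_inv c s)) (chart_img c)"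
    and z: "gradient_within (\<lambda>s. f (chart_inv c s)) (chart_img c) (chart_map c t) = 0"
  shows "gradient_within (\<lambda>s. f (chart_inv c' s)) (chart_img c') (chart_map c' t) = 0" (is "?g' = 0")
proof -
  let ?s = "chart_map c' t" and ?tr = "transition c c'"
  define W where "W = chart_dom c \<inter> (chart_dom c' \<inter> I)"
  define T where "T = chart_map c' ` W"
  have T: "open T" unfolding T_def
    by (rule open_map_interior[OF c(2)])
      (use image_interior[OF c(2)] in \<open>auto simp: W_def intro!: openin_Int dom_open chart_interior_open c\<close>)
  have sT: "?s \<in> T" using t by (auto simp: T_def W_def)
  have To: "T \<subseteq> overlap c c'" by (auto simp: T_def W_def overlap_def)
  have si: "?s \<in> interior (overlap c c')" using T sT To by (rule interiorI)
  have trs: "?tr ?s = chart_map c t" by (simp add: transition_def inv_map c t)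
  have "Ck_on (Suc 0) ?tr (overlap c c')" using transition_smooth[OF c] by (simp add: smooth_on_def)
  then have "?tr differentiable (at ?s within overlap c c')" using sT To by auto
  then obtain A where A: "(?tr has_derivative A) (at ?s)"
    unfolding at_within_interior[OF si] by (auto simp: differentiable_def)
  have "chart_map c t \<in> interior (chart_img c)" using interior_chart[OF c(1) t(1)] t(3) by simp
  from gradient_within_interior[OF C2[OF c(1)] this]
  have "((\<lambda>s. f (chart_inv c s)) has_derivative (\<lambda>h. 0)) (at (?tr ?s))"
    unfolding trs by (rule has_derivative_eq_rhs) (simp add: z fun_eq_iff)
  from has_derivative_compose[OF A this] have "((\<lambda>x. f (chart_inv c (?tr x))) has_derivative (\<lambda>h. 0)) (at ?s)" by simp
  then have "((\<lambda>x. f (chart_inv c' x)) has_derivative (\<lambda>h. 0)) (at ?s)"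
    by (rule has_derivative_transform_within_open[OF _ T sT])
      (auto simp: T_def W_def transition_def inv_map c)
  moreover have "((\<lambda>x. f (chart_inv c' x)) has_derivative (\<lambda>h. ?g' \<bullet> h)) (at ?s)"
    by (rule gradient_within_interior[OF C2[OF c(2)]]) (use interior_chart[OF c(2) t(2)] t(3) in simp)
  ultimately have "(\<lambda>h. 0) = (\<lambda>h. ?g' \<bullet> h)" by (rule has_derivative_unique)
  then have "?g' \<bullet> ?g' = 0" by metis
  then show ?thesis by simp
qed

text \<open>At a local maximum the Hessian is symmetric and negative semidefinite, and a nonzero
  determinant turns this into definiteness; a degenerate critical point would break the equivalence
  here. The converse is the second order test, carried back to an open subset of \<open>U\<close> by
  the chart.\<close>

lemma local_max_chart:
  fixes f :: "'a \<Rightarrow> real"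
  assumes c: "c \<in> \<A>" and t: "t \<in> chart_dom c" "t \<in> I"
    and C2: "Ck_on 2 (\<lambda>s. f (chart_inv c s)) (chart_img c)"
  defines "D \<equiv> gradient_within (\<lambda>s. f (chart_inv c s)) (chart_img c)"
    and "H \<equiv> hessian_within (\<lambda>s. f (chart_inv c s)) (chart_img c)"
  assumes nd: "D (chart_map c t) = 0 \<longrightarrow> det (H (chart_map c t)) \<noteq> 0"
  shows "(\<exists>N. openin U N \<and> t \<in> N \<and> (\<forall>t'\<in>N. f t' \<le> f t)) \<longleftrightarrow> D (chart_map c t) = 0 \<and> negative_definite (H (chart_map c t))"
proof -
  let ?s = "chart_map c t" and ?O = "interior (chart_img c)"
  have s: "?s \<in> ?O" using interior_chart[OF c t(1)] t(2) by simp
  have d1: "((\<lambda>s. f (chart_inv c s)) has_derivative (\<lambda>h. D x \<bullet> h)) (at x)" if "x \<in> ?O" for x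
    unfolding D_def by (rule gradient_within_interior[OF C2 that])
  have d2: "(D has_derivative (\<lambda>h. H x *v h)) (at x)" if "x \<in> ?O" for x
    unfolding D_def H_def by (rule hessian_within_interior[OF C2 that])
  have Hc: "continuous_on ?O H" unfolding H_def by (rule hessian_within_continuous[OF C2])
  show ?thesis
  proof
    assume "\<exists>N. openin U N \<and> t \<in> N \<and> (\<forall>t'\<in>N. f t' \<le> f t)"
    then obtain N where N: "openin U N" "t \<in> N" "\<And>t'. t' \<in> N \<Longrightarrow> f t' \<le> f t" by blast
    define V where "V = chart_map c ` (N \<inter> (chart_dom c \<inter> I))"
    have VO: "V \<subseteq> ?O" using image_interior[OF c] by (auto simp: V_def)
    have V: "open V" unfolding V_def
      by (rule open_map_interior[OF c])
        (use VO in \<open>auto simp: V_def intro!: openin_Int N chart_interior_open c\<close>)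
    have sV: "?s \<in> V" using t N by (auto simp: V_def)
    have d1V: "((\<lambda>s. f (chart_inv c s)) has_derivative (\<lambda>h. D x \<bullet> h)) (at x)" if "x \<in> V" for x
      by (rule d1) (use that VO in blast)
    have lm: "f (chart_inv c x) \<le> f (chart_inv c ?s)" if "x \<in> V" for x
      using that N(3) by (auto simp: V_def inv_map c t)
    have D0: "D ?s = 0" by (rule local_max_semidefinite(1)[OF V sV d1V d2[OF s] lm])
    have nsd: "v \<bullet> (H ?s *v v) \<le> 0" for v by (rule local_max_semidefinite(2)[OF V sV d1V d2[OF s] lm])
    have sym: "(H ?s *v v) \<bullet> w = (H ?s *v w) \<bullet> v" for v w
      by (rule hessian_symmetric[OF open_interior s d1 d2 Hc])
    have "v \<bullet> (H ?s *v v) < 0" if "v \<noteq> 0" for v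
      by (rule negative_semidefinite_det_nonzero[OF sym nsd _ that]) (use nd D0 in blast)
    with D0 show "D ?s = 0 \<and> negative_definite (H ?s)" by (simp add: negative_definite_def)
  next
    assume a: "D ?s = 0 \<and> negative_definite (H ?s)"
    have neg: "v \<bullet> (H ?s *v v) < 0" if "v \<noteq> 0" for v using a that by (simp add: negative_definite_def)
    have "\<exists>r>0. \<forall>x\<in>ball ?s r. f (chart_inv c x) \<le> f (chart_inv c ?s)"
    proof (rule negative_definite_local_max[OF open_interior s d1 d2[OF s] conjunct1[OF a] neg])
      fix r :: real
      assume "r > 0" "\<And>x. x \<in> ball ?s r \<Longrightarrow> f (chart_inv c x) \<le> f (chart_inv c ?s)"
      then show "\<exists>r>0. \<forall>x\<in>ball ?s r. f (chart_inv c x) \<le> f (chart_inv c ?s)" by auto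
    qed
    then obtain r where r: "r > 0" "\<And>x. x \<in> ball ?s r \<Longrightarrow> f (chart_inv c x) \<le> f (chart_inv c ?s)" by auto
    show "\<exists>N. openin U N \<and> t \<in> N \<and> (\<forall>t'\<in>N. f t' \<le> f t)"
    proof (intro exI conjI ballI)
      show "openin U {t'\<in>chart_dom c. chart_map c t' \<in> ball ?s r}" by (rule open_preimage[OF c]) simp
      show "t \<in> {t'\<in>chart_dom c. chart_map c t' \<in> ball ?s r}" using t r(1) by simp
      fix t' assume "t' \<in> {t'\<in>chart_dom c. chart_map c t' \<in> ball ?s r}"
      then show "f t' \<le> f t" using r(2)[of "chart_map c t'"] by (simp add: inv_map c t)
    qed
  qed
qed

text \<open>For an outcome without degenerate critical points in the chart, being a local maximum or
  a critical point is a condition on gradient and Hessian in coordinates, and injectivity of the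
  chart preserves the number of points.\<close>

lemma M_count_chart:
  assumes C2: "\<And>c. c \<in> \<A> \<Longrightarrow> path_Ck_in_chart 2 X c \<omega>" and c: "c \<in> \<A>" and S: "S \<subseteq> chart_dom c \<inter> I"
    and nd: "\<forall>s\<in>interior (chart_img c). DY_chart X c s \<omega> = 0 \<longrightarrow> det (D2Y_chart X c s \<omega>) \<noteq> 0"
  shows "M_count U \<A> X u k S \<omega> = emeasure (count_space UNIV)
    {s\<in>chart_map c ` S. DY_chart X c s \<omega> = 0 \<and> u < Y_chart X c s \<omega> \<and> good k (D2Y_chart X c s \<omega>)}"
proof -
  have C2': "Ck_on 2 (\<lambda>s. X (chart_inv c s) \<omega>) (chart_img c)" if "c \<in> \<A>" for c
    using C2[OF that] by (simp add: path_Ck_in_chart_def Y_chart_def)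
  have crit: "critical_point \<A> X \<omega> t \<longleftrightarrow> DY_chart X c (chart_map c t) \<omega> = 0" if t: "t \<in> S" for t
  proof
    assume "DY_chart X c (chart_map c t) \<omega> = 0"
    then have z: "gradient_within (\<lambda>s. X (chart_inv c s) \<omega>) (chart_img c) (chart_map c t) = 0"
      by (simp add: DY_chart_def Y_chart_def)
    have ti: "t \<in> chart_dom c" "t \<in> I" using t S by auto
    show "critical_point \<A> X \<omega> t"
      unfolding critical_point_def DY_chart_def Y_chart_def
      by (intro ballI impI) (rule critical_transfer[where f = "\<lambda>t. X t \<omega>", OF c _ ti(1) _ ti(2) C2' z])
  qed (use t S c in \<open>auto simp: critical_point_def\<close>)
  have lmax: "local_maximum U X \<omega> t \<longleftrightarrow> DY_chart X c (chart_map c t) \<omega> = 0 \<and> negative_definite (D2Y_chart X c (chart_map c t) \<omega>)"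
    and ndt: "DY_chart X c (chart_map c t) \<omega> = 0 \<longrightarrow> det (D2Y_chart X c (chart_map c t) \<omega>) \<noteq> 0" if t: "t \<in> S" for t
  proof -
    have ti: "t \<in> chart_dom c" "t \<in> I" using t S by auto
    show n: "DY_chart X c (chart_map c t) \<omega> = 0 \<longrightarrow> det (D2Y_chart X c (chart_map c t) \<omega>) \<noteq> 0"
      using nd interior_chart[OF c ti(1)] ti(2) by blast
    show "local_maximum U X \<omega> t \<longleftrightarrow> DY_chart X c (chart_map c t) \<omega> = 0 \<and> negative_definite (D2Y_chart X c (chart_map c t) \<omega>)"
      using local_max_chart[where f = "\<lambda>t. X t \<omega>", OF c ti C2'[OF c]] n
      by (simp add: local_maximum_def DY_chart_def D2Y_chart_def Y_chart_def)
  qed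
  have Yt: "Y_chart X c (chart_map c t) \<omega> = X t \<omega>" if "t \<in> S" for t
    using that S inv_map[OF c] by (auto simp: Y_chart_def)
  have "{s\<in>chart_map c ` S. DY_chart X c s \<omega> = 0 \<and> u < Y_chart X c s \<omega> \<and> good k (D2Y_chart X c s \<omega>)} =
    chart_map c ` {t\<in>S. DY_chart X c (chart_map c t) \<omega> = 0 \<and> u < Y_chart X c (chart_map c t) \<omega> \<and> good k (D2Y_chart X c (chart_map c t) \<omega>)}"
    by auto
  also have "{t\<in>S. DY_chart X c (chart_map c t) \<omega> = 0 \<and> u < Y_chart X c (chart_map c t) \<omega> \<and> good k (D2Y_chart X c (chart_map c t) \<omega>)} =
    {t\<in>S. (if k = 1 then local_maximum U X \<omega> t else critical_point \<A> X \<omega> t) \<and> u < X t \<omega>}"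
    using crit lmax ndt by (auto simp: Yt good_def)
  finally have eq: "{s\<in>chart_map c ` S. DY_chart X c s \<omega> = 0 \<and> u < Y_chart X c s \<omega> \<and> good k (D2Y_chart X c s \<omega>)} =
    chart_map c ` {t\<in>S. (if k = 1 then local_maximum U X \<omega> t else critical_point \<A> X \<omega> t) \<and> u < X t \<omega>}" .
  have "inj_on (chart_map c) {t\<in>S. (if k = 1 then local_maximum U X \<omega> t else critical_point \<A> X \<omega> t) \<and> u < X t \<omega>}"
    by (rule inj_on_subset[OF chart_inj[OF c]]) (use S in auto)
  from emeasure_count_space_image[OF this] show ?thesis unfolding M_count_def eq by (rule sym)
qed

end


section \<open>The Rice form\<close>

text \<open>The count of points of \<open>U\<close> equals a measurable count in coordinates only
  outside a null set, on which nothing is claimed about it; changes on null sets do not affect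
  measurability for the completion.\<close>

lemma borel_measurable_completion_AE:
  fixes f g :: "'w \<Rightarrow> ennreal"
  assumes g: "g \<in> borel_measurable M" and ae: "AE x in M. f x = g x"
  shows "f \<in> borel_measurable (completion M)"
proof (rule measurableI)
  fix A :: "ennreal set" assume A: "A \<in> sets borel"
  show "f -` A \<inter> space (completion M) \<in> sets (completion M)"
  proof (rule completion.in_sets_AE)
    show "AE x in completion M. x \<in> g -` A \<inter> space M \<longleftrightarrow> x \<in> f -` A \<inter> space (completion M)"
      using AE_completion[OF ae] by eventually_elim simp
    show "g -` A \<inter> space M \<in> sets (completion M)" using measurable_sets[OF g A] by simp
  qed simp
qed simp

lemma M_count_sums:
  assumes "disjoint_family F" "(\<Union>i. F i) = S"
  shows "M_count U \<A> X u k S \<omega> = (\<Sum>i. M_count U \<A> X u k (F i) \<omega>)"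
proof -
  let ?A = "\<lambda>T. {t\<in>T. (if k = 1 then local_maximum U X \<omega> t else critical_point \<A> X \<omega> t) \<and> u < X t \<omega>}"
  have "(\<Sum>i. emeasure (count_space UNIV) (?A (F i))) = emeasure (count_space UNIV) (\<Union>i. ?A (F i))"
    by (rule suminf_emeasure) (use assms(1) in \<open>fastforce simp: disjoint_family_on_def\<close>)+
  moreover have "(\<Union>i. ?A (F i)) = ?A S" using assms(2) by blast
  ultimately show ?thesis by (simp add: M_count_def)
qed

locale gaussian_manifold = manifold_with_atlas U \<A>
  for U :: "'a topology" and \<A> :: "('a, 'n::finite) chart set" +
  fixes P :: "'w measure" and X :: "'a \<Rightarrow> 'w \<Rightarrow> real"
  assumes P: "prob_space P" and gp: "gaussian_process P (topspace U) X"
    and C2: "\<And>c \<omega>. c \<in> \<A> \<Longrightarrow> \<omega> \<in> space P \<Longrightarrow> path_Ck_in_chart 2 X c \<omega>"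
    and nondeg: "\<And>c s. c \<in> \<A> \<Longrightarrow> s \<in> chart_img c \<Longrightarrow> nondegenerate P (\<lambda>\<omega>. (Y_chart X c s \<omega>, DY_chart X c s \<omega>))"
begin

abbreviation R where "R \<equiv> restrict_space (borel_of_top U) I"

abbreviation EM where "EM u k S \<equiv> (\<integral>\<^sup>+\<omega>. M_count U \<A> X u k S \<omega> \<partial>completion P)"

lemma sets_R: "S \<in> sets R \<longleftrightarrow> S \<subseteq> I \<and> S \<in> sets (borel_of_top U)"
proof (rule sets_restrict_space_iff)
  show "I \<inter> space (borel_of_top U) \<in> sets (borel_of_top U)"
    using open_borel[OF I_open] openin_subset[OF I_open] by (simp add: inf.absorb1)
qed

lemma space_R: "space R = I"
  using openin_subset[OF I_open] by (auto simp: space_restrict_space)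

lemma chart_process_gaussian:
  assumes c: "c \<in> \<A>"
  shows "gaussian_process P (interior (chart_img c)) (Y_chart X c)"
  unfolding gaussian_process_def
proof (intro allI impI)
  fix F :: "(real^'n) set" and b :: "real^'n \<Rightarrow> real" assume F: "finite F \<and> F \<subseteq> interior (chart_img c)"
  then have Fi: "s \<in> chart_img c" if "s \<in> F" for s using that interior_subset by blast
  have inj: "inj_on (chart_inv c) F" by (rule inj_on_inverseI[of _ "chart_map c"]) (simp add: map_inv Fi)
  have "chart_inv c ` F \<subseteq> topspace U" using inv_dom[OF Fi] openin_subset[OF dom_open[OF c]] by auto
  then have "gaussian_rv P (\<lambda>\<omega>. \<Sum>t\<in>chart_inv c ` F. b (chart_map c t) * X t \<omega>)"
    using gp F unfolding gaussian_process_def by (simp del: sum.reindex)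
  moreover have "(\<Sum>t\<in>chart_inv c ` F. b (chart_map c t) * X t \<omega>) = (\<Sum>s\<in>F. b s * Y_chart X c s \<omega>)" for \<omega>
    by (simp add: sum.reindex[OF inj] Y_chart_def map_inv Fi)
  ultimately show "gaussian_rv P (\<lambda>\<omega>. \<Sum>s\<in>F. b s * Y_chart X c s \<omega>)" by simp
qed

lemma chart_field:
  assumes c: "c \<in> \<A>"
  shows "\<exists>L. c2_gaussian_field P L (interior (chart_img c)) (Y_chart X c) (DY_chart X c) (D2Y_chart X c)"
proof (rule c2_gaussian_field_exists[OF P chart_process_gaussian[OF c] open_interior])
  fix \<omega> assume w: "\<omega> \<in> space P"
  have g: "Ck_on 2 (\<lambda>s. Y_chart X c s \<omega>) (chart_img c)" using C2[OF c w] by (simp add: path_Ck_in_chart_def)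
  show "continuous_on (interior (chart_img c)) (\<lambda>s. D2Y_chart X c s \<omega>)"
    unfolding D2Y_chart_def by (rule hessian_within_continuous[OF g])
  fix s assume s: "s \<in> interior (chart_img c)"
  show "((\<lambda>s. Y_chart X c s \<omega>) has_derivative (\<lambda>h. DY_chart X c s \<omega> \<bullet> h)) (at s)"
    unfolding DY_chart_def by (rule gradient_within_interior[OF g s])
  show "((\<lambda>s. DY_chart X c s \<omega>) has_derivative (\<lambda>h. D2Y_chart X c s \<omega> *v h)) (at s)"
    unfolding DY_chart_def D2Y_chart_def by (rule hessian_within_interior[OF g s])
qed (rule nondeg[OF c], erule subsetD[OF interior_subset])

lemma rice_density_chart:
  "rice_density P u k (Y_chart X c s) (DY_chart X c s) (D2Y_chart X c s) = rice_integrand P X u k c s"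
  by (simp add: rice_density_def rice_integrand_def)

lemma rice_integrand_measurable:
  assumes c: "c \<in> \<A>"
  shows "(\<lambda>s. rice_integrand P X u k c s * indicator (interior (chart_img c)) s) \<in> borel_measurable borel"
proof -
  obtain L where "c2_gaussian_field P L (interior (chart_img c)) (Y_chart X c) (DY_chart X c) (D2Y_chart X c)"
    using chart_field[OF c] by blast
  from c2_gaussian_field.rice_formula(2)[OF this, of u k] show ?thesis by (simp only: rice_density_chart)
qed

lemma
  assumes c: "c \<in> \<A>" and S: "S \<in> sets (borel_of_top U)" "S \<subseteq> chart_dom c \<inter> I"
  shows M_count_measurable_chart: "M_count U \<A> X u k S \<in> borel_measurable (completion P)"
    and EM_chart: "EM u k S = (\<integral>\<^sup>+s. rice_integrand P X u k c s * indicator (chart_map c ` S) s \<partial>lborel)"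
proof -
  obtain L where L: "c2_gaussian_field P L (interior (chart_img c)) (Y_chart X c) (DY_chart X c) (D2Y_chart X c)"
    using chart_field[OF c] by blast
  let ?N = "\<lambda>\<omega>. emeasure (count_space UNIV)
    {s\<in>chart_map c ` S. DY_chart X c s \<omega> = 0 \<and> u < Y_chart X c s \<omega> \<and> good k (D2Y_chart X c s \<omega>)}"
  have T: "chart_map c ` S \<in> sets borel" "chart_map c ` S \<subseteq> interior (chart_img c)"
    using chart_image_borel[OF c S] image_interior[OF c] S(2) by auto
  have N: "?N \<in> borel_measurable P" by (rule c2_gaussian_field.rice_formula(3)[OF L T])
  have "AE \<omega> in P. \<forall>s\<in>interior (chart_img c). DY_chart X c s \<omega> = 0 \<longrightarrow> det (D2Y_chart X c s \<omega>) \<noteq> 0"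
    by (rule c2_gaussian_field.rice_formula(1)[OF L])
  then have ae: "AE \<omega> in P. M_count U \<A> X u k S \<omega> = ?N \<omega>"
    using AE_space by eventually_elim (rule M_count_chart[OF C2 c S(2)])
  show "M_count U \<A> X u k S \<in> borel_measurable (completion P)"
    by (rule borel_measurable_completion_AE[OF N ae])
  have "EM u k S = (\<integral>\<^sup>+\<omega>. ?N \<omega> \<partial>completion P)" by (rule nn_integral_cong_AE[OF AE_completion[OF ae]])
  also have "\<dots> = (\<integral>\<^sup>+\<omega>. ?N \<omega> \<partial>P)" by (rule nn_integral_completion)
  also have "\<dots> = (\<integral>\<^sup>+s. rice_integrand P X u k c s * indicator (chart_map c ` S) s \<partial>lborel)"
    using c2_gaussian_field.rice_formula(4)[OF L T, of u k] by (simp only: rice_density_chart)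
  finally show "EM u k S = (\<integral>\<^sup>+s. rice_integrand P X u k c s * indicator (chart_map c ` S) s \<partial>lborel)" .
qed

lemma M_count_measurable:
  assumes S: "S \<in> sets R"
  shows "M_count U \<A> X u k S \<in> borel_measurable (completion P)"
proof -
  obtain E where E': "\<forall>i::nat. E i \<in> sets (borel_of_top U)" "disjoint_family E" "(\<Union>i. E i) = I"
    "\<forall>i. E i \<noteq> {} \<longrightarrow> (\<exists>c\<in>\<A>. E i \<subseteq> chart_dom c \<inter> I)"
    using interior_cover by (elim exE conjE)
  note E = E'(1)[rule_format] E'(2,3) E'(4)[rule_format]
  have "M_count U \<A> X u k (S \<inter> E i) \<in> borel_measurable (completion P)" for i
  proof (cases "E i = {}")
    case True
    have "M_count U \<A> X u k {} = (\<lambda>_. 0)" by (simp add: M_count_def fun_eq_iff)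
    with True show ?thesis by simp
  next
    case False
    from E(4)[OF this] obtain c where c: "c \<in> \<A>" "E i \<subseteq> chart_dom c \<inter> I" by blast
    show ?thesis by (rule M_count_measurable_chart[OF c(1)]) (use S E(1)[of i] c(2) in \<open>auto simp: sets_R\<close>)
  qed
  moreover have "M_count U \<A> X u k S = (\<lambda>\<omega>. \<Sum>i. M_count U \<A> X u k (S \<inter> E i) \<omega>)"
    by (rule ext, rule M_count_sums) (use S E in \<open>auto simp: sets_R disjoint_family_on_def\<close>)
  ultimately show ?thesis by simp
qed

lemma EM_sums:
  assumes "range F \<subseteq> sets R" "disjoint_family F" "(\<Union>i. F i) = S"
  shows "EM u k S = (\<Sum>i. EM u k (F i))"
proof -
  have "EM u k S = (\<integral>\<^sup>+\<omega>. (\<Sum>i. M_count U \<A> X u k (F i) \<omega>) \<partial>completion P)"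
    by (intro nn_integral_cong M_count_sums assms)
  also have "\<dots> = (\<Sum>i. EM u k (F i))"
    by (rule nn_integral_suminf, rule M_count_measurable) (use assms(1) in auto)
  finally show ?thesis .
qed

definition rice_measure where "rice_measure u k = measure_of I (sets R) (EM u k)"

lemma sets_rice_measure: "sets (rice_measure u k) = sets R"
  unfolding rice_measure_def using sets.sigma_sets_eq[of R] sets.space_closed[of R] by (simp add: space_R)

lemma emeasure_rice_measure:
  assumes S: "S \<in> sets R"
  shows "emeasure (rice_measure u k) S = EM u k S"
  unfolding rice_measure_def
proof (rule emeasure_measure_of_sigma[OF _ _ _ S])
  show "sigma_algebra I (sets R)" using sets.sigma_algebra_axioms[of R] by (simp only: space_R)
  show "positive (sets R) (EM u k)" by (simp add: positive_def M_count_def)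
  show "countably_additive (sets R) (EM u k)"
    unfolding countably_additive_def using EM_sums[OF _ _ refl, of _ u k] by metis
qed

lemma emeasure_distr_chart:
  assumes \<Omega>: "sets \<Omega> = sets R" and c: "c \<in> \<A>" and T: "T \<in> sets borel"
  shows "emeasure (distr (restrict_space \<Omega> (chart_dom c)) borel (chart_map c)) T =
    emeasure \<Omega> {t\<in>chart_dom c \<inter> I. chart_map c t \<in> T}"
proof -
  have sp: "space \<Omega> = I" using sets_eq_imp_space_eq[OF \<Omega>] by (simp add: space_R)
  have "sets (restrict_space \<Omega> (chart_dom c)) = sets (restrict_space R (chart_dom c))"
    by (rule sets_restrict_space_cong[OF \<Omega>])
  also have "\<dots> = sets (restrict_space (borel_of_top U) (chart_dom c \<inter> I))"
    by (simp add: sets_restrict_restrict_space Int_commute)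
  finally have "chart_map c \<in> measurable (restrict_space \<Omega> (chart_dom c)) borel"
    using chart_map_measurable[OF c] measurable_cong_sets by blast
  from emeasure_distr[OF this T]
  have "emeasure (distr (restrict_space \<Omega> (chart_dom c)) borel (chart_map c)) T =
    emeasure (restrict_space \<Omega> (chart_dom c)) (chart_map c -` T \<inter> space (restrict_space \<Omega> (chart_dom c)))" .
  also have "chart_map c -` T \<inter> space (restrict_space \<Omega> (chart_dom c)) = {t\<in>chart_dom c \<inter> I. chart_map c t \<in> T}"
    by (auto simp: space_restrict_space sp)
  also have "emeasure (restrict_space \<Omega> (chart_dom c)) \<dots> = emeasure \<Omega> {t\<in>chart_dom c \<inter> I. chart_map c t \<in> T}"
    by (rule emeasure_restrict_space) (use chart_interior_borel[OF c] in \<open>auto simp: sp \<Omega> sets_R\<close>)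
  finally show ?thesis .
qed

text \<open>On a set inside one chart a form is determined by its local expression, because the
  chart is injective and the image measure is known. A general set is cut into countably many
  disjoint pieces of this kind, and both sides are countably additive.\<close>

lemma expressed_as_EM:
  assumes \<Omega>: "sets \<Omega> = sets R" and ex: "expressed_as \<A> \<Omega> (rice_integrand P X u k)" and S: "S \<in> sets R"
  shows "emeasure \<Omega> S = EM u k S"
proof -
  have chart_case: "emeasure \<Omega> S = EM u k S" if c: "c \<in> \<A>" and S: "S \<in> sets R" "S \<subseteq> chart_dom c \<inter> I" for c S
  proof -
    let ?f = "\<lambda>s. rice_integrand P X u k c s * indicator (interior (chart_img c)) s"
    have S': "S \<in> sets (borel_of_top U)" using S(1) by (simp add: sets_R)
    have T: "chart_map c ` S \<in> sets borel" by (rule chart_image_borel[OF c S' S(2)])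
    have d: "distr (restrict_space \<Omega> (chart_dom c)) borel (chart_map c) = density lborel ?f"
      using ex c by (simp add: expressed_as_def Let_def image_interior[OF c])
    have "{t\<in>chart_dom c \<inter> I. chart_map c t \<in> chart_map c ` S} = S"
      using S(2) inj_on_image_mem_iff[OF chart_inj[OF c]] by blast
    then have "emeasure \<Omega> S = emeasure (density lborel ?f) (chart_map c ` S)"
      using emeasure_distr_chart[OF \<Omega> c T] by (simp add: d)
    also have "\<dots> = (\<integral>\<^sup>+s. ?f s * indicator (chart_map c ` S) s \<partial>lborel)"
      by (rule emeasure_density) (use rice_integrand_measurable[OF c] T in auto)
    also have "\<dots> = (\<integral>\<^sup>+s. rice_integrand P X u k c s * indicator (chart_map c ` S) s \<partial>lborel)"
      using image_interior[OF c] S(2) by (intro nn_integral_cong) (auto simp: indicator_def)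
    also have "\<dots> = EM u k S" by (rule EM_chart[OF c S' S(2), symmetric])
    finally show ?thesis .
  qed
  obtain E where E': "\<forall>i::nat. E i \<in> sets (borel_of_top U)" "disjoint_family E" "(\<Union>i. E i) = I"
    "\<forall>i. E i \<noteq> {} \<longrightarrow> (\<exists>c\<in>\<A>. E i \<subseteq> chart_dom c \<inter> I)"
    using interior_cover by (elim exE conjE)
  note E = E'(1)[rule_format] E'(2,3) E'(4)[rule_format]
  have SE: "S \<inter> E i \<in> sets R" for i using S E(1)[of i] by (auto simp: sets_R)
  have eq: "emeasure \<Omega> (S \<inter> E i) = EM u k (S \<inter> E i)" for i
  proof (cases "E i = {}")
    case False
    from E(4)[OF this] obtain c where c: "c \<in> \<A>" "E i \<subseteq> chart_dom c \<inter> I" by blast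
    show ?thesis by (rule chart_case[OF c(1) SE]) (use c(2) in auto)
  qed (simp add: M_count_def)
  have SU: "(\<Union>i. S \<inter> E i) = S" using S E(3) by (auto simp: sets_R)
  have dj: "disjoint_family (\<lambda>i. S \<inter> E i)" using E(2) by (auto simp: disjoint_family_on_def)
  have "emeasure \<Omega> S = (\<Sum>i. emeasure \<Omega> (S \<inter> E i))"
    using suminf_emeasure[of "\<lambda>i. S \<inter> E i" \<Omega>, unfolded SU] SE dj by (simp add: \<Omega> image_subset_iff)
  also have "\<dots> = EM u k S"
    unfolding eq by (rule EM_sums[symmetric]) (use SE dj SU in auto)
  finally show ?thesis .
qed

lemma rice_measure_expressed: "expressed_as \<A> (rice_measure u k) (rice_integrand P X u k)"
  unfolding expressed_as_def Let_def
proof (intro ballI conjI)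
  fix c assume c: "c \<in> \<A>"
  let ?f = "\<lambda>s. rice_integrand P X u k c s * indicator (chart_map c ` (chart_dom c \<inter> I)) s"
  show m: "?f \<in> borel_measurable lborel" using rice_integrand_measurable[OF c] by (simp add: image_interior[OF c])
  show "distr (restrict_space (rice_measure u k) (chart_dom c)) borel (chart_map c) = density lborel ?f"
  proof (rule measure_eqI)
    fix T assume "T \<in> sets (distr (restrict_space (rice_measure u k) (chart_dom c)) borel (chart_map c))"
    then have T: "T \<in> sets borel" by simp
    let ?S = "{t\<in>chart_dom c \<inter> I. chart_map c t \<in> T}"
    have S: "?S \<in> sets (borel_of_top U)" "?S \<subseteq> chart_dom c \<inter> I" using chart_preimage_borel[OF c T] by auto
    have "emeasure (distr (restrict_space (rice_measure u k) (chart_dom c)) borel (chart_map c)) T = EM u k ?S"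
      using emeasure_distr_chart[OF sets_rice_measure c T] S by (simp add: emeasure_rice_measure sets_R)
    also have "\<dots> = (\<integral>\<^sup>+s. rice_integrand P X u k c s * indicator (chart_map c ` ?S) s \<partial>lborel)"
      by (rule EM_chart[OF c S])
    also have "\<dots> = (\<integral>\<^sup>+s. ?f s * indicator T s \<partial>lborel)"
      by (intro nn_integral_cong) (auto simp: indicator_def)
    also have "\<dots> = emeasure (density lborel ?f) T" by (rule emeasure_density[symmetric]) (use m T in auto)
    finally show "emeasure (distr (restrict_space (rice_measure u k) (chart_dom c)) borel (chart_map c)) T = emeasure (density lborel ?f) T" .
  qed simp
qed

lemma expressed_as_top_form:
  assumes "sets \<Omega> = sets R" "expressed_as \<A> \<Omega> f"
  shows "top_form U \<A> \<Omega>"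
  unfolding top_form_def
proof (intro conjI ballI assms(1))
  fix c assume "c \<in> \<A>"
  then have m: "(\<lambda>s. f c s * indicator (chart_map c ` (chart_dom c \<inter> I)) s) \<in> borel_measurable lborel"
    and d: "distr (restrict_space \<Omega> (chart_dom c)) borel (chart_map c) =
      density lborel (\<lambda>s. f c s * indicator (chart_map c ` (chart_dom c \<inter> I)) s)"
    using assms(2) unfolding expressed_as_def Let_def by blast+
  show "absolutely_continuous lborel (distr (restrict_space \<Omega> (chart_dom c)) borel (chart_map c))"
    unfolding d by (rule absolutely_continuousI_density[OF m])
qed

end

theorem proposition2p2:
  fixes U :: "'a topology" and \<A> :: "('a, 'n::finite) chart set"
    and P :: "'w measure" and X :: "'a \<Rightarrow> 'w \<Rightarrow> real" and u :: real
  assumes "oriented_manifold U \<A>"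
    and "prob_space P"
    and "gaussian_process P (topspace U) X"
    and "\<And>c \<omega>. c \<in> \<A> \<Longrightarrow> \<omega> \<in> space P \<Longrightarrow> path_Ck_in_chart 2 X c \<omega>"
    and "\<And>c s. c \<in> \<A> \<Longrightarrow> s \<in> chart_img c \<Longrightarrow> nondegenerate P (\<lambda>\<omega>. (Y_chart X c s \<omega>, DY_chart X c s \<omega>))"
    and "\<And>c. c \<in> \<A> \<Longrightarrow> (AE \<omega> in P. path_Ck_in_chart 3 X c \<omega>) \<or> hessian_det_condition P X c"
  shows "\<forall>k\<in>{1, 2}.
    (\<exists>!\<Omega>. top_form U \<A> \<Omega> \<and> expressed_as \<A> \<Omega> (rice_integrand P X u k)) \<and>
    (\<forall>\<Omega>. top_form U \<A> \<Omega> \<and> expressed_as \<A> \<Omega> (rice_integrand P X u k) \<longrightarrow>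
       (\<forall>S\<in>sets (borel_of_top U). S \<subseteq> manifold_interior \<A> \<longrightarrow>
          M_count U \<A> X u k S \<in> borel_measurable (completion P) \<and>
          emeasure \<Omega> S = (\<integral>\<^sup>+\<omega>. M_count U \<A> X u k S \<omega> \<partial>completion P)))"
proof -
  interpret gaussian_manifold U \<A> P X
    by (intro gaussian_manifold.intro manifold_with_atlas.intro gaussian_manifold_axioms.intro)
      (rule assms; assumption)+
  have form: "top_form U \<A> (rice_measure u k) \<and> expressed_as \<A> (rice_measure u k) (rice_integrand P X u k)" for k
    using expressed_as_top_form[OF sets_rice_measure rice_measure_expressed] rice_measure_expressed by blast
  have EM: "sets \<Omega> = sets R \<and> (\<forall>S\<in>sets R. emeasure \<Omega> S = EM u k S)"
    if \<Omega>: "top_form U \<A> \<Omega> \<and> expressed_as \<A> \<Omega> (rice_integrand P X u k)" for \<Omega> k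
  proof -
    have s: "sets \<Omega> = sets R" using \<Omega> by (simp add: top_form_def)
    then show ?thesis using expressed_as_EM[OF s] \<Omega> by blast
  qed
  show ?thesis
  proof (intro ballI conjI ex1I allI impI)
    fix k \<Omega> assume \<Omega>: "top_form U \<A> \<Omega> \<and> expressed_as \<A> \<Omega> (rice_integrand P X u k)"
    show "\<Omega> = rice_measure u k"
      using EM[OF \<Omega>] by (intro measure_eqI) (auto simp: sets_rice_measure emeasure_rice_measure)
    fix S assume "S \<in> sets (borel_of_top U)" "S \<subseteq> manifold_interior \<A>"
    then have S: "S \<in> sets R" by (simp add: sets_R)
    show "M_count U \<A> X u k S \<in> borel_measurable (completion P)" by (rule M_count_measurable[OF S])
    show "emeasure \<Omega> S = (\<integral>\<^sup>+\<omega>. M_count U \<A> X u k S \<omega> \<partial>completion P)" using EM[OF \<Omega>] S by blast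
  qed (use form in blast)+
qed

end
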